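(* Let $(\mathcal T,\mathcal T^{\mathrm p},\mathbb S,\mathcal S)$ be an SMC quadruple over a field $k$, let $\mathcal T_{\mathrm{sg}}=\mathcal T/\mathcal T^{\mathrm p}$ be the Verdier quotient, and put $$\mathcal F=\mathcal T_{>0}^{\perp}\cap{}^{\perp}(\mathcal T_{\le -1}\cap\mathcal T^{\mathrm p}),\qquad \mathcal P=\mathcal T_{\ge 0}\cap\mathcal T_{\le 0}.$$ Then: (1) $\mathcal F$ is a Frobenius extriangulated category whose subcategory of projective objects is $\mathrm{Proj}\,\mathcal F=\mathcal P$; (2) the composition $\mathcal F\subset\mathcal T\to\mathcal T_{\mathrm{sg}}$ induces an equivalence of additive categories $\pi:\mathcal F/[\mathcal P]\xrightarrow{\simeq}\mathcal T_{\mathrm{sg}}$. Moreover, $\mathcal T_{\mathrm{sg}}$ has a Serre functor $\mathbb S[-1]$ (the composite of the functor induced by $\mathbb S$ with $[-1]$).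
   Context: $k$ is a field; subcategories are full. For a collection $\mathcal S$ of objects in a triangulated category $\mathcal T$ and $n\in\mathbb Z$, $\mathcal S[\ge n]=\{S[i]\mid S\in\mathcal S,i\ge n\}$, and similarly for $>,\le,<$. $\mathcal S^{\perp}=\{X\mid\mathrm{Hom}_{\mathcal T}(\mathcal S,X)=0\}$, ${}^{\perp}\mathcal S=\{X\mid\mathrm{Hom}_{\mathcal T}(X,\mathcal S)=0\}$. $\mathcal S$ is a simple-minded collection (SMC) if for all $X,Y\in\mathcal S$: $\mathrm{Hom}_{\mathcal T}(X,Y[i])=0$ for $i<0$, $\dim_k\mathrm{Hom}_{\mathcal T}(X,Y)=\delta_{X,Y}$, and the smallest thick subcategory containing $\mathcal S$ is $\mathcal T$. For full subcategories $\mathcal X,\mathcal Y$, $\mathcal X*\mathcal Y$ consists of all $T$ admitting a triangle $X\to T\to Y\to X[1]$ with $X\in\mathcal X,Y\in\mathcal Y$; one writes $\mathcal X\perp\mathcal Y$ for $\mathcal X*\mathcal Y$ when $\mathrm{Hom}_{\mathcal T}(\mathcal X,\mathcal Y)=0$. $\mathcal T=\mathcal X\perp\mathcal Y$ is a torsion pair if also $\mathcal X^\perp=\mathcal Y$, ${}^\perp\mathcal Y=\mathcal X$, and a co-$t$-structure if moreover $\mathcal Y[1]\subset\mathcal Y$. An SMC quadruple $(\mathcal T,\mathcal T^{\mathrm p},\mathbb S,\mathcal S)$ consists of the following. (RS0) $\mathcal T$ is a $k$-linear Hom-finite Krull–Schmidt triangulated category and $\mathcal T^{\mathrm p}$ is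 a thick subcategory. (RS1) $\mathbb S:\mathcal T\to\mathcal T$ is a triangle equivalence restricting to an equivalence $\mathcal T^{\mathrm p}\to\mathcal T^{\mathrm p}$, with a bifunctorial isomorphism $D\mathrm{Hom}_{\mathcal T}(X,Y)\simeq\mathrm{Hom}_{\mathcal T}(Y,\mathbb SX)$ for $X\in\mathcal T^{\mathrm p}$, $Y\in\mathcal T$, where $D=\mathrm{Hom}_k(-,k)$. (RS2) $\mathcal S$ is an SMC in $\mathcal T$, and $\mathcal T={}^{\perp}\mathcal S[\ge 0]\perp{}^{\perp}\mathcal S[<0]=\mathcal S[\ge 0]^{\perp}\perp\mathcal S[<0]^{\perp}$ are co-$t$-structures with ${}^{\perp}\mathcal S[\ge 0]\subset\mathcal T^{\mathrm p}$ and $\mathcal S[<0]^{\perp}\subset\mathcal T^{\mathrm p}$. Notation: $\mathcal T_{>i}=\mathcal T_{\ge i+1}={}^{\perp}\mathcal S[\ge -i]$ and $\mathcal T_{\le i}=\mathcal T_{<i+1}={}^{\perp}\mathcal S[<-i]$ for $i\in\mathbb Z$. $\mathcal F/[\mathcal P]$ is the additive quotient by the ideal of morphisms factoring through objects of $\mathcal P$. "Extriangulated category" is in the sense of Nakaoka–Palu; an extension-closed full subcategory $\mathcal F$ of $\mathcal T$ is extriangulated with $\mathbb E(C,A)=\mathrm{Hom}_{\mathcal T}(C,A[1])$, the conflations $A\to B\to C$ being those from triangles $A\to B\to C\to A[1]$ with $A,B,C\in\mathcal F$. $P\in\mathcal F$ is projective if $\mathbb E(P,-)=0$, injective if $\mathbb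 E(-,P)=0$. $\mathcal F$ is Frobenius if projectives and injectives coincide and every $X\in\mathcal F$ admits conflations $X'\to P\to X$ and $X\to I\to X''$ with $P$ projective and $I$ injective. *)

theory Defs
  imports "HOL-Algebra.AbelCoset" "Jordan_Normal_Form.Missing_VectorSpace"
begin

section \<open>Linear categories\<close>

text \<open>
  The vector space \<open>Hom C X Y\<close> is a \<open>module\<close> record whose fields \<open>mult\<close> and \<open>one\<close>
  are irrelevant. Distinct ordered pairs of objects have disjoint Hom sets, so that a morphism
  determines its source and target.
\<close>

record ('o, 'm, 'k) lincat =
  Obj :: "'o set"
  Hom :: "'o \<Rightarrow> 'o \<Rightarrow> ('k, 'm) module"
  ident :: "'o \<Rightarrow> 'm"
  cmp :: "'m \<Rightarrow> 'm \<Rightarrow> 'm"  (infixr \<open>\<cdot>\<index>\<close> 75)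

abbreviation Mor :: "('o, 'm, 'k, 'z) lincat_scheme \<Rightarrow> 'o \<Rightarrow> 'o \<Rightarrow> 'm set" where
  "Mor C X Y \<equiv> carrier (Hom C X Y)"

locale lin_cat =
  fixes k :: "('k, 'r) ring_scheme" and C :: "('o, 'm, 'k, 'z) lincat_scheme"
  assumes ground_field: "field k"
    and hom_vectorspace:
      "\<lbrakk>X \<in> Obj C; Y \<in> Obj C\<rbrakk> \<Longrightarrow> vectorspace k (Hom C X Y)"
    and hom_disjoint:
      "\<lbrakk>X \<in> Obj C; Y \<in> Obj C; X' \<in> Obj C; Y' \<in> Obj C; f \<in> Mor C X Y; f \<in> Mor C X' Y'\<rbrakk>
        \<Longrightarrow> X = X' \<and> Y = Y'"
    and ident_closed: "X \<in> Obj C \<Longrightarrow> ident C X \<in> Mor C X X"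
    and cmp_closed:
      "\<lbrakk>X \<in> Obj C; Y \<in> Obj C; Z \<in> Obj C; f \<in> Mor C X Y; g \<in> Mor C Y Z\<rbrakk>
        \<Longrightarrow> g \<cdot>\<^bsub>C\<^esub> f \<in> Mor C X Z"
    and cmp_ident_left:
      "\<lbrakk>X \<in> Obj C; Y \<in> Obj C; f \<in> Mor C X Y\<rbrakk> \<Longrightarrow> ident C Y \<cdot>\<^bsub>C\<^esub> f = f"
    and cmp_ident_right:
      "\<lbrakk>X \<in> Obj C; Y \<in> Obj C; f \<in> Mor C X Y\<rbrakk> \<Longrightarrow> f \<cdot>\<^bsub>C\<^esub> ident C X = f"
    and cmp_assoc:
      "\<lbrakk>W \<in> Obj C; X \<in> Obj C; Y \<in> Obj C; Z \<in> Obj C;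
        f \<in> Mor C W X; g \<in> Mor C X Y; h \<in> Mor C Y Z\<rbrakk>
        \<Longrightarrow> (h \<cdot>\<^bsub>C\<^esub> g) \<cdot>\<^bsub>C\<^esub> f = h \<cdot>\<^bsub>C\<^esub> (g \<cdot>\<^bsub>C\<^esub> f)"
    and cmp_linear_left:
      "\<lbrakk>X \<in> Obj C; Y \<in> Obj C; Z \<in> Obj C; f \<in> Mor C X Y\<rbrakk>
        \<Longrightarrow> linear_map k (Hom C Y Z) (Hom C X Z) (\<lambda>g. g \<cdot>\<^bsub>C\<^esub> f)"
    and cmp_linear_right:
      "\<lbrakk>X \<in> Obj C; Y \<in> Obj C; Z \<in> Obj C; g \<in> Mor C Y Z\<rbrakk>
        \<Longrightarrow> linear_map k (Hom C X Y) (Hom C X Z) (\<lambda>f. g \<cdot>\<^bsub>C\<^esub> f)"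

definition hom_zero :: "('o, 'm, 'k, 'z) lincat_scheme \<Rightarrow> 'o \<Rightarrow> 'o \<Rightarrow> bool" where
  "hom_zero C X Y \<longleftrightarrow> Mor C X Y = {\<zero>\<^bsub>Hom C X Y\<^esub>}"

definition is_iso :: "('o, 'm, 'k, 'z) lincat_scheme \<Rightarrow> 'o \<Rightarrow> 'o \<Rightarrow> 'm \<Rightarrow> bool" where
  "is_iso C X Y f \<longleftrightarrow> X \<in> Obj C \<and> Y \<in> Obj C \<and> f \<in> Mor C X Y \<and>
     (\<exists>g\<in>Mor C Y X. g \<cdot>\<^bsub>C\<^esub> f = ident C X \<and> f \<cdot>\<^bsub>C\<^esub> g = ident C Y)"

definition is_zero_obj :: "('o, 'm, 'k, 'z) lincat_scheme \<Rightarrow> 'o \<Rightarrow> bool" where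
  "is_zero_obj C Z \<longleftrightarrow> Z \<in> Obj C \<and> (\<forall>X\<in>Obj C. hom_zero C Z X \<and> hom_zero C X Z)"

definition is_biproduct ::
  "('o, 'm, 'k, 'z) lincat_scheme \<Rightarrow> 'o \<Rightarrow> 'o \<Rightarrow> 'o \<Rightarrow> 'm \<Rightarrow> 'm \<Rightarrow> 'm \<Rightarrow> 'm \<Rightarrow> bool" where
  "is_biproduct C X Y B i j p q \<longleftrightarrow>
     X \<in> Obj C \<and> Y \<in> Obj C \<and> B \<in> Obj C \<and>
     i \<in> Mor C X B \<and> j \<in> Mor C Y B \<and> p \<in> Mor C B X \<and> q \<in> Mor C B Y \<and>
     p \<cdot>\<^bsub>C\<^esub> i = ident C X \<and> q \<cdot>\<^bsub>C\<^esub> j = ident C Y \<and>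
     p \<cdot>\<^bsub>C\<^esub> j = \<zero>\<^bsub>Hom C Y X\<^esub> \<and> q \<cdot>\<^bsub>C\<^esub> i = \<zero>\<^bsub>Hom C X Y\<^esub> \<and>
     (i \<cdot>\<^bsub>C\<^esub> p) \<oplus>\<^bsub>Hom C B B\<^esub> (j \<cdot>\<^bsub>C\<^esub> q) = ident C B"

locale additive_cat = lin_cat +
  assumes zero_obj_exists: "\<exists>Z. is_zero_obj C Z"
    and biproduct_exists:
      "\<lbrakk>X \<in> Obj C; Y \<in> Obj C\<rbrakk> \<Longrightarrow> \<exists>B i j p q. is_biproduct C X Y B i j p q"

definition full_sub :: "('o, 'm, 'k, 'z) lincat_scheme \<Rightarrow> 'o set \<Rightarrow> ('o, 'm, 'k) lincat" where
  "full_sub C U = \<lparr>Obj = U, Hom = Hom C, ident = ident C, cmp = cmp C\<rparr>"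

definition hom_finite ::
  "('k, 'r) ring_scheme \<Rightarrow> ('o, 'm, 'k, 'z) lincat_scheme \<Rightarrow> bool" where
  "hom_finite k C \<longleftrightarrow> (\<forall>X\<in>Obj C. \<forall>Y\<in>Obj C. vectorspace.fin_dim k (Hom C X Y))"


subsection \<open>Krull--Schmidt categories\<close>

definition is_direct_sum ::
  "('o, 'm, 'k, 'z) lincat_scheme \<Rightarrow> nat \<Rightarrow> (nat \<Rightarrow> 'o) \<Rightarrow> 'o \<Rightarrow> bool" where
  "is_direct_sum C n Y X \<longleftrightarrow> X \<in> Obj C \<and> (\<forall>i<n. Y i \<in> Obj C) \<and>
     (\<exists>\<iota> \<pi>. (\<forall>i<n. \<iota> i \<in> Mor C (Y i) X \<and> \<pi> i \<in> Mor C X (Y i)) \<and>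
       (\<forall>i<n. \<forall>j<n. \<pi> i \<cdot>\<^bsub>C\<^esub> \<iota> j = (if i = j then ident C (Y i) else \<zero>\<^bsub>Hom C (Y j) (Y i)\<^esub>)) \<and>
       (\<Oplus>\<^bsub>Hom C X X\<^esub>i\<in>{..<n}. \<iota> i \<cdot>\<^bsub>C\<^esub> \<pi> i) = ident C X)"

definition End_ring :: "('o, 'm, 'k, 'z) lincat_scheme \<Rightarrow> 'o \<Rightarrow> ('k, 'm) module" where
  "End_ring C X = (Hom C X X)\<lparr>mult := cmp C, one := ident C X\<rparr>"

definition local_ring :: "('a, 'r) ring_scheme \<Rightarrow> bool" where
  "local_ring R \<longleftrightarrow> ring R \<and> \<one>\<^bsub>R\<^esub> \<noteq> \<zero>\<^bsub>R\<^esub> \<and>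
     (\<forall>x\<in>carrier R - Units R. \<forall>y\<in>carrier R - Units R. x \<oplus>\<^bsub>R\<^esub> y \<notin> Units R)"

definition krull_schmidt :: "('o, 'm, 'k, 'z) lincat_scheme \<Rightarrow> bool" where
  "krull_schmidt C \<longleftrightarrow> (\<forall>X\<in>Obj C. \<exists>n Y. is_direct_sum C n Y X \<and>
     (\<forall>i<n. local_ring (End_ring C (Y i))))"


subsection \<open>Functors\<close>

record ('o, 'm, 'p, 'n) fct =
  FO :: "'o \<Rightarrow> 'p"
  FM :: "'m \<Rightarrow> 'n"

definition fid :: "('o, 'm, 'o, 'm) fct" where
  "fid = \<lparr>FO = (\<lambda>X. X), FM = (\<lambda>f. f)\<rparr>"

definition functor_cmp ::
  "('p, 'n, 'q, 'l) fct \<Rightarrow> ('o, 'm, 'p, 'n) fct \<Rightarrow> ('o, 'm, 'q, 'l) fct" where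
  "functor_cmp G F = \<lparr>FO = FO G \<circ> FO F, FM = FM G \<circ> FM F\<rparr>"

definition lin_functor ::
  "('k, 'r) ring_scheme \<Rightarrow> ('o, 'm, 'k, 'y) lincat_scheme \<Rightarrow> ('p, 'n, 'k, 'z) lincat_scheme \<Rightarrow>
     ('o, 'm, 'p, 'n) fct \<Rightarrow> bool" where
  "lin_functor k C D F \<longleftrightarrow> lin_cat k C \<and> lin_cat k D \<and>
     (\<forall>X\<in>Obj C. FO F X \<in> Obj D \<and> FM F (ident C X) = ident D (FO F X)) \<and>
     (\<forall>X\<in>Obj C. \<forall>Y\<in>Obj C. linear_map k (Hom C X Y) (Hom D (FO F X) (FO F Y)) (FM F)) \<and>
     (\<forall>X\<in>Obj C. \<forall>Y\<in>Obj C. \<forall>Z\<in>Obj C. \<forall>f\<in>Mor C X Y. \<forall>g\<in>Mor C Y Z.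
        FM F (g \<cdot>\<^bsub>C\<^esub> f) = FM F g \<cdot>\<^bsub>D\<^esub> FM F f)"

definition nat_iso ::
  "('o, 'm, 'k, 'y) lincat_scheme \<Rightarrow> ('p, 'n, 'k, 'z) lincat_scheme \<Rightarrow>
     ('o, 'm, 'p, 'n) fct \<Rightarrow> ('o, 'm, 'p, 'n) fct \<Rightarrow> ('o \<Rightarrow> 'n) \<Rightarrow> bool" where
  "nat_iso C D F G \<eta> \<longleftrightarrow> (\<forall>X\<in>Obj C. is_iso D (FO F X) (FO G X) (\<eta> X)) \<and>
     (\<forall>X\<in>Obj C. \<forall>Y\<in>Obj C. \<forall>f\<in>Mor C X Y. \<eta> Y \<cdot>\<^bsub>D\<^esub> FM F f = FM G f \<cdot>\<^bsub>D\<^esub> \<eta> X)"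

definition lin_equivalence ::
  "('k, 'r) ring_scheme \<Rightarrow> ('o, 'm, 'k, 'y) lincat_scheme \<Rightarrow> ('p, 'n, 'k, 'z) lincat_scheme \<Rightarrow>
     ('o, 'm, 'p, 'n) fct \<Rightarrow> bool" where
  "lin_equivalence k C D F \<longleftrightarrow> lin_functor k C D F \<and>
     (\<exists>G \<eta> \<epsilon>. lin_functor k D C G \<and> nat_iso C C fid (functor_cmp G F) \<eta> \<and>
        nat_iso D D (functor_cmp F G) fid \<epsilon>)"


subsection \<open>Serre duality\<close>

text \<open>Functionals are extensional, so that equal functionals are equal as functions.\<close>

definition dual :: "('k, 'r) ring_scheme \<Rightarrow> ('k, 'm, 'z) module_scheme \<Rightarrow> ('k, 'm \<Rightarrow> 'k) module" where
  "dual k V = (ring.func_space k (carrier V))\<lparr>carrier :=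
     {\<phi> \<in> carrier V \<rightarrow>\<^sub>E carrier k.
        (\<forall>v\<in>carrier V. \<forall>w\<in>carrier V. \<phi> (v \<oplus>\<^bsub>V\<^esub> w) = \<phi> v \<oplus>\<^bsub>k\<^esub> \<phi> w) \<and>
        (\<forall>c\<in>carrier k. \<forall>v\<in>carrier V. \<phi> (c \<odot>\<^bsub>V\<^esub> v) = c \<otimes>\<^bsub>k\<^esub> \<phi> v)}\<rparr>"

text \<open>
  \<open>\<alpha> X Y\<close> is an isomorphism from the dual of \<open>Hom(X, Y)\<close> to \<open>Hom(Y, F X)\<close>, natural in
  \<open>X\<close> in the full subcategory on \<open>A\<close> and in all \<open>Y\<close>.
\<close>

definition serre_duality ::
  "('k, 'r) ring_scheme \<Rightarrow> ('o, 'm, 'k, 'z) lincat_scheme \<Rightarrow> 'o set \<Rightarrow> ('o, 'm, 'o, 'm) fct \<Rightarrow>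
     ('o \<Rightarrow> 'o \<Rightarrow> ('m \<Rightarrow> 'k) \<Rightarrow> 'm) \<Rightarrow> bool" where
  "serre_duality k C A F \<alpha> \<longleftrightarrow>
     (\<forall>X\<in>A. \<forall>Y\<in>Obj C.
        linear_map k (dual k (Hom C X Y)) (Hom C Y (FO F X)) (\<alpha> X Y) \<and>
        bij_betw (\<alpha> X Y) (carrier (dual k (Hom C X Y))) (Mor C Y (FO F X))) \<and>
     (\<forall>X\<in>A. \<forall>X'\<in>A. \<forall>Y\<in>Obj C. \<forall>f\<in>Mor C X X'. \<forall>\<phi>\<in>carrier (dual k (Hom C X Y)).
        \<alpha> X' Y (\<lambda>h\<in>Mor C X' Y. \<phi> (h \<cdot>\<^bsub>C\<^esub> f)) = FM F f \<cdot>\<^bsub>C\<^esub> \<alpha> X Y \<phi>) \<and>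
     (\<forall>X\<in>A. \<forall>Y\<in>Obj C. \<forall>Y'\<in>Obj C. \<forall>g\<in>Mor C Y' Y. \<forall>\<phi>\<in>carrier (dual k (Hom C X Y)).
        \<alpha> X Y' (\<lambda>h\<in>Mor C X Y'. \<phi> (g \<cdot>\<^bsub>C\<^esub> h)) = \<alpha> X Y \<phi> \<cdot>\<^bsub>C\<^esub> g)"

definition serre_functor ::
  "('k, 'r) ring_scheme \<Rightarrow> ('o, 'm, 'k, 'z) lincat_scheme \<Rightarrow> ('o, 'm, 'o, 'm) fct \<Rightarrow> bool" where
  "serre_functor k C F \<longleftrightarrow> hom_finite k C \<and> lin_equivalence k C C F \<and>
     (\<exists>\<alpha>. serre_duality k C (Obj C) F \<alpha>)"


section \<open>Triangulated categories\<close>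

text \<open>
  The shift \<open>Sh\<close> is an automorphism with inverse \<open>Shi\<close>.
  \<open>Tri T X Y Z f g h\<close> says that \<open>X \<longrightarrow> Y \<longrightarrow> Z \<longrightarrow> X[1]\<close>, with maps \<open>f\<close>, \<open>g\<close>, \<open>h\<close>,
  is a distinguished triangle.
\<close>

record ('o, 'm, 'k) tricat = "('o, 'm, 'k) lincat" +
  Sh :: "('o, 'm, 'o, 'm) fct"
  Shi :: "('o, 'm, 'o, 'm) fct"
  Tri :: "'o \<Rightarrow> 'o \<Rightarrow> 'o \<Rightarrow> 'm \<Rightarrow> 'm \<Rightarrow> 'm \<Rightarrow> bool"

definition candidate ::
  "('o, 'm, 'k, 'z) lincat_scheme \<Rightarrow> ('o, 'm, 'o, 'm) fct \<Rightarrow>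
     'o \<Rightarrow> 'o \<Rightarrow> 'o \<Rightarrow> 'm \<Rightarrow> 'm \<Rightarrow> 'm \<Rightarrow> bool" where
  "candidate C \<Sigma> X Y Z f g h \<longleftrightarrow> X \<in> Obj C \<and> Y \<in> Obj C \<and> Z \<in> Obj C \<and>
     f \<in> Mor C X Y \<and> g \<in> Mor C Y Z \<and> h \<in> Mor C Z (FO \<Sigma> X)"

definition candidate_iso ::
  "('o, 'm, 'k, 'z) lincat_scheme \<Rightarrow> ('o, 'm, 'o, 'm) fct \<Rightarrow>
     'o \<Rightarrow> 'o \<Rightarrow> 'o \<Rightarrow> 'm \<Rightarrow> 'm \<Rightarrow> 'm \<Rightarrow> 'o \<Rightarrow> 'o \<Rightarrow> 'o \<Rightarrow> 'm \<Rightarrow> 'm \<Rightarrow> 'm \<Rightarrow> bool" where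
  "candidate_iso C \<Sigma> X Y Z f g h X' Y' Z' f' g' h' \<longleftrightarrow>
     candidate C \<Sigma> X Y Z f g h \<and> candidate C \<Sigma> X' Y' Z' f' g' h' \<and>
     (\<exists>a b c. is_iso C X X' a \<and> is_iso C Y Y' b \<and> is_iso C Z Z' c \<and>
        b \<cdot>\<^bsub>C\<^esub> f = f' \<cdot>\<^bsub>C\<^esub> a \<and> c \<cdot>\<^bsub>C\<^esub> g = g' \<cdot>\<^bsub>C\<^esub> b \<and> FM \<Sigma> a \<cdot>\<^bsub>C\<^esub> h = h' \<cdot>\<^bsub>C\<^esub> c)"

locale triangulated = additive_cat k T
  for k :: "('k, 'r) ring_scheme" and T :: "('o, 'm, 'k, 'z) tricat_scheme" +
  assumes shift_functor: "lin_functor k T T (Sh T)"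
    and unshift_functor: "lin_functor k T T (Shi T)"
    and unshift_shift_obj: "X \<in> Obj T \<Longrightarrow> FO (Shi T) (FO (Sh T) X) = X"
    and shift_unshift_obj: "X \<in> Obj T \<Longrightarrow> FO (Sh T) (FO (Shi T) X) = X"
    and unshift_shift_mor:
      "\<lbrakk>X \<in> Obj T; Y \<in> Obj T; f \<in> Mor T X Y\<rbrakk> \<Longrightarrow> FM (Shi T) (FM (Sh T) f) = f"
    and shift_unshift_mor:
      "\<lbrakk>X \<in> Obj T; Y \<in> Obj T; f \<in> Mor T X Y\<rbrakk> \<Longrightarrow> FM (Sh T) (FM (Shi T) f) = f"
    and tri_candidate: "Tri T X Y Z f g h \<Longrightarrow> candidate T (Sh T) X Y Z f g h"
    and tri_iso:
      "\<lbrakk>Tri T X Y Z f g h; candidate_iso T (Sh T) X Y Z f g h X' Y' Z' f' g' h'\<rbrakk>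
        \<Longrightarrow> Tri T X' Y' Z' f' g' h'"
    and tri_ident:
      "\<lbrakk>X \<in> Obj T; is_zero_obj T Z\<rbrakk>
        \<Longrightarrow> Tri T X X Z (ident T X) \<zero>\<^bsub>Hom T X Z\<^esub> \<zero>\<^bsub>Hom T Z (FO (Sh T) X)\<^esub>"
    and tri_cone:
      "\<lbrakk>X \<in> Obj T; Y \<in> Obj T; f \<in> Mor T X Y\<rbrakk> \<Longrightarrow> \<exists>Z g h. Tri T X Y Z f g h"
    and tri_rotate:
      "candidate T (Sh T) X Y Z f g h
        \<Longrightarrow> Tri T X Y Z f g h \<longleftrightarrow>
            Tri T Y Z (FO (Sh T) X) g h (\<ominus>\<^bsub>Hom T (FO (Sh T) X) (FO (Sh T) Y)\<^esub> FM (Sh T) f)"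
    and tri_morphism:
      "\<lbrakk>Tri T X Y Z f g h; Tri T X' Y' Z' f' g' h'; a \<in> Mor T X X'; b \<in> Mor T Y Y';
        b \<cdot>\<^bsub>T\<^esub> f = f' \<cdot>\<^bsub>T\<^esub> a\<rbrakk>
        \<Longrightarrow> \<exists>c\<in>Mor T Z Z'. c \<cdot>\<^bsub>T\<^esub> g = g' \<cdot>\<^bsub>T\<^esub> b \<and> FM (Sh T) a \<cdot>\<^bsub>T\<^esub> h = h' \<cdot>\<^bsub>T\<^esub> c"
    and tri_octahedral:
      "\<lbrakk>Tri T X Y A f u u'; Tri T Y Z B g v v'; Tri T X Z C (g \<cdot>\<^bsub>T\<^esub> f) w w'\<rbrakk>
        \<Longrightarrow> \<exists>a b. Tri T A C B a b (FM (Sh T) u \<cdot>\<^bsub>T\<^esub> v') \<and>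
              a \<cdot>\<^bsub>T\<^esub> u = w \<cdot>\<^bsub>T\<^esub> g \<and> w' \<cdot>\<^bsub>T\<^esub> a = u' \<and>
              b \<cdot>\<^bsub>T\<^esub> w = v \<and> v' \<cdot>\<^bsub>T\<^esub> b = FM (Sh T) f \<cdot>\<^bsub>T\<^esub> w'"

definition shift :: "('o, 'm, 'k, 'z) tricat_scheme \<Rightarrow> int \<Rightarrow> 'o \<Rightarrow> 'o" where
  "shift T i X =
     (if 0 \<le> i then (FO (Sh T) ^^ nat i) X else (FO (Shi T) ^^ nat (- i)) X)"

definition thick :: "('o, 'm, 'k, 'z) tricat_scheme \<Rightarrow> 'o set \<Rightarrow> bool" where
  "thick T U \<longleftrightarrow> U \<subseteq> Obj T \<and> (\<exists>Z\<in>U. is_zero_obj T Z) \<and>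
     (\<forall>X\<in>U. \<forall>Y f. is_iso T X Y f \<longrightarrow> Y \<in> U) \<and>
     (\<forall>X\<in>U. FO (Sh T) X \<in> U \<and> FO (Shi T) X \<in> U) \<and>
     (\<forall>X Y Z f g h. Tri T X Y Z f g h \<and> X \<in> U \<and> Y \<in> U \<longrightarrow> Z \<in> U) \<and>
     (\<forall>X Y B i j p q. is_biproduct T X Y B i j p q \<and> B \<in> U \<longrightarrow> X \<in> U)"

definition triangle_equivalence ::
  "('k, 'r) ring_scheme \<Rightarrow> ('o, 'm, 'k, 'z) tricat_scheme \<Rightarrow> ('o, 'm, 'o, 'm) fct \<Rightarrow> bool" where
  "triangle_equivalence k T F \<longleftrightarrow> lin_equivalence k T T F \<and>
     (\<exists>\<eta>. nat_iso T T (functor_cmp F (Sh T)) (functor_cmp (Sh T) F) \<eta> \<and>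
       (\<forall>X Y Z f g h. Tri T X Y Z f g h \<longrightarrow>
          Tri T (FO F X) (FO F Y) (FO F Z) (FM F f) (FM F g) (\<eta> X \<cdot>\<^bsub>T\<^esub> FM F h)))"


subsection \<open>Verdier quotients\<close>

text \<open>
  \<open>qis T U X Y\<close> is the set of morphisms \<open>X \<longrightarrow> Y\<close> with cone in \<open>U\<close>. A morphism
  \<open>X \<longrightarrow> Y\<close> of the Verdier quotient is an equivalence class of roofs \<open>(s, f)\<close>, standing
  for \<open>f \<cdot> s\<^sup>-\<^sup>1\<close>, where \<open>s\<close> is a map \<open>W \<longrightarrow> X\<close> with cone in \<open>U\<close> and \<open>f\<close> is a map \<open>W \<longrightarrow> Y\<close>.
\<close>

definition qis :: "('o, 'm, 'k, 'z) tricat_scheme \<Rightarrow> 'o set \<Rightarrow> 'o \<Rightarrow> 'o \<Rightarrow> 'm set" where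
  "qis T U X Y = {s \<in> Mor T X Y. \<exists>Z\<in>U. \<exists>g h. Tri T X Y Z s g h}"

definition roofs :: "('o, 'm, 'k, 'z) tricat_scheme \<Rightarrow> 'o set \<Rightarrow> 'o \<Rightarrow> 'o \<Rightarrow> ('m \<times> 'm) set" where
  "roofs T U X Y = {(s, f). \<exists>W\<in>Obj T. s \<in> qis T U W X \<and> f \<in> Mor T W Y}"

definition roof_rel ::
  "('o, 'm, 'k, 'z) tricat_scheme \<Rightarrow> 'o set \<Rightarrow> 'o \<Rightarrow> 'o \<Rightarrow> (('m \<times> 'm) \<times> ('m \<times> 'm)) set" where
  "roof_rel T U X Y = {((s, f), (t, g)).
     \<exists>V\<in>Obj T. \<exists>W\<in>Obj T. \<exists>W'\<in>Obj T. \<exists>u\<in>Mor T V W. \<exists>v\<in>Mor T V W'.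
       s \<in> qis T U W X \<and> f \<in> Mor T W Y \<and> t \<in> qis T U W' X \<and> g \<in> Mor T W' Y \<and>
       s \<cdot>\<^bsub>T\<^esub> u = t \<cdot>\<^bsub>T\<^esub> v \<and> s \<cdot>\<^bsub>T\<^esub> u \<in> qis T U V X \<and> f \<cdot>\<^bsub>T\<^esub> u = g \<cdot>\<^bsub>T\<^esub> v}"

definition roof_class ::
  "('o, 'm, 'k, 'z) tricat_scheme \<Rightarrow> 'o set \<Rightarrow> 'o \<Rightarrow> 'o \<Rightarrow> 'm \<Rightarrow> 'm \<Rightarrow> ('m \<times> 'm) set" where
  "roof_class T U X Y s f = roof_rel T U X Y `` {(s, f)}"

text \<open>
  The operations on classes are given by the unions of the classes of all results obtained from
  representatives: sums are formed with common denominators, and roofs are composed by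
  completing \<open>f\<close>, \<open>t\<close> to a commutative square \<open>f \<cdot> t' = t \<cdot> f'\<close>.
\<close>

definition verdier_hom ::
  "('o, 'm, 'k, 'z) tricat_scheme \<Rightarrow> 'o set \<Rightarrow> 'o \<Rightarrow> 'o \<Rightarrow> ('k, ('m \<times> 'm) set) module" where
  "verdier_hom T U X Y = \<lparr>
     carrier = roofs T U X Y // roof_rel T U X Y,
     mult = undefined,
     one = undefined,
     zero = roof_class T U X Y (ident T X) \<zero>\<^bsub>Hom T X Y\<^esub>,
     add = (\<lambda>a b. {r. \<exists>W\<in>Obj T. \<exists>s f g. f \<in> Mor T W Y \<and> g \<in> Mor T W Y \<and>
              (s, f) \<in> a \<and> (s, g) \<in> b \<and> r \<in> roof_class T U X Y s (f \<oplus>\<^bsub>Hom T W Y\<^esub> g)}),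
     smult = (\<lambda>c a. {r. \<exists>W\<in>Obj T. \<exists>s f. f \<in> Mor T W Y \<and>
              (s, f) \<in> a \<and> r \<in> roof_class T U X Y s (c \<odot>\<^bsub>Hom T W Y\<^esub> f)})\<rparr>"

definition verdier_cmp ::
  "('o, 'm, 'k, 'z) tricat_scheme \<Rightarrow> 'o set \<Rightarrow> ('m \<times> 'm) set \<Rightarrow> ('m \<times> 'm) set \<Rightarrow> ('m \<times> 'm) set" where
  "verdier_cmp T U b a = {r. \<exists>X\<in>Obj T. \<exists>Y\<in>Obj T. \<exists>Z\<in>Obj T. \<exists>W\<in>Obj T. \<exists>W'\<in>Obj T. \<exists>V\<in>Obj T.
     \<exists>s f t g t' f'. (s, f) \<in> a \<and> (t, g) \<in> b \<and>
       s \<in> qis T U W X \<and> f \<in> Mor T W Y \<and> t \<in> qis T U W' Y \<and> g \<in> Mor T W' Z \<and>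
       t' \<in> qis T U V W \<and> f' \<in> Mor T V W' \<and> f \<cdot>\<^bsub>T\<^esub> t' = t \<cdot>\<^bsub>T\<^esub> f' \<and>
       r \<in> roof_class T U X Z (s \<cdot>\<^bsub>T\<^esub> t') (g \<cdot>\<^bsub>T\<^esub> f')}"

definition verdier_lincat ::
  "('o, 'm, 'k, 'z) tricat_scheme \<Rightarrow> 'o set \<Rightarrow> ('o, ('m \<times> 'm) set, 'k) lincat" where
  "verdier_lincat T U = \<lparr>
     Obj = Obj T,
     Hom = verdier_hom T U,
     ident = (\<lambda>X. roof_class T U X X (ident T X) (ident T X)),
     cmp = verdier_cmp T U\<rparr>"

definition verdier_functor ::
  "('o, 'm, 'k, 'z) tricat_scheme \<Rightarrow> 'o set \<Rightarrow> ('o, 'm, 'o, ('m \<times> 'm) set) fct" where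
  "verdier_functor T U = \<lparr>
     FO = (\<lambda>X. X),
     FM = (\<lambda>f. {r. \<exists>X\<in>Obj T. \<exists>Y\<in>Obj T. f \<in> Mor T X Y \<and> r \<in> roof_class T U X Y (ident T X) f})\<rparr>"

text \<open>The functor induced on the Verdier quotient by an endofunctor \<open>F\<close> that preserves \<open>qis\<close>.\<close>

definition verdier_induced ::
  "('o, 'm, 'k, 'z) tricat_scheme \<Rightarrow> 'o set \<Rightarrow> ('o, 'm, 'o, 'm) fct \<Rightarrow>
     ('o, ('m \<times> 'm) set, 'o, ('m \<times> 'm) set) fct" where
  "verdier_induced T U F = \<lparr>
     FO = FO F,
     FM = (\<lambda>a. {r. \<exists>X\<in>Obj T. \<exists>Y\<in>Obj T. \<exists>s f. (s, f) \<in> a \<and> (s, f) \<in> roofs T U X Y \<and>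
             r \<in> roof_class T U (FO F X) (FO F Y) (FM F s) (FM F f)})\<rparr>"

definition verdier_quotient ::
  "('o, 'm, 'k, 'z) tricat_scheme \<Rightarrow> 'o set \<Rightarrow> ('o, ('m \<times> 'm) set, 'k) tricat" where
  "verdier_quotient T U = lincat.extend (verdier_lincat T U) \<lparr>
     Sh = verdier_induced T U (Sh T),
     Shi = verdier_induced T U (Shi T),
     Tri = (\<lambda>X Y Z a b c. \<exists>X' Y' Z' f g h. Tri T X' Y' Z' f g h \<and>
        candidate_iso (verdier_lincat T U) (verdier_induced T U (Sh T))
          X' Y' Z' (FM (verdier_functor T U) f) (FM (verdier_functor T U) g)
            (FM (verdier_functor T U) h)
          X Y Z a b c)\<rparr>"


section \<open>Additive quotients\<close>

definition factor_ideal ::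
  "('o, 'm, 'k, 'z) lincat_scheme \<Rightarrow> 'o set \<Rightarrow> 'o \<Rightarrow> 'o \<Rightarrow> 'm set" where
  "factor_ideal C P X Y = {g \<cdot>\<^bsub>C\<^esub> f | f g. \<exists>Z\<in>P. f \<in> Mor C X Z \<and> g \<in> Mor C Z Y}"

definition quotient_hom ::
  "('o, 'm, 'k, 'z) lincat_scheme \<Rightarrow> 'o set \<Rightarrow> 'o \<Rightarrow> 'o \<Rightarrow> ('k, 'm set) module" where
  "quotient_hom C P X Y = (let I = factor_ideal C P X Y in \<lparr>
     carrier = a_rcosets\<^bsub>Hom C X Y\<^esub> I,
     mult = undefined,
     one = undefined,
     zero = I,
     add = (\<lambda>a b. a <+>\<^bsub>Hom C X Y\<^esub> b),
     smult = (\<lambda>c a. I <+>\<^bsub>Hom C X Y\<^esub> ((\<lambda>f. c \<odot>\<^bsub>Hom C X Y\<^esub> f) ` a))\<rparr>)"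

definition additive_quotient ::
  "('o, 'm, 'k, 'z) lincat_scheme \<Rightarrow> 'o set \<Rightarrow> ('o, 'm set, 'k) lincat" where
  "additive_quotient C P = \<lparr>
     Obj = Obj C,
     Hom = quotient_hom C P,
     ident = (\<lambda>X. factor_ideal C P X X +>\<^bsub>Hom C X X\<^esub> ident C X),
     cmp = (\<lambda>b a. {h. \<exists>X\<in>Obj C. \<exists>Y\<in>Obj C. \<exists>Z\<in>Obj C. \<exists>f\<in>a \<inter> Mor C X Y. \<exists>g\<in>b \<inter> Mor C Y Z.
              h \<in> factor_ideal C P X Z +>\<^bsub>Hom C X Z\<^esub> (g \<cdot>\<^bsub>C\<^esub> f)})\<rparr>"

definition additive_quotient_functor ::
  "('o, 'm, 'k, 'z) lincat_scheme \<Rightarrow> 'o set \<Rightarrow> ('o, 'm, 'o, 'm set) fct" where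
  "additive_quotient_functor C P = \<lparr>
     FO = (\<lambda>X. X),
     FM = (\<lambda>f. {h. \<exists>X\<in>Obj C. \<exists>Y\<in>Obj C. f \<in> Mor C X Y \<and>
             h \<in> factor_ideal C P X Y +>\<^bsub>Hom C X Y\<^esub> f})\<rparr>"


section \<open>Extriangulated categories\<close>

text \<open>
  \<open>Ext E C A\<close> is the group \<open>\<E>(C, A)\<close>. For \<open>\<delta> \<in> \<E>(C, A)\<close>, \<open>Push E C a \<delta>\<close> is \<open>a\<^sub>*\<delta>\<close> and
  \<open>Pull E A c \<delta>\<close> is \<open>c\<^sup>*\<delta>\<close>; the object argument is the one not determined by the morphism.
  \<open>Real E A B C x y \<delta>\<close> says that \<open>A \<longrightarrow> B \<longrightarrow> C\<close>, with maps \<open>x\<close>, \<open>y\<close>, belongs to the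
  equivalence class \<open>\<s>(\<delta>)\<close>.
\<close>

record ('o, 'm, 'k, 'e) extricat = "('o, 'm, 'k) lincat" +
  Ext :: "'o \<Rightarrow> 'o \<Rightarrow> 'e ring"
  Push :: "'o \<Rightarrow> 'm \<Rightarrow> 'e \<Rightarrow> 'e"
  Pull :: "'o \<Rightarrow> 'm \<Rightarrow> 'e \<Rightarrow> 'e"
  Real :: "'o \<Rightarrow> 'o \<Rightarrow> 'o \<Rightarrow> 'm \<Rightarrow> 'm \<Rightarrow> 'e \<Rightarrow> bool"

abbreviation ExtEl :: "('o, 'm, 'k, 'e, 'z) extricat_scheme \<Rightarrow> 'o \<Rightarrow> 'o \<Rightarrow> 'e set" where
  "ExtEl E C A \<equiv> carrier (Ext E C A)"

definition seq_equiv ::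
  "('o, 'm, 'k, 'z) lincat_scheme \<Rightarrow> 'o \<Rightarrow> 'm \<Rightarrow> 'm \<Rightarrow> 'o \<Rightarrow> 'm \<Rightarrow> 'm \<Rightarrow> bool" where
  "seq_equiv E B x y B' x' y' \<longleftrightarrow>
     (\<exists>b. is_iso E B B' b \<and> b \<cdot>\<^bsub>E\<^esub> x = x' \<and> y' \<cdot>\<^bsub>E\<^esub> b = y)"

text \<open>\<open>ET4op\<close> is the formal dual of \<open>ET4\<close>, with arrows reversed and \<open>\<E>(C, A)\<close> turned into \<open>\<E>(A, C)\<close>.\<close>

locale extriangulated = additive_cat k E
  for k :: "('k, 'r) ring_scheme" and E :: "('o, 'm, 'k, 'e, 'z) extricat_scheme" +
  assumes ext_group: "\<lbrakk>C \<in> Obj E; A \<in> Obj E\<rbrakk> \<Longrightarrow> abelian_group (Ext E C A)"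
    and push_closed:
      "\<lbrakk>A \<in> Obj E; A' \<in> Obj E; C \<in> Obj E; a \<in> Mor E A A'; \<delta> \<in> ExtEl E C A\<rbrakk>
        \<Longrightarrow> Push E C a \<delta> \<in> ExtEl E C A'"
    and pull_closed:
      "\<lbrakk>A \<in> Obj E; C \<in> Obj E; C' \<in> Obj E; c \<in> Mor E C' C; \<delta> \<in> ExtEl E C A\<rbrakk>
        \<Longrightarrow> Pull E A c \<delta> \<in> ExtEl E C' A"
    and push_ident:
      "\<lbrakk>A \<in> Obj E; C \<in> Obj E; \<delta> \<in> ExtEl E C A\<rbrakk> \<Longrightarrow> Push E C (ident E A) \<delta> = \<delta>"
    and pull_ident:
      "\<lbrakk>A \<in> Obj E; C \<in> Obj E; \<delta> \<in> ExtEl E C A\<rbrakk> \<Longrightarrow> Pull E A (ident E C) \<delta> = \<delta>"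
    and push_cmp:
      "\<lbrakk>A \<in> Obj E; A' \<in> Obj E; A'' \<in> Obj E; C \<in> Obj E;
        a \<in> Mor E A A'; a' \<in> Mor E A' A''; \<delta> \<in> ExtEl E C A\<rbrakk>
        \<Longrightarrow> Push E C (a' \<cdot>\<^bsub>E\<^esub> a) \<delta> = Push E C a' (Push E C a \<delta>)"
    and pull_cmp:
      "\<lbrakk>A \<in> Obj E; C \<in> Obj E; C' \<in> Obj E; C'' \<in> Obj E;
        c \<in> Mor E C' C; c' \<in> Mor E C'' C'; \<delta> \<in> ExtEl E C A\<rbrakk>
        \<Longrightarrow> Pull E A (c \<cdot>\<^bsub>E\<^esub> c') \<delta> = Pull E A c' (Pull E A c \<delta>)"
    and push_pull:
      "\<lbrakk>A \<in> Obj E; A' \<in> Obj E; C \<in> Obj E; C' \<in> Obj E;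
        a \<in> Mor E A A'; c \<in> Mor E C' C; \<delta> \<in> ExtEl E C A\<rbrakk>
        \<Longrightarrow> Push E C' a (Pull E A c \<delta>) = Pull E A' c (Push E C a \<delta>)"
    and push_add_ext:
      "\<lbrakk>A \<in> Obj E; A' \<in> Obj E; C \<in> Obj E; a \<in> Mor E A A'; \<delta> \<in> ExtEl E C A; \<delta>' \<in> ExtEl E C A\<rbrakk>
        \<Longrightarrow> Push E C a (\<delta> \<oplus>\<^bsub>Ext E C A\<^esub> \<delta>') = Push E C a \<delta> \<oplus>\<^bsub>Ext E C A'\<^esub> Push E C a \<delta>'"
    and pull_add_ext:
      "\<lbrakk>A \<in> Obj E; C \<in> Obj E; C' \<in> Obj E; c \<in> Mor E C' C; \<delta> \<in> ExtEl E C A; \<delta>' \<in> ExtEl E C A\<rbrakk>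
        \<Longrightarrow> Pull E A c (\<delta> \<oplus>\<^bsub>Ext E C A\<^esub> \<delta>') = Pull E A c \<delta> \<oplus>\<^bsub>Ext E C' A\<^esub> Pull E A c \<delta>'"
    and push_add_mor:
      "\<lbrakk>A \<in> Obj E; A' \<in> Obj E; C \<in> Obj E; a \<in> Mor E A A'; a' \<in> Mor E A A'; \<delta> \<in> ExtEl E C A\<rbrakk>
        \<Longrightarrow> Push E C (a \<oplus>\<^bsub>Hom E A A'\<^esub> a') \<delta> = Push E C a \<delta> \<oplus>\<^bsub>Ext E C A'\<^esub> Push E C a' \<delta>"
    and pull_add_mor:
      "\<lbrakk>A \<in> Obj E; C \<in> Obj E; C' \<in> Obj E; c \<in> Mor E C' C; c' \<in> Mor E C' C; \<delta> \<in> ExtEl E C A\<rbrakk>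
        \<Longrightarrow> Pull E A (c \<oplus>\<^bsub>Hom E C' C\<^esub> c') \<delta> = Pull E A c \<delta> \<oplus>\<^bsub>Ext E C' A\<^esub> Pull E A c' \<delta>"
    and real_typed:
      "Real E A B C x y \<delta> \<Longrightarrow> A \<in> Obj E \<and> B \<in> Obj E \<and> C \<in> Obj E \<and>
         x \<in> Mor E A B \<and> y \<in> Mor E B C \<and> \<delta> \<in> ExtEl E C A"
    and real_exists:
      "\<lbrakk>A \<in> Obj E; C \<in> Obj E; \<delta> \<in> ExtEl E C A\<rbrakk> \<Longrightarrow> \<exists>B x y. Real E A B C x y \<delta>"
    and real_class:
      "\<lbrakk>Real E A B C x y \<delta>; B' \<in> Obj E; x' \<in> Mor E A B'; y' \<in> Mor E B' C\<rbrakk>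
        \<Longrightarrow> Real E A B' C x' y' \<delta> \<longleftrightarrow> seq_equiv E B x y B' x' y'"
    and real_morphism:
      "\<lbrakk>Real E A B C x y \<delta>; Real E A' B' C' x' y' \<delta>'; a \<in> Mor E A A'; c \<in> Mor E C C';
        Push E C a \<delta> = Pull E A' c \<delta>'\<rbrakk>
        \<Longrightarrow> \<exists>b\<in>Mor E B B'. b \<cdot>\<^bsub>E\<^esub> x = x' \<cdot>\<^bsub>E\<^esub> a \<and> y' \<cdot>\<^bsub>E\<^esub> b = c \<cdot>\<^bsub>E\<^esub> y"
    and real_split:
      "is_biproduct E A C B i j p q \<Longrightarrow> Real E A B C i q \<zero>\<^bsub>Ext E C A\<^esub>"
    and real_sum:
      "\<lbrakk>Real E A B C x y \<delta>; Real E A' B' C' x' y' \<delta>';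
        is_biproduct E A A' A'' iA iA' pA pA'; is_biproduct E B B' B'' iB iB' pB pB';
        is_biproduct E C C' C'' iC iC' pC pC'\<rbrakk>
        \<Longrightarrow> Real E A'' B'' C''
              ((iB \<cdot>\<^bsub>E\<^esub> x \<cdot>\<^bsub>E\<^esub> pA) \<oplus>\<^bsub>Hom E A'' B''\<^esub> (iB' \<cdot>\<^bsub>E\<^esub> x' \<cdot>\<^bsub>E\<^esub> pA'))
              ((iC \<cdot>\<^bsub>E\<^esub> y \<cdot>\<^bsub>E\<^esub> pB) \<oplus>\<^bsub>Hom E B'' C''\<^esub> (iC' \<cdot>\<^bsub>E\<^esub> y' \<cdot>\<^bsub>E\<^esub> pB'))
              (Push E C'' iA (Pull E A pC \<delta>) \<oplus>\<^bsub>Ext E C'' A''\<^esub> Push E C'' iA' (Pull E A' pC' \<delta>'))"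
    and ET3:
      "\<lbrakk>Real E A B C x y \<delta>; Real E A' B' C' x' y' \<delta>'; a \<in> Mor E A A'; b \<in> Mor E B B';
        b \<cdot>\<^bsub>E\<^esub> x = x' \<cdot>\<^bsub>E\<^esub> a\<rbrakk>
        \<Longrightarrow> \<exists>c\<in>Mor E C C'. c \<cdot>\<^bsub>E\<^esub> y = y' \<cdot>\<^bsub>E\<^esub> b \<and> Push E C a \<delta> = Pull E A' c \<delta>'"
    and ET3op:
      "\<lbrakk>Real E A B C x y \<delta>; Real E A' B' C' x' y' \<delta>'; b \<in> Mor E B B'; c \<in> Mor E C C';
        c \<cdot>\<^bsub>E\<^esub> y = y' \<cdot>\<^bsub>E\<^esub> b\<rbrakk>
        \<Longrightarrow> \<exists>a\<in>Mor E A A'. b \<cdot>\<^bsub>E\<^esub> x = x' \<cdot>\<^bsub>E\<^esub> a \<and> Push E C a \<delta> = Pull E A' c \<delta>'"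
    and ET4:
      "\<lbrakk>Real E A B D f f' \<delta>; Real E B C F g g' \<delta>'\<rbrakk>
        \<Longrightarrow> \<exists>G\<in>Obj E. \<exists>h' d e \<delta>''.
              Real E A C G (g \<cdot>\<^bsub>E\<^esub> f) h' \<delta>'' \<and>
              d \<in> Mor E D G \<and> e \<in> Mor E G F \<and>
              h' \<cdot>\<^bsub>E\<^esub> g = d \<cdot>\<^bsub>E\<^esub> f' \<and> e \<cdot>\<^bsub>E\<^esub> h' = g' \<and>
              Real E D G F d e (Push E F f' \<delta>') \<and>
              Pull E A d \<delta>'' = \<delta> \<and>
              Push E G f \<delta>'' = Pull E B e \<delta>'"
    and ET4op:
      "\<lbrakk>Real E D B A f' f \<delta>; Real E F C B g' g \<delta>'\<rbrakk>
        \<Longrightarrow> \<exists>G\<in>Obj E. \<exists>h' d e \<delta>''.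
              Real E G C A h' (f \<cdot>\<^bsub>E\<^esub> g) \<delta>'' \<and>
              d \<in> Mor E G D \<and> e \<in> Mor E F G \<and>
              g \<cdot>\<^bsub>E\<^esub> h' = f' \<cdot>\<^bsub>E\<^esub> d \<and> h' \<cdot>\<^bsub>E\<^esub> e = g' \<and>
              Real E F G D e d (Pull E F f' \<delta>') \<and>
              Push E A d \<delta>'' = \<delta> \<and>
              Pull E G f \<delta>'' = Push E B e \<delta>'"

definition conflation ::
  "('o, 'm, 'k, 'e, 'z) extricat_scheme \<Rightarrow> 'o \<Rightarrow> 'o \<Rightarrow> 'o \<Rightarrow> bool" where
  "conflation E A B C \<longleftrightarrow> (\<exists>x y. \<exists>\<delta>\<in>ExtEl E C A. Real E A B C x y \<delta>)"

definition Proj :: "('o, 'm, 'k, 'e, 'z) extricat_scheme \<Rightarrow> 'o set" where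
  "Proj E = {P \<in> Obj E. \<forall>A\<in>Obj E. ExtEl E P A = {\<zero>\<^bsub>Ext E P A\<^esub>}}"

definition Inj :: "('o, 'm, 'k, 'e, 'z) extricat_scheme \<Rightarrow> 'o set" where
  "Inj E = {I \<in> Obj E. \<forall>C\<in>Obj E. ExtEl E C I = {\<zero>\<^bsub>Ext E C I\<^esub>}}"

definition frobenius_extriangulated ::
  "('k, 'r) ring_scheme \<Rightarrow> ('o, 'm, 'k, 'e, 'z) extricat_scheme \<Rightarrow> bool" where
  "frobenius_extriangulated k E \<longleftrightarrow> extriangulated k E \<and> Proj E = Inj E \<and>
     (\<forall>X\<in>Obj E. (\<exists>X'\<in>Obj E. \<exists>P\<in>Proj E. conflation E X' P X) \<and>
                (\<exists>I\<in>Inj E. \<exists>X''\<in>Obj E. conflation E X I X''))"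

definition extension_closed :: "('o, 'm, 'k, 'z) tricat_scheme \<Rightarrow> 'o set \<Rightarrow> bool" where
  "extension_closed T U \<longleftrightarrow> U \<subseteq> Obj T \<and>
     (\<forall>A B C f g h. Tri T A B C f g h \<and> A \<in> U \<and> C \<in> U \<longrightarrow> B \<in> U)"

definition sub_extricat ::
  "('o, 'm, 'k, 'z) tricat_scheme \<Rightarrow> 'o set \<Rightarrow> ('o, 'm, 'k, 'm) extricat" where
  "sub_extricat T U = lincat.extend (full_sub T U) \<lparr>
     Ext = (\<lambda>C A. ring.truncate (Hom T C (FO (Sh T) A))),
     Push = (\<lambda>C a \<delta>. FM (Sh T) a \<cdot>\<^bsub>T\<^esub> \<delta>),
     Pull = (\<lambda>A c \<delta>. \<delta> \<cdot>\<^bsub>T\<^esub> c),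
     Real = (\<lambda>A B C x y \<delta>. A \<in> U \<and> B \<in> U \<and> C \<in> U \<and> Tri T A B C x y \<delta>)\<rparr>"


section \<open>SMC quadruples\<close>

definition right_perp :: "('o, 'm, 'k, 'z) lincat_scheme \<Rightarrow> 'o set \<Rightarrow> 'o set" where
  "right_perp C A = {X \<in> Obj C. \<forall>S\<in>A. hom_zero C S X}"

definition left_perp :: "('o, 'm, 'k, 'z) lincat_scheme \<Rightarrow> 'o set \<Rightarrow> 'o set" where
  "left_perp C A = {X \<in> Obj C. \<forall>S\<in>A. hom_zero C X S}"

definition shifts_ge :: "('o, 'm, 'k, 'z) tricat_scheme \<Rightarrow> 'o set \<Rightarrow> int \<Rightarrow> 'o set" where
  "shifts_ge T A n = {shift T i S | S i. S \<in> A \<and> i \<ge> n}"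

definition shifts_less :: "('o, 'm, 'k, 'z) tricat_scheme \<Rightarrow> 'o set \<Rightarrow> int \<Rightarrow> 'o set" where
  "shifts_less T A n = {shift T i S | S i. S \<in> A \<and> i < n}"

definition star :: "('o, 'm, 'k, 'z) tricat_scheme \<Rightarrow> 'o set \<Rightarrow> 'o set \<Rightarrow> 'o set" where
  "star T A B = {W \<in> Obj T. \<exists>X\<in>A. \<exists>Y\<in>B. \<exists>f g h. Tri T X W Y f g h}"

definition torsion_pair :: "('o, 'm, 'k, 'z) tricat_scheme \<Rightarrow> 'o set \<Rightarrow> 'o set \<Rightarrow> bool" where
  "torsion_pair T A B \<longleftrightarrow> A \<subseteq> Obj T \<and> B \<subseteq> Obj T \<and> (\<forall>X\<in>A. \<forall>Y\<in>B. hom_zero T X Y) \<and>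
     star T A B = Obj T \<and> right_perp T A = B \<and> left_perp T B = A"

definition co_t_structure :: "('o, 'm, 'k, 'z) tricat_scheme \<Rightarrow> 'o set \<Rightarrow> 'o set \<Rightarrow> bool" where
  "co_t_structure T A B \<longleftrightarrow> torsion_pair T A B \<and> FO (Sh T) ` B \<subseteq> B"

definition smc ::
  "('k, 'r) ring_scheme \<Rightarrow> ('o, 'm, 'k, 'z) tricat_scheme \<Rightarrow> 'o set \<Rightarrow> bool" where
  "smc k T A \<longleftrightarrow> A \<subseteq> Obj T \<and>
     (\<forall>X\<in>A. \<forall>Y\<in>A. \<forall>i<0. hom_zero T X (shift T i Y)) \<and>
     (\<forall>X\<in>A. \<forall>Y\<in>A. vectorspace.fin_dim k (Hom T X Y) \<and>
        vectorspace.dim k (Hom T X Y) = (if X = Y then 1 else 0)) \<and>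
     \<Inter>{U. thick T U \<and> A \<subseteq> U} = Obj T"

locale smc_quadruple = triangulated k T
  for k :: "('k, 'r) ring_scheme" and T :: "('o, 'm, 'k, 'z) tricat_scheme"
    and Tp :: "'o set" and SS :: "('o, 'm, 'o, 'm) fct" and S :: "'o set" +
  assumes RS0_hom_finite: "hom_finite k T"
    and RS0_krull_schmidt: "krull_schmidt T"
    and RS0_thick: "thick T Tp"
    and RS1_triangle_equivalence: "triangle_equivalence k T SS"
    and RS1_restricts: "lin_equivalence k (full_sub T Tp) (full_sub T Tp) SS"
    and RS1_duality: "\<exists>\<alpha>. serre_duality k T Tp SS \<alpha>"
    and RS2_smc: "smc k T S"
    and RS2_left:
      "co_t_structure T (left_perp T (shifts_ge T S 0)) (left_perp T (shifts_less T S 0))"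
    and RS2_right:
      "co_t_structure T (right_perp T (shifts_ge T S 0)) (right_perp T (shifts_less T S 0))"
    and RS2_left_perfect: "left_perp T (shifts_ge T S 0) \<subseteq> Tp"
    and RS2_right_perfect: "right_perp T (shifts_less T S 0) \<subseteq> Tp"

text \<open>Here are \<open>\<T>\<^bsub>>i\<^esub>\<close> and \<open>\<T>\<^bsub>\<le>i\<^esub>\<close>; then \<open>\<T>\<^bsub>\<ge>i\<^esub>\<close> is \<open>T_gt T S (i - 1)\<close>.\<close>

definition T_gt :: "('o, 'm, 'k, 'z) tricat_scheme \<Rightarrow> 'o set \<Rightarrow> int \<Rightarrow> 'o set" where
  "T_gt T S i = left_perp T (shifts_ge T S (- i))"

definition T_le :: "('o, 'm, 'k, 'z) tricat_scheme \<Rightarrow> 'o set \<Rightarrow> int \<Rightarrow> 'o set" where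
  "T_le T S i = left_perp T (shifts_less T S (- i))"

definition T_ge :: "('o, 'm, 'k, 'z) tricat_scheme \<Rightarrow> 'o set \<Rightarrow> int \<Rightarrow> 'o set" where
  "T_ge T S i = T_gt T S (i - 1)"

end

theory Submission
  imports Defs
begin

text \<open>
  Serre duality turns the second co-t-structure into one of the form \<open>L i \<perp> (TL i \<inter> Tp)\<close>, where
  \<open>TL i\<close> is \<open>T_le T S i\<close> and \<open>L i\<close> is the left orthogonal of \<open>TL i \<inter> Tp\<close>, so that \<open>F\<close> is
  \<open>TL 0 \<inter> L (-1)\<close>. Truncating with respect to both families replaces every object by one of \<open>F\<close>
  up to perfect objects, and also gives the conflations with middle term in \<open>P\<close>. A morphism of \<open>F\<close>
  dies in the singularity category iff it factors through a perfect object, and truncating that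
  object puts it in \<open>P\<close>; roofs between objects of \<open>F\<close> are straightened in the same way.

  For Serre duality, the cone of the denominator turns a roof \<open>X \<longleftarrow> W \<longrightarrow> \<S> X[-1]\<close> into a pair of
  maps that can be evaluated against each other by the duality for perfect objects. This defines a
  cyclic trace. It is nondegenerate because \<open>X\<close> and \<open>Y\<close> can be replaced so that their morphisms in
  the quotient are the morphisms of \<open>T\<close> from \<open>X\<close> to a perfect truncation of \<open>Y\<close>.
\<close>


section \<open>Linear algebra\<close>

text \<open>The two families of truncations are complementary. \<open>TG i\<close> consists of
  perfect objects, while the other family has the perfect right halves
  \<open>TL i \<inter> Tp\<close>; so each truncation changes an object only by a perfect one.
  Membership in \<open>TL 0\<close> controls maps coming from \<open>TG 0\<close>, and membership in
  \<open>L (-1)\<close> controls maps into perfect objects of \<open>TL (-1)\<close>. The indices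
  differ by one because T_{>=0} is \<open>TG (-1)\<close>: with this choice the perfect part of an
  object of \<open>F\<close> lies in \<open>P\<close>, both for the \<open>TG\<close> family cut at
  -1 and for the \<open>L\<close> family cut at 0.

  The obstacle in the duality is that a morphism of the quotient has no preferred roof, so that no
  formula for the inverse of the trace form suggests itself. Generation of \<open>T\<close> by
  \<open>S\<close> supplies bounds: a fixed object receives no maps from \<open>TL (-m)\<close> and
  has no maps to \<open>L m\<close> once m is large. With replacements of both objects, these bounds
  reduce the realisation of functionals to finite-dimensional duality in \<open>T\<close>.
  Nondegeneracy then follows formally from cyclicity and from the fullness of the functor induced by
  \<S>[-1].\<close>

lemma linear_mapI:
  assumes "vectorspace k V" "vectorspace k W"
    and "\<And>x. x \<in> carrier V \<Longrightarrow> h x \<in> carrier W"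
    and "\<And>x y. \<lbrakk>x \<in> carrier V; y \<in> carrier V\<rbrakk> \<Longrightarrow> h (x \<oplus>\<^bsub>V\<^esub> y) = h x \<oplus>\<^bsub>W\<^esub> h y"
    and "\<And>c x. \<lbrakk>c \<in> carrier k; x \<in> carrier V\<rbrakk> \<Longrightarrow> h (c \<odot>\<^bsub>V\<^esub> x) = c \<odot>\<^bsub>W\<^esub> h x"
  shows "linear_map k V W h"
  using assms unfolding linear_map_def mod_hom_def mod_hom_axioms_def module_hom_def
  by (auto simp: vectorspace.axioms)

lemma linear_mapD:
  assumes "linear_map k V W h"
  shows "x \<in> carrier V \<Longrightarrow> h x \<in> carrier W"
    and "\<lbrakk>x \<in> carrier V; y \<in> carrier V\<rbrakk> \<Longrightarrow> h (x \<oplus>\<^bsub>V\<^esub> y) = h x \<oplus>\<^bsub>W\<^esub> h y"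
    and "\<lbrakk>c \<in> carrier k; x \<in> carrier V\<rbrakk> \<Longrightarrow> h (c \<odot>\<^bsub>V\<^esub> x) = c \<odot>\<^bsub>W\<^esub> h x"
    and "h \<zero>\<^bsub>V\<^esub> = \<zero>\<^bsub>W\<^esub>"
    and "x \<in> carrier V \<Longrightarrow> h (\<ominus>\<^bsub>V\<^esub> x) = \<ominus>\<^bsub>W\<^esub> h x"
    and "vectorspace k V" and "vectorspace k W"
proof -
  interpret linear_map k V W h by fact
  show "x \<in> carrier V \<Longrightarrow> h x \<in> carrier W" 
    "\<lbrakk>x \<in> carrier V; y \<in> carrier V\<rbrakk> \<Longrightarrow> h (x \<oplus>\<^bsub>V\<^esub> y) = h x \<oplus>\<^bsub>W\<^esub> h y"
    "\<lbrakk>c \<in> carrier k; x \<in> carrier V\<rbrakk> \<Longrightarrow> h (c \<odot>\<^bsub>V\<^esub> x) = c \<odot>\<^bsub>W\<^esub> h x" 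
    "h \<zero>\<^bsub>V\<^esub> = \<zero>\<^bsub>W\<^esub>" "x \<in> carrier V \<Longrightarrow> h (\<ominus>\<^bsub>V\<^esub> x) = \<ominus>\<^bsub>W\<^esub> h x"
    by simp_all
  show "vectorspace k V" "vectorspace k W" by unfold_locales
qed

text \<open>Quotients and filtered unions of vector spaces are instances of the following criterion.\<close>

lemma vectorspaceI_image:
  fixes W :: "('k, 'n, 'z) module_scheme"
  assumes k: "field k" and z: "\<zero>\<^bsub>W\<^esub> \<in> carrier W"
    and ex: "\<And>a b c. \<lbrakk>a \<in> carrier W; b \<in> carrier W; c \<in> carrier W\<rbrakk> \<Longrightarrow>
      \<exists>(V :: ('k, 'm) module) h. vectorspace k V \<and> h \<in> carrier V \<rightarrow> carrier W \<and>
        (\<forall>x\<in>carrier V. \<forall>y\<in>carrier V. h (x \<oplus>\<^bsub>V\<^esub> y) = h x \<oplus>\<^bsub>W\<^esub> h y) \<and>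
        (\<forall>r\<in>carrier k. \<forall>x\<in>carrier V. h (r \<odot>\<^bsub>V\<^esub> x) = r \<odot>\<^bsub>W\<^esub> h x) \<and>
        h \<zero>\<^bsub>V\<^esub> = \<zero>\<^bsub>W\<^esub> \<and> a \<in> h ` carrier V \<and> b \<in> h ` carrier V \<and> c \<in> h ` carrier V"
  shows "vectorspace k W"
proof -
  interpret k: field k by fact
  \<comment> \<open>Each vector space axiom involves at most three vectors, so three elements of
    \<open>W\<close> at a time are pulled back to one \<open>V\<close> and the axioms are read off
    there. Different triples may use different \<open>V\<close>.\<close>
  { fix a b c assume abc: "a \<in> carrier W" "b \<in> carrier W" "c \<in> carrier W"
    from ex[OF this] obtain V :: "('k, 'm) module" and h where V: "vectorspace k V" and
      hc: "h \<in> carrier V \<rightarrow> carrier W" and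
      ha: "\<And>x y. x \<in> carrier V \<Longrightarrow> y \<in> carrier V \<Longrightarrow> h x \<oplus>\<^bsub>W\<^esub> h y = h (x \<oplus>\<^bsub>V\<^esub> y)" and
      hs: "\<And>r x. r \<in> carrier k \<Longrightarrow> x \<in> carrier V \<Longrightarrow> r \<odot>\<^bsub>W\<^esub> h x = h (r \<odot>\<^bsub>V\<^esub> x)" and
      hz: "\<zero>\<^bsub>W\<^esub> = h \<zero>\<^bsub>V\<^esub>" and im: "a \<in> h ` carrier V" "b \<in> h ` carrier V" "c \<in> h ` carrier V"
      by metis
    interpret vectorspace k V by fact
    from im obtain x y w where x: "x \<in> carrier V" "a = h x" and y: "y \<in> carrier V" "b = h y"
      and w: "w \<in> carrier V" "c = h w" by blast
    have hcD: "h u \<in> carrier W" if "u \<in> carrier V" for u using hc that by blast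
    have 1: "a \<oplus>\<^bsub>W\<^esub> b \<in> carrier W" using x y by (simp add: ha hcD)
    have 2: "\<exists>n\<in>carrier W. a \<oplus>\<^bsub>W\<^esub> n = \<zero>\<^bsub>W\<^esub>"
      using x by (intro bexI[of _ "h (\<ominus>\<^bsub>V\<^esub> x)"]) (simp_all add: ha hz hcD M.r_neg)
    have 3: "a \<oplus>\<^bsub>W\<^esub> b = b \<oplus>\<^bsub>W\<^esub> a" unfolding x y ha[OF x(1) y(1)] ha[OF y(1) x(1)]
      using M.a_comm[OF x(1) y(1)] by simp
    have 4: "(a \<oplus>\<^bsub>W\<^esub> b) \<oplus>\<^bsub>W\<^esub> c = a \<oplus>\<^bsub>W\<^esub> (b \<oplus>\<^bsub>W\<^esub> c)"
      unfolding x(2) y(2) w(2) using x(1) y(1) w(1) by (simp add: ha M.a_assoc)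
    have 5: "a \<oplus>\<^bsub>W\<^esub> \<zero>\<^bsub>W\<^esub> = a" "\<one>\<^bsub>k\<^esub> \<odot>\<^bsub>W\<^esub> a = a" "\<And>r. r \<in> carrier k \<Longrightarrow> r \<odot>\<^bsub>W\<^esub> a \<in> carrier W"
      unfolding x(2) using x(1) by (simp_all add: ha hs hz hcD)
    have 6: "\<And>r s. r \<in> carrier k \<Longrightarrow> s \<in> carrier k \<Longrightarrow> (r \<otimes>\<^bsub>k\<^esub> s) \<odot>\<^bsub>W\<^esub> a = r \<odot>\<^bsub>W\<^esub> (s \<odot>\<^bsub>W\<^esub> a)"
      "\<And>r s. r \<in> carrier k \<Longrightarrow> s \<in> carrier k \<Longrightarrow> (r \<oplus>\<^bsub>k\<^esub> s) \<odot>\<^bsub>W\<^esub> a = (r \<odot>\<^bsub>W\<^esub> a) \<oplus>\<^bsub>W\<^esub> (s \<odot>\<^bsub>W\<^esub> a)"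
      unfolding x(2) using x(1) by (simp_all add: ha hs smult_assoc1 smult_l_distr)
    have 7: "\<And>r. r \<in> carrier k \<Longrightarrow> r \<odot>\<^bsub>W\<^esub> (a \<oplus>\<^bsub>W\<^esub> b) = (r \<odot>\<^bsub>W\<^esub> a) \<oplus>\<^bsub>W\<^esub> (r \<odot>\<^bsub>W\<^esub> b)"
      unfolding x(2) y(2) using x(1) y(1) by (simp add: ha hs smult_r_distr)
    note 1 2 3 4 5 6 7
  } note ax = this
  show ?thesis
  proof (rule vs_criteria[OF k z])
    show "\<forall>v\<in>carrier W. \<exists>n\<in>carrier W. v \<oplus>\<^bsub>W\<^esub> n = \<zero>\<^bsub>W\<^esub>" using ax(2)[OF _ z z] by simp
  qed (simp_all add: ax(1)[OF _ _ z] ax(4) ax(5)[OF _ z z] ax(6)[OF _ z z]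
      ax(7)[OF _ z z] ax(8)[OF _ z z] ax(9)[OF _ z z] ax(10)[OF _ _ z],
      use ax(3)[OF _ _ z] in blast)
qed

text \<open>\<open>dual\<close> is a function space whose carrier has been cut down to the
  extensional linear forms, so only closure under the operations has to be checked.\<close>

lemma dual_vectorspace:
  assumes "vectorspace k V"
  shows "vectorspace k (dual k V)"
proof -
  interpret vectorspace k V by fact
  interpret FS: vectorspace k "func_space (carrier V)" by (rule func_space_is_vs)
  show ?thesis
    unfolding dual_def
    by (rule FS.subspace_is_vs)
      (intro subspace.intro submodule.intro FS.vectorspace_axioms FS.module_axioms,
        auto simp: func_space_def PiE_mem2 R.a_ac R.m_ac R.r_distr)
qed

lemma dual_simps:
  assumes "vectorspace k V"
  shows "\<phi> \<in> carrier (dual k V) \<longleftrightarrow> \<phi> \<in> carrier V \<rightarrow>\<^sub>E carrier k \<and>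
        (\<forall>v\<in>carrier V. \<forall>w\<in>carrier V. \<phi> (v \<oplus>\<^bsub>V\<^esub> w) = \<phi> v \<oplus>\<^bsub>k\<^esub> \<phi> w) \<and>
        (\<forall>c\<in>carrier k. \<forall>v\<in>carrier V. \<phi> (c \<odot>\<^bsub>V\<^esub> v) = c \<otimes>\<^bsub>k\<^esub> \<phi> v)"
    and "\<phi> \<oplus>\<^bsub>dual k V\<^esub> \<psi> = (\<lambda>v\<in>carrier V. \<phi> v \<oplus>\<^bsub>k\<^esub> \<psi> v)"
    and "c \<odot>\<^bsub>dual k V\<^esub> \<phi> = (\<lambda>v\<in>carrier V. c \<otimes>\<^bsub>k\<^esub> \<phi> v)"
    and "\<zero>\<^bsub>dual k V\<^esub> = (\<lambda>v\<in>carrier V. \<zero>\<^bsub>k\<^esub>)"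
proof -
  interpret vectorspace k V by fact
  show "\<phi> \<in> carrier (dual k V) \<longleftrightarrow> \<phi> \<in> carrier V \<rightarrow>\<^sub>E carrier k \<and>
        (\<forall>v\<in>carrier V. \<forall>w\<in>carrier V. \<phi> (v \<oplus>\<^bsub>V\<^esub> w) = \<phi> v \<oplus>\<^bsub>k\<^esub> \<phi> w) \<and>
        (\<forall>c\<in>carrier k. \<forall>v\<in>carrier V. \<phi> (c \<odot>\<^bsub>V\<^esub> v) = c \<otimes>\<^bsub>k\<^esub> \<phi> v)"
   "\<phi> \<oplus>\<^bsub>dual k V\<^esub> \<psi> = (\<lambda>v\<in>carrier V. \<phi> v \<oplus>\<^bsub>k\<^esub> \<psi> v)"
   "c \<odot>\<^bsub>dual k V\<^esub> \<phi> = (\<lambda>v\<in>carrier V. c \<otimes>\<^bsub>k\<^esub> \<phi> v)"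
   "\<zero>\<^bsub>dual k V\<^esub> = (\<lambda>v\<in>carrier V. \<zero>\<^bsub>k\<^esub>)"
    by (auto simp: dual_def func_space_def)
qed

lemma dual_zero:
  assumes "vectorspace k V" "\<phi> \<in> carrier (dual k V)"
  shows "\<phi> \<zero>\<^bsub>V\<^esub> = \<zero>\<^bsub>k\<^esub>"
proof -
  interpret vectorspace k V by fact
  have "\<phi> (\<zero>\<^bsub>k\<^esub> \<odot>\<^bsub>V\<^esub> \<zero>\<^bsub>V\<^esub>) = \<zero>\<^bsub>k\<^esub> \<otimes>\<^bsub>k\<^esub> \<phi> \<zero>\<^bsub>V\<^esub>"
    using assms(2) R.zero_closed M.zero_closed unfolding dual_simps(1)[OF assms(1)] by blast
  thus ?thesis using assms by (auto simp: dual_simps(1)[OF assms(1)] PiE_mem2)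
qed

text \<open>Stated for additive maps of abelian groups because the target will be the field
  \<open>k\<close> itself, which is not given as a \<open>module\<close> record over
  \<open>k\<close>.\<close>

lemma additive_finsum:
  assumes "abelian_group V" "abelian_group W" and h: "\<And>x. x \<in> carrier V \<Longrightarrow> h x \<in> carrier W"
    and ha: "\<And>x y. x \<in> carrier V \<Longrightarrow> y \<in> carrier V \<Longrightarrow> h (x \<oplus>\<^bsub>V\<^esub> y) = h x \<oplus>\<^bsub>W\<^esub> h y"
    and hz: "h \<zero>\<^bsub>V\<^esub> = \<zero>\<^bsub>W\<^esub>"
    and "finite B" and "\<And>b. b \<in> B \<Longrightarrow> g b \<in> carrier V"
  shows "h (\<Oplus>\<^bsub>V\<^esub>b\<in>B. g b) = (\<Oplus>\<^bsub>W\<^esub>b\<in>B. h (g b))"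
proof -
  interpret V: abelian_group V by fact
  interpret W: abelian_group W by fact
  show ?thesis using assms(6,7)
    by (induction B rule: finite_induct) (auto simp: hz ha h Pi_def)
qed

text \<open>Coordinate functionals of a finite basis. They take the place of dimension counts:
  separation of vectors and reflexivity are both computed from this expansion.\<close>

lemma finite_dual_basis:
  assumes V: "vectorspace k V" and fd: "vectorspace.fin_dim k V"
  shows "\<exists>B c. finite B \<and> B \<subseteq> carrier V \<and> (\<forall>b\<in>B. c b \<in> carrier (dual k V)) \<and>
           (\<forall>v\<in>carrier V. v = (\<Oplus>\<^bsub>V\<^esub>b\<in>B. c b v \<odot>\<^bsub>V\<^esub> b))"
proof -
  interpret vectorspace k V by fact
  obtain B where B: "finite B" "basis B" using finite_basis_exists[OF fd] by blast
  hence BV: "B \<subseteq> carrier V" by (auto simp: basis_def)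
  have ex1: "\<exists>!a. a \<in> B \<rightarrow>\<^sub>E carrier k \<and> lincomb a B = v" if "v \<in> carrier V" for v
    using basis_criterion[OF B(1) BV] B(2) that by blast
  define A where "A v = (THE a. a \<in> B \<rightarrow>\<^sub>E carrier k \<and> lincomb a B = v)" for v
  have A: "A v \<in> B \<rightarrow>\<^sub>E carrier k" "lincomb (A v) B = v" if "v \<in> carrier V" for v
    using theI'[OF ex1[OF that]] unfolding A_def by auto
  have Au: "A v b = a b" if "a \<in> B \<rightarrow> carrier k" "lincomb a B = v" "v \<in> carrier V" "b \<in> B" for v a b
  proof -
    \<comment> \<open>Uniqueness of coefficients holds among extensional functions, so
      \<open>a\<close> is cut down to \<open>B\<close> before it is compared with
      \<open>A v\<close>.\<close>
    have "lincomb (restrict a B) B = lincomb a B"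
      unfolding lincomb_def using that(1) BV by (intro M.finsum_cong') auto
    hence "lincomb (restrict a B) B = v" using that(2) by simp
    moreover have "restrict a B \<in> B \<rightarrow>\<^sub>E carrier k" using that(1) by auto
    ultimately have "A v = restrict a B" unfolding A_def
      by (intro the1_equality[OF ex1[OF that(3)]] conjI)
    thus ?thesis using that by simp
  qed
  define c where "c b = (\<lambda>v\<in>carrier V. A v b)" for b
  have Ac: "A v b \<in> carrier k" if "v \<in> carrier V" "b \<in> B" for v b
    by (rule PiE_mem[OF A(1)[OF that(1)] that(2)])
  have Af: "A v \<in> B \<rightarrow> carrier k" if "v \<in> carrier V" for v using Ac[OF that] by (intro Pi_I)
  have "c b \<in> carrier (dual k V)" if b: "b \<in> B" for b
  proof -
    have 1: "A (v \<oplus>\<^bsub>V\<^esub> w) b = A v b \<oplus>\<^bsub>k\<^esub> A w b" if vw: "v \<in> carrier V" "w \<in> carrier V" for v w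
    proof (rule Au[of "\<lambda>b. A v b \<oplus>\<^bsub>k\<^esub> A w b"])
      show "(\<lambda>b. A v b \<oplus>\<^bsub>k\<^esub> A w b) \<in> B \<rightarrow> carrier k" using Ac vw by (intro Pi_I R.a_closed)
      show "lincomb (\<lambda>b. A v b \<oplus>\<^bsub>k\<^esub> A w b) B = v \<oplus>\<^bsub>V\<^esub> w"
        using lincomb_sum[OF B(1) BV Af[OF vw(1)] Af[OF vw(2)]] A(2) vw by simp
    qed (use vw b in simp_all)
    have 2: "A (r \<odot>\<^bsub>V\<^esub> v) b = r \<otimes>\<^bsub>k\<^esub> A v b" if rv: "r \<in> carrier k" "v \<in> carrier V" for r v
    proof (rule Au[of "\<lambda>b. r \<otimes>\<^bsub>k\<^esub> A v b"])
      show "(\<lambda>b. r \<otimes>\<^bsub>k\<^esub> A v b) \<in> B \<rightarrow> carrier k" using Ac rv by (intro Pi_I R.m_closed)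
      show "lincomb (\<lambda>b. r \<otimes>\<^bsub>k\<^esub> A v b) B = r \<odot>\<^bsub>V\<^esub> v"
        using lincomb_smult[OF BV Af[OF rv(2)] rv(1)] A(2) rv by simp
    qed (use rv b in simp_all)
    show ?thesis unfolding dual_simps(1)[OF V] c_def using 1 2 Ac b by (simp add: restrict_PiE_iff)
  qed
  moreover have "v = (\<Oplus>\<^bsub>V\<^esub>b\<in>B. c b v \<odot>\<^bsub>V\<^esub> b)" if "v \<in> carrier V" for v
    using A(2)[OF that] that by (simp add: lincomb_def c_def)
  ultimately show ?thesis using B(1) BV by blast
qed

lemma dual_separates:
  assumes V: "vectorspace k V" "vectorspace.fin_dim k V" and v: "v \<in> carrier V"
    and z: "\<And>\<phi>. \<phi> \<in> carrier (dual k V) \<Longrightarrow> \<phi> v = \<zero>\<^bsub>k\<^esub>"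
  shows "v = \<zero>\<^bsub>V\<^esub>"
proof -
  interpret vectorspace k V by fact
  obtain B c where B: "finite B" "B \<subseteq> carrier V" "\<forall>b\<in>B. c b \<in> carrier (dual k V)"
    and exp: "\<forall>v\<in>carrier V. v = (\<Oplus>\<^bsub>V\<^esub>b\<in>B. c b v \<odot>\<^bsub>V\<^esub> b)" using finite_dual_basis[OF V] by blast
  have "c b v \<odot>\<^bsub>V\<^esub> b = \<zero>\<^bsub>V\<^esub>" if "b \<in> B" for b
    using z[of "c b"] B that by (simp add: subsetD)
  hence "(\<Oplus>\<^bsub>V\<^esub>b\<in>B. c b v \<odot>\<^bsub>V\<^esub> b) = (\<Oplus>\<^bsub>V\<^esub>b\<in>B. \<zero>\<^bsub>V\<^esub>)"
    by (intro M.finsum_cong') simp_all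
  thus ?thesis using exp v M.finsum_zero by metis
qed

text \<open>Reflexivity with an explicit preimage: the sum of the multiples of the basis vectors
  \<open>b\<close> by \<open>\<Phi> (c b)\<close>. \<open>\<Phi>\<close> is a plain function, so
  that no extensional double dual has to be formed.\<close>

lemma double_dual_surj:
  assumes V: "vectorspace k V" "vectorspace.fin_dim k V"
    and \<Phi>: "\<And>\<phi>. \<phi> \<in> carrier (dual k V) \<Longrightarrow> \<Phi> \<phi> \<in> carrier k"
    and add: "\<And>\<phi> \<psi>. \<lbrakk>\<phi> \<in> carrier (dual k V); \<psi> \<in> carrier (dual k V)\<rbrakk> \<Longrightarrow>
        \<Phi> (\<phi> \<oplus>\<^bsub>dual k V\<^esub> \<psi>) = \<Phi> \<phi> \<oplus>\<^bsub>k\<^esub> \<Phi> \<psi>"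
    and smult: "\<And>c \<phi>. \<lbrakk>c \<in> carrier k; \<phi> \<in> carrier (dual k V)\<rbrakk> \<Longrightarrow>
        \<Phi> (c \<odot>\<^bsub>dual k V\<^esub> \<phi>) = c \<otimes>\<^bsub>k\<^esub> \<Phi> \<phi>"
  shows "\<exists>v\<in>carrier V. \<forall>\<phi>\<in>carrier (dual k V). \<Phi> \<phi> = \<phi> v"
proof -
  interpret vectorspace k V by (rule V(1))
  interpret D: vectorspace k "dual k V" by (rule dual_vectorspace[OF V(1)])
  note ds = dual_simps[OF V(1)]
  obtain B c where B: "finite B" "B \<subseteq> carrier V" "\<forall>b\<in>B. c b \<in> carrier (dual k V)"
    and exp: "\<forall>v\<in>carrier V. v = (\<Oplus>\<^bsub>V\<^esub>b\<in>B. c b v \<odot>\<^bsub>V\<^esub> b)" using finite_dual_basis[OF V] by blast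
  have cB: "c b \<in> carrier (dual k V)" if "b \<in> B" for b using B(3) that by blast
  have BV: "b \<in> carrier V" if "b \<in> B" for b using that B by blast
  have k: "abelian_group k" by (rule R.abelian_group_axioms)
  have phc: "\<phi> v \<in> carrier k" if "\<phi> \<in> carrier (dual k V)" "v \<in> carrier V" for \<phi> v
    using that ds(1) PiE_mem by blast
  define e where "e = (\<Oplus>\<^bsub>V\<^esub>b\<in>B. \<Phi> (c b) \<odot>\<^bsub>V\<^esub> b)"
  have e: "e \<in> carrier V" unfolding e_def using \<Phi> BV cB by (intro M.finsum_closed Pi_I smult_closed) blast+
  have "\<Phi> \<phi> = \<phi> e" if ph: "\<phi> \<in> carrier (dual k V)" for \<phi>
  proof -
    define ps where "ps = (\<Oplus>\<^bsub>dual k V\<^esub>b\<in>B. \<phi> b \<odot>\<^bsub>dual k V\<^esub> c b)"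
    have term_c: "\<phi> b \<odot>\<^bsub>dual k V\<^esub> c b \<in> carrier (dual k V)" if "b \<in> B" for b
      using that ph BV phc cB by (intro D.smult_closed) blast+
    have ps: "ps \<in> carrier (dual k V)" unfolding ps_def using term_c by (intro D.M.finsum_closed Pi_I) blast
    have fin: "\<phi> (\<Oplus>\<^bsub>V\<^esub>b\<in>B. g b) = (\<Oplus>\<^bsub>k\<^esub>b\<in>B. \<phi> (g b))" if "\<And>b. b\<in>B \<Longrightarrow> g b \<in> carrier V" for g
      by (rule additive_finsum[OF M.abelian_group_axioms k])
        (use ph phc that B(1) dual_zero[OF V(1) ph] in \<open>simp_all add: ds(1)\<close>)
    \<comment> \<open>A functional is the combination of the coordinate functionals with its own
      values on the basis as coefficients; hence \<open>\<Phi>\<close> is determined by its values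
      on the \<open>c b\<close>.\<close>
    have "ps = \<phi>"
    proof (rule extensionalityI[of _ "carrier V"])
      show "ps \<in> extensional (carrier V)" "\<phi> \<in> extensional (carrier V)" 
        using ps ph by (simp_all add: ds(1) PiE_def)
      fix v assume v: "v \<in> carrier V"
      have "ps v = (\<Oplus>\<^bsub>k\<^esub>b\<in>B. (\<phi> b \<odot>\<^bsub>dual k V\<^esub> c b) v)" unfolding ps_def
        by (rule additive_finsum[OF D.M.abelian_group_axioms k, of "\<lambda>f. f v"])
          (use v B(1) term_c phc in \<open>simp_all add: ds(2,4)\<close>)
      also have "\<dots> = (\<Oplus>\<^bsub>k\<^esub>b\<in>B. \<phi> (c b v \<odot>\<^bsub>V\<^esub> b))"
        using v ph phc BV cB by (intro R.finsum_cong' Pi_I) (simp_all add: ds(1,3) R.m_comm)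
      also have "\<dots> = \<phi> (\<Oplus>\<^bsub>V\<^esub>b\<in>B. c b v \<odot>\<^bsub>V\<^esub> b)"
        by (rule fin[symmetric]) (use v cB BV phc in simp)
      finally show "ps v = \<phi> v" using exp v by simp
    qed
    hence "\<Phi> \<phi> = (\<Oplus>\<^bsub>k\<^esub>b\<in>B. \<Phi> (\<phi> b \<odot>\<^bsub>dual k V\<^esub> c b))"
    proof -
      have "\<Phi> ps = (\<Oplus>\<^bsub>k\<^esub>b\<in>B. \<Phi> (\<phi> b \<odot>\<^bsub>dual k V\<^esub> c b))" unfolding ps_def
      proof (rule additive_finsum[OF D.M.abelian_group_axioms k \<Phi> add _ B(1) term_c])
        have "\<Phi> (\<zero>\<^bsub>k\<^esub> \<odot>\<^bsub>dual k V\<^esub> \<zero>\<^bsub>dual k V\<^esub>) = \<zero>\<^bsub>k\<^esub> \<otimes>\<^bsub>k\<^esub> \<Phi> \<zero>\<^bsub>dual k V\<^esub>"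
          by (rule smult) simp_all
        thus "\<Phi> \<zero>\<^bsub>dual k V\<^esub> = \<zero>\<^bsub>k\<^esub>" using \<Phi> by simp
      qed
      thus ?thesis using \<open>ps = \<phi>\<close> by simp
    qed
    also have "\<dots> = (\<Oplus>\<^bsub>k\<^esub>b\<in>B. \<phi> (\<Phi> (c b) \<odot>\<^bsub>V\<^esub> b))"
      using cB ph phc BV \<Phi> by (intro R.finsum_cong' Pi_I) (simp_all add: smult ds(1) R.m_comm)
    also have "\<dots> = \<phi> e" unfolding e_def
      by (rule fin[symmetric]) (use cB BV \<Phi> in simp)
    finally show ?thesis .
  qed
  thus ?thesis using e by blast
qed

lemma fin_dim_transfer:
  assumes "linear_map k V W h" "vectorspace.fin_dim k V" "h ` carrier V = carrier W"
  shows "vectorspace.fin_dim k W"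
  using linear_map.rank_nullity_main(2)[OF assms] .


section \<open>Calculus in linear categories\<close>

context lin_cat
begin

abbreviation comp_mor (infixr "\<bullet>" 75) where "g \<bullet> f \<equiv> g \<cdot>\<^bsub>C\<^esub> f"
abbreviation zr where "zr X Y \<equiv> \<zero>\<^bsub>Hom C X Y\<^esub>"

text \<open>Since hom sets of distinct pairs are disjoint, source and target are functions of a
  morphism. Rules phrased with \<open>ar\<close>, \<open>src\<close> and \<open>tgt\<close> let the
  simplifier verify composability by itself, without instantiating the objects that occur in the
  locale axioms.\<close>

definition arrow where "arrow f X Y \<longleftrightarrow> X \<in> Obj C \<and> Y \<in> Obj C \<and> f \<in> Mor C X Y"
definition ar where "ar f \<longleftrightarrow> (\<exists>X Y. arrow f X Y)"
definition src where "src f = (THE X. \<exists>Y. arrow f X Y)"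
definition tgt where "tgt f = (THE Y. \<exists>X. arrow f X Y)"

lemma arrow_unique: "\<lbrakk>arrow f X Y; arrow f X' Y'\<rbrakk> \<Longrightarrow> X = X' \<and> Y = Y'"
  unfolding arrow_def using hom_disjoint by blast

lemma arrow_iff: "arrow f X Y \<longleftrightarrow> ar f \<and> src f = X \<and> tgt f = Y \<and> X \<in> Obj C \<and> Y \<in> Obj C"
proof
  assume f: "arrow f X Y"
  have "src f = X" "tgt f = Y" unfolding src_def tgt_def using f arrow_unique by blast+
  thus "ar f \<and> src f = X \<and> tgt f = Y \<and> X \<in> Obj C \<and> Y \<in> Obj C" using f by (auto simp: ar_def arrow_def)
next
  assume *: "ar f \<and> src f = X \<and> tgt f = Y \<and> X \<in> Obj C \<and> Y \<in> Obj C"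
  then obtain X' Y' where f: "arrow f X' Y'" by (auto simp: ar_def)
  have "src f = X'" "tgt f = Y'" unfolding src_def tgt_def using f arrow_unique by blast+
  thus "arrow f X Y" using * f by simp
qed

lemma ar_arrow: "ar f \<Longrightarrow> arrow f (src f) (tgt f)"
  unfolding ar_def by (metis arrow_iff)

lemma ar_obj [simp]: "ar f \<Longrightarrow> src f \<in> Obj C" "ar f \<Longrightarrow> tgt f \<in> Obj C"
  using ar_arrow by (auto simp: arrow_def)

lemma Mor_arrow: "\<lbrakk>X \<in> Obj C; Y \<in> Obj C\<rbrakk> \<Longrightarrow> f \<in> Mor C X Y \<longleftrightarrow> arrow f X Y"
  by (simp add: arrow_def)

lemma arrow_Mor: "arrow f X Y \<Longrightarrow> f \<in> Mor C X Y"
  by (simp add: arrow_def)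

lemma arrow_cmp: "\<lbrakk>arrow f X Y; arrow g Y Z\<rbrakk> \<Longrightarrow> arrow (g \<bullet> f) X Z"
  using cmp_closed by (auto simp: arrow_def)

lemma ar_cmp [simp]:
  assumes "ar f" "ar g" "src g = tgt f"
  shows "ar (g \<bullet> f)" "src (g \<bullet> f) = src f" "tgt (g \<bullet> f) = tgt g"
  using arrow_cmp[OF ar_arrow[OF assms(1)], of g "tgt g"] ar_arrow[OF assms(2)] assms(3)
  by (auto simp: arrow_iff)

lemma arrow_ident: "X \<in> Obj C \<Longrightarrow> arrow (ident C X) X X"
  using ident_closed by (auto simp: arrow_def)

lemma ar_ident [simp]:
  assumes "X \<in> Obj C" shows "ar (ident C X)" "src (ident C X) = X" "tgt (ident C X) = X"
  using arrow_ident[OF assms] by (auto simp: arrow_iff)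

lemma cmp_ident [simp]:
  "\<lbrakk>ar f; tgt f = Y\<rbrakk> \<Longrightarrow> ident C Y \<bullet> f = f" "\<lbrakk>ar f; src f = X\<rbrakk> \<Longrightarrow> f \<bullet> ident C X = f"
  using ar_arrow[of f] cmp_ident_left[of X Y f] cmp_ident_right[of X Y f] 
    cmp_ident_left[of "src f" Y f] cmp_ident_right[of X "tgt f" f] by (auto simp: arrow_def)

lemma assoc [simp]:
  assumes "ar f" "ar g" "ar h" "src g = tgt f" "src h = tgt g"
  shows "(h \<bullet> g) \<bullet> f = h \<bullet> (g \<bullet> f)"
  using ar_arrow[OF assms(1)] ar_arrow[OF assms(2)] ar_arrow[OF assms(3)] assms(4,5)
    cmp_assoc[of "src f" "tgt f" "tgt g" "tgt h" f g h] by (simp add: arrow_def)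

text \<open>The simplifier associates composites to the right, which hides the left-hand side
  \<open>x \<bullet> y\<close> of a known equation inside a longer composite. This is the form of
  the equation with a tail \<open>t\<close>, to be used as a rewrite rule.\<close>

lemma cmp_rew: "\<lbrakk>x \<bullet> y = z; ar x; ar y; src x = tgt y; ar t; tgt t = src y\<rbrakk> \<Longrightarrow> x \<bullet> (y \<bullet> t) = z \<bullet> t"
  using assoc[of t y x] by simp

text \<open>Addition, negation and scalar multiplication without object indices: the hom space is
  recovered from the first morphism. Terms of different provenance thus have the same syntactic
  shape.\<close>

definition pl (infixl "\<boxplus>" 65) where "f \<boxplus> g = f \<oplus>\<^bsub>Hom C (src f) (tgt f)\<^esub> g"
definition ng ("\<boxminus> _" [80] 80) where "\<boxminus> f = \<ominus>\<^bsub>Hom C (src f) (tgt f)\<^esub> f"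
definition sm (infixr "\<triangleright>" 75) where "c \<triangleright> f = c \<odot>\<^bsub>Hom C (src f) (tgt f)\<^esub> f"

lemma pl_eq: "arrow f X Y \<Longrightarrow> f \<oplus>\<^bsub>Hom C X Y\<^esub> g = f \<boxplus> g"
  and ng_eq: "arrow f X Y \<Longrightarrow> \<ominus>\<^bsub>Hom C X Y\<^esub> f = \<boxminus> f"
  and sm_eq: "arrow f X Y \<Longrightarrow> c \<odot>\<^bsub>Hom C X Y\<^esub> f = c \<triangleright> f"
  by (auto simp: arrow_iff pl_def ng_def sm_def)

lemma Hom_ag: "\<lbrakk>X \<in> Obj C; Y \<in> Obj C\<rbrakk> \<Longrightarrow> abelian_group (Hom C X Y)"
  using hom_vectorspace vectorspace.axioms(1) module.axioms(2) by blast

lemma Hom_mod: "\<lbrakk>X \<in> Obj C; Y \<in> Obj C\<rbrakk> \<Longrightarrow> module k (Hom C X Y)"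
  using hom_vectorspace vectorspace.axioms(1) by blast

lemma arrow_zr: "\<lbrakk>X \<in> Obj C; Y \<in> Obj C\<rbrakk> \<Longrightarrow> arrow (zr X Y) X Y"
  using abelian_group.axioms(1)[OF Hom_ag] abelian_monoid.zero_closed by (auto simp: arrow_def)

lemma ar_zr [simp]:
  assumes "X \<in> Obj C" "Y \<in> Obj C" shows "ar (zr X Y)" "src (zr X Y) = X" "tgt (zr X Y) = Y"
  using arrow_zr[OF assms] by (auto simp: arrow_iff)

lemma arrow_pl: "\<lbrakk>arrow f X Y; arrow g X Y\<rbrakk> \<Longrightarrow> arrow (f \<boxplus> g) X Y"
  using abelian_group.axioms(1)[OF Hom_ag] abelian_monoid.a_closed pl_eq
  by (metis arrow_def)

lemma arrow_ng: "arrow f X Y \<Longrightarrow> arrow (\<boxminus> f) X Y"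
  using abelian_group.a_inv_closed[OF Hom_ag] ng_eq by (metis arrow_def)

lemma arrow_sm: "\<lbrakk>c \<in> carrier k; arrow f X Y\<rbrakk> \<Longrightarrow> arrow (c \<triangleright> f) X Y"
  using module.smult_closed[OF Hom_mod] sm_eq by (metis arrow_def)

lemma ar_pl [simp]:
  assumes "ar f" "ar g" "src g = src f" "tgt g = tgt f"
  shows "ar (f \<boxplus> g)" "src (f \<boxplus> g) = src f" "tgt (f \<boxplus> g) = tgt f"
  using arrow_pl[OF ar_arrow[OF assms(1)], of g] ar_arrow[OF assms(2)] assms
  by (auto simp: arrow_iff)

lemma ar_ng [simp]:
  assumes "ar f" shows "ar (\<boxminus> f)" "src (\<boxminus> f) = src f" "tgt (\<boxminus> f) = tgt f"
  using arrow_ng[OF ar_arrow[OF assms(1)]] by (auto simp: arrow_iff)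

lemma ar_sm [simp]:
  assumes "c \<in> carrier k" "ar f"
  shows "ar (c \<triangleright> f)" "src (c \<triangleright> f) = src f" "tgt (c \<triangleright> f) = tgt f"
  using arrow_sm[OF assms(1) ar_arrow[OF assms(2)]] by (auto simp: arrow_iff)

lemma pl_assoc:
  assumes "ar f" "ar g" "ar h" "src g = src f" "tgt g = tgt f" "src h = src f" "tgt h = tgt f"
  shows "f \<boxplus> g \<boxplus> h = f \<boxplus> (g \<boxplus> h)"
proof -
  let ?V = "Hom C (src f) (tgt f)"
  interpret V: abelian_group ?V using assms by (simp add: Hom_ag)
  have "f \<in> carrier ?V" "g \<in> carrier ?V" "h \<in> carrier ?V" 
    using ar_arrow[OF assms(1)] ar_arrow[OF assms(2)] ar_arrow[OF assms(3)] assms by (auto simp: arrow_def)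
  hence "(f \<oplus>\<^bsub>?V\<^esub> g) \<oplus>\<^bsub>?V\<^esub> h = f \<oplus>\<^bsub>?V\<^esub> (g \<oplus>\<^bsub>?V\<^esub> h)" by (rule V.a_assoc)
  moreover have "f \<boxplus> g = f \<oplus>\<^bsub>?V\<^esub> g" "f \<boxplus> (g \<boxplus> h) = f \<oplus>\<^bsub>?V\<^esub> (g \<boxplus> h)" by (simp_all add: pl_def)
  moreover have "g \<boxplus> h = g \<oplus>\<^bsub>?V\<^esub> h" using assms by (simp add: pl_def)
  moreover have "f \<boxplus> g \<boxplus> h = (f \<boxplus> g) \<oplus>\<^bsub>?V\<^esub> h" using assms by (simp add: pl_def[of "f \<boxplus> g"])
  ultimately show ?thesis by simp
qed

lemma pl_comm:
  assumes "ar f" "ar g" "src g = src f" "tgt g = tgt f"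
  shows "f \<boxplus> g = g \<boxplus> f"
proof -
  let ?V = "Hom C (src f) (tgt f)"
  interpret V: abelian_group ?V using assms by (simp add: Hom_ag)
  have "f \<in> carrier ?V" "g \<in> carrier ?V"  
    using ar_arrow[OF assms(1)] ar_arrow[OF assms(2)] assms by (auto simp: arrow_def)
  thus ?thesis using assms V.a_comm by (simp add: pl_def)
qed

lemma pl_lcomm:
  assumes "ar f" "ar g" "ar h" "src g = src f" "tgt g = tgt f" "src h = src f" "tgt h = tgt f"
  shows "f \<boxplus> (g \<boxplus> h) = g \<boxplus> (f \<boxplus> h)"
  using pl_assoc[of f g h] pl_assoc[of g f h] pl_comm[of f g] assms by simp

lemmas pl_ac = pl_assoc pl_comm pl_lcomm

lemma pl_zr [simp]:
  assumes "ar f" "src f = X" "tgt f = Y"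
  shows "f \<boxplus> zr X Y = f" "zr X Y \<boxplus> f = f"
proof -
  interpret V: abelian_group "Hom C X Y" using assms by (auto simp: Hom_ag)
  have "arrow f X Y" using ar_arrow[OF assms(1)] assms by simp
  hence "f \<oplus>\<^bsub>Hom C X Y\<^esub> zr X Y = f" using arrow_Mor by simp
  thus 1: "f \<boxplus> zr X Y = f" using assms by (simp add: pl_def)
  show "zr X Y \<boxplus> f = f" using pl_comm[of f "zr X Y"] 1 assms by auto
qed

lemma pl_ng [simp]:
  assumes "ar f"
  shows "f \<boxplus> \<boxminus> f = zr (src f) (tgt f)" "\<boxminus> f \<boxplus> f = zr (src f) (tgt f)"
proof -
  interpret V: abelian_group "Hom C (src f) (tgt f)" using assms by (auto simp: Hom_ag)
  have "f \<in> Mor C (src f) (tgt f)" using ar_arrow assms arrow_Mor by simp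
  thus 1: "f \<boxplus> \<boxminus> f = zr (src f) (tgt f)" unfolding pl_def ng_def by (rule V.r_neg)
  show "\<boxminus> f \<boxplus> f = zr (src f) (tgt f)" using pl_comm[of f "\<boxminus> f"] 1 assms by auto
qed

lemma pl_cancel [simp]:
  assumes "ar f" "ar g" "src g = src f" "tgt g = tgt f"
  shows "f \<boxplus> (\<boxminus> f \<boxplus> g) = g" "\<boxminus> f \<boxplus> (f \<boxplus> g) = g"
  using pl_assoc[of f "\<boxminus> f" g] pl_assoc[of "\<boxminus> f" f g] assms by simp_all

lemma ng_unique: "\<lbrakk>ar f; ar g; src g = src f; tgt g = tgt f; f \<boxplus> g = zr (src f) (tgt f)\<rbrakk> \<Longrightarrow> g = \<boxminus> f"
  using pl_cancel(2)[of f g] by simp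

lemma ng_ng [simp]: "ar f \<Longrightarrow> \<boxminus> \<boxminus> f = f"
  using ng_unique[of "\<boxminus> f" f] by simp

lemma ng_zr [simp]: "\<lbrakk>X \<in> Obj C; Y \<in> Obj C\<rbrakk> \<Longrightarrow> \<boxminus> zr X Y = zr X Y"
  using ng_unique[of "zr X Y" "zr X Y"] by simp

lemma ng_pl:
  assumes "ar f" "ar g" "src g = src f" "tgt g = tgt f"
  shows "\<boxminus> (f \<boxplus> g) = \<boxminus> f \<boxplus> \<boxminus> g"
proof -
  have "f \<boxplus> g \<boxplus> (\<boxminus> f \<boxplus> \<boxminus> g) = f \<boxplus> (\<boxminus> f \<boxplus> (g \<boxplus> \<boxminus> g))"
    using assms pl_assoc[of f g "\<boxminus> f \<boxplus> \<boxminus> g"] pl_lcomm[of g "\<boxminus> f" "\<boxminus> g"] by simp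
  also have "\<dots> = zr (src f) (tgt f)" using assms by simp
  finally show ?thesis using ng_unique[of "f \<boxplus> g" "\<boxminus> f \<boxplus> \<boxminus> g"] assms by simp
qed

lemma eq_iff_diff: "\<lbrakk>ar f; ar g; src g = src f; tgt g = tgt f\<rbrakk> \<Longrightarrow> f = g \<longleftrightarrow> f \<boxplus> \<boxminus> g = zr (src f) (tgt f)"
proof
  assume *: "ar f" "ar g" "src g = src f" "tgt g = tgt f" "f \<boxplus> \<boxminus> g = zr (src f) (tgt f)"
  hence "\<boxminus> g = \<boxminus> f" using ng_unique[of f "\<boxminus> g"] by simp
  thus "f = g" using ng_ng * by metis
qed auto

lemma cmp_pl:
  assumes "ar f" "ar g" "ar h" "src g = src f" "tgt g = tgt f"
  shows "src h = tgt f \<Longrightarrow> h \<bullet> (f \<boxplus> g) = h \<bullet> f \<boxplus> h \<bullet> g"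
    and "tgt h = src f \<Longrightarrow> (f \<boxplus> g) \<bullet> h = f \<bullet> h \<boxplus> g \<bullet> h"
proof -
  have fg: "f \<in> Mor C (src f) (tgt f)" "g \<in> Mor C (src f) (tgt f)" "h \<in> Mor C (src h) (tgt h)"
    using ar_arrow[OF assms(1)] ar_arrow[OF assms(2)] ar_arrow[OF assms(3)] assms by (auto simp: arrow_def)
  show "h \<bullet> (f \<boxplus> g) = h \<bullet> f \<boxplus> h \<bullet> g" if "src h = tgt f"
    using linear_mapD(2)[OF cmp_linear_right[of "src f" "tgt f" "tgt h" h] fg(1,2)] assms fg that
    by (simp add: pl_def)
  show "(f \<boxplus> g) \<bullet> h = f \<bullet> h \<boxplus> g \<bullet> h" if "tgt h = src f"
    using linear_mapD(2)[OF cmp_linear_left[of "src h" "src f" "tgt f" h] fg(1,2)] assms fg that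
    by (simp add: pl_def)
qed

lemma cmp_sm:
  assumes "c \<in> carrier k" "ar f" "ar h"
  shows "src h = tgt f \<Longrightarrow> h \<bullet> (c \<triangleright> f) = c \<triangleright> (h \<bullet> f)"
    and "tgt h = src f \<Longrightarrow> (c \<triangleright> f) \<bullet> h = c \<triangleright> (f \<bullet> h)"
proof -
  have fg: "f \<in> Mor C (src f) (tgt f)" "h \<in> Mor C (src h) (tgt h)"
    using ar_arrow[OF assms(2)] ar_arrow[OF assms(3)] assms by (auto simp: arrow_def)
  show "h \<bullet> (c \<triangleright> f) = c \<triangleright> (h \<bullet> f)" if "src h = tgt f"
    using linear_mapD(3)[OF cmp_linear_right[of "src f" "tgt f" "tgt h" h] assms(1) fg(1)] assms fg that
    by (simp add: sm_def)
  show "(c \<triangleright> f) \<bullet> h = c \<triangleright> (f \<bullet> h)" if "tgt h = src f"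
    using linear_mapD(3)[OF cmp_linear_left[of "src h" "src f" "tgt f" h] assms(1) fg(1)] assms fg that
    by (simp add: sm_def)
qed

lemma cmp_zr [simp]:
  assumes "ar h"
  shows "\<lbrakk>X \<in> Obj C; src h = Y\<rbrakk> \<Longrightarrow> h \<bullet> zr X Y = zr X (tgt h)"
    and "\<lbrakk>Y \<in> Obj C; tgt h = X\<rbrakk> \<Longrightarrow> zr X Y \<bullet> h = zr (src h) Y"
proof -
  have h: "h \<in> Mor C (src h) (tgt h)" using ar_arrow[OF assms] by (auto simp: arrow_def)
  show "h \<bullet> zr X Y = zr X (tgt h)" if "X \<in> Obj C" "src h = Y"
    using linear_mapD(4)[OF cmp_linear_right[of X "src h" "tgt h" h]] assms ar_obj[OF assms] h that by simp
  show "zr X Y \<bullet> h = zr (src h) Y" if "Y \<in> Obj C" "tgt h = X"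
    using linear_mapD(4)[OF cmp_linear_left[of "src h" "tgt h" Y h]] assms ar_obj[OF assms] h that by simp
qed

lemma cmp_ng:
  assumes "ar f" "ar h"
  shows "src h = tgt f \<Longrightarrow> h \<bullet> \<boxminus> f = \<boxminus> (h \<bullet> f)"
    and "tgt h = src f \<Longrightarrow> \<boxminus> f \<bullet> h = \<boxminus> (f \<bullet> h)"
proof -
  show "h \<bullet> \<boxminus> f = \<boxminus> (h \<bullet> f)" if "src h = tgt f"
    using ng_unique[of "h \<bullet> f" "h \<bullet> \<boxminus> f"] cmp_pl(1)[of f "\<boxminus> f" h] assms that by simp
  show "\<boxminus> f \<bullet> h = \<boxminus> (f \<bullet> h)" if "tgt h = src f"
    using ng_unique[of "f \<bullet> h" "\<boxminus> f \<bullet> h"] cmp_pl(2)[of f "\<boxminus> f" h] assms that by simp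
qed

lemmas lin = cmp_pl cmp_ng cmp_sm ng_pl

lemma sub_zero: "\<lbrakk>arrow f X Y; arrow g X Y; f \<boxplus> \<boxminus> g = zr X Y\<rbrakk> \<Longrightarrow> f = g"
  using eq_iff_diff[of f g] by (simp add: arrow_iff)

lemma hom_zero_iff:
  "\<lbrakk>X \<in> Obj C; Y \<in> Obj C\<rbrakk> \<Longrightarrow> hom_zero C X Y \<longleftrightarrow> (\<forall>f. arrow f X Y \<longrightarrow> f = zr X Y)"
  using arrow_zr[of X Y] by (auto simp: hom_zero_def arrow_def)

lemma hom_zeroD: "\<lbrakk>hom_zero C X Y; arrow f X Y\<rbrakk> \<Longrightarrow> f = zr X Y"
  by (simp add: hom_zero_def arrow_def)

lemma is_iso_iff:
  "is_iso C X Y f \<longleftrightarrow> arrow f X Y \<and> (\<exists>g. arrow g Y X \<and> g \<bullet> f = ident C X \<and> f \<bullet> g = ident C Y)"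
  by (auto simp: is_iso_def arrow_def)

lemma is_iso_arrow: "is_iso C X Y f \<Longrightarrow> arrow f X Y"
  by (simp add: is_iso_iff)

lemma is_isoI: "\<lbrakk>arrow f X Y; arrow g Y X; g \<bullet> f = ident C X; f \<bullet> g = ident C Y\<rbrakk> \<Longrightarrow> is_iso C X Y f"
  by (auto simp: is_iso_iff)

lemma is_isoE:
  assumes "is_iso C X Y f"
  obtains g where "arrow f X Y" "arrow g Y X" "g \<bullet> f = ident C X" "f \<bullet> g = ident C Y" "is_iso C Y X g"
proof -
  obtain g where g: "arrow f X Y" "arrow g Y X" "g \<bullet> f = ident C X" "f \<bullet> g = ident C Y"
    using assms by (auto simp: is_iso_iff)
  show ?thesis by (rule that[OF g is_isoI[OF g(2,1,4,3)]])
qed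

lemma is_iso_ident: "X \<in> Obj C \<Longrightarrow> is_iso C X X (ident C X)"
  by (rule is_isoI[OF arrow_ident arrow_ident]) simp_all

lemma is_iso_cmp:
  assumes "is_iso C X Y f" "is_iso C Y Z g"
  shows "is_iso C X Z (g \<bullet> f)"
proof -
  obtain f' where f: "arrow f X Y" "arrow f' Y X" "f' \<bullet> f = ident C X" "f \<bullet> f' = ident C Y"
    using assms(1) by (rule is_isoE)
  obtain g' where g: "arrow g Y Z" "arrow g' Z Y" "g' \<bullet> g = ident C Y" "g \<bullet> g' = ident C Z"
    using assms(2) by (rule is_isoE)
  show ?thesis
    by (rule is_isoI[OF arrow_cmp[OF f(1) g(1)] arrow_cmp[OF g(2) f(2)]])
      (use f g in \<open>simp_all add: arrow_iff cmp_rew[OF f(3)] cmp_rew[OF f(4)] cmp_rew[OF g(3)] cmp_rew[OF g(4)]\<close>)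
qed

lemma is_iso_ng:
  assumes "is_iso C X Y f" shows "is_iso C X Y (\<boxminus> f)"
proof -
  obtain g where g: "arrow f X Y" "arrow g Y X" "g \<bullet> f = ident C X" "f \<bullet> g = ident C Y"
    using assms by (rule is_isoE)
  show ?thesis
    by (rule is_isoI[OF arrow_ng[OF g(1)] arrow_ng[OF g(2)]]) (use g in \<open>simp_all add: arrow_iff lin\<close>)
qed

lemma is_iso_cancel_left:
  assumes "is_iso C Y Z f" "arrow a X Y" "arrow b X Y" "f \<bullet> a = f \<bullet> b"
  shows "a = b"
proof -
  obtain g where g: "arrow f Y Z" "arrow g Z Y" "g \<bullet> f = ident C Y" using assms(1) by (rule is_isoE)
  have "g \<bullet> (f \<bullet> a) = g \<bullet> (f \<bullet> b)" using assms(4) by simp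
  thus ?thesis using g assms(2,3) by (simp add: arrow_iff cmp_rew[OF g(3)])
qed

lemma is_biproduct_iff:
  "is_biproduct C X Y B i j p q \<longleftrightarrow>
     arrow i X B \<and> arrow j Y B \<and> arrow p B X \<and> arrow q B Y \<and>
     p \<bullet> i = ident C X \<and> q \<bullet> j = ident C Y \<and> p \<bullet> j = zr Y X \<and> q \<bullet> i = zr X Y \<and>
     i \<bullet> p \<boxplus> j \<bullet> q = ident C B"
proof -
  have "arrow i X B \<and> arrow p B X \<Longrightarrow> (i \<bullet> p) \<oplus>\<^bsub>Hom C B B\<^esub> (j \<bullet> q) = i \<bullet> p \<boxplus> j \<bullet> q"
    using pl_eq[of "i \<bullet> p" B B] arrow_cmp[of p B X i B] by blast
  thus ?thesis unfolding is_biproduct_def arrow_def by metis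
qed

lemma zero_obj_hom: "\<lbrakk>is_zero_obj C Z; arrow f Z X\<rbrakk> \<Longrightarrow> f = zr Z X" "\<lbrakk>is_zero_obj C Z; arrow f X Z\<rbrakk> \<Longrightarrow> f = zr X Z"
  by (auto simp: is_zero_obj_def arrow_def hom_zero_def)

lemma is_zero_objI:
  assumes "Z \<in> Obj C" "ident C Z = zr Z Z" shows "is_zero_obj C Z"
proof -
  { fix X assume X: "X \<in> Obj C"
    have "f = zr Z X" if "arrow f Z X" for f
    proof -
      have "f = f \<bullet> ident C Z" using that by (simp add: arrow_iff)
      also have "\<dots> = zr Z X" using that assms(1) unfolding assms(2) by (simp add: arrow_iff)
      finally show ?thesis .
    qed
    moreover have "f = zr X Z" if "arrow f X Z" for f
    proof -
      have "f = ident C Z \<bullet> f" using that by (simp add: arrow_iff)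
      also have "\<dots> = zr X Z" using that assms(1) unfolding assms(2) by (simp add: arrow_iff)
      finally show ?thesis .
    qed
    ultimately have "hom_zero C Z X \<and> hom_zero C X Z" using X assms by (simp add: hom_zero_iff) }
  thus ?thesis using assms by (simp add: is_zero_obj_def)
qed

lemma hom_zero_iso:
  assumes "hom_zero C X Y" "is_iso C X X' f" "is_iso C Y Y' g" shows "hom_zero C X' Y'"
proof -
  obtain f' where f: "arrow f X X'" "arrow f' X' X" "f' \<bullet> f = ident C X" "f \<bullet> f' = ident C X'"
    using assms(2) by (rule is_isoE)
  obtain g' where g: "arrow g Y Y'" "arrow g' Y' Y" "g' \<bullet> g = ident C Y" "g \<bullet> g' = ident C Y'"
    using assms(3) by (rule is_isoE)
  have "h = zr X' Y'" if h: "arrow h X' Y'" for h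
  proof -
    have "g' \<bullet> h \<bullet> f = zr X Y" using h f g assms(1) by (intro hom_zeroD) (simp_all add: arrow_iff)
    hence "g \<bullet> (g' \<bullet> h \<bullet> f) \<bullet> f' = zr X' Y'" using f g by (simp add: arrow_iff)
    thus ?thesis using h f g by (simp add: arrow_iff cmp_rew[OF g(4)] cmp_rew[OF f(4)])
  qed
  thus ?thesis using f g by (simp add: hom_zero_iff arrow_iff)
qed

end

locale lin_fun = C: lin_cat k C + D: lin_cat k D
  for k :: "('k, 'r) ring_scheme" and C :: "('o, 'm, 'k, 'y) lincat_scheme"
    and D :: "('p, 'n, 'k, 'z) lincat_scheme" and F :: "('o, 'm, 'p, 'n) fct" +
  assumes lin_functor: "lin_functor k C D F"
begin

lemma F_obj [simp]: "X \<in> Obj C \<Longrightarrow> FO F X \<in> Obj D"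
  and F_ident [simp]: "X \<in> Obj C \<Longrightarrow> FM F (ident C X) = ident D (FO F X)"
  using lin_functor by (auto simp: lin_functor_def)

lemma F_linear: "\<lbrakk>X \<in> Obj C; Y \<in> Obj C\<rbrakk> \<Longrightarrow> linear_map k (Hom C X Y) (Hom D (FO F X) (FO F Y)) (FM F)"
  using lin_functor by (auto simp: lin_functor_def)

lemma F_arrow: "C.arrow f X Y \<Longrightarrow> D.arrow (FM F f) (FO F X) (FO F Y)"
  using linear_mapD(1)[OF F_linear] by (auto simp: C.arrow_def D.arrow_def)

lemma F_ar [simp]:
  assumes "C.ar f"
  shows "D.ar (FM F f)" "D.src (FM F f) = FO F (C.src f)" "D.tgt (FM F f) = FO F (C.tgt f)"
  using F_arrow[OF C.ar_arrow[OF assms]] by (auto simp: D.arrow_iff)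

lemma F_cmp [simp]:
  assumes "C.ar f" "C.ar g" "C.src g = C.tgt f"
  shows "FM F (g \<cdot>\<^bsub>C\<^esub> f) = FM F g \<cdot>\<^bsub>D\<^esub> FM F f"
proof -
  have "f \<in> Mor C (C.src f) (C.tgt f)" "g \<in> Mor C (C.tgt f) (C.tgt g)"
    using C.ar_arrow[OF assms(1)] C.ar_arrow[OF assms(2)] assms by (auto simp: C.arrow_def)
  moreover have "C.src f \<in> Obj C" "C.tgt f \<in> Obj C" "C.tgt g \<in> Obj C" using assms by auto
  ultimately show ?thesis using lin_functor unfolding lin_functor_def by blast
qed

lemma F_pl [simp]:
  assumes "C.ar f" "C.ar g" "C.src g = C.src f" "C.tgt g = C.tgt f"
  shows "FM F (C.pl f g) = D.pl (FM F f) (FM F g)"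
  using linear_mapD(2)[OF F_linear[of "C.src f" "C.tgt f"], of f g] C.ar_arrow[OF assms(1)] C.ar_arrow[OF assms(2)] assms
  by (simp add: C.pl_def D.pl_def C.arrow_def)

lemma F_sm [simp]:
  assumes "c \<in> carrier k" "C.ar f"
  shows "FM F (C.sm c f) = D.sm c (FM F f)"
  using linear_mapD(3)[OF F_linear[of "C.src f" "C.tgt f"], of c f] C.ar_arrow[OF assms(2)] assms
  by (simp add: C.sm_def D.sm_def C.arrow_def)

lemma F_zr [simp]: "\<lbrakk>X \<in> Obj C; Y \<in> Obj C\<rbrakk> \<Longrightarrow> FM F (C.zr X Y) = D.zr (FO F X) (FO F Y)"
  using linear_mapD(4)[OF F_linear] .

lemma F_ng [simp]: "C.ar f \<Longrightarrow> FM F (C.ng f) = D.ng (FM F f)"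
  using linear_mapD(5)[OF F_linear[of "C.src f" "C.tgt f"], of f] C.ar_arrow[of f]
  by (simp add: C.ng_def D.ng_def C.arrow_def)

lemma F_iso: "is_iso C X Y f \<Longrightarrow> is_iso D (FO F X) (FO F Y) (FM F f)"
proof (erule C.is_isoE)
  fix g assume f: "C.arrow f X Y" "C.arrow g Y X" "g \<cdot>\<^bsub>C\<^esub> f = ident C X" "f \<cdot>\<^bsub>C\<^esub> g = ident C Y"
  show ?thesis
  proof (rule D.is_isoI[OF F_arrow[OF f(1)] F_arrow[OF f(2)]])
    show "FM F g \<cdot>\<^bsub>D\<^esub> FM F f = ident D (FO F X)"
      using f(1,2) by (simp add: C.arrow_iff f(3) flip: F_cmp)
    show "FM F f \<cdot>\<^bsub>D\<^esub> FM F g = ident D (FO F Y)"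
      using f(1,2) by (simp add: C.arrow_iff f(4) flip: F_cmp)
  qed
qed

end

lemma lin_funI: "lin_functor k C D F \<Longrightarrow> lin_fun k C D F"
  by (intro lin_fun.intro lin_fun_axioms.intro) (auto simp: lin_functor_def)

lemma lin_functorI:
  assumes "lin_cat k C" "lin_cat k D"
    and "\<And>X. X \<in> Obj C \<Longrightarrow> FO F X \<in> Obj D"
    and "\<And>X. X \<in> Obj C \<Longrightarrow> FM F (ident C X) = ident D (FO F X)"
    and "\<And>f X Y. lin_cat.arrow C f X Y \<Longrightarrow> lin_cat.arrow D (FM F f) (FO F X) (FO F Y)"
    and "\<And>f g X Y. \<lbrakk>lin_cat.arrow C f X Y; lin_cat.arrow C g X Y\<rbrakk> \<Longrightarrow>
      FM F (f \<oplus>\<^bsub>Hom C X Y\<^esub> g) = FM F f \<oplus>\<^bsub>Hom D (FO F X) (FO F Y)\<^esub> FM F g"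
    and "\<And>c f X Y. \<lbrakk>c \<in> carrier k; lin_cat.arrow C f X Y\<rbrakk> \<Longrightarrow>
      FM F (c \<odot>\<^bsub>Hom C X Y\<^esub> f) = c \<odot>\<^bsub>Hom D (FO F X) (FO F Y)\<^esub> FM F f"
    and "\<And>f g X Y Z. \<lbrakk>lin_cat.arrow C f X Y; lin_cat.arrow C g Y Z\<rbrakk> \<Longrightarrow>
      FM F (g \<cdot>\<^bsub>C\<^esub> f) = FM F g \<cdot>\<^bsub>D\<^esub> FM F f"
  shows "lin_functor k C D F"
proof -
  interpret C: lin_cat k C by fact
  interpret D: lin_cat k D by fact
  show ?thesis unfolding lin_functor_def
  proof (intro conjI ballI)
    fix X Y assume X: "X \<in> Obj C" and Y: "Y \<in> Obj C"
    show "linear_map k (Hom C X Y) (Hom D (FO F X) (FO F Y)) (FM F)"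
      by (rule linear_mapI)
        (use assms(3,5-7) X Y in \<open>simp_all add: C.hom_vectorspace D.hom_vectorspace C.Mor_arrow D.Mor_arrow\<close>)
  qed (use assms in \<open>simp_all add: C.Mor_arrow\<close>)
qed


section \<open>Equivalences\<close>

context lin_fun
begin

definition faithful where
  "faithful \<longleftrightarrow> (\<forall>X Y f g. C.arrow f X Y \<and> C.arrow g X Y \<and> FM F f = FM F g \<longrightarrow> f = g)"
definition full where
  "full \<longleftrightarrow> (\<forall>X\<in>Obj C. \<forall>Y\<in>Obj C. \<forall>h. D.arrow h (FO F X) (FO F Y) \<longrightarrow> (\<exists>f. C.arrow f X Y \<and> FM F f = h))"
definition dense where
  "dense \<longleftrightarrow> (\<forall>Z\<in>Obj D. \<exists>X\<in>Obj C. \<exists>e. is_iso D (FO F X) Z e)"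

lemma faithfulD: "\<lbrakk>faithful; C.arrow f X Y; C.arrow g X Y; FM F f = FM F g\<rbrakk> \<Longrightarrow> f = g"
  unfolding faithful_def by blast

lemma fullE:
  assumes full "X \<in> Obj C" "Y \<in> Obj C" "D.arrow h (FO F X) (FO F Y)"
  obtains f where "C.arrow f X Y" "FM F f = h"
  using assms unfolding full_def by blast

lemma faithfulI:
  assumes "\<And>f X Y. \<lbrakk>C.arrow f X Y; FM F f = D.zr (FO F X) (FO F Y)\<rbrakk> \<Longrightarrow> f = C.zr X Y"
  shows faithful
  unfolding faithful_def
proof (intro allI impI, elim conjE)
  fix X Y f g assume fg: "C.arrow f X Y" "C.arrow g X Y" "FM F f = FM F g"
  have "C.pl f (C.ng g) = C.zr X Y"
    using fg(1,2) by (intro assms) (simp_all add: C.arrow_iff fg(3))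
  thus "f = g" using C.sub_zero[OF fg(1,2)] by simp
qed

lemma reflects_iso:
  assumes "faithful" "full" "C.arrow f X Y" "is_iso D (FO F X) (FO F Y) (FM F f)"
  shows "is_iso C X Y f"
proof -
  have XY: "X \<in> Obj C" "Y \<in> Obj C" using assms(3) by (auto simp: C.arrow_def)
  obtain h where h: "D.arrow h (FO F Y) (FO F X)" "h \<cdot>\<^bsub>D\<^esub> FM F f = ident D (FO F X)"
    "FM F f \<cdot>\<^bsub>D\<^esub> h = ident D (FO F Y)" using assms(4) by (rule D.is_isoE)
  obtain g where g: "C.arrow g Y X" "FM F g = h" using assms(2) XY(2,1) h(1) by (rule fullE)
  show ?thesis
  proof (rule C.is_isoI[OF assms(3) g(1)])
    show "g \<cdot>\<^bsub>C\<^esub> f = ident C X"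
      by (rule faithfulD[OF assms(1), of _ X X]) (use assms(3) g h XY in \<open>simp_all add: C.arrow_iff\<close>)
    show "f \<cdot>\<^bsub>C\<^esub> g = ident C Y"
      by (rule faithfulD[OF assms(1), of _ Y Y]) (use assms(3) g h XY in \<open>simp_all add: C.arrow_iff\<close>)
  qed
qed

text \<open>Density gives preimages \<open>GO Z\<close> with isomorphisms \<open>e Z\<close>, and
  full faithfulness then forces the value of the quasi-inverse on morphisms. Every identity required
  of it is tested after applying the faithful functor \<open>F\<close>.\<close>

lemma equivalenceI:
  assumes faithful full dense
  shows "lin_equivalence k C D F"
proof -
  define GO where "GO Z = (SOME X. X \<in> Obj C \<and> (\<exists>e. is_iso D (FO F X) Z e))" for Z
  have GO: "GO Z \<in> Obj C" "\<exists>e. is_iso D (FO F (GO Z)) Z e" if "Z \<in> Obj D" for Z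
  proof -
    have "\<exists>X. X \<in> Obj C \<and> (\<exists>e. is_iso D (FO F X) Z e)" using assms(3) that unfolding dense_def by blast
    from someI_ex[OF this] show "GO Z \<in> Obj C" "\<exists>e. is_iso D (FO F (GO Z)) Z e"
      unfolding GO_def by auto
  qed
  define e where "e Z = (SOME e. is_iso D (FO F (GO Z)) Z e)" for Z
  have e_iso: "is_iso D (FO F (GO Z)) Z (e Z)" if "Z \<in> Obj D" for Z
    unfolding e_def using someI_ex[OF GO(2)[OF that]] .
  define d where "d Z = (SOME d. D.arrow d Z (FO F (GO Z)) \<and> d \<cdot>\<^bsub>D\<^esub> e Z = ident D (FO F (GO Z)) \<and>
      e Z \<cdot>\<^bsub>D\<^esub> d = ident D Z)" for Z
  have ed: "D.arrow (e Z) (FO F (GO Z)) Z" "D.arrow (d Z) Z (FO F (GO Z))"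
    "d Z \<cdot>\<^bsub>D\<^esub> e Z = ident D (FO F (GO Z))" "e Z \<cdot>\<^bsub>D\<^esub> d Z = ident D Z" if "Z \<in> Obj D" for Z
  proof -
    show "D.arrow (e Z) (FO F (GO Z)) Z" using e_iso[OF that] by (rule D.is_iso_arrow)
    have "\<exists>d. D.arrow d Z (FO F (GO Z)) \<and> d \<cdot>\<^bsub>D\<^esub> e Z = ident D (FO F (GO Z)) \<and>
      e Z \<cdot>\<^bsub>D\<^esub> d = ident D Z" using e_iso[OF that] by (auto simp: D.is_iso_iff)
    from someI_ex[OF this] show "D.arrow (d Z) Z (FO F (GO Z))"
      "d Z \<cdot>\<^bsub>D\<^esub> e Z = ident D (FO F (GO Z))" "e Z \<cdot>\<^bsub>D\<^esub> d Z = ident D Z" unfolding d_def by auto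
  qed
  have d_iso: "is_iso D Z (FO F (GO Z)) (d Z)" if "Z \<in> Obj D" for Z
    by (rule D.is_isoI[OF ed(2,1,4,3)]) (rule that)+
  have eds [simp]: "D.ar (e Z)" "D.src (e Z) = FO F (GO Z)" "D.tgt (e Z) = Z"
    "D.ar (d Z)" "D.tgt (d Z) = FO F (GO Z)" "D.src (d Z) = Z" if "Z \<in> Obj D" for Z
    using ed(1,2)[OF that] by (simp_all add: D.arrow_iff)
  note edc = D.cmp_rew[OF ed(3)] D.cmp_rew[OF ed(4)] ed(3,4)
  \<comment> \<open>The lift along \<open>F\<close> of \<open>h\<close> conjugated by the chosen
    isomorphisms; naturality of \<open>e\<close> is thereby built into the definition.\<close>
  define GM where "GM h = (SOME f. C.arrow f (GO (D.src h)) (GO (D.tgt h)) \<and>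
      FM F f = d (D.tgt h) \<cdot>\<^bsub>D\<^esub> (h \<cdot>\<^bsub>D\<^esub> e (D.src h)))" for h
  have GM: "C.arrow (GM h) (GO X) (GO Y)" "FM F (GM h) = d Y \<cdot>\<^bsub>D\<^esub> (h \<cdot>\<^bsub>D\<^esub> e X)"
    if h: "D.arrow h X Y" for h X Y
  proof -
    have XY: "X \<in> Obj D" "Y \<in> Obj D" using h by (auto simp: D.arrow_def)
    have "D.arrow (d Y \<cdot>\<^bsub>D\<^esub> (h \<cdot>\<^bsub>D\<^esub> e X)) (FO F (GO X)) (FO F (GO Y))"
      using h GO(1) by (simp add: D.arrow_iff)
    then obtain f where "C.arrow f (GO X) (GO Y)" "FM F f = d Y \<cdot>\<^bsub>D\<^esub> (h \<cdot>\<^bsub>D\<^esub> e X)"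
      using fullE[OF assms(2) GO(1)[OF XY(1)] GO(1)[OF XY(2)]] by metis
    moreover have "D.src h = X" "D.tgt h = Y" using h by (auto simp: D.arrow_iff)
    ultimately have "\<exists>f. C.arrow f (GO (D.src h)) (GO (D.tgt h)) \<and>
      FM F f = d (D.tgt h) \<cdot>\<^bsub>D\<^esub> (h \<cdot>\<^bsub>D\<^esub> e (D.src h))" by auto
    from someI_ex[OF this] show "C.arrow (GM h) (GO X) (GO Y)"
      "FM F (GM h) = d Y \<cdot>\<^bsub>D\<^esub> (h \<cdot>\<^bsub>D\<^esub> e X)" unfolding GM_def \<open>D.src h = X\<close> \<open>D.tgt h = Y\<close> by auto
  qed
  define G where "G = \<lparr>FO = GO, FM = GM\<rparr>"
  have G [simp]: "FO G = GO" "FM G = GM" by (auto simp: G_def)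
  have lin: "lin_functor k D C G"
  proof (rule lin_functorI)
    show "lin_cat k D" "lin_cat k C" by unfold_locales
    show "FO G X \<in> Obj C" if "X \<in> Obj D" for X using GO(1)[OF that] by simp
    show "FM G (ident D X) = ident C (FO G X)" if "X \<in> Obj D" for X
      by (rule faithfulD[OF assms(1), of _ "GO X" "GO X"])
        (use that GO(1)[OF that] in \<open>simp_all add: GM[OF D.arrow_ident] C.arrow_ident ed\<close>)
    show "C.arrow (FM G f) (FO G X) (FO G Y)" if "D.arrow f X Y" for f X Y
      using GM(1)[OF that] by simp
    show "FM G (f \<oplus>\<^bsub>Hom D X Y\<^esub> g) = FM G f \<oplus>\<^bsub>Hom C (FO G X) (FO G Y)\<^esub> FM G g"
      if fg: "D.arrow f X Y" "D.arrow g X Y" for f g X Y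
    proof -
      have "GM (D.pl f g) = C.pl (GM f) (GM g)"
      proof (rule faithfulD[OF assms(1)])
        show "C.arrow (GM (D.pl f g)) (GO X) (GO Y)" using fg by (intro GM D.arrow_pl)
        show "C.arrow (C.pl (GM f) (GM g)) (GO X) (GO Y)" using fg by (intro GM C.arrow_pl)
        show "FM F (GM (D.pl f g)) = FM F (C.pl (GM f) (GM g))"
          using fg GM(1)[OF fg(1)] GM(1)[OF fg(2)] GO
          by (simp add: GM(2)[OF D.arrow_pl[OF fg]] GM(2)[OF fg(1)] GM(2)[OF fg(2)] C.arrow_iff D.arrow_iff D.lin)
      qed
      thus ?thesis using fg by (simp add: D.pl_eq[OF fg(1)] C.pl_eq[OF GM(1)[OF fg(1)]])
    qed
    show "FM G (c \<odot>\<^bsub>Hom D X Y\<^esub> f) = c \<odot>\<^bsub>Hom C (FO G X) (FO G Y)\<^esub> FM G f"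
      if fg: "c \<in> carrier k" "D.arrow f X Y" for c f X Y
    proof -
      have "GM (D.sm c f) = C.sm c (GM f)"
      proof (rule faithfulD[OF assms(1)])
        show "C.arrow (GM (D.sm c f)) (GO X) (GO Y)" using fg by (intro GM D.arrow_sm)
        show "C.arrow (C.sm c (GM f)) (GO X) (GO Y)" using fg by (intro GM C.arrow_sm)
        show "FM F (GM (D.sm c f)) = FM F (C.sm c (GM f))"
          using fg GM(1)[OF fg(2)] GO
          by (simp add: GM(2)[OF D.arrow_sm[OF fg]] GM(2)[OF fg(2)] C.arrow_iff D.arrow_iff D.lin)
      qed
      thus ?thesis using fg by (simp add: D.sm_eq[OF fg(2)] C.sm_eq[OF GM(1)[OF fg(2)]])
    qed
    show "FM G (g \<cdot>\<^bsub>D\<^esub> f) = FM G g \<cdot>\<^bsub>C\<^esub> FM G f" if fg: "D.arrow f X Y" "D.arrow g Y Z" for f g X Y Z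
    proof -
      have "GM (g \<cdot>\<^bsub>D\<^esub> f) = GM g \<cdot>\<^bsub>C\<^esub> GM f"
      proof (rule faithfulD[OF assms(1)])
        show "C.arrow (GM (g \<cdot>\<^bsub>D\<^esub> f)) (GO X) (GO Z)" using fg by (intro GM D.arrow_cmp)
        show "C.arrow (GM g \<cdot>\<^bsub>C\<^esub> GM f) (GO X) (GO Z)" using fg by (meson GM C.arrow_cmp)
        show "FM F (GM (g \<cdot>\<^bsub>D\<^esub> f)) = FM F (GM g \<cdot>\<^bsub>C\<^esub> GM f)"
          using fg GM(1)[OF fg(1)] GM(1)[OF fg(2)] GO
          by (simp add: GM(2)[OF D.arrow_cmp[OF fg]] GM(2)[OF fg(1)] GM(2)[OF fg(2)] C.arrow_iff D.arrow_iff edc)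
      qed
      thus ?thesis by simp
    qed
  qed
  \<comment> \<open>The unit is the lift of the inverse \<open>d\<close> of the counit; it is
    invertible because a fully faithful functor reflects isomorphisms.\<close>
  define u where "u X = (SOME f. C.arrow f X (GO (FO F X)) \<and> FM F f = d (FO F X))" for X
  have u: "C.arrow (u X) X (GO (FO F X))" "FM F (u X) = d (FO F X)" if X: "X \<in> Obj C" for X
  proof -
    have "\<exists>f. C.arrow f X (GO (FO F X)) \<and> FM F f = d (FO F X)"
      using fullE[OF assms(2) X GO(1)[OF F_obj[OF X]] ed(2)[OF F_obj[OF X]]] by metis
    from someI_ex[OF this] show "C.arrow (u X) X (GO (FO F X))" "FM F (u X) = d (FO F X)"
      unfolding u_def by auto
  qed
  have "nat_iso C C fid (functor_cmp G F) u"
    unfolding nat_iso_def fid_def functor_cmp_def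
  proof (intro conjI ballI; simp)
    show "is_iso C X (GO (FO F X)) (u X)" if X: "X \<in> Obj C" for X
      by (rule reflects_iso[OF assms(1,2) u(1)]) (use X d_iso u in auto)
    show "u Y \<cdot>\<^bsub>C\<^esub> f = GM (FM F f) \<cdot>\<^bsub>C\<^esub> u X" if XY: "X \<in> Obj C" "Y \<in> Obj C" "f \<in> Mor C X Y" for X Y f
    proof -
      have f: "C.arrow f X Y" using XY by (simp add: C.arrow_def)
      show ?thesis
      proof (rule faithfulD[OF assms(1)])
        show "C.arrow (u Y \<cdot>\<^bsub>C\<^esub> f) X (GO (FO F Y))" using f u XY by (meson C.arrow_cmp)
        show "C.arrow (GM (FM F f) \<cdot>\<^bsub>C\<^esub> u X) X (GO (FO F Y))"
          using GM(1)[OF F_arrow[OF f]] u XY by (meson C.arrow_cmp)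
        show "FM F (u Y \<cdot>\<^bsub>C\<^esub> f) = FM F (GM (FM F f) \<cdot>\<^bsub>C\<^esub> u X)"
          using f u(1)[OF XY(1)] u(1)[OF XY(2)] GM(1)[OF F_arrow[OF f]] XY
          by (simp add: C.arrow_iff GM(2)[OF F_arrow[OF f]] u(2) edc)
      qed
    qed
  qed
  moreover have "nat_iso D D (functor_cmp F G) fid e"
    unfolding nat_iso_def fid_def functor_cmp_def
  proof (intro conjI ballI; simp)
    show "is_iso D (FO F (GO X)) X (e X)" if "X \<in> Obj D" for X using e_iso[OF that] .
    show "e Y \<cdot>\<^bsub>D\<^esub> FM F (GM f) = f \<cdot>\<^bsub>D\<^esub> e X" if XY: "X \<in> Obj D" "Y \<in> Obj D" "f \<in> Mor D X Y" for X Y f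
    proof -
      have f: "D.arrow f X Y" using XY by (simp add: D.arrow_def)
      thus ?thesis using XY GO by (simp add: GM(2)[OF f] edc D.arrow_iff)
    qed
  qed
  ultimately show ?thesis
    unfolding lin_equivalence_def using lin_functor lin by blast
qed

lemma nat_iso_faithful:
  assumes "lin_functor k D C G" "nat_iso C C fid (functor_cmp G F) \<eta>"
  shows faithful
  unfolding faithful_def
proof (intro allI impI, elim conjE)
  fix X Y f g assume fg: "C.arrow f X Y" "C.arrow g X Y" "FM F f = FM F g"
  have XY: "X \<in> Obj C" "Y \<in> Obj C" using fg by (auto simp: C.arrow_def)
  have "is_iso C Y (FO G (FO F Y)) (\<eta> Y)" and
    "\<eta> Y \<cdot>\<^bsub>C\<^esub> f = FM G (FM F f) \<cdot>\<^bsub>C\<^esub> \<eta> X" "\<eta> Y \<cdot>\<^bsub>C\<^esub> g = FM G (FM F g) \<cdot>\<^bsub>C\<^esub> \<eta> X"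
    using assms(2) fg XY by (auto simp: nat_iso_def fid_def functor_cmp_def C.arrow_def)
  thus "f = g" using C.is_iso_cancel_left[OF _ fg(1,2)] fg(3) by metis
qed

text \<open>Faithfulness of the quasi-inverse, read off from the counit. It is what turns equality
  after \<open>G\<close> into equality in \<open>D\<close> when fullness of \<open>F\<close> is
  shown.\<close>

lemma nat_iso_faithful_right:
  assumes "lin_functor k D C G" "nat_iso D D (functor_cmp F G) fid \<epsilon>"
    and "D.arrow f X Y" "D.arrow g X Y" "FM G f = FM G g"
  shows "f = g"
proof -
  have XY: "X \<in> Obj D" "Y \<in> Obj D" using assms(3) by (auto simp: D.arrow_def)
  have e: "is_iso D (FO F (FO G X)) X (\<epsilon> X)" and
    e2: "\<epsilon> Y \<cdot>\<^bsub>D\<^esub> FM F (FM G f) = f \<cdot>\<^bsub>D\<^esub> \<epsilon> X" "\<epsilon> Y \<cdot>\<^bsub>D\<^esub> FM F (FM G g) = g \<cdot>\<^bsub>D\<^esub> \<epsilon> X"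
    using assms(2-4) XY by (auto simp: nat_iso_def fid_def functor_cmp_def D.arrow_def)
  obtain d where d: "D.arrow (\<epsilon> X) (FO F (FO G X)) X" "D.arrow d X (FO F (FO G X))" "\<epsilon> X \<cdot>\<^bsub>D\<^esub> d = ident D X"
    using e by (rule D.is_isoE)
  have "(f \<cdot>\<^bsub>D\<^esub> \<epsilon> X) \<cdot>\<^bsub>D\<^esub> d = (g \<cdot>\<^bsub>D\<^esub> \<epsilon> X) \<cdot>\<^bsub>D\<^esub> d" using e2 assms(5) by simp
  thus "f = g" using assms(3,4) d by (simp add: D.arrow_iff)
qed

lemma equivalenceD:
  assumes "lin_equivalence k C D F"
  shows faithful full dense
proof -
  obtain G \<eta> \<epsilon> where G: "lin_functor k D C G" and \<eta>: "nat_iso C C fid (functor_cmp G F) \<eta>"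
    and \<epsilon>: "nat_iso D D (functor_cmp F G) fid \<epsilon>" using assms by (auto simp: lin_equivalence_def)
  interpret G: lin_fun k D C G using G by (rule lin_funI)
  show faithful using G \<eta> by (rule nat_iso_faithful)
  show dense unfolding dense_def
  proof
    fix Z assume Z: "Z \<in> Obj D"
    hence "is_iso D (FO F (FO G Z)) Z (\<epsilon> Z)" using \<epsilon> by (auto simp: nat_iso_def fid_def functor_cmp_def)
    thus "\<exists>X\<in>Obj C. \<exists>e. is_iso D (FO F X) Z e" using Z G.F_obj by blast
  qed
  show full unfolding full_def
  proof (intro ballI allI impI)
    fix X Y h assume XY: "X \<in> Obj C" "Y \<in> Obj C" and h: "D.arrow h (FO F X) (FO F Y)"
    have nx: "is_iso C X (FO G (FO F X)) (\<eta> X)" and ny: "is_iso C Y (FO G (FO F Y)) (\<eta> Y)"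
      using \<eta> XY by (auto simp: nat_iso_def fid_def functor_cmp_def)
    obtain ny' where ny': "C.arrow (\<eta> Y) Y (FO G (FO F Y))" "C.arrow ny' (FO G (FO F Y)) Y"
       "ny' \<cdot>\<^bsub>C\<^esub> \<eta> Y = ident C Y" "\<eta> Y \<cdot>\<^bsub>C\<^esub> ny' = ident C (FO G (FO F Y))" using ny by (rule C.is_isoE)
    obtain nx' where nx': "C.arrow (\<eta> X) X (FO G (FO F X))" "C.arrow nx' (FO G (FO F X)) X"
       "\<eta> X \<cdot>\<^bsub>C\<^esub> nx' = ident C (FO G (FO F X))" using nx by (rule C.is_isoE)
    \<comment> \<open>The only candidate for a preimage of \<open>h\<close>: naturality of
      \<open>\<eta>\<close> makes \<open>G\<close> agree on \<open>FM F f\<close> and on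
      \<open>h\<close>.\<close>
    define f where "f = ny' \<cdot>\<^bsub>C\<^esub> (FM G h \<cdot>\<^bsub>C\<^esub> \<eta> X)"
    have Gh: "C.arrow (FM G h) (FO G (FO F X)) (FO G (FO F Y))" using G.F_arrow[OF h] .
    have f: "C.arrow f X Y" using Gh nx' ny' by (simp add: f_def C.arrow_iff)
    have "FM G (FM F f) \<cdot>\<^bsub>C\<^esub> \<eta> X = \<eta> Y \<cdot>\<^bsub>C\<^esub> f"
      using \<eta> f XY by (auto simp: nat_iso_def fid_def functor_cmp_def C.arrow_def)
    also have "\<dots> = FM G h \<cdot>\<^bsub>C\<^esub> \<eta> X" using Gh nx' ny'
      by (simp add: f_def C.arrow_iff C.cmp_rew[OF ny'(4)])
    finally have "(FM G (FM F f) \<cdot>\<^bsub>C\<^esub> \<eta> X) \<cdot>\<^bsub>C\<^esub> nx' = (FM G h \<cdot>\<^bsub>C\<^esub> \<eta> X) \<cdot>\<^bsub>C\<^esub> nx'" by simp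
    hence "FM G (FM F f) = FM G h" using f h nx' Gh G.F_arrow[OF F_arrow[OF f]] by (simp add: C.arrow_iff)
    hence "FM F f = h" by (rule nat_iso_faithful_right[OF G \<epsilon> F_arrow[OF f] h])
    thus "\<exists>f. C.arrow f X Y \<and> FM F f = h" using f by blast
  qed
qed

end


section \<open>Triangulated categories\<close>

sublocale triangulated \<subseteq> Sh: lin_fun k T T "Sh T"
  by (rule lin_funI[OF shift_functor])
sublocale triangulated \<subseteq> Shi: lin_fun k T T "Shi T"
  by (rule lin_funI[OF unshift_functor])

context triangulated
begin

notation comp_mor (infixr "\<bullet>" 75) and pl (infixl "\<boxplus>" 65) and ng ("\<boxminus> _" [80] 80)
  and sm (infixr "\<triangleright>" 75)

abbreviation Sg ("\<Sigma>") where "\<Sigma> X \<equiv> FO (Sh T) X"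
abbreviation sg ("\<sigma>") where "\<sigma> f \<equiv> FM (Sh T) f"
abbreviation Sgi ("\<Sigma>\<^sub>-") where "\<Sigma>\<^sub>- X \<equiv> FO (Shi T) X"
abbreviation sgi ("\<sigma>\<^sub>-") where "\<sigma>\<^sub>- f \<equiv> FM (Shi T) f"
abbreviation idt where "idt X \<equiv> ident T X"

lemmas shift_obj [simp] = unshift_shift_obj shift_unshift_obj

lemma shift_mor [simp]: "ar f \<Longrightarrow> \<sigma>\<^sub>- (\<sigma> f) = f" "ar f \<Longrightarrow> \<sigma> (\<sigma>\<^sub>- f) = f"
  using ar_arrow[of f] unshift_shift_mor[of "src f" "tgt f" f] shift_unshift_mor[of "src f" "tgt f" f]
  by (simp_all add: arrow_def)

lemma tri_arrow: 
  assumes "Tri T X Y Z f g h" shows "arrow f X Y" "arrow g Y Z" "arrow h Z (\<Sigma> X)"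
  using tri_candidate[OF assms] by (auto simp: candidate_def arrow_def)

lemma tri_obj:
  assumes "Tri T X Y Z f g h" shows "X \<in> Obj T" "Y \<in> Obj T" "Z \<in> Obj T"
  using tri_candidate[OF assms] by (auto simp: candidate_def)

lemma candidate_iff: "candidate T (Sh T) X Y Z f g h \<longleftrightarrow> arrow f X Y \<and> arrow g Y Z \<and> arrow h Z (\<Sigma> X)"
  by (auto simp: candidate_def arrow_def)

lemma tri_rot_iff:
  assumes "arrow f X Y" "arrow g Y Z" "arrow h Z (\<Sigma> X)"
  shows "Tri T X Y Z f g h \<longleftrightarrow> Tri T Y Z (\<Sigma> X) g h (\<boxminus> \<sigma> f)"
  using tri_rotate[of X Y Z f g h] assms ng_eq[OF Sh.F_arrow[OF assms(1)]] by (simp add: candidate_iff)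

lemma tri_rot: "Tri T X Y Z f g h \<Longrightarrow> Tri T Y Z (\<Sigma> X) g h (\<boxminus> \<sigma> f)"
  using tri_rot_iff[OF tri_arrow] by blast

lemma tri_change_iso:
  assumes "Tri T X Y Z f g h" "is_iso T X X' a" "is_iso T Y Y' b" "is_iso T Z Z' c"
    "arrow f' X' Y'" "arrow g' Y' Z'" "arrow h' Z' (\<Sigma> X')"
    "b \<bullet> f = f' \<bullet> a" "c \<bullet> g = g' \<bullet> b" "\<sigma> a \<bullet> h = h' \<bullet> c"
  shows "Tri T X' Y' Z' f' g' h'"
  using tri_iso[OF assms(1), of X' Y' Z' f' g' h'] assms tri_arrow[OF assms(1)]
  unfolding candidate_iso_def candidate_iff by blast

lemma tri_sign12:
  assumes t: "Tri T X Y Z f g h" shows "Tri T X Y Z (\<boxminus> f) (\<boxminus> g) h"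
  by (rule tri_change_iso[OF t is_iso_ident is_iso_ng[OF is_iso_ident] is_iso_ident])
    (use tri_arrow[OF t] in \<open>simp_all add: arrow_iff lin\<close>)

text \<open>Three rotations put a minus sign on each shifted map. Two of the signs are removed by
  the isomorphism that is -1 in the middle, so exactly one survives.\<close>

lemma tri_shift_iff:
  assumes a: "arrow f X Y" "arrow g Y Z" "arrow h Z (\<Sigma> X)"
  shows "Tri T X Y Z f g h \<longleftrightarrow> Tri T (\<Sigma> X) (\<Sigma> Y) (\<Sigma> Z) (\<sigma> f) (\<sigma> g) (\<boxminus> \<sigma> h)"
proof -
  have "Tri T X Y Z f g h \<longleftrightarrow> Tri T Y Z (\<Sigma> X) g h (\<boxminus> \<sigma> f)" by (rule tri_rot_iff[OF a])
  also have "\<dots> \<longleftrightarrow> Tri T Z (\<Sigma> X) (\<Sigma> Y) h (\<boxminus> \<sigma> f) (\<boxminus> \<sigma> g)"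
    using a by (intro tri_rot_iff) (simp_all add: arrow_iff)
  also have "\<dots> \<longleftrightarrow> Tri T (\<Sigma> X) (\<Sigma> Y) (\<Sigma> Z) (\<boxminus> \<sigma> f) (\<boxminus> \<sigma> g) (\<boxminus> \<sigma> h)"
    using a by (intro tri_rot_iff) (simp_all add: arrow_iff)
  also have "\<dots> \<longleftrightarrow> Tri T (\<Sigma> X) (\<Sigma> Y) (\<Sigma> Z) (\<sigma> f) (\<sigma> g) (\<boxminus> \<sigma> h)"
    using tri_sign12[of "\<Sigma> X" "\<Sigma> Y" "\<Sigma> Z" "\<boxminus> \<sigma> f" "\<boxminus> \<sigma> g" "\<boxminus> \<sigma> h"]
      tri_sign12[of "\<Sigma> X" "\<Sigma> Y" "\<Sigma> Z" "\<sigma> f" "\<sigma> g" "\<boxminus> \<sigma> h"] a by (auto simp: arrow_iff)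
  finally show ?thesis .
qed

lemma tri_shift: "Tri T X Y Z f g h \<Longrightarrow> Tri T (\<Sigma> X) (\<Sigma> Y) (\<Sigma> Z) (\<sigma> f) (\<sigma> g) (\<boxminus> \<sigma> h)"
  using tri_shift_iff[OF tri_arrow] by blast

lemma tri_unshift:
  assumes t: "Tri T X Y Z f g h"
  shows "Tri T (\<Sigma>\<^sub>- X) (\<Sigma>\<^sub>- Y) (\<Sigma>\<^sub>- Z) (\<sigma>\<^sub>- f) (\<sigma>\<^sub>- g) (\<boxminus> \<sigma>\<^sub>- h)"
proof -
  note a = tri_arrow[OF t]
  show ?thesis
    by (subst tri_shift_iff) (use a t in \<open>simp_all add: arrow_iff\<close>)
qed

lemma tri_unrot:
  assumes t: "Tri T X Y Z f g h"
  shows "Tri T (\<Sigma>\<^sub>- Z) X Y (\<boxminus> \<sigma>\<^sub>- h) f g"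
  by (subst tri_rot_iff) (use tri_arrow[OF t] t in \<open>simp_all add: arrow_iff\<close>)

lemma tri_morphism':
  assumes "Tri T X Y Z f g h" "Tri T X' Y' Z' f' g' h'" "arrow a X X'" "arrow b Y Y'" "b \<bullet> f = f' \<bullet> a"
  obtains c where "arrow c Z Z'" "c \<bullet> g = g' \<bullet> b" "\<sigma> a \<bullet> h = h' \<bullet> c"
  using tri_morphism[OF assms(1,2) arrow_Mor[OF assms(3)] arrow_Mor[OF assms(4)] assms(5)]
    tri_obj[OF assms(1)] tri_obj[OF assms(2)] by (auto simp: arrow_def)

lemma tri_id:
  assumes "X \<in> Obj T" "is_zero_obj T Z" shows "Tri T X X Z (idt X) (zr X Z) (zr Z (\<Sigma> X))"
  using tri_ident assms .

lemma zero_objE: obtains Z where "is_zero_obj T Z" "Z \<in> Obj T"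
  using zero_obj_exists by (auto simp: is_zero_obj_def)

text \<open>The trivial triangle on the identity of \<open>X\<close> maps to the given one by
  \<open>idt X\<close> and \<open>f\<close>; the third component starts at a zero object, and it
  computes \<open>g \<bullet> f\<close>.\<close>

lemma tri_comp_zero12: assumes t: "Tri T X Y Z f g h" shows "g \<bullet> f = zr X Z"
proof -
  note a = tri_arrow[OF t] and o = tri_obj[OF t]
  obtain Z0 where z: "is_zero_obj T Z0" "Z0 \<in> Obj T" by (rule zero_objE)
  obtain c where "arrow c Z0 Z" "c \<bullet> zr X Z0 = g \<bullet> f"
    by (rule tri_morphism'[OF tri_id[OF o(1) z(1)] t arrow_ident[OF o(1)] a(1)]) (use a in simp_all)
  thus ?thesis using o by (simp add: arrow_iff)
qed

lemma tri_comp_zero23: assumes t: "Tri T X Y Z f g h" shows "h \<bullet> g = zr Y (\<Sigma> X)"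
  using tri_comp_zero12[OF tri_rot[OF t]] .

lemma tri_comp_zero31: assumes t: "Tri T X Y Z f g h" shows "\<sigma> f \<bullet> h = zr Z (\<Sigma> Y)"
proof -
  have "\<boxminus> (\<sigma> f \<bullet> h) = zr Z (\<Sigma> Y)"
    using tri_comp_zero12[OF tri_rot[OF tri_rot[OF t]]] tri_arrow[OF t] by (simp add: arrow_iff lin)
  hence "\<boxminus> \<boxminus> (\<sigma> f \<bullet> h) = \<boxminus> zr Z (\<Sigma> Y)" by simp
  thus ?thesis using tri_arrow[OF t] tri_obj[OF t] by (simp add: arrow_iff)
qed

text \<open>Exactness of Hom(W, -) at the middle term. The rotated trivial triangle on
  \<open>W\<close> maps to the rotated triangle by \<open>b\<close> and zero; unshifting the third
  component gives the lift.\<close>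

lemma tri_lift:
  assumes t: "Tri T X Y Z f g h" and b: "arrow b W Y" "g \<bullet> b = zr W Z"
  obtains a where "arrow a W X" "f \<bullet> a = b"
proof -
  note a = tri_arrow[OF t] and o = tri_obj[OF t]
  obtain Z0 where z: "is_zero_obj T Z0" "Z0 \<in> Obj T" by (rule zero_objE)
  have W: "W \<in> Obj T" using b by (simp add: arrow_def)
  obtain c where c: "arrow c (\<Sigma> W) (\<Sigma> X)" "\<sigma> b \<bullet> (\<boxminus> \<sigma> (idt W)) = (\<boxminus> \<sigma> f) \<bullet> c"
    by (rule tri_morphism'[OF tri_rot[OF tri_id[OF W z(1)]] tri_rot[OF t] b(1) arrow_zr[OF z(2) o(3)]])
      (use b W z o in simp_all)
  have "\<boxminus> (\<sigma> b) = \<boxminus> (\<sigma> f \<bullet> c)" using c b a W by (simp add: arrow_iff lin)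
  hence "\<sigma> b = \<sigma> f \<bullet> c" using ng_ng[of "\<sigma> b"] ng_ng[of "\<sigma> f \<bullet> c"] a b c by (simp add: arrow_iff)
  hence "\<sigma>\<^sub>- (\<sigma> b) = \<sigma>\<^sub>- (\<sigma> f \<bullet> c)" by simp
  hence "f \<bullet> \<sigma>\<^sub>- c = b" using a b c by (simp add: arrow_iff)
  moreover have "arrow (\<sigma>\<^sub>- c) W X" using c W o by (simp add: arrow_iff)
  ultimately show ?thesis using that by blast
qed

lemma tri_zero_id:
  assumes W: "W \<in> Obj T" and z: "is_zero_obj T Z"
  shows "\<exists>Z'. is_zero_obj T Z' \<and> Tri T Z' W W (zr Z' W) (idt W) (zr W (\<Sigma> Z'))"
proof -
  have zo: "Z \<in> Obj T" using z by (simp add: is_zero_obj_def)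
  have "idt (\<Sigma>\<^sub>- Z) = \<sigma>\<^sub>- (idt Z)" using zo by simp
  also have "idt Z = zr Z Z" using zero_obj_hom(1)[OF z arrow_ident[OF zo]] .
  finally have "is_zero_obj T (\<Sigma>\<^sub>- Z)" using zo by (intro is_zero_objI) simp_all
  moreover have "Tri T (\<Sigma>\<^sub>- Z) W W (zr (\<Sigma>\<^sub>- Z) W) (idt W) (zr W (\<Sigma> (\<Sigma>\<^sub>- Z)))"
    using tri_unrot[OF tri_id[OF W z]] W zo by simp
  ultimately show ?thesis by blast
qed

text \<open>Exactness of Hom(-, W): the third component of a morphism to the triangle formed by zero
  and the identity of \<open>W\<close> is the extension.\<close>

lemma tri_extend:
  assumes t: "Tri T X Y Z f g h" and b: "arrow b Y W" "b \<bullet> f = zr X W"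
  obtains c where "arrow c Z W" "c \<bullet> g = b"
proof -
  note a = tri_arrow[OF t] and o = tri_obj[OF t]
  have W: "W \<in> Obj T" using b by (simp add: arrow_def)
  obtain Z1 where "is_zero_obj T Z1" "Z1 \<in> Obj T" by (rule zero_objE)
  then obtain Z0 where z: "is_zero_obj T Z0" and t0: "Tri T Z0 W W (zr Z0 W) (idt W) (zr W (\<Sigma> Z0))"
    using tri_zero_id[OF W] by blast
  have zo: "Z0 \<in> Obj T" using z by (simp add: is_zero_obj_def)
  obtain c where "arrow c Z W" "c \<bullet> g = idt W \<bullet> b"
    by (rule tri_morphism'[OF t t0 arrow_zr[OF o(1) zo] b(1)]) (use b o zo W in simp_all)
  moreover have "idt W \<bullet> b = b" using b by (simp add: arrow_iff)
  ultimately show ?thesis using that by metis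
qed

text \<open>A candidate triangle is exact if \<open>Hom(W, -)\<close> turns it into a long exact sequence. Unlike for
distinguished triangles, closure of these under direct sums is immediate.\<close>

definition exact_cand where
  "exact_cand X Y Z f g h \<longleftrightarrow> arrow f X Y \<and> arrow g Y Z \<and> arrow h Z (\<Sigma> X) \<and>
    g \<bullet> f = zr X Z \<and> h \<bullet> g = zr Y (\<Sigma> X) \<and> \<sigma> f \<bullet> h = zr Z (\<Sigma> Y) \<and>
    (\<forall>W b. arrow b W Y \<and> g \<bullet> b = zr W Z \<longrightarrow> (\<exists>a. arrow a W X \<and> f \<bullet> a = b)) \<and>
    (\<forall>W b. arrow b W Z \<and> h \<bullet> b = zr W (\<Sigma> X) \<longrightarrow> (\<exists>a. arrow a W Y \<and> g \<bullet> a = b)) \<and>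
    (\<forall>W b. arrow b W (\<Sigma> X) \<and> \<sigma> f \<bullet> b = zr W (\<Sigma> Y) \<longrightarrow> (\<exists>a. arrow a W Z \<and> h \<bullet> a = b))"

lemma tri_exact: assumes t: "Tri T X Y Z f g h" shows "exact_cand X Y Z f g h"
proof -
  note a = tri_arrow[OF t]
  have "\<exists>a. arrow a W Z \<and> h \<bullet> a = b" if b: "arrow b W (\<Sigma> X)" "\<sigma> f \<bullet> b = zr W (\<Sigma> Y)" for W b
  proof -
    have "(\<boxminus> \<sigma> f) \<bullet> b = zr W (\<Sigma> Y)" using a b by (simp add: arrow_iff lin)
    thus ?thesis using tri_lift[OF tri_rot[OF tri_rot[OF t]] b(1)] by blast
  qed
  moreover have "\<exists>a. arrow a W X \<and> f \<bullet> a = b" if "arrow b W Y" "g \<bullet> b = zr W Z" for W b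
    using tri_lift[OF t that] by blast
  moreover have "\<exists>a. arrow a W Y \<and> g \<bullet> a = b" if "arrow b W Z" "h \<bullet> b = zr W (\<Sigma> X)" for W b
    using tri_lift[OF tri_rot[OF t] that] by blast
  ultimately show ?thesis unfolding exact_cand_def
    using a tri_comp_zero12[OF t] tri_comp_zero23[OF t] tri_comp_zero31[OF t] by simp
qed

lemma exact_candD:
  assumes "exact_cand X Y Z f g h"
  shows "arrow f X Y" "arrow g Y Z" "arrow h Z (\<Sigma> X)"
    "g \<bullet> f = zr X Z" "h \<bullet> g = zr Y (\<Sigma> X)" "\<sigma> f \<bullet> h = zr Z (\<Sigma> Y)"
    "\<lbrakk>arrow b W Y; g \<bullet> b = zr W Z\<rbrakk> \<Longrightarrow> \<exists>a. arrow a W X \<and> f \<bullet> a = b"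
    "\<lbrakk>arrow b W Z; h \<bullet> b = zr W (\<Sigma> X)\<rbrakk> \<Longrightarrow> \<exists>a. arrow a W Y \<and> g \<bullet> a = b"
    "\<lbrakk>arrow b W (\<Sigma> X); \<sigma> f \<bullet> b = zr W (\<Sigma> Y)\<rbrakk> \<Longrightarrow> \<exists>a. arrow a W Z \<and> h \<bullet> a = b"
  using assms unfolding exact_cand_def by blast+

text \<open>The five lemma, chased on morphisms from an arbitrary \<open>W\<close>. It is stated for
  exact candidates so that a candidate not yet known to be distinguished can be compared with a
  distinguished triangle.\<close>

lemma five:
  assumes e: "exact_cand X Y Z f g h" and e': "exact_cand X' Y' Z' f' g' h'"
    and a: "is_iso T X X' a" and b: "is_iso T Y Y' b" and c: "arrow c Z Z'"
    and sq: "b \<bullet> f = f' \<bullet> a" "c \<bullet> g = g' \<bullet> b" "\<sigma> a \<bullet> h = h' \<bullet> c"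
  shows "is_iso T Z Z' c"
proof -
  note E = exact_candD[OF e] and E' = exact_candD[OF e']
  obtain a' where a': "arrow a X X'" "arrow a' X' X" "a' \<bullet> a = idt X" "a \<bullet> a' = idt X'" using a by (rule is_isoE)
  obtain b' where b': "arrow b Y Y'" "arrow b' Y' Y" "b' \<bullet> b = idt Y" "b \<bullet> b' = idt Y'" using b by (rule is_isoE)
  have sa': "\<sigma> a' \<bullet> \<sigma> a = idt (\<Sigma> X)" "\<sigma> a \<bullet> \<sigma> a' = idt (\<Sigma> X')"
    using a' by (simp_all add: arrow_iff flip: Sh.F_cmp)
  have sb': "\<sigma> b' \<bullet> \<sigma> b = idt (\<Sigma> Y)" using b' by (simp add: arrow_iff flip: Sh.F_cmp)
  note A = E(1-3) E'(1-3) a'(1,2) b'(1,2) c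
  have ssq: "\<sigma> b \<bullet> \<sigma> f = \<sigma> f' \<bullet> \<sigma> a" using sq(1) A by (simp add: arrow_iff flip: Sh.F_cmp)
  have inj: "u = zr W Z" if u: "arrow u W Z" "c \<bullet> u = zr W Z'" for u W
  proof -
    have W: "W \<in> Obj T" using u by (simp add: arrow_def)
    have "\<sigma> a \<bullet> (h \<bullet> u) = h' \<bullet> (c \<bullet> u)" using A u(1) by (simp add: arrow_iff cmp_rew[OF sq(3)])
    hence "\<sigma> a' \<bullet> (\<sigma> a \<bullet> (h \<bullet> u)) = zr W (\<Sigma> X)" using A u W by (simp add: arrow_iff)
    hence "h \<bullet> u = zr W (\<Sigma> X)" using A u(1) by (simp add: arrow_iff cmp_rew[OF sa'(1)])
    then obtain y where y: "arrow y W Y" "g \<bullet> y = u" using E(8) u by blast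
    have "g' \<bullet> (b \<bullet> y) = c \<bullet> (g \<bullet> y)" using A y(1) by (simp add: arrow_iff cmp_rew[OF sq(2)])
    hence "g' \<bullet> (b \<bullet> y) = zr W Z'" using y u by simp
    then obtain x where x: "arrow x W X'" "f' \<bullet> x = b \<bullet> y" using E'(7)[of "b \<bullet> y" W] A y by (auto simp: arrow_iff)
    have "b \<bullet> (f \<bullet> (a' \<bullet> x)) = f' \<bullet> x" using A x(1)
      by (simp add: arrow_iff cmp_rew[OF sq(1)] cmp_rew[OF a'(4)])
    hence "b' \<bullet> (b \<bullet> (f \<bullet> (a' \<bullet> x))) = b' \<bullet> (b \<bullet> y)" using x by simp
    hence "f \<bullet> (a' \<bullet> x) = y" using A x(1) y by (simp add: arrow_iff cmp_rew[OF b'(3)])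
    hence "u = (g \<bullet> f) \<bullet> (a' \<bullet> x)" using y A x(1) by (auto simp: arrow_iff)
    also have "\<dots> = zr W Z" using A x(1) unfolding E(4) by (simp add: arrow_iff)
    finally show ?thesis .
  qed
  have surj: "\<exists>u. arrow u W Z \<and> c \<bullet> u = v" if v: "arrow v W Z'" for v W
  proof -
    have W: "W \<in> Obj T" using v by (simp add: arrow_def)
    define x where "x = \<sigma> a' \<bullet> (h' \<bullet> v)"
    have x: "arrow x W (\<Sigma> X)" using A v by (simp add: x_def arrow_iff)
    have "\<sigma> b \<bullet> (\<sigma> f \<bullet> x) = (\<sigma> f' \<bullet> h') \<bullet> v"
      using A v by (simp add: x_def arrow_iff cmp_rew[OF ssq] cmp_rew[OF sa'(2)])
    also have "\<dots> = zr W (\<Sigma> Y')" using A v unfolding E'(6) by (simp add: arrow_iff)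
    finally have "\<sigma> b' \<bullet> (\<sigma> b \<bullet> (\<sigma> f \<bullet> x)) = zr W (\<Sigma> Y)" using A W by (simp add: arrow_iff)
    hence "\<sigma> f \<bullet> x = zr W (\<Sigma> Y)" using A x by (simp add: arrow_iff cmp_rew[OF sb'])
    then obtain z where z: "arrow z W Z" "h \<bullet> z = x" using E(9)[OF x] by blast
    have "h' \<bullet> (c \<bullet> z) = \<sigma> a \<bullet> (h \<bullet> z)" using A z(1) by (simp add: arrow_iff cmp_rew[OF sq(3)])
    also have "\<dots> = h' \<bullet> v" using A v z by (simp add: x_def arrow_iff cmp_rew[OF sa'(2)])
    finally have "h' \<bullet> (v \<boxplus> \<boxminus> (c \<bullet> z)) = zr W (\<Sigma> X')" using A v z(1) by (simp add: arrow_iff lin)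
    then obtain y where y: "arrow y W Y'" "g' \<bullet> y = v \<boxplus> \<boxminus> (c \<bullet> z)"
      using E'(8)[of "v \<boxplus> \<boxminus> (c \<bullet> z)" W] A v z(1) by (auto simp: arrow_iff)
    have "c \<bullet> (g \<bullet> (b' \<bullet> y)) = g' \<bullet> y" using A y(1)
      by (simp add: arrow_iff cmp_rew[OF sq(2)] cmp_rew[OF b'(4)])
    hence "c \<bullet> (z \<boxplus> g \<bullet> (b' \<bullet> y)) = v" using y A z(1) v
      by (simp add: arrow_iff lin pl_ac)
    moreover have "arrow (z \<boxplus> g \<bullet> (b' \<bullet> y)) W Z" using A y(1) z by (simp add: arrow_iff)
    ultimately show ?thesis by blast
  qed
  have o: "Z \<in> Obj T" "Z' \<in> Obj T" using c by (auto simp: arrow_def)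
  \<comment> \<open>Surjectivity at the identity gives a right inverse of \<open>c\<close>;
    injectivity applied to \<open>d \<bullet> c\<close> minus the identity makes it
    two-sided.\<close>
  obtain d where d: "arrow d Z' Z" "c \<bullet> d = idt Z'" using surj[OF arrow_ident[OF o(2)]] by blast
  have "d \<bullet> c \<boxplus> \<boxminus> idt Z = zr Z Z"
    using c d o by (intro inj) (simp_all add: arrow_iff lin cmp_rew[OF d(2)])
  hence "d \<bullet> c = idt Z" by (rule sub_zero[OF arrow_cmp[OF c d(1)] arrow_ident[OF o(1)]])
  thus ?thesis using is_isoI[OF c d(1)] d(2) by blast
qed

lemma five_tri:
  assumes "Tri T X Y Z f g h" "Tri T X' Y' Z' f' g' h'" "is_iso T X X' a" "is_iso T Y Y' b" "arrow c Z Z'"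
    "b \<bullet> f = f' \<bullet> a" "c \<bullet> g = g' \<bullet> b" "\<sigma> a \<bullet> h = h' \<bullet> c"
  shows "is_iso T Z Z' c"
  using five[OF tri_exact[OF assms(1)] tri_exact[OF assms(2)] assms(3-8)] .

lemma tri_cone': 
  assumes "arrow f X Y" obtains Z g h where "Tri T X Y Z f g h"
  using tri_cone[of X Y f] assms by (auto simp: arrow_def)

lemma tri_cocone:
  assumes "arrow g Y Z" obtains X f h where "Tri T X Y Z f g h"
proof -
  obtain W u v where "Tri T Y Z W g u v" using assms by (rule tri_cone')
  thus ?thesis using that tri_unrot by blast
qed

text \<open>Two backward rotations of a cone of \<open>h\<close> bring \<open>h\<close> into third
  place; they return to \<open>X\<close> because the shift is an automorphism, not merely an
  equivalence.\<close>

lemma tri_cone_third: 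
  assumes "arrow h Z (\<Sigma> X)" "X \<in> Obj T" obtains Y f g where "Tri T X Y Z f g h"
proof -
  obtain W u v where w: "Tri T Z (\<Sigma> X) W h u v" using assms(1) by (rule tri_cone')
  have "Tri T (\<Sigma>\<^sub>- (\<Sigma> X)) (\<Sigma>\<^sub>- W) Z (\<boxminus> \<sigma>\<^sub>- u) (\<boxminus> \<sigma>\<^sub>- v) h"
    using tri_unrot[OF tri_unrot[OF w]] .
  thus ?thesis using that assms by simp
qed

text \<open>Rotation moves the missing component to the third place, where the axiom applies, and
  the inverse shift brings it back. The same device serves the middle component below.\<close>

lemma tri_morphism_left:
  assumes t: "Tri T X Y Z f g h" and t': "Tri T X' Y' Z' f' g' h'" 
    and b: "arrow b Y Y'" and c: "arrow c Z Z'" and sq: "c \<bullet> g = g' \<bullet> b"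
  obtains a where "arrow a X X'" "b \<bullet> f = f' \<bullet> a" "\<sigma> a \<bullet> h = h' \<bullet> c"
proof -
  note A = tri_arrow[OF t] tri_arrow[OF t'] b c and O = tri_obj[OF t] tri_obj[OF t']
  obtain a where a: "arrow a (\<Sigma> X) (\<Sigma> X')" "a \<bullet> h = h' \<bullet> c" "\<sigma> b \<bullet> (\<boxminus> \<sigma> f) = (\<boxminus> \<sigma> f') \<bullet> a"
    by (rule tri_morphism'[OF tri_rot[OF t] tri_rot[OF t'] b c sq])
  have "\<boxminus> (\<sigma> b \<bullet> \<sigma> f) = \<boxminus> (\<sigma> f' \<bullet> a)" using a A by (simp add: arrow_iff lin)
  hence "\<sigma> b \<bullet> \<sigma> f = \<sigma> f' \<bullet> a"
    using ng_ng[of "\<sigma> b \<bullet> \<sigma> f"] ng_ng[of "\<sigma> f' \<bullet> a"] a(1) A by (simp add: arrow_iff)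
  hence "\<sigma>\<^sub>- (\<sigma> b \<bullet> \<sigma> f) = \<sigma>\<^sub>- (\<sigma> f' \<bullet> a)" by simp
  hence "b \<bullet> f = f' \<bullet> \<sigma>\<^sub>- a" using a(1) A by (simp add: arrow_iff)
  moreover have "arrow (\<sigma>\<^sub>- a) X X'" "\<sigma> (\<sigma>\<^sub>- a) \<bullet> h = h' \<bullet> c" using a A O by (simp_all add: arrow_iff)
  ultimately show ?thesis using that by blast
qed

lemma tri_morphism_mid:
  assumes t: "Tri T X Y Z f g h" and t': "Tri T X' Y' Z' f' g' h'" 
    and a: "arrow a X X'" and c: "arrow c Z Z'" and sq: "\<sigma> a \<bullet> h = h' \<bullet> c"
  obtains b where "arrow b Y Y'" "b \<bullet> f = f' \<bullet> a" "c \<bullet> g = g' \<bullet> b"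
proof -
  note A = tri_arrow[OF t] tri_arrow[OF t'] a c
  obtain b where b: "arrow b Y Y'" "c \<bullet> g = g' \<bullet> b" "\<sigma> b \<bullet> (\<boxminus> \<sigma> f) = (\<boxminus> \<sigma> f') \<bullet> \<sigma> a"
    by (rule tri_morphism_left[OF tri_rot[OF t] tri_rot[OF t'] c Sh.F_arrow[OF a] sq]) blast
  have "\<boxminus> (\<sigma> (b \<bullet> f)) = \<boxminus> (\<sigma> (f' \<bullet> a))" using b A by (simp add: arrow_iff lin)
  hence "\<sigma> (b \<bullet> f) = \<sigma> (f' \<bullet> a)"
    using ng_ng[of "\<sigma> (b \<bullet> f)"] ng_ng[of "\<sigma> (f' \<bullet> a)"] b(1) A by (simp add: arrow_iff)
  hence "\<sigma>\<^sub>- (\<sigma> (b \<bullet> f)) = \<sigma>\<^sub>- (\<sigma> (f' \<bullet> a))" by simp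
  hence "b \<bullet> f = f' \<bullet> a" using b(1) A by (simp add: arrow_iff)
  thus ?thesis using that b by blast
qed

lemma tri_iso_mid:
  assumes t: "Tri T X Y Z f g h" and t': "Tri T X' Y' Z' f' g' h'"
    and a: "is_iso T X X' a" and c: "is_iso T Z Z' c" and b: "arrow b Y Y'"
    and sq: "b \<bullet> f = f' \<bullet> a" "c \<bullet> g = g' \<bullet> b" "\<sigma> a \<bullet> h = h' \<bullet> c"
  shows "is_iso T Y Y' b"
proof -
  note A = tri_arrow[OF t] tri_arrow[OF t'] is_iso_arrow[OF a] is_iso_arrow[OF c] b
  note O = tri_obj[OF t] tri_obj[OF t']
  have "is_iso T (\<Sigma>\<^sub>- Z) (\<Sigma>\<^sub>- Z') (\<sigma>\<^sub>- c)" by (rule Shi.F_iso[OF c])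
  moreover have "\<sigma>\<^sub>- (\<sigma> a \<bullet> h) = \<sigma>\<^sub>- (h' \<bullet> c)" using sq(3) by simp
  hence "a \<bullet> (\<boxminus> \<sigma>\<^sub>- h) = (\<boxminus> \<sigma>\<^sub>- h') \<bullet> \<sigma>\<^sub>- c" using A by (simp add: arrow_iff lin)
  moreover have "\<sigma> (\<sigma>\<^sub>- c) \<bullet> g = g' \<bullet> b" using sq A by (simp add: arrow_iff)
  ultimately show ?thesis using five_tri[OF tri_unrot[OF t] tri_unrot[OF t'] _ a b _ sq(1)] by blast
qed

end


section \<open>Verdier quotients\<close>

locale thick_subcategory = triangulated k T
  for k :: "('k, 'r) ring_scheme" and T :: "('o, 'm, 'k, 'z) tricat_scheme" +
  fixes U :: "'o set"
  assumes thick: "thick T U"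
begin

lemma U_obj: "X \<in> U \<Longrightarrow> X \<in> Obj T"
  using thick unfolding thick_def by blast

lemma U_iso: "\<lbrakk>X \<in> U; is_iso T X Y f\<rbrakk> \<Longrightarrow> Y \<in> U"
  using thick unfolding thick_def by blast

lemma U_shift: "X \<in> U \<Longrightarrow> \<Sigma> X \<in> U" "X \<in> U \<Longrightarrow> \<Sigma>\<^sub>- X \<in> U"
  using thick unfolding thick_def by blast+

lemma U_cone: "\<lbrakk>Tri T X Y Z f g h; X \<in> U; Y \<in> U\<rbrakk> \<Longrightarrow> Z \<in> U"
  using thick unfolding thick_def by blast

lemma U_first: "\<lbrakk>Tri T X Y Z f g h; Y \<in> U; Z \<in> U\<rbrakk> \<Longrightarrow> X \<in> U"
  using U_cone[OF tri_rot] U_shift(2) tri_obj(1) unshift_shift_obj by metis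

lemma U_mid: "\<lbrakk>Tri T X Y Z f g h; X \<in> U; Z \<in> U\<rbrakk> \<Longrightarrow> Y \<in> U"
  using U_first[OF tri_rot] U_shift(1) by metis

lemma U_zero: obtains Z where "is_zero_obj T Z" "Z \<in> U"
  using thick unfolding thick_def by blast

section \<open>Morphisms with cone in the thick subcategory and the Ore conditions\<close>

definition qs where "qs s \<longleftrightarrow> ar s \<and> (\<exists>Z\<in>U. \<exists>g h. Tri T (src s) (tgt s) Z s g h)"

lemma qs_ar [simp]: "qs s \<Longrightarrow> ar s"
  by (simp add: qs_def)

lemma qsI: "\<lbrakk>Tri T X Y Z s g h; Z \<in> U\<rbrakk> \<Longrightarrow> qs s"
  using tri_arrow(1)[of X Y Z s g h] unfolding qs_def arrow_iff by blast

lemma qsE: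
  assumes "qs s" obtains Z g h where "Z \<in> U" "Tri T (src s) (tgt s) Z s g h"
  using assms unfolding qs_def by blast

lemma qis_iff: "s \<in> qis T U X Y \<longleftrightarrow> arrow s X Y \<and> qs s"
proof
  assume "s \<in> qis T U X Y"
  then obtain Z g h where "Z \<in> U" "Tri T X Y Z s g h" by (auto simp: qis_def)
  thus "arrow s X Y \<and> qs s" using tri_arrow(1) qsI by blast
next
  assume *: "arrow s X Y \<and> qs s"
  then obtain Z g h where "Z \<in> U" "Tri T (src s) (tgt s) Z s g h" using qsE by blast
  moreover have "s \<in> Mor T X Y" using * arrow_Mor by blast
  moreover have "src s = X" "tgt s = Y" using * by (auto simp: arrow_iff)
  ultimately show "s \<in> qis T U X Y" unfolding qis_def by blast
qed

text \<open>Any two cones of \<open>s\<close> are isomorphic by the five lemma and \<open>U\<close>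
  is closed under isomorphism, so the choice of the triangle in \<open>qs\<close> is
  immaterial.\<close>

lemma qs_cone_in:
  assumes "qs s" "Tri T X Y Z s g h" shows "Z \<in> U"
proof -
  have "src s = X" "tgt s = Y" using tri_arrow(1)[OF assms(2)] by (auto simp: arrow_iff)
  then obtain Z' g' h' where Z': "Z' \<in> U" "Tri T X Y Z' s g' h'" using qsE[OF assms(1)] by metis
  note o = tri_obj[OF assms(2)]
  have sq: "idt Y \<bullet> s = s \<bullet> idt X" using tri_arrow(1)[OF assms(2)] by (simp add: arrow_iff)
  obtain c where c: "arrow c Z' Z" "c \<bullet> g' = g \<bullet> idt Y" "\<sigma> (idt X) \<bullet> h' = h \<bullet> c"
    by (rule tri_morphism'[OF Z'(2) assms(2) arrow_ident[OF o(1)] arrow_ident[OF o(2)] sq])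
  have "is_iso T Z' Z c"
    by (rule five_tri[OF Z'(2) assms(2) is_iso_ident[OF o(1)] is_iso_ident[OF o(2)] c(1) sq c(2,3)])
  thus ?thesis using U_iso Z'(1) by blast
qed

lemma qs_iso: assumes "is_iso T X Y s" shows "qs s"
proof -
  obtain Z where z: "is_zero_obj T Z" "Z \<in> U" by (rule U_zero)
  have s: "arrow s X Y" using assms by (rule is_iso_arrow)
  note o = s[unfolded arrow_iff] U_obj[OF z(2)]
  have "Tri T X Y Z s (zr Y Z) (zr Z (\<Sigma> X))"
    by (rule tri_change_iso[OF tri_id is_iso_ident assms is_iso_ident])
      (use z o in \<open>simp_all add: arrow_iff\<close>)
  thus ?thesis using qsI z by blast
qed

lemma qs_ident [simp]: "X \<in> Obj T \<Longrightarrow> qs (idt X)"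
  by (rule qs_iso[OF is_iso_ident])

text \<open>By the octahedral axiom the cones of \<open>s\<close>, of \<open>t \<bullet> s\<close>
  and of \<open>t\<close> form a triangle, so cancellation and composition in \<open>qs\<close>
  become closure properties of \<open>U\<close>.\<close>

lemma qs_oct:
  assumes "ar s" "ar t" "src t = tgt s"
  obtains A B C f g h where "Tri T A C B f g h" "qs s \<longleftrightarrow> A \<in> U" "qs t \<longleftrightarrow> B \<in> U" "qs (t \<bullet> s) \<longleftrightarrow> C \<in> U"
proof -
  obtain A u u' where A: "Tri T (src s) (tgt s) A s u u'" using tri_cone'[OF ar_arrow[OF assms(1)]] by blast
  obtain B v v' where B: "Tri T (tgt s) (tgt t) B t v v'" using tri_cone'[OF ar_arrow[OF assms(2)]] assms(3) by metis
  have "arrow (t \<bullet> s) (src s) (tgt t)" using assms by (simp add: arrow_iff)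
  then obtain C w w' where C: "Tri T (src s) (tgt t) C (t \<bullet> s) w w'" by (rule tri_cone')
  obtain f g where "Tri T A C B f g (\<sigma> u \<bullet> v')" using tri_octahedral[OF A B C] by blast
  thus ?thesis using that qs_cone_in[OF _ A] qs_cone_in[OF _ B] qs_cone_in[OF _ C] qsI[OF A] qsI[OF B] qsI[OF C]
    by blast
qed

lemma qs_cmp [simp]: "\<lbrakk>qs s; qs t; src t = tgt s\<rbrakk> \<Longrightarrow> qs (t \<bullet> s)"
  using qs_oct[of s t] U_mid by (metis qs_ar)

lemma qs_right_factor: "\<lbrakk>qs t; qs (t \<bullet> s); ar s; src t = tgt s\<rbrakk> \<Longrightarrow> qs s"
  using qs_oct[of s t] U_first by (metis qs_ar)

text \<open>If \<open>g\<close> is the map from \<open>tgt f\<close> to the cone \<open>C\<close> of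
  \<open>t\<close>, take for \<open>t'\<close> the cocone of \<open>g \<bullet> f\<close>. It has
  the same cone \<open>C\<close>, and \<open>f \<bullet> t'\<close> lifts along \<open>t\<close>
  because \<open>g\<close> kills it.\<close>

lemma ore:
  assumes "ar f" "qs t" "tgt t = tgt f"
  obtains t' f' where "qs t'" "tgt t' = src f" "ar f'" "src f' = src t'" "tgt f' = src t" "f \<bullet> t' = t \<bullet> f'"
proof -
  obtain C g h where C: "C \<in> U" "Tri T (src t) (tgt f) C t g h" using qsE[OF assms(2)] assms(3) by metis
  note g = tri_arrow[OF C(2), unfolded arrow_iff]
  have "arrow (g \<bullet> f) (src f) C" using g assms by (simp add: arrow_iff)
  then obtain V t' h' where V: "Tri T V (src f) C t' (g \<bullet> f) h'" by (rule tri_cocone)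
  note t' = tri_arrow(1)[OF V, unfolded arrow_iff]
  have "g \<bullet> (f \<bullet> t') = zr V C" using tri_comp_zero12[OF V] g t' assms by simp
  obtain f' where f': "arrow f' V (src t)" "t \<bullet> f' = f \<bullet> t'"
    using tri_lift[OF C(2) _ \<open>g \<bullet> (f \<bullet> t') = zr V C\<close>] arrow_cmp[OF tri_arrow(1)[OF V] ar_arrow[OF assms(1)]] by blast
  thus ?thesis using that[of t' f'] qsI[OF V C(1)] t' by (simp add: arrow_iff)
qed

text \<open>A map killed by \<open>t\<close> factors through the unshifted cone of \<open>t\<close>,
  which lies in \<open>U\<close>; the cocone \<open>u\<close> of the first factor kills the map and
  has its cone in \<open>U\<close>.\<close>

lemma qs_kill:
  assumes "qs t" "ar f" "src t = tgt f" "t \<bullet> f = zr (src f) (tgt t)"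
  obtains u where "qs u" "tgt u = src f" "f \<bullet> u = zr (src u) (tgt f)"
proof -
  obtain C g h where C: "C \<in> U" "Tri T (src t) (tgt t) C t g h" using qsE[OF assms(1)] by metis
  define w where "w = \<boxminus> \<sigma>\<^sub>- h"
  have t: "Tri T (\<Sigma>\<^sub>- C) (tgt f) (tgt t) w t g" using tri_unrot[OF C(2)] assms(3) by (simp add: w_def)
  obtain a where a: "arrow a (src f) (\<Sigma>\<^sub>- C)" "w \<bullet> a = f" 
    using tri_lift[OF t ar_arrow[OF assms(2)] assms(4)] by blast
  obtain V u h' where V: "Tri T V (src f) (\<Sigma>\<^sub>- C) u a h'" using a(1) by (rule tri_cocone)
  note A = tri_arrow[OF V] tri_arrow[OF t]
  have "f \<bullet> u = (w \<bullet> a) \<bullet> u" by (simp only: a(2))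
  also have "\<dots> = w \<bullet> (a \<bullet> u)" using A a(1) by (simp add: arrow_iff)
  also have "\<dots> = zr (src u) (tgt f)" using A tri_comp_zero12[OF V] by (simp add: arrow_iff)
  finally show ?thesis using that[of u] qsI[OF V U_shift(2)[OF C(1)]] A by (simp add: arrow_iff)
qed

lemma qs_cancel:
  assumes "qs t" "ar f" "ar g" "src t = tgt f" "tgt g = tgt f" "src g = src f" "t \<bullet> f = t \<bullet> g"
  obtains u where "qs u" "tgt u = src f" "f \<bullet> u = g \<bullet> u"
proof -
  have "t \<bullet> (f \<boxplus> \<boxminus> g) = zr (src f) (tgt t)" using assms by (simp add: lin)
  then obtain u where u: "qs u" "tgt u = src f" "(f \<boxplus> \<boxminus> g) \<bullet> u = zr (src u) (tgt f)"
    using qs_kill[OF assms(1), of "f \<boxplus> \<boxminus> g"] assms by auto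
  hence "f \<bullet> u \<boxplus> \<boxminus> (g \<bullet> u) = zr (src u) (tgt f)" using assms by (simp add: lin)
  hence "f \<bullet> u = g \<bullet> u" using sub_zero[of "f \<bullet> u" "src u" "tgt f" "g \<bullet> u"] assms u(1,2) by (simp add: arrow_iff)
  thus ?thesis using that u by blast
qed

section \<open>Equivalence of roofs\<close>

abbreviation roof where "roof s f \<equiv> qs s \<and> ar f \<and> src f = src s"

lemma roofs_iff:
  "\<lbrakk>X \<in> Obj T; Y \<in> Obj T\<rbrakk> \<Longrightarrow> (s, f) \<in> roofs T U X Y \<longleftrightarrow> roof s f \<and> tgt s = X \<and> tgt f = Y"
  unfolding roofs_def qis_iff by (auto simp: arrow_iff Mor_arrow)

lemma roof_relD:
  assumes "((s, f), (t, g)) \<in> roof_rel T U X Y" "X \<in> Obj T" "Y \<in> Obj T"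
  obtains u v where "roof s f" "roof t g" "tgt s = X" "tgt t = X" "tgt f = Y" "tgt g = Y"
    "ar u" "ar v" "src v = src u" "tgt u = src s" "tgt v = src t" "s \<bullet> u = t \<bullet> v" "qs (s \<bullet> u)" "f \<bullet> u = g \<bullet> v"
proof -
  obtain V W W' u v where "V \<in> Obj T" "W \<in> Obj T" "W' \<in> Obj T" "u \<in> Mor T V W" "v \<in> Mor T V W'"
    and *: "s \<in> qis T U W X" "f \<in> Mor T W Y" "t \<in> qis T U W' X" "g \<in> Mor T W' Y"
    "s \<bullet> u = t \<bullet> v" "s \<bullet> u \<in> qis T U V X" "f \<bullet> u = g \<bullet> v"
    using assms(1) unfolding roof_rel_def by auto
  hence "arrow u V W" "arrow v V W'" "arrow f W Y" "arrow g W' Y" "arrow s W X" "qs s" "arrow t W' X" "qs t"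
    "qs (s \<bullet> u)" using assms(2,3) by (simp_all add: Mor_arrow qis_iff)
  thus ?thesis using * by (intro that[of u v]) (simp_all add: arrow_iff)
qed

lemma roof_relI:
  assumes "roof s f" "roof t g" "tgt s = X" "tgt t = X" "tgt f = Y" "tgt g = Y"
    "ar u" "ar v" "src v = src u" "tgt u = src s" "tgt v = src t" "s \<bullet> u = t \<bullet> v" "qs (s \<bullet> u)" "f \<bullet> u = g \<bullet> v"
  shows "((s, f), (t, g)) \<in> roof_rel T U X Y"
proof -
  have "src u \<in> Obj T" "src s \<in> Obj T" "src t \<in> Obj T" "u \<in> Mor T (src u) (src s)" "v \<in> Mor T (src u) (src t)"
    "s \<in> qis T U (src s) X" "f \<in> Mor T (src s) Y" "t \<in> qis T U (src t) X" "g \<in> Mor T (src t) Y"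
    "s \<bullet> u \<in> qis T U (src u) X" using assms ar_obj[OF assms(7)] ar_obj(2)[of s] ar_obj(2)[of f]
    by (simp_all add: qis_iff arrow_iff Mor_arrow)
  thus ?thesis unfolding roof_rel_def using assms by blast
qed

text \<open>Equivalence of roofs provides one witness \<open>u\<close>, \<open>v\<close>, whereas
  the conclusion concerns a given commuting pair \<open>p\<close>, \<open>q\<close>. An Ore square
  compares \<open>s \<bullet> p\<close> with \<open>s \<bullet> u\<close>; cancelling
  \<open>s\<close> and then \<open>t\<close>, each after a further restriction, makes both legs
  agree. Well-definedness of all operations rests on this.\<close>

lemma roof_rel_equalize:
  assumes r: "((s, f), (t, g)) \<in> roof_rel T U X Y" "X \<in> Obj T" "Y \<in> Obj T"
    and p: "ar p" "ar q" "tgt p = src s" "tgt q = src t" "src q = src p" "s \<bullet> p = t \<bullet> q"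
  obtains w where "qs w" "tgt w = src p" "f \<bullet> (p \<bullet> w) = g \<bullet> (q \<bullet> w)"
proof -
  obtain u v where R: "roof s f" "roof t g" "tgt s = X" "tgt t = X" "tgt f = Y" "tgt g = Y"
    "ar u" "ar v" "src v = src u" "tgt u = src s" "tgt v = src t" "s \<bullet> u = t \<bullet> v" "qs (s \<bullet> u)" "f \<bullet> u = g \<bullet> v"
    using r by (rule roof_relD)
  note R' = R(1-11,13) and P = p(1-5)
  obtain z y where z: "qs z" "tgt z = src p" "ar y" "src y = src z" "tgt y = src u"
    and ez: "(s \<bullet> p) \<bullet> z = (s \<bullet> u) \<bullet> y" using R' P ore[of "s \<bullet> p" "s \<bullet> u"] by auto
  have "s \<bullet> (p \<bullet> z) = s \<bullet> (u \<bullet> y)" using ez z R' P by simp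
  then obtain z' where z': "qs z'" "tgt z' = src z" and ez': "(p \<bullet> z) \<bullet> z' = (u \<bullet> y) \<bullet> z'"
    using qs_cancel[of s "p \<bullet> z" "u \<bullet> y"] z R' P by auto
  have "t \<bullet> ((q \<bullet> z) \<bullet> z') = (s \<bullet> p) \<bullet> (z \<bullet> z')" using z z' R' P unfolding p(6) by simp
  also have "\<dots> = s \<bullet> ((p \<bullet> z) \<bullet> z')" using z z' R' P by simp
  also have "\<dots> = (s \<bullet> u) \<bullet> (y \<bullet> z')" unfolding ez' using z z' R' P by simp
  also have "\<dots> = t \<bullet> ((v \<bullet> y) \<bullet> z')" unfolding R(12) using z z' R' P by simp
  finally obtain z2 where z2: "qs z2" "tgt z2 = src z'" and ez2: "((q \<bullet> z) \<bullet> z') \<bullet> z2 = ((v \<bullet> y) \<bullet> z') \<bullet> z2"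
    using qs_cancel[of t "(q \<bullet> z) \<bullet> z'" "(v \<bullet> y) \<bullet> z'"] z z' R' P by auto
  have "f \<bullet> (p \<bullet> (z \<bullet> (z' \<bullet> z2))) = f \<bullet> (((p \<bullet> z) \<bullet> z') \<bullet> z2)" using z z' z2 R' P by simp
  also have "\<dots> = (f \<bullet> u) \<bullet> (y \<bullet> (z' \<bullet> z2))" unfolding ez' using z z' z2 R' P by simp
  also have "\<dots> = g \<bullet> (((v \<bullet> y) \<bullet> z') \<bullet> z2)" unfolding R(14) using z z' z2 R' P by simp
  also have "\<dots> = g \<bullet> (q \<bullet> (z \<bullet> (z' \<bullet> z2)))" unfolding ez2[symmetric] using z z' z2 R' P by simp
  finally show ?thesis using that[of "z \<bullet> (z' \<bullet> z2)"] z z' z2 R' P by simp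
qed

lemma roof_rel_refl: "roof s f \<Longrightarrow> ((s, f), (s, f)) \<in> roof_rel T U (tgt s) (tgt f)"
  by (rule roof_relI[where u = "idt (src s)" and v = "idt (src s)"]) simp_all

lemma roof_rel_sym:
  assumes "((s, f), (t, g)) \<in> roof_rel T U X Y" "X \<in> Obj T" "Y \<in> Obj T"
  shows "((t, g), (s, f)) \<in> roof_rel T U X Y"
  using assms by (rule roof_relD) (rule roof_relI; (assumption | (rule sym, assumption) | simp))

text \<open>Over a common refinement of all three denominators, the numerators \<open>f\<close>,
  \<open>g\<close> and then \<open>g\<close>, \<open>h\<close> are equalised by successive
  restrictions.\<close>

lemma roof_rel_trans:
  assumes 1: "((s, f), (t, g)) \<in> roof_rel T U X Y" and 2: "((t, g), (r, h)) \<in> roof_rel T U X Y"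
    and XY: "X \<in> Obj T" "Y \<in> Obj T"
  shows "((s, f), (r, h)) \<in> roof_rel T U X Y"
proof -
  have R: "roof s f" "roof t g" "tgt s = X" "tgt t = X" "tgt f = Y" "tgt g = Y"
    using roof_relD[OF 1 XY] by blast+
  have R': "roof r h" "tgt r = X" "tgt h = Y"
    using roof_relD[OF 2 XY] by blast+
  obtain p q where p: "qs p" "tgt p = src s" "ar q" "src q = src p" "tgt q = src r"
    and ep: "s \<bullet> p = r \<bullet> q" using ore[of s r] R R' by auto
  obtain x y where x: "qs x" "tgt x = src p" "ar y" "src y = src x" "tgt y = src t"
    and ex: "(s \<bullet> p) \<bullet> x = t \<bullet> y" using ore[of "s \<bullet> p" t] R p by auto
  have e1: "s \<bullet> (p \<bullet> x) = t \<bullet> y" using ex x p R by simp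
  obtain w where w: "qs w" "tgt w = src x" and ew: "f \<bullet> ((p \<bullet> x) \<bullet> w) = g \<bullet> (y \<bullet> w)"
    using roof_rel_equalize[OF 1 XY _ _ _ _ _ e1] x p R by auto
  have "t \<bullet> (y \<bullet> w) = (s \<bullet> p) \<bullet> (x \<bullet> w)" using x p R w by (simp add: cmp_rew[OF e1[symmetric]])
  also have "\<dots> = r \<bullet> (q \<bullet> (x \<bullet> w))" unfolding ep using x p R R' w by simp
  finally have e2: "t \<bullet> (y \<bullet> w) = r \<bullet> (q \<bullet> (x \<bullet> w))" .
  obtain w' where w': "qs w'" "tgt w' = src w" and ew': "g \<bullet> ((y \<bullet> w) \<bullet> w') = h \<bullet> ((q \<bullet> (x \<bullet> w)) \<bullet> w')"
    using roof_rel_equalize[OF 2 XY _ _ _ _ _ e2] x p R R' w by auto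
  show ?thesis
  proof (rule roof_relI[OF R(1) R'(1) R(3) R'(2) R(5) R'(3), where u = "p \<bullet> (x \<bullet> (w \<bullet> w'))" and v = "q \<bullet> (x \<bullet> (w \<bullet> w'))"])
    have "f \<bullet> (p \<bullet> (x \<bullet> (w \<bullet> w'))) = (f \<bullet> ((p \<bullet> x) \<bullet> w)) \<bullet> w'" using x p R w w' by simp
    also have "\<dots> = g \<bullet> ((y \<bullet> w) \<bullet> w')" unfolding ew using x p R w w' by simp
    also have "\<dots> = h \<bullet> (q \<bullet> (x \<bullet> (w \<bullet> w')))" unfolding ew' using x p R R' w w' by simp
    finally show "f \<bullet> (p \<bullet> (x \<bullet> (w \<bullet> w'))) = h \<bullet> (q \<bullet> (x \<bullet> (w \<bullet> w')))" .
    have "s \<bullet> (p \<bullet> (x \<bullet> (w \<bullet> w'))) = (s \<bullet> p) \<bullet> (x \<bullet> (w \<bullet> w'))" using x p R w w' by simp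
    thus "s \<bullet> (p \<bullet> (x \<bullet> (w \<bullet> w'))) = r \<bullet> (q \<bullet> (x \<bullet> (w \<bullet> w')))"
      unfolding ep using x p R R' w w' by simp
  qed (use x p R R' w w' in simp_all)
qed

definition fr where "fr s f = roof_class T U (tgt s) (tgt f) s f"

lemma fr_eq_iff:
  assumes "roof s f" "roof t g" "tgt t = tgt s" "tgt g = tgt f"
  shows "fr s f = fr t g \<longleftrightarrow> ((s, f), (t, g)) \<in> roof_rel T U (tgt s) (tgt f)"
proof -
  have o: "tgt s \<in> Obj T" "tgt f \<in> Obj T" using assms by simp_all
  have r: "((t, g), (t, g)) \<in> roof_rel T U (tgt s) (tgt f)" using roof_rel_refl[OF assms(2)] assms by simp
  show ?thesis
  proof
    assume "fr s f = fr t g"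
    hence "(t, g) \<in> fr s f" using r assms by (simp add: fr_def roof_class_def)
    thus "((s, f), (t, g)) \<in> roof_rel T U (tgt s) (tgt f)" by (simp add: fr_def roof_class_def)
  next
    assume *: "((s, f), (t, g)) \<in> roof_rel T U (tgt s) (tgt f)"
    have "x \<in> fr s f \<longleftrightarrow> x \<in> fr t g" for x
      using roof_rel_trans[OF * _ o] roof_rel_trans[OF roof_rel_sym[OF * o] _ o] assms
      by (cases x) (auto simp: fr_def roof_class_def)
    thus "fr s f = fr t g" by blast
  qed
qed

lemma fr_eqI:
  assumes "roof s f" "roof t g" "tgt t = tgt s" "tgt g = tgt f"
    "ar u" "ar v" "src v = src u" "tgt u = src s" "tgt v = src t" "s \<bullet> u = t \<bullet> v" "qs (s \<bullet> u)" "f \<bullet> u = g \<bullet> v"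
  shows "fr s f = fr t g"
  using fr_eq_iff[OF assms(1-4)] roof_relI[OF assms(1,2)] assms(3-) by simp

lemma fr_equalize:
  assumes "fr s f = fr t g" "roof s f" "roof t g" "tgt t = tgt s" "tgt g = tgt f"
    and p: "ar p" "ar q" "tgt p = src s" "tgt q = src t" "src q = src p" "s \<bullet> p = t \<bullet> q"
  obtains w where "qs w" "tgt w = src p" "f \<bullet> (p \<bullet> w) = g \<bullet> (q \<bullet> w)"
proof -
  have "((s, f), (t, g)) \<in> roof_rel T U (tgt s) (tgt f)" using fr_eq_iff assms by blast
  thus ?thesis using roof_rel_equalize[OF _ _ _ p, of f g "tgt s" "tgt f"] that assms by auto
qed

lemma fr_refine:
  assumes "roof s f" "qs u" "tgt u = src s"
  shows "fr (s \<bullet> u) (f \<bullet> u) = fr s f" "roof (s \<bullet> u) (f \<bullet> u)"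
proof -
  show r: "roof (s \<bullet> u) (f \<bullet> u)" using assms by simp
  show "fr (s \<bullet> u) (f \<bullet> u) = fr s f"
    by (rule fr_eqI[OF r assms(1), where u = "idt (src u)" and v = u]) (use assms in simp_all)
qed

lemma fr_mem: "x \<in> fr s f \<Longrightarrow> roof s f \<Longrightarrow>
   \<exists>t g. x = (t, g) \<and> roof t g \<and> tgt t = tgt s \<and> tgt g = tgt f \<and> fr t g = fr s f"
proof (cases x)
  case (Pair t g)
  assume "x \<in> fr s f" and r: "roof s f"
  hence *: "((s, f), (t, g)) \<in> roof_rel T U (tgt s) (tgt f)" using Pair by (simp add: fr_def roof_class_def)
  have o: "tgt s \<in> Obj T" "tgt f \<in> Obj T" using r by simp_all
  have "roof t g" "tgt t = tgt s" "tgt g = tgt f" using roof_relD[OF * o] by blast+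
  thus ?thesis using Pair fr_eq_iff[OF r] * by auto
qed

lemma fr_self: "roof s f \<Longrightarrow> (s, f) \<in> fr s f"
  using roof_rel_refl by (simp add: fr_def roof_class_def)

text \<open>The last clause keeps the refining morphism. A further numerator over \<open>s\<close>
  can then be moved to the new denominator as well, which is how three roofs are treated at
  once.\<close>

lemma common_denominator2:
  assumes "roof s f" "roof t g" "tgt t = tgt s"
  obtains r f' g' where "roof r f'" "roof r g'" "tgt r = tgt s" "tgt f' = tgt f" "tgt g' = tgt g"
    "fr s f = fr r f'" "fr t g = fr r g'" "\<exists>u. qs u \<and> tgt u = src s \<and> r = s \<bullet> u \<and> f' = f \<bullet> u"
proof -
  obtain p q where p: "qs p" "tgt p = src s" "ar q" "src q = src p" "tgt q = src t"
    and ep: "s \<bullet> p = t \<bullet> q" using ore[of s t] assms by auto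
  have "qs (t \<bullet> q)" using p(1,2) assms unfolding ep[symmetric] by simp
  hence q: "qs q" using qs_right_factor[of t q] p assms by simp
  show ?thesis
    by (rule that[of "s \<bullet> p" "f \<bullet> p" "g \<bullet> q"])
      (use assms p q fr_refine[OF assms(1) p(1,2)] fr_refine[OF assms(2) q p(5), folded ep] in auto)
qed

end


section \<open>Arithmetic of fractions\<close>

context thick_subcategory
begin

text \<open>The second equalisation starts from the restriction produced by the first, so that a
  single refinement serves both pairs of numerators.\<close>

lemma fr_add_cong:
  assumes e: "fr s f = fr s' f'" "fr s g = fr s' g'"
    and r: "roof s f" "roof s' f'" "roof s g" "roof s' g'" "tgt s' = tgt s" "tgt f' = tgt f" "tgt g = tgt f" "tgt g' = tgt f"
  shows "fr s (f \<boxplus> g) = fr s' (f' \<boxplus> g')"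
proof -
  obtain p q where p: "qs p" "tgt p = src s" "ar q" "src q = src p" "tgt q = src s'"
    and ep: "s \<bullet> p = s' \<bullet> q" using ore[of s s'] r by auto
  obtain w where w: "qs w" "tgt w = src p" and ew: "f \<bullet> (p \<bullet> w) = f' \<bullet> (q \<bullet> w)"
    using fr_equalize[OF e(1) _ _ _ _ _ _ _ _ _ ep] r p by auto
  have "s \<bullet> (p \<bullet> w) = (s \<bullet> p) \<bullet> w" using r p w by simp
  hence e2: "s \<bullet> (p \<bullet> w) = s' \<bullet> (q \<bullet> w)" unfolding ep using r p w by simp
  obtain w' where w': "qs w'" "tgt w' = src w" and ew': "g \<bullet> ((p \<bullet> w) \<bullet> w') = g' \<bullet> ((q \<bullet> w) \<bullet> w')"
    using fr_equalize[OF e(2) _ _ _ _ _ _ _ _ _ e2] r p w by auto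
  show ?thesis
  proof (rule fr_eqI[where u = "p \<bullet> (w \<bullet> w')" and v = "q \<bullet> (w \<bullet> w')"])
    have "s \<bullet> (p \<bullet> (w \<bullet> w')) = (s \<bullet> (p \<bullet> w)) \<bullet> w'" using r p w w' by simp
    thus "s \<bullet> (p \<bullet> (w \<bullet> w')) = s' \<bullet> (q \<bullet> (w \<bullet> w'))" unfolding e2 using r p w w' by simp
    have "f \<bullet> (p \<bullet> (w \<bullet> w')) = (f \<bullet> (p \<bullet> w)) \<bullet> w'" using r p w w' by simp
    hence "f \<bullet> (p \<bullet> (w \<bullet> w')) = f' \<bullet> (q \<bullet> (w \<bullet> w'))" unfolding ew using r p w w' by simp
    moreover have "g \<bullet> (p \<bullet> (w \<bullet> w')) = g' \<bullet> (q \<bullet> (w \<bullet> w'))" using ew' r p w w' by simp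
    ultimately show "(f \<boxplus> g) \<bullet> (p \<bullet> (w \<bullet> w')) = (f' \<boxplus> g') \<bullet> (q \<bullet> (w \<bullet> w'))" using r p w w' by (simp add: cmp_pl)
  qed (use r p w w' in simp_all)
qed

lemma fr_sm_cong:
  assumes e: "fr s f = fr s' f'" and c: "c \<in> carrier k"
    and r: "roof s f" "roof s' f'" "tgt s' = tgt s" "tgt f' = tgt f"
  shows "fr s (c \<triangleright> f) = fr s' (c \<triangleright> f')"
proof -
  obtain p q where p: "qs p" "tgt p = src s" "ar q" "src q = src p" "tgt q = src s'"
    and ep: "s \<bullet> p = s' \<bullet> q" using ore[of s s'] r by auto
  obtain w where w: "qs w" "tgt w = src p" and ew: "f \<bullet> (p \<bullet> w) = f' \<bullet> (q \<bullet> w)"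
    using fr_equalize[OF e(1) _ _ _ _ _ _ _ _ _ ep] r p by auto
  have "s \<bullet> (p \<bullet> w) = (s \<bullet> p) \<bullet> w" using r p w by simp
  hence e2: "s \<bullet> (p \<bullet> w) = s' \<bullet> (q \<bullet> w)" unfolding ep using r p w by simp
  show ?thesis
  proof (rule fr_eqI[where u = "p \<bullet> w" and v = "q \<bullet> w"])
    show "(c \<triangleright> f) \<bullet> (p \<bullet> w) = (c \<triangleright> f') \<bullet> (q \<bullet> w)" using r p w c by (simp add: cmp_sm ew)
    show "qs (s \<bullet> (p \<bullet> w))" using r p w by simp
  qed (use r p w c e2 in simp_all)
qed

text \<open>Independence of the representatives and of the completed squares in one statement.
  Equalising \<open>f\<close> and \<open>f1\<close> makes the composites through \<open>t\<close>
  and \<open>t1\<close> agree, and this is the input needed to equalise \<open>g\<close> and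
  \<open>g1\<close>.\<close>

lemma fr_cmp_cong:
  assumes e: "fr s f = fr s1 f1" "fr t g = fr t1 g1"
    and r: "roof s f" "roof s1 f1" "roof t g" "roof t1 g1"
      "tgt s1 = tgt s" "tgt f1 = tgt f" "tgt t = tgt f" "tgt t1 = tgt t" "tgt g1 = tgt g"
    and t: "roof t' f'" "tgt t' = src s" "tgt f' = src t" and sq: "f \<bullet> t' = t \<bullet> f'"
    and t1: "roof t1' f1'" "tgt t1' = src s1" "tgt f1' = src t1" and sq1: "f1 \<bullet> t1' = t1 \<bullet> f1'"
  shows "fr (s \<bullet> t') (g \<bullet> f') = fr (s1 \<bullet> t1') (g1 \<bullet> f1')"
proof -
  obtain x y where x: "qs x" "tgt x = src t'" "ar y" "src y = src x" "tgt y = src t1'"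
    and ex: "(s \<bullet> t') \<bullet> x = (s1 \<bullet> t1') \<bullet> y" using ore[of "s \<bullet> t'" "s1 \<bullet> t1'"] r t t1 by auto
  have e1: "s \<bullet> (t' \<bullet> x) = s1 \<bullet> (t1' \<bullet> y)" using ex r t t1 x by simp
  obtain w where w: "qs w" "tgt w = src x" and ew: "f \<bullet> ((t' \<bullet> x) \<bullet> w) = f1 \<bullet> ((t1' \<bullet> y) \<bullet> w)"
    using fr_equalize[OF e(1) _ _ _ _ _ _ _ _ _ e1] r t t1 x by auto
  have "t \<bullet> (f' \<bullet> (x \<bullet> w)) = (f \<bullet> t') \<bullet> (x \<bullet> w)" unfolding sq using r t t1 x w by simp
  also have "\<dots> = f1 \<bullet> ((t1' \<bullet> y) \<bullet> w)" unfolding ew[symmetric] using r t t1 x w by simp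
  also have "\<dots> = (f1 \<bullet> t1') \<bullet> (y \<bullet> w)" using r t t1 x w by simp
  also have "\<dots> = t1 \<bullet> (f1' \<bullet> (y \<bullet> w))" unfolding sq1 using r t t1 x w by simp
  finally have e2: "t \<bullet> (f' \<bullet> (x \<bullet> w)) = t1 \<bullet> (f1' \<bullet> (y \<bullet> w))" .
  obtain w' where w': "qs w'" "tgt w' = src w"
    and ew': "g \<bullet> ((f' \<bullet> (x \<bullet> w)) \<bullet> w') = g1 \<bullet> ((f1' \<bullet> (y \<bullet> w)) \<bullet> w')"
    using fr_equalize[OF e(2) _ _ _ _ _ _ _ _ _ e2] r t t1 x w by auto
  show ?thesis
  proof (rule fr_eqI[where u = "x \<bullet> (w \<bullet> w')" and v = "y \<bullet> (w \<bullet> w')"])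
    have "(s \<bullet> t') \<bullet> (x \<bullet> (w \<bullet> w')) = ((s \<bullet> t') \<bullet> x) \<bullet> (w \<bullet> w')" using r t t1 x w w' by simp
    thus "(s \<bullet> t') \<bullet> (x \<bullet> (w \<bullet> w')) = (s1 \<bullet> t1') \<bullet> (y \<bullet> (w \<bullet> w'))"
      unfolding ex using r t t1 x w w' by simp
    show "(g \<bullet> f') \<bullet> (x \<bullet> (w \<bullet> w')) = (g1 \<bullet> f1') \<bullet> (y \<bullet> (w \<bullet> w'))" using ew' r t t1 x w w' by simp
  qed (use r t t1 x w w' in simp_all)
qed

abbreviation VQ ("\<Q>") where "\<Q> \<equiv> verdier_quotient T U"

lemma VQ_simps: "Hom \<Q> = verdier_hom T U" "cmp \<Q> = verdier_cmp T U"
    "Sh \<Q> = verdier_induced T U (Sh T)" "Shi \<Q> = verdier_induced T U (Shi T)"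
  by (simp_all add: verdier_quotient_def verdier_lincat_def lincat.defs)

lemma VQ_Obj [simp]: "Obj \<Q> = Obj T"
  by (simp add: verdier_quotient_def verdier_lincat_def lincat.defs)

lemma VQ_ident: "X \<in> Obj T \<Longrightarrow> ident \<Q> X = fr (idt X) (idt X)"
  by (simp add: verdier_quotient_def verdier_lincat_def lincat.defs fr_def)

lemma vhom_carrier:
  assumes "X \<in> Obj T" "Y \<in> Obj T"
  shows "a \<in> carrier (verdier_hom T U X Y) \<longleftrightarrow> (\<exists>s f. roof s f \<and> tgt s = X \<and> tgt f = Y \<and> a = fr s f)"
proof -
  have "a \<in> carrier (verdier_hom T U X Y) \<longleftrightarrow> (\<exists>s f. (s, f) \<in> roofs T U X Y \<and> a = roof_rel T U X Y `` {(s, f)})"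
    by (auto simp: verdier_hom_def quotient_def)
  also have "\<dots> \<longleftrightarrow> (\<exists>s f. (s, f) \<in> roofs T U X Y \<and> a = fr s f)"
    using roofs_iff[OF assms] unfolding fr_def roof_class_def by metis
  finally show ?thesis using roofs_iff[OF assms] by auto
qed

lemma vhomE:
  assumes "a \<in> carrier (verdier_hom T U X Y)" "X \<in> Obj T" "Y \<in> Obj T"
  obtains s f where "roof s f" "tgt s = X" "tgt f = Y" "a = fr s f"
  using assms vhom_carrier by blast

lemma fr_in: "roof s f \<Longrightarrow> fr s f \<in> carrier (verdier_hom T U (tgt s) (tgt f))"
  using vhom_carrier[of "tgt s" "tgt f"] by auto

lemma fr_zero:
  assumes "qs s" "Y \<in> Obj T" "tgt s = X" shows "fr s (zr (src s) Y) = \<zero>\<^bsub>verdier_hom T U X Y\<^esub>"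
proof -
  have "\<zero>\<^bsub>verdier_hom T U X Y\<^esub> = fr (idt X) (zr X Y)" using assms by (auto simp: verdier_hom_def fr_def)
  also have "\<dots> = fr (idt X \<bullet> s) (zr X Y \<bullet> s)"
    by (rule fr_refine(1)[symmetric]) (use assms in auto)
  also have "\<dots> = fr s (zr (src s) Y)" using assms by auto
  finally show ?thesis by simp
qed

text \<open>The sum is defined as a union over all pairs of representatives with a common
  denominator. By the congruence lemma all members of the union coincide, and the given pair shows
  that the union is not empty. Scalar multiples and composites are handled in the same way.\<close>

lemma fr_add:
  assumes r: "roof s f" "roof s g" "tgt s = X" "tgt f = Y" "tgt g = Y"
  shows "fr s f \<oplus>\<^bsub>verdier_hom T U X Y\<^esub> fr s g = fr s (f \<boxplus> g)"
proof -
  have *: "roof_class T U X Y s' (f' \<oplus>\<^bsub>Hom T W Y\<^esub> g') = fr s (f \<boxplus> g)"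
    if "W \<in> Obj T" "f' \<in> Mor T W Y" "g' \<in> Mor T W Y" "(s', f') \<in> fr s f" "(s', g') \<in> fr s g"
    for W s' f' g'
  proof -
    have F: "roof s' f'" "tgt s' = X" "tgt f' = Y" "fr s' f' = fr s f" using fr_mem[OF that(4) r(1)] r by auto
    have G: "roof s' g'" "tgt g' = Y" "fr s' g' = fr s g" using fr_mem[OF that(5) r(2)] r by auto
    have "arrow f' W Y" using that(1,2) r ar_obj(2)[of f] by (simp add: Mor_arrow)
    hence "f' \<oplus>\<^bsub>Hom T W Y\<^esub> g' = f' \<boxplus> g'" by (rule pl_eq)
    moreover have "fr s (f \<boxplus> g) = fr s' (f' \<boxplus> g')"
      by (rule fr_add_cong) (use F G r in simp_all)
    ultimately show ?thesis using F G by (simp add: fr_def)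
  qed
  have o: "src s \<in> Obj T" "f \<in> Mor T (src s) Y" "g \<in> Mor T (src s) Y"
    using r ar_arrow[of f] ar_arrow[of g] arrow_Mor by auto
  have "fr s f \<oplus>\<^bsub>verdier_hom T U X Y\<^esub> fr s g = {r. \<exists>W\<in>Obj T. \<exists>s' f' g'. f' \<in> Mor T W Y \<and> g' \<in> Mor T W Y \<and>
     (s', f') \<in> fr s f \<and> (s', g') \<in> fr s g \<and> r \<in> roof_class T U X Y s' (f' \<oplus>\<^bsub>Hom T W Y\<^esub> g')}"
    by (simp add: verdier_hom_def)
  also have "\<dots> = fr s (f \<boxplus> g)"
  proof (intro equalityI subsetI)
    fix x assume "x \<in> fr s (f \<boxplus> g)"
    thus "x \<in> {r. \<exists>W\<in>Obj T. \<exists>s' f' g'. f' \<in> Mor T W Y \<and> g' \<in> Mor T W Y \<and>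
     (s', f') \<in> fr s f \<and> (s', g') \<in> fr s g \<and> r \<in> roof_class T U X Y s' (f' \<oplus>\<^bsub>Hom T W Y\<^esub> g')}"
      using o fr_self[OF r(1)] fr_self[OF r(2)] *[OF o fr_self[OF r(1)] fr_self[OF r(2)]] by blast
  next
    fix x assume "x \<in> {r. \<exists>W\<in>Obj T. \<exists>s' f' g'. f' \<in> Mor T W Y \<and> g' \<in> Mor T W Y \<and>
     (s', f') \<in> fr s f \<and> (s', g') \<in> fr s g \<and> r \<in> roof_class T U X Y s' (f' \<oplus>\<^bsub>Hom T W Y\<^esub> g')}"
    thus "x \<in> fr s (f \<boxplus> g)" unfolding mem_Collect_eq by (elim bexE exE conjE) (simp only: *)
  qed
  finally show ?thesis .
qed

lemma fr_smult:
  assumes c: "c \<in> carrier k" and r: "roof s f" "tgt s = X" "tgt f = Y"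
  shows "c \<odot>\<^bsub>verdier_hom T U X Y\<^esub> fr s f = fr s (c \<triangleright> f)"
proof -
  have *: "roof_class T U X Y s' (c \<odot>\<^bsub>Hom T W Y\<^esub> f') = fr s (c \<triangleright> f)"
    if "W \<in> Obj T" "f' \<in> Mor T W Y" "(s', f') \<in> fr s f" for W s' f'
  proof -
    have F: "roof s' f'" "tgt s' = X" "tgt f' = Y" "fr s' f' = fr s f" using fr_mem[OF that(3) r(1)] r by auto
    have "arrow f' W Y" using that(1,2) r ar_obj(2)[of f] by (simp add: Mor_arrow)
    hence "c \<odot>\<^bsub>Hom T W Y\<^esub> f' = c \<triangleright> f'" by (rule sm_eq)
    moreover have "fr s (c \<triangleright> f) = fr s' (c \<triangleright> f')"
      by (rule fr_sm_cong[OF _ c]) (use F r in simp_all)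
    ultimately show ?thesis using F c by (simp add: fr_def)
  qed
  have o: "src s \<in> Obj T" "f \<in> Mor T (src s) Y" using r ar_arrow[of f] arrow_Mor by auto
  have "c \<odot>\<^bsub>verdier_hom T U X Y\<^esub> fr s f = {r. \<exists>W\<in>Obj T. \<exists>s' f'. f' \<in> Mor T W Y \<and>
     (s', f') \<in> fr s f \<and> r \<in> roof_class T U X Y s' (c \<odot>\<^bsub>Hom T W Y\<^esub> f')}"
    by (simp add: verdier_hom_def)
  also have "\<dots> = fr s (c \<triangleright> f)"
  proof (intro equalityI subsetI)
    fix x assume "x \<in> fr s (c \<triangleright> f)"
    thus "x \<in> {r. \<exists>W\<in>Obj T. \<exists>s' f'. f' \<in> Mor T W Y \<and>
     (s', f') \<in> fr s f \<and> r \<in> roof_class T U X Y s' (c \<odot>\<^bsub>Hom T W Y\<^esub> f')}"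
      using o fr_self[OF r(1)] *[OF o fr_self[OF r(1)]] by blast
  next
    fix x assume "x \<in> {r. \<exists>W\<in>Obj T. \<exists>s' f'. f' \<in> Mor T W Y \<and>
     (s', f') \<in> fr s f \<and> r \<in> roof_class T U X Y s' (c \<odot>\<^bsub>Hom T W Y\<^esub> f')}"
    thus "x \<in> fr s (c \<triangleright> f)" unfolding mem_Collect_eq by (elim bexE exE conjE) (simp only: *)
  qed
  finally show ?thesis .
qed

lemma fr_cmp:
  assumes r: "roof s f" "roof t g" "tgt t = tgt f"
    and t: "roof t' f'" "tgt t' = src s" "tgt f' = src t" and sq: "f \<bullet> t' = t \<bullet> f'"
  shows "verdier_cmp T U (fr t g) (fr s f) = fr (s \<bullet> t') (g \<bullet> f')"
proof -
  have *: "roof_class T U X Z (s1 \<bullet> t1') (g1 \<bullet> f1') = fr (s \<bullet> t') (g \<bullet> f')"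
    if "X \<in> Obj T" "Y \<in> Obj T" "Z \<in> Obj T" "W \<in> Obj T" "W' \<in> Obj T" "V \<in> Obj T"
      "(s1, f1) \<in> fr s f" "(t1, g1) \<in> fr t g"
      "s1 \<in> qis T U W X" "f1 \<in> Mor T W Y" "t1 \<in> qis T U W' Y" "g1 \<in> Mor T W' Z"
      "t1' \<in> qis T U V W" "f1' \<in> Mor T V W'" "f1 \<bullet> t1' = t1 \<bullet> f1'" for X Y Z W W' V s1 f1 t1 g1 t1' f1'
  proof -
    have F: "roof s1 f1" "tgt s1 = tgt s" "tgt f1 = tgt f" "fr s1 f1 = fr s f"
      using fr_mem[OF that(7) r(1)] by auto
    have G: "roof t1 g1" "tgt t1 = tgt t" "tgt g1 = tgt g" "fr t1 g1 = fr t g"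
      using fr_mem[OF that(8) r(2)] by auto
    have A: "arrow s1 W X" "arrow t1' V W" "arrow f1' V W'" "arrow t1 W' Y" "arrow g1 W' Z" "qs t1'"
      using that by (simp_all add: qis_iff Mor_arrow)
    have "fr (s \<bullet> t') (g \<bullet> f') = fr (s1 \<bullet> t1') (g1 \<bullet> f1')"
      by (rule fr_cmp_cong[OF F(4)[symmetric] G(4)[symmetric] r(1) F(1) r(2) G(1) F(2,3) r(3) G(2,3) t sq _ _ _ that(15)])
        (use A in \<open>simp_all add: arrow_iff\<close>)
    thus ?thesis using A F G by (simp add: fr_def arrow_iff)
  qed
  have o: "tgt s \<in> Obj T" "tgt f \<in> Obj T" "tgt g \<in> Obj T" "src s \<in> Obj T" "src t \<in> Obj T" "src t' \<in> Obj T"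
    "(s, f) \<in> fr s f" "(t, g) \<in> fr t g"
      "s \<in> qis T U (src s) (tgt s)" "f \<in> Mor T (src s) (tgt f)" "t \<in> qis T U (src t) (tgt f)"
      "g \<in> Mor T (src t) (tgt g)" "t' \<in> qis T U (src t') (src s)" "f' \<in> Mor T (src t') (src t)"
    using r t ar_arrow[of f] ar_arrow[of g] ar_arrow[of f'] arrow_Mor fr_self[of s f] fr_self[of t g] 
      ar_arrow[of s] ar_arrow[of t] ar_arrow[of t']
    by (auto simp: qis_iff)
  show ?thesis
  proof (intro equalityI subsetI)
    fix x assume x: "x \<in> verdier_cmp T U (fr t g) (fr s f)"
    show "x \<in> fr (s \<bullet> t') (g \<bullet> f')" 
      using x unfolding verdier_cmp_def mem_Collect_eq by (elim bexE exE conjE) (simp only: *)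
  next
    fix x assume "x \<in> fr (s \<bullet> t') (g \<bullet> f')"
    hence "x \<in> roof_class T U (tgt s) (tgt g) (s \<bullet> t') (g \<bullet> f')" using *[OF o sq] by simp
    thus "x \<in> verdier_cmp T U (fr t g) (fr s f)"
      unfolding verdier_cmp_def mem_Collect_eq using o sq by blast
  qed
qed

lemma fr_cmp_ex:
  assumes r: "roof s f" "roof t g" "tgt t = tgt f"
  obtains t' f' where "roof t' f'" "tgt t' = src s" "tgt f' = src t" "f \<bullet> t' = t \<bullet> f'"
    "verdier_cmp T U (fr t g) (fr s f) = fr (s \<bullet> t') (g \<bullet> f')"
proof -
  obtain t' f' where t: "qs t'" "tgt t' = src s" "ar f'" "src f' = src t'" "tgt f' = src t"
    and sq: "f \<bullet> t' = t \<bullet> f'" using ore[of f t] r by auto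
  have "roof t' f'" using t by simp
  thus ?thesis using that[OF _ t(2,5) sq fr_cmp[OF r _ t(2,5) sq]] by blast
qed

text \<open>Three fractions have a common denominator \<open>r2\<close>, so they lie in the image of
  the linear map that sends a numerator on \<open>src r2\<close> to its fraction over
  \<open>r2\<close>.\<close>

lemma VQ_vectorspace:
  assumes XY: "X \<in> Obj T" "Y \<in> Obj T" shows "vectorspace k (verdier_hom T U X Y)"
proof (rule vectorspaceI_image[OF ground_field])
  have "roof (idt X) (zr X Y)" using XY by simp
  from fr_in[OF this] show "\<zero>\<^bsub>verdier_hom T U X Y\<^esub> \<in> carrier (verdier_hom T U X Y)"
    using fr_zero[of "idt X" Y X] XY by simp
  fix a b c assume abc: "a \<in> carrier (verdier_hom T U X Y)" "b \<in> carrier (verdier_hom T U X Y)"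
    "c \<in> carrier (verdier_hom T U X Y)"
  obtain s f where a: "roof s f" "tgt s = X" "tgt f = Y" "a = fr s f" using abc(1) XY by (rule vhomE)
  obtain t g where b: "roof t g" "tgt t = X" "tgt g = Y" "b = fr t g" using abc(2) XY by (rule vhomE)
  obtain r h where c: "roof r h" "tgt r = X" "tgt h = Y" "c = fr r h" using abc(3) XY by (rule vhomE)
  obtain r1 f1 g1 where 1: "roof r1 f1" "roof r1 g1" "tgt r1 = tgt s" "tgt f1 = tgt f" "tgt g1 = tgt g"
    "fr s f = fr r1 f1" "fr t g = fr r1 g1" using common_denominator2[OF a(1) b(1)] a b by metis
  obtain r2 f2 h2 u where 2: "roof r2 f2" "roof r2 h2" "tgt r2 = tgt r1" "tgt f2 = tgt f1" "tgt h2 = tgt h"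
    "fr r1 f1 = fr r2 f2" "fr r h = fr r2 h2" "qs u" "tgt u = src r1" "r2 = r1 \<bullet> u" "f2 = f1 \<bullet> u"
    using common_denominator2[OF 1(1) c(1)] 1(3) a(2) c(2) by metis
  have g2: "fr r1 g1 = fr r2 (g1 \<bullet> u)" "roof r2 (g1 \<bullet> u)" "tgt (g1 \<bullet> u) = Y"
    using fr_refine[OF 1(2) 2(8,9)] 2 1 b by auto
  let ?V = "Hom T (src r2) Y"
  have o: "src r2 \<in> Obj T" using 2(1) by simp
  have c2: "x \<in> carrier ?V \<longleftrightarrow> ar x \<and> src x = src r2 \<and> tgt x = Y" for x
    using XY o by (simp add: Mor_arrow arrow_iff)
  have X: "tgt r2 = X" using 2 1 a by simp
  show "\<exists>(V :: ('k, 'm) module) h. vectorspace k V \<and> h \<in> carrier V \<rightarrow> carrier (verdier_hom T U X Y) \<and>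
        (\<forall>x\<in>carrier V. \<forall>y\<in>carrier V. h (x \<oplus>\<^bsub>V\<^esub> y) = h x \<oplus>\<^bsub>verdier_hom T U X Y\<^esub> h y) \<and>
        (\<forall>r\<in>carrier k. \<forall>x\<in>carrier V. h (r \<odot>\<^bsub>V\<^esub> x) = r \<odot>\<^bsub>verdier_hom T U X Y\<^esub> h x) \<and>
        h \<zero>\<^bsub>V\<^esub> = \<zero>\<^bsub>verdier_hom T U X Y\<^esub> \<and> a \<in> h ` carrier V \<and> b \<in> h ` carrier V \<and> c \<in> h ` carrier V"
  proof (intro exI[of _ ?V] exI[of _ "fr r2"] conjI ballI)
    show "vectorspace k ?V" using hom_vectorspace o XY by simp
    show "fr r2 \<in> carrier ?V \<rightarrow> carrier (verdier_hom T U X Y)"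
      using 2 X fr_in unfolding c2 Pi_def by auto
    show "fr r2 (x \<oplus>\<^bsub>?V\<^esub> y) = fr r2 x \<oplus>\<^bsub>verdier_hom T U X Y\<^esub> fr r2 y" if "x \<in> carrier ?V" "y \<in> carrier ?V" for x y
      using that 2(1) X fr_add[of r2 x y X Y] pl_eq[of x "src r2" Y y] XY unfolding c2 arrow_iff by simp
    show "fr r2 (q \<odot>\<^bsub>?V\<^esub> x) = q \<odot>\<^bsub>verdier_hom T U X Y\<^esub> fr r2 x" if "q \<in> carrier k" "x \<in> carrier ?V" for q x
      using that 2(1) X fr_smult[of q r2 x X Y] sm_eq[of x "src r2" Y q] XY unfolding c2 arrow_iff by simp
    show "fr r2 (zr (src r2) Y) = \<zero>\<^bsub>verdier_hom T U X Y\<^esub>" using fr_zero 2(1) XY X by simp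
    show "a \<in> fr r2 ` carrier ?V" by (rule image_eqI[of _ _ f2], use a 1(6) 2(6) in metis, use a(3) 1(4) 2(1,4) in \<open>simp only: c2\<close>)
    show "b \<in> fr r2 ` carrier ?V" by (rule image_eqI[of _ _ "g1 \<bullet> u"], use b 1(7) g2(1) in metis, use g2(2,3) in \<open>simp only: c2\<close>)
    show "c \<in> fr r2 ` carrier ?V" by (rule image_eqI[of _ _ h2], use c 2(7) in metis, use c(3) 2(2,5) in \<open>simp only: c2\<close>)
  qed
qed

end


context lin_fun
begin

lemma F_biproduct:
  assumes "is_biproduct C X Y B i j p q"
  shows "is_biproduct D (FO F X) (FO F Y) (FO F B) (FM F i) (FM F j) (FM F p) (FM F q)"
proof -
  have b: "C.arrow i X B" "C.arrow j Y B" "C.arrow p B X" "C.arrow q B Y"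
    and e: "p \<cdot>\<^bsub>C\<^esub> i = ident C X" "q \<cdot>\<^bsub>C\<^esub> j = ident C Y" "p \<cdot>\<^bsub>C\<^esub> j = C.zr Y X" "q \<cdot>\<^bsub>C\<^esub> i = C.zr X Y"
     "C.pl (i \<cdot>\<^bsub>C\<^esub> p) (j \<cdot>\<^bsub>C\<^esub> q) = ident C B"
    using assms unfolding C.is_biproduct_iff by blast+
  have "FM F p \<cdot>\<^bsub>D\<^esub> FM F i = ident D (FO F X)" "FM F q \<cdot>\<^bsub>D\<^esub> FM F j = ident D (FO F Y)"
    "FM F p \<cdot>\<^bsub>D\<^esub> FM F j = D.zr (FO F Y) (FO F X)" "FM F q \<cdot>\<^bsub>D\<^esub> FM F i = D.zr (FO F X) (FO F Y)"
    using b e(1-4) by (simp_all add: C.arrow_iff flip: F_cmp)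
  moreover have "FM F (C.pl (i \<cdot>\<^bsub>C\<^esub> p) (j \<cdot>\<^bsub>C\<^esub> q)) = ident D (FO F B)" unfolding e(5) using b(1) by (simp add: C.arrow_iff)
  hence "D.pl (FM F i \<cdot>\<^bsub>D\<^esub> FM F p) (FM F j \<cdot>\<^bsub>D\<^esub> FM F q) = ident D (FO F B)"
    using b by (simp add: C.arrow_iff)
  ultimately show ?thesis
    unfolding D.is_biproduct_iff using F_arrow[OF b(1)] F_arrow[OF b(2)] F_arrow[OF b(3)] F_arrow[OF b(4)]
    by blast
qed

end

section \<open>The Verdier quotient as a linear category\<close>

lemma (in thick_subcategory) VQ_lin_cat: "lin_cat k \<Q>"
proof (rule lin_cat.intro, unfold VQ_Obj VQ_simps)
  show "field k" by (rule ground_field)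
  show "vectorspace k (verdier_hom T U X Y)" if "X \<in> Obj T" "Y \<in> Obj T" for X Y
    using VQ_vectorspace that .
next
  fix X Y X' Y' f assume o: "X \<in> Obj T" "Y \<in> Obj T" "X' \<in> Obj T" "Y' \<in> Obj T"
    and f: "f \<in> carrier (verdier_hom T U X Y)" "f \<in> carrier (verdier_hom T U X' Y')"
  obtain s g where 1: "roof s g" "tgt s = X" "tgt g = Y" "f = fr s g" using f(1) o(1,2) by (rule vhomE)
  obtain t h where 2: "roof t h" "tgt t = X'" "tgt h = Y'" "f = fr t h" using f(2) o(3,4) by (rule vhomE)
  have "(s, g) \<in> fr t h" using 1(4) 2(4) fr_self[OF 1(1)] by simp
  from fr_mem[OF this 2(1)] show "X = X' \<and> Y = Y'" using 1 2 by auto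
next
  fix X assume "X \<in> Obj T"
  thus "ident \<Q> X \<in> carrier (verdier_hom T U X X)" using fr_in[of "idt X" "idt X"] by (simp add: VQ_ident)
next
  fix X Y Z f g assume o: "X \<in> Obj T" "Y \<in> Obj T" "Z \<in> Obj T"
    and f: "f \<in> carrier (verdier_hom T U X Y)" and g: "g \<in> carrier (verdier_hom T U Y Z)"
  obtain s f1 where 1: "roof s f1" "tgt s = X" "tgt f1 = Y" "f = fr s f1" using f o(1,2) by (rule vhomE)
  obtain t g1 where 2: "roof t g1" "tgt t = Y" "tgt g1 = Z" "g = fr t g1" using g o(2,3) by (rule vhomE)
  obtain t' f' where 3: "roof t' f'" "tgt t' = src s" "tgt f' = src t" "f1 \<bullet> t' = t \<bullet> f'"
    "verdier_cmp T U (fr t g1) (fr s f1) = fr (s \<bullet> t') (g1 \<bullet> f')"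
    by (rule fr_cmp_ex[OF 1(1) 2(1)]) (use 1 2 in auto)
  show "verdier_cmp T U g f \<in> carrier (verdier_hom T U X Z)"
    using fr_in[of "s \<bullet> t'" "g1 \<bullet> f'"] 1 2 3 by simp
next
  fix X Y f assume o: "X \<in> Obj T" "Y \<in> Obj T" and f: "f \<in> carrier (verdier_hom T U X Y)"
  obtain s f1 where 1: "roof s f1" "tgt s = X" "tgt f1 = Y" "f = fr s f1" using f o(1,2) by (rule vhomE)
  show "verdier_cmp T U (ident \<Q> Y) f = f"
    using fr_cmp[of s f1 "idt Y" "idt Y" "idt (src s)" f1] 1 o by (simp add: VQ_ident)
  show "verdier_cmp T U f (ident \<Q> X) = f"
    using fr_cmp[of "idt X" "idt X" s f1 s "idt (src s)"] 1 o by (simp add: VQ_ident)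
next
  fix W X Y Z f g h assume o: "W \<in> Obj T" "X \<in> Obj T" "Y \<in> Obj T" "Z \<in> Obj T"
    and f: "f \<in> carrier (verdier_hom T U W X)" and g: "g \<in> carrier (verdier_hom T U X Y)"
    and h: "h \<in> carrier (verdier_hom T U Y Z)"
  obtain s f1 where 1: "roof s f1" "tgt s = W" "tgt f1 = X" "f = fr s f1" using f o(1,2) by (rule vhomE)
  obtain t g1 where 2: "roof t g1" "tgt t = X" "tgt g1 = Y" "g = fr t g1" using g o(2,3) by (rule vhomE)
  obtain r h1 where 3: "roof r h1" "tgt r = Y" "tgt h1 = Z" "h = fr r h1" using h o(3,4) by (rule vhomE)
  obtain t' g' where 4: "roof t' g'" "tgt t' = src t" "tgt g' = src r" and e4: "g1 \<bullet> t' = r \<bullet> g'"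
    and c4: "verdier_cmp T U (fr r h1) (fr t g1) = fr (t \<bullet> t') (h1 \<bullet> g')"
    by (rule fr_cmp_ex[OF 2(1) 3(1)]) (use 2 3 in auto)
  have r5: "roof (t \<bullet> t') (h1 \<bullet> g')" "tgt (t \<bullet> t') = tgt f1" using 1 2 3 4 by simp_all
  obtain u f' where 5: "roof u f'" "tgt u = src s" "tgt f' = src (t \<bullet> t')" and e5: "f1 \<bullet> u = (t \<bullet> t') \<bullet> f'"
    and c5: "verdier_cmp T U (fr (t \<bullet> t') (h1 \<bullet> g')) (fr s f1) = fr (s \<bullet> u) ((h1 \<bullet> g') \<bullet> f')"
    by (rule fr_cmp_ex[OF 1(1) r5])
  have f't: "tgt f' = src t'" using 5(3) 2 4 by simp
  have c6: "verdier_cmp T U (fr t g1) (fr s f1) = fr (s \<bullet> u) (g1 \<bullet> (t' \<bullet> f'))"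
    by (rule fr_cmp[OF 1(1) 2(1)]) (use 1 2 4 5(1,2) e5 f't in simp_all)
  \<comment> \<open>The square chosen for one bracketing serves the other one too: its left leg
    there is an identity, and the right leg is \<open>g' \<bullet> f'\<close>. No further Ore square
    is needed.\<close>
  have e7: "(g1 \<bullet> (t' \<bullet> f')) \<bullet> idt (src u) = r \<bullet> (g' \<bullet> f')"
  proof -
    have "(g1 \<bullet> (t' \<bullet> f')) \<bullet> idt (src u) = (g1 \<bullet> t') \<bullet> f'" using 1 2 4 5(1,2) f't by simp
    also have "\<dots> = r \<bullet> (g' \<bullet> f')" unfolding e4 using 1 2 3 4 5(1,2) f't by simp
    finally show ?thesis .
  qed
  have c7: "verdier_cmp T U (fr r h1) (fr (s \<bullet> u) (g1 \<bullet> (t' \<bullet> f'))) = fr ((s \<bullet> u) \<bullet> idt (src u)) (h1 \<bullet> (g' \<bullet> f'))"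
    by (rule fr_cmp[OF _ 3(1) _ _ _ _ e7]) (use 1 2 3 4 5(1,2) f't in simp_all)
  show "verdier_cmp T U (verdier_cmp T U h g) f = verdier_cmp T U h (verdier_cmp T U g f)"
    unfolding 1(4) 2(4) 3(4) c4 c5 c6 c7 using 1 2 3 4 5(1,2) f't by simp
next
  fix X Y Z f assume o: "X \<in> Obj T" "Y \<in> Obj T" "Z \<in> Obj T" and f: "f \<in> carrier (verdier_hom T U X Y)"
  obtain s f1 where 1: "roof s f1" "tgt s = X" "tgt f1 = Y" "f = fr s f1" using f o(1,2) by (rule vhomE)
  show "linear_map k (verdier_hom T U Y Z) (verdier_hom T U X Z) (\<lambda>g. verdier_cmp T U g f)"
  proof (rule linear_mapI)
    show "vectorspace k (verdier_hom T U Y Z)" "vectorspace k (verdier_hom T U X Z)"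
      using VQ_vectorspace o by blast+
    show "verdier_cmp T U g f \<in> carrier (verdier_hom T U X Z)" if g: "g \<in> carrier (verdier_hom T U Y Z)" for g
    proof -
      obtain t g1 where 2: "roof t g1" "tgt t = Y" "tgt g1 = Z" "g = fr t g1" using g o(2,3) by (rule vhomE)
      obtain t' f' where 3: "roof t' f'" "tgt t' = src s" "tgt f' = src t" "f1 \<bullet> t' = t \<bullet> f'"
        "verdier_cmp T U (fr t g1) (fr s f1) = fr (s \<bullet> t') (g1 \<bullet> f')"
        by (rule fr_cmp_ex[OF 1(1) 2(1)]) (use 1 2 in auto)
      show ?thesis using fr_in[of "s \<bullet> t'" "g1 \<bullet> f'"] 1 2 3 by simp
    qed
    show "verdier_cmp T U (g \<oplus>\<^bsub>verdier_hom T U Y Z\<^esub> h) f =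
        verdier_cmp T U g f \<oplus>\<^bsub>verdier_hom T U X Z\<^esub> verdier_cmp T U h f"
      if gh: "g \<in> carrier (verdier_hom T U Y Z)" "h \<in> carrier (verdier_hom T U Y Z)" for g h
    proof -
      obtain t1 g1 where a: "roof t1 g1" "tgt t1 = Y" "tgt g1 = Z" "g = fr t1 g1" using gh(1) o(2,3) by (rule vhomE)
      obtain t2 h2 where b: "roof t2 h2" "tgt t2 = Y" "tgt h2 = Z" "h = fr t2 h2" using gh(2) o(2,3) by (rule vhomE)
      obtain t g' h' where c: "roof t g'" "roof t h'" "tgt t = Y" "tgt g' = Z" "tgt h' = Z" "g = fr t g'" "h = fr t h'"
        using common_denominator2[OF a(1) b(1)] a b by metis
      obtain t' f' where sq: "roof t' f'" "tgt t' = src s" "tgt f' = src t" "f1 \<bullet> t' = t \<bullet> f'"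
        by (rule fr_cmp_ex[OF 1(1) c(1)]) (use 1 c in auto)
      have ct: "tgt t = tgt f1" using 1 c by simp
      have "verdier_cmp T U (fr t (g' \<boxplus> h')) (fr s f1) = fr (s \<bullet> t') ((g' \<boxplus> h') \<bullet> f')"
        by (rule fr_cmp[OF 1(1) _ ct sq]) (use c in simp)
      also have "(g' \<boxplus> h') \<bullet> f' = g' \<bullet> f' \<boxplus> h' \<bullet> f'" using c(1-5) sq(1-3) by (simp add: cmp_pl)
      finally show ?thesis unfolding c 1(4) 
        using fr_cmp[OF 1(1) c(1) ct sq] fr_cmp[OF 1(1) c(2) ct sq] 1(1-3) sq(1-3) c(1-5)
          fr_add[OF c(1,2,3,4,5)] fr_add[of "s \<bullet> t'" "g' \<bullet> f'" "h' \<bullet> f'" X Z] by simp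
    qed
    show "verdier_cmp T U (c \<odot>\<^bsub>verdier_hom T U Y Z\<^esub> g) f = c \<odot>\<^bsub>verdier_hom T U X Z\<^esub> verdier_cmp T U g f"
      if cc: "c \<in> carrier k" and g: "g \<in> carrier (verdier_hom T U Y Z)" for c g
    proof -
      obtain t g1 where a: "roof t g1" "tgt t = Y" "tgt g1 = Z" "g = fr t g1" using g o(2,3) by (rule vhomE)
      obtain t' f' where sq: "roof t' f'" "tgt t' = src s" "tgt f' = src t" "f1 \<bullet> t' = t \<bullet> f'"
        by (rule fr_cmp_ex[OF 1(1) a(1)]) (use 1 a in auto)
      have ct: "tgt t = tgt f1" using 1 a by simp
      have "verdier_cmp T U (fr t (c \<triangleright> g1)) (fr s f1) = fr (s \<bullet> t') ((c \<triangleright> g1) \<bullet> f')"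
        by (rule fr_cmp[OF 1(1) _ ct sq]) (use a cc in simp)
      also have "(c \<triangleright> g1) \<bullet> f' = c \<triangleright> (g1 \<bullet> f')" using a(1-3) sq(1-3) cc by (simp add: cmp_sm)
      finally show ?thesis unfolding a(4) 1(4) 
        using fr_cmp[OF 1(1) a(1) ct sq] 1(1-3) sq(1-3) a(1-3) cc
          fr_smult[OF cc a(1,2,3)] fr_smult[OF cc, of "s \<bullet> t'" "g1 \<bullet> f'" X Z] by simp
    qed
  qed
next
  fix X Y Z g assume o: "X \<in> Obj T" "Y \<in> Obj T" "Z \<in> Obj T" and g: "g \<in> carrier (verdier_hom T U Y Z)"
  obtain t g1 where 1: "roof t g1" "tgt t = Y" "tgt g1 = Z" "g = fr t g1" using g o(2,3) by (rule vhomE)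
  show "linear_map k (verdier_hom T U X Y) (verdier_hom T U X Z) (verdier_cmp T U g)"
  proof (rule linear_mapI)
    show "vectorspace k (verdier_hom T U X Y)" "vectorspace k (verdier_hom T U X Z)"
      using VQ_vectorspace o by blast+
    show "verdier_cmp T U g f \<in> carrier (verdier_hom T U X Z)" if f: "f \<in> carrier (verdier_hom T U X Y)" for f
    proof -
      obtain s f1 where 2: "roof s f1" "tgt s = X" "tgt f1 = Y" "f = fr s f1" using f o(1,2) by (rule vhomE)
      obtain t' f' where 3: "roof t' f'" "tgt t' = src s" "tgt f' = src t" "f1 \<bullet> t' = t \<bullet> f'"
        "verdier_cmp T U (fr t g1) (fr s f1) = fr (s \<bullet> t') (g1 \<bullet> f')"
        by (rule fr_cmp_ex[OF 2(1) 1(1)]) (use 1 2 in auto)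
      show ?thesis using fr_in[of "s \<bullet> t'" "g1 \<bullet> f'"] 1 2 3 by simp
    qed
    show "verdier_cmp T U g (e \<oplus>\<^bsub>verdier_hom T U X Y\<^esub> f) =
        verdier_cmp T U g e \<oplus>\<^bsub>verdier_hom T U X Z\<^esub> verdier_cmp T U g f"
      if ef: "e \<in> carrier (verdier_hom T U X Y)" "f \<in> carrier (verdier_hom T U X Y)" for e f
    proof -
      obtain s1 e1 where a: "roof s1 e1" "tgt s1 = X" "tgt e1 = Y" "e = fr s1 e1" using ef(1) o(1,2) by (rule vhomE)
      obtain s2 f2 where b: "roof s2 f2" "tgt s2 = X" "tgt f2 = Y" "f = fr s2 f2" using ef(2) o(1,2) by (rule vhomE)
      obtain s e' f' where c: "roof s e'" "roof s f'" "tgt s = X" "tgt e' = Y" "tgt f' = Y" "e = fr s e'" "f = fr s f'"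
        using common_denominator2[OF a(1) b(1)] a b by metis
      obtain t1 d1 where p: "roof t1 d1" "tgt t1 = src s" "tgt d1 = src t" and ep: "e' \<bullet> t1 = t \<bullet> d1"
        by (rule fr_cmp_ex[OF c(1) 1(1)]) (use 1 c in auto)
      obtain t2 d2 where q: "roof t2 d2" "tgt t2 = src s" "tgt d2 = src t" and eq: "f' \<bullet> t2 = t \<bullet> d2"
        by (rule fr_cmp_ex[OF c(2) 1(1)]) (use 1 c in auto)
      \<comment> \<open>The two numerators were completed by squares with different left legs; a
        common refinement of the legs is required before the squares can be added.\<close>
      obtain x y where x: "qs x" "tgt x = src t1" "ar y" "src y = src x" "tgt y = src t2" and ex: "t1 \<bullet> x = t2 \<bullet> y"
        using ore[of t1 t2] p q by auto
      have e1: "e' \<bullet> (t1 \<bullet> x) = t \<bullet> (d1 \<bullet> x)" using c(1-5) p x 1 by (simp add: cmp_rew[OF ep])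
      have e2: "f' \<bullet> (t1 \<bullet> x) = t \<bullet> (d2 \<bullet> y)" unfolding ex using c(1-5) q x 1 by (simp add: cmp_rew[OF eq])
      have e3: "(e' \<boxplus> f') \<bullet> (t1 \<bullet> x) = t \<bullet> (d1 \<bullet> x \<boxplus> d2 \<bullet> y)"
        using e1 e2 c(1-5) p q x 1 by (simp add: cmp_pl)
      have ct: "tgt t = tgt e'" "tgt t = tgt f'" "tgt t = tgt (e' \<boxplus> f')" using c(1-5) 1 by simp_all
      have ty: "roof (t1 \<bullet> x) (d1 \<bullet> x)" "roof (t1 \<bullet> x) (d2 \<bullet> y)" "roof (t1 \<bullet> x) (d1 \<bullet> x \<boxplus> d2 \<bullet> y)"
         "tgt (t1 \<bullet> x) = src s" "tgt (d1 \<bullet> x) = src t" "tgt (d2 \<bullet> y) = src t" "tgt (d1 \<bullet> x \<boxplus> d2 \<bullet> y) = src t"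
         "roof s (e' \<boxplus> f')"
        using c(1-5) p q x 1 by simp_all
      have "verdier_cmp T U (fr t g1) (fr s (e' \<boxplus> f')) = fr (s \<bullet> (t1 \<bullet> x)) (g1 \<bullet> (d1 \<bullet> x \<boxplus> d2 \<bullet> y))"
        by (rule fr_cmp[OF ty(8) 1(1) ct(3) ty(3,4,7) e3])
      also have "g1 \<bullet> (d1 \<bullet> x \<boxplus> d2 \<bullet> y) = g1 \<bullet> (d1 \<bullet> x) \<boxplus> g1 \<bullet> (d2 \<bullet> y)" using p q x 1(1-3) by (simp add: cmp_pl)
      finally show ?thesis unfolding c(6,7) 1(4) 
        using fr_cmp[OF c(1) 1(1) ct(1) ty(1,4,5) e1] fr_cmp[OF c(2) 1(1) ct(2) ty(2,4,6) e2]
          fr_add[OF c(1-5)] fr_add[of "s \<bullet> (t1 \<bullet> x)" "g1 \<bullet> (d1 \<bullet> x)" "g1 \<bullet> (d2 \<bullet> y)" X Z] c(1-5) p q x 1(1-3) by simp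
    qed
    show "verdier_cmp T U g (c \<odot>\<^bsub>verdier_hom T U X Y\<^esub> f) = c \<odot>\<^bsub>verdier_hom T U X Z\<^esub> verdier_cmp T U g f"
      if cc: "c \<in> carrier k" and f: "f \<in> carrier (verdier_hom T U X Y)" for c f
    proof -
      obtain s f1 where a: "roof s f1" "tgt s = X" "tgt f1 = Y" "f = fr s f1" using f o(1,2) by (rule vhomE)
      obtain t' f' where sq: "roof t' f'" "tgt t' = src s" "tgt f' = src t" and es: "f1 \<bullet> t' = t \<bullet> f'"
        by (rule fr_cmp_ex[OF a(1) 1(1)]) (use 1 a in auto)
      have ct: "tgt t = tgt f1" "tgt t = tgt (c \<triangleright> f1)" using 1 a cc by simp_all
      have e: "(c \<triangleright> f1) \<bullet> t' = t \<bullet> (c \<triangleright> f')" using es a(1-3) sq 1(1-3) cc by (simp add: cmp_sm)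
      have "verdier_cmp T U (fr t g1) (fr s (c \<triangleright> f1)) = fr (s \<bullet> t') (g1 \<bullet> (c \<triangleright> f'))"
        by (rule fr_cmp[OF _ 1(1) ct(2) _ _ _ e]) (use a(1-3) sq cc in simp_all)
      also have "g1 \<bullet> (c \<triangleright> f') = c \<triangleright> (g1 \<bullet> f')" using a(1-3) sq(1-3) cc 1(1-3) by (simp add: cmp_sm)
      finally show ?thesis unfolding a(4) 1(4) 
        using fr_cmp[OF a(1) 1(1) ct(1) sq es] 1(1-3) sq(1-3) a(1-3) cc
          fr_smult[OF cc a(1,2,3)] fr_smult[OF cc, of "s \<bullet> t'" "g1 \<bullet> f'" X Z] by simp
    qed
  qed
qed

sublocale thick_subcategory \<subseteq> Q: lin_cat k "verdier_quotient T U"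
  by (rule VQ_lin_cat)

section \<open>The quotient functor\<close>

context thick_subcategory
begin

abbreviation vf where "vf \<equiv> verdier_functor T U"
abbreviation qf where "qf f \<equiv> FM vf f"

lemma vf_FO [simp]: "FO vf X = X"
  by (simp add: verdier_functor_def)

lemma qf_eq: assumes "ar f" shows "qf f = fr (idt (src f)) f"
proof -
  have 1: "X = src f" "Y = tgt f" if "X \<in> Obj T" "Y \<in> Obj T" "f \<in> Mor T X Y" for X Y
    using that by (simp_all add: Mor_arrow arrow_iff)
  have 2: "f \<in> Mor T (src f) (tgt f)" "src f \<in> Obj T" "tgt f \<in> Obj T"
    using ar_arrow[OF assms] arrow_Mor assms by auto
  have "(\<exists>X\<in>Obj T. \<exists>Y\<in>Obj T. f \<in> Mor T X Y \<and> r \<in> roof_class T U X Y (idt X) f) \<longleftrightarrow>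
      r \<in> roof_class T U (src f) (tgt f) (idt (src f)) f" for r
    using 1 2 by metis
  thus ?thesis using 2 by (simp add: verdier_functor_def fr_def)
qed

lemma fr_arrow: "roof s f \<Longrightarrow> Q.arrow (fr s f) (tgt s) (tgt f)"
  unfolding Q.arrow_def VQ_simps using fr_in ar_obj(2) qs_ar by simp

lemma Q_arrowE:
  assumes "Q.arrow a X Y"
  obtains s f where "roof s f" "tgt s = X" "tgt f = Y" "a = fr s f" "X \<in> Obj T" "Y \<in> Obj T"
proof -
  have "X \<in> Obj T" "Y \<in> Obj T" "a \<in> carrier (verdier_hom T U X Y)"
    using assms by (simp_all add: Q.arrow_def VQ_simps)
  thus ?thesis using that vhomE by metis
qed

lemmas Q_add = fr_add[folded VQ_simps(1)]
  and Q_smult = fr_smult[folded VQ_simps(1)]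
  and Q_cmp = fr_cmp[folded VQ_simps(2)]

lemma Q_zr: "\<lbrakk>qs s; Y \<in> Obj T; tgt s = X\<rbrakk> \<Longrightarrow> fr s (zr (src s) Y) = Q.zr X Y"
  using fr_zero by (simp add: VQ_simps)

lemma fr_pl: "\<lbrakk>roof s f; roof s g; tgt g = tgt f\<rbrakk> \<Longrightarrow> Q.pl (fr s f) (fr s g) = fr s (f \<boxplus> g)"
  using Q_add[of s f g "tgt s" "tgt f"] Q.pl_eq[OF fr_arrow, of s f] by simp

lemma fr_sm: "\<lbrakk>roof s f; c \<in> carrier k\<rbrakk> \<Longrightarrow> Q.sm c (fr s f) = fr s (c \<triangleright> f)"
  using Q_smult[of c s f "tgt s" "tgt f"] Q.sm_eq[OF fr_arrow, of s f] by simp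

lemma vf_functor: "lin_functor k T \<Q> vf"
proof (rule lin_functorI)
  show "lin_cat k T" "lin_cat k \<Q>" by unfold_locales
  show "Q.arrow (qf f) (FO vf X) (FO vf Y)" if "arrow f X Y" for f X Y
    using that fr_arrow[of "idt X" f] by (simp add: qf_eq arrow_iff)
  show "qf (f \<oplus>\<^bsub>Hom T X Y\<^esub> g) = qf f \<oplus>\<^bsub>Hom \<Q> (FO vf X) (FO vf Y)\<^esub> qf g"
    if "arrow f X Y" "arrow g X Y" for f g X Y
    using that Q_add[of "idt X" f g X Y] pl_eq[OF that(1), of g] by (simp add: qf_eq arrow_iff)
  show "qf (c \<odot>\<^bsub>Hom T X Y\<^esub> f) = c \<odot>\<^bsub>Hom \<Q> (FO vf X) (FO vf Y)\<^esub> qf f"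
    if "c \<in> carrier k" "arrow f X Y" for c f X Y
    using that Q_smult[of c "idt X" f X Y] sm_eq[OF that(2), of c] by (simp add: qf_eq arrow_iff)
  show "qf (g \<bullet> f) = qf g \<cdot>\<^bsub>\<Q>\<^esub> qf f" if "arrow f X Y" "arrow g Y Z" for f g X Y Z
    using that Q_cmp[of "idt X" f "idt Y" g "idt X" f] by (simp add: qf_eq arrow_iff)
qed (simp_all add: qf_eq VQ_ident)

end

sublocale thick_subcategory \<subseteq> Qf: lin_fun k T "verdier_quotient T U" "verdier_functor T U"
  by (rule lin_funI[OF vf_functor])

context thick_subcategory
begin

lemma qf_arrow: "arrow f X Y \<Longrightarrow> Q.arrow (qf f) X Y"
  using Qf.F_arrow by simp

lemma fr_qf: "roof s f \<Longrightarrow> fr s f \<cdot>\<^bsub>\<Q>\<^esub> qf s = qf f"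
  using Q_cmp[of "idt (src s)" s s f "idt (src s)" "idt (src s)"] by (simp add: qf_eq)

lemma qf_fr: "\<lbrakk>roof s f; ar g; src g = tgt f\<rbrakk> \<Longrightarrow> qf g \<cdot>\<^bsub>\<Q>\<^esub> fr s f = fr s (g \<bullet> f)"
  using Q_cmp[of s f "idt (tgt f)" g "idt (src s)" f] by (simp add: qf_eq)

lemma qf_iso: assumes "qs s" shows "is_iso \<Q> (src s) (tgt s) (qf s)"
proof (rule Q.is_isoI)
  show "Q.arrow (qf s) (src s) (tgt s)" using assms ar_arrow qf_arrow by simp
  show "Q.arrow (fr s (idt (src s))) (tgt s) (src s)" using fr_arrow[of s "idt (src s)"] assms by simp
  show "fr s (idt (src s)) \<cdot>\<^bsub>\<Q>\<^esub> qf s = ident \<Q> (src s)"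
    using fr_qf[of s "idt (src s)"] assms by (simp add: qf_eq VQ_ident)
  have "qf s \<cdot>\<^bsub>\<Q>\<^esub> fr s (idt (src s)) = fr (idt (tgt s) \<bullet> s) (idt (tgt s) \<bullet> s)"
    using qf_fr[of s "idt (src s)" s] assms by simp
  also have "\<dots> = ident \<Q> (tgt s)" using fr_refine(1)[of "idt (tgt s)" "idt (tgt s)" s] assms by (simp add: VQ_ident)
  finally show "qf s \<cdot>\<^bsub>\<Q>\<^esub> fr s (idt (src s)) = ident \<Q> (tgt s)" .
qed

text \<open>The zero morphism from a zero object to \<open>V\<close> has cone \<open>V\<close>,
  hence is an admissible denominator. Refining the identity fraction along it makes the numerator
  zero.\<close>

lemma VQ_zero_obj: assumes "V \<in> U" shows "is_zero_obj \<Q> V"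
proof (rule Q.is_zero_objI)
  have V: "V \<in> Obj T" using assms by (rule U_obj)
  thus "V \<in> Obj \<Q>" by simp
  obtain Z0 where "is_zero_obj T Z0" by (rule zero_objE)
  then obtain Z where Z: "is_zero_obj T Z" "Tri T Z V V (zr Z V) (idt V) (zr V (\<Sigma> Z))"
    using tri_zero_id[OF V] by blast
  have Zo: "Z \<in> Obj T" using Z(1) by (simp add: is_zero_obj_def)
  have q: "qs (zr Z V)" using qsI[OF Z(2) assms] .
  have "ident \<Q> V = fr (idt V \<bullet> zr Z V) (idt V \<bullet> zr Z V)"
    using fr_refine(1)[of "idt V" "idt V" "zr Z V"] q V Zo by (simp add: VQ_ident)
  thus "ident \<Q> V = Q.zr V V" using Q_zr[OF q V] V Zo by simp
qed

lemma fr_eq_zero: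
  assumes "roof s f" "fr s f = Q.zr (tgt s) (tgt f)"
  obtains u where "qs u" "tgt u = src s" "f \<bullet> u = zr (src u) (tgt f)"
proof -
  have "fr s f = fr s (zr (src s) (tgt f))" using assms Q_zr[of s "tgt f" "tgt s"] by simp
  then obtain w where "qs w" "tgt w = src s" "f \<bullet> (idt (src s) \<bullet> w) = zr (src s) (tgt f) \<bullet> (idt (src s) \<bullet> w)"
    using fr_equalize[of s f s "zr (src s) (tgt f)" "idt (src s)" "idt (src s)"] assms(1) by auto
  thus ?thesis using that[of w] assms(1) by simp
qed

lemma fr_zeroI:
  assumes "roof s f" "qs u" "tgt u = src s" "f \<bullet> u = zr (src u) (tgt f)"
  shows "fr s f = Q.zr (tgt s) (tgt f)"
proof -
  have "fr s f = fr (s \<bullet> u) (f \<bullet> u)" using fr_refine(1)[OF assms(1-3)] by simp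
  thus ?thesis using Q_zr[of "s \<bullet> u" "tgt f" "tgt s"] assms by simp
qed

text \<open>A morphism that dies in the quotient is killed by some \<open>u\<close> with cone in
  \<open>U\<close>, and then extends over that cone.\<close>

lemma qf_zero_factor:
  assumes f: "arrow f X Y" "qf f = Q.zr X Y"
  obtains V a b where "V \<in> U" "arrow a X V" "arrow b V Y" "f = b \<bullet> a"
proof -
  have A: "ar f" "src f = X" "tgt f = Y" "X \<in> Obj T" "Y \<in> Obj T" using f(1) by (auto simp: arrow_iff)
  obtain u where u: "qs u" "tgt u = X" "f \<bullet> u = zr (src u) Y"
    using fr_eq_zero[of "idt X" f] f(2) A qf_eq[of f] by auto
  obtain V g h where V: "V \<in> U" "Tri T (src u) X V u g h" using qsE[OF u(1)] u(2) by metis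
  obtain b where "arrow b V Y" "b \<bullet> g = f" by (rule tri_extend[OF V(2) f(1) u(3)])
  thus ?thesis using that[OF V(1) tri_arrow(2)[OF V(2)]] by blast
qed

lemma qf_factor_zero:
  assumes "V \<in> U" "arrow a X V" "arrow b V Y" shows "qf (b \<bullet> a) = Q.zr X Y"
proof -
  have "qf a = Q.zr X V" by (rule Q.zero_obj_hom(2)[OF VQ_zero_obj[OF assms(1)] qf_arrow[OF assms(2)]])
  thus ?thesis using assms qf_arrow[OF assms(3)] by (simp add: arrow_iff Q.arrow_iff)
qed

lemma VQ_additive: "additive_cat k \<Q>"
proof
  obtain Z where "Z \<in> U" by (rule U_zero)
  thus "\<exists>Z. is_zero_obj \<Q> Z" using VQ_zero_obj by blast
  fix X Y assume "X \<in> Obj \<Q>" "Y \<in> Obj \<Q>"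
  then obtain B i j p q where "is_biproduct T X Y B i j p q" using biproduct_exists VQ_Obj by metis
  from Qf.F_biproduct[OF this] show "\<exists>B i j p q. is_biproduct \<Q> X Y B i j p q"
    unfolding vf_FO by blast
qed

end


subsection \<open>Induced functors\<close>

lemma lin_functor_cmp:
  assumes "lin_functor k C D F" "lin_functor k D E G"
  shows "lin_functor k C E (functor_cmp G F)"
proof -
  interpret F: lin_fun k C D F using assms(1) by (rule lin_funI)
  interpret G: lin_fun k D E G using assms(2) by (rule lin_funI)
  show ?thesis
  proof (rule lin_functorI)
    show "lin_cat k C" "lin_cat k E" by unfold_locales
    show "G.D.arrow (FM (functor_cmp G F) f) (FO (functor_cmp G F) X) (FO (functor_cmp G F) Y)"
      if "F.C.arrow f X Y" for f X Y
      using G.F_arrow[OF F.F_arrow[OF that]] by (simp add: functor_cmp_def)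
    show "FM (functor_cmp G F) (f \<oplus>\<^bsub>Hom C X Y\<^esub> g) =
       FM (functor_cmp G F) f \<oplus>\<^bsub>Hom E (FO (functor_cmp G F) X) (FO (functor_cmp G F) Y)\<^esub> FM (functor_cmp G F) g"
      if "F.C.arrow f X Y" "F.C.arrow g X Y" for f g X Y
      using that G.D.pl_eq[OF G.F_arrow[OF F.F_arrow[OF that(1)]]]
      by (simp add: functor_cmp_def F.C.pl_eq[OF that(1)] F.C.arrow_iff)
    show "FM (functor_cmp G F) (c \<odot>\<^bsub>Hom C X Y\<^esub> f) =
       c \<odot>\<^bsub>Hom E (FO (functor_cmp G F) X) (FO (functor_cmp G F) Y)\<^esub> FM (functor_cmp G F) f"
      if "c \<in> carrier k" "F.C.arrow f X Y" for c f X Y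
      using that G.D.sm_eq[OF G.F_arrow[OF F.F_arrow[OF that(2)]]]
      by (simp add: functor_cmp_def F.C.sm_eq[OF that(2)] F.C.arrow_iff)
    show "FM (functor_cmp G F) (g \<cdot>\<^bsub>C\<^esub> f) = FM (functor_cmp G F) g \<cdot>\<^bsub>E\<^esub> FM (functor_cmp G F) f"
      if "F.C.arrow f X Y" "F.C.arrow g Y Z" for f g X Y Z
      using that by (simp add: functor_cmp_def F.C.arrow_iff)
  qed (simp_all add: functor_cmp_def)
qed

lemma lin_equivalence_cmp:
  assumes "lin_equivalence k C D F" "lin_equivalence k D E G"
  shows "lin_equivalence k C E (functor_cmp G F)"
proof -
  have l: "lin_functor k C D F" "lin_functor k D E G" using assms by (auto simp: lin_equivalence_def)
  interpret F: lin_fun k C D F using l(1) by (rule lin_funI)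
  interpret G: lin_fun k D E G using l(2) by (rule lin_funI)
  interpret GF: lin_fun k C E "functor_cmp G F" using lin_functor_cmp[OF l] by (rule lin_funI)
  note F = F.equivalenceD[OF assms(1)] and G = G.equivalenceD[OF assms(2)]
  have c: "FO (functor_cmp G F) X = FO G (FO F X)" "FM (functor_cmp G F) f = FM G (FM F f)" for X f
    by (simp_all add: functor_cmp_def)
  show ?thesis
  proof (rule GF.equivalenceI)
    show GF.faithful unfolding GF.faithful_def c
      using F.faithfulD[OF F(1)] G.faithfulD[OF G(1)] F.F_arrow by metis
    show GF.full unfolding GF.full_def c
    proof (intro ballI allI impI)
      fix X Y h assume XY: "X \<in> Obj C" "Y \<in> Obj C" "G.D.arrow h (FO G (FO F X)) (FO G (FO F Y))"
      obtain g where g: "F.D.arrow g (FO F X) (FO F Y)" "FM G g = h"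
        using G.fullE[OF G(2) F.F_obj[OF XY(1)] F.F_obj[OF XY(2)] XY(3)] .
      obtain f where "F.C.arrow f X Y" "FM F f = g" using F.fullE[OF F(2) XY(1,2) g(1)] .
      thus "\<exists>f. F.C.arrow f X Y \<and> FM G (FM F f) = h" using g by blast
    qed
    show GF.dense unfolding GF.dense_def c
    proof
      fix Z assume "Z \<in> Obj E"
      then obtain Y e where Y: "Y \<in> Obj D" "is_iso E (FO G Y) Z e" using G(3) unfolding G.dense_def by blast
      then obtain X e' where X: "X \<in> Obj C" "is_iso D (FO F X) Y e'" using F(3) unfolding F.dense_def by blast
      have "is_iso E (FO G (FO F X)) Z (e \<cdot>\<^bsub>E\<^esub> FM G e')" by (rule G.D.is_iso_cmp[OF G.F_iso[OF X(2)] Y(2)])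
      thus "\<exists>X\<in>Obj C. \<exists>e. is_iso E (FO G (FO F X)) Z e" using X by blast
    qed
  qed
qed

locale quotient_endofunctor = thick_subcategory k T U + E: lin_fun k T T E
  for k :: "('k, 'r) ring_scheme" and T :: "('o, 'm, 'k, 'z) tricat_scheme" and U
    and E :: "('o, 'm, 'o, 'm) fct" +
  assumes E_qs: "qs s \<Longrightarrow> qs (FM E s)"
begin

abbreviation VE where "VE \<equiv> verdier_induced T U E"

lemma VE_FO [simp]: "FO VE X = FO E X"
  by (simp add: verdier_induced_def)

lemma E_fr_cong:
  assumes e: "fr s f = fr s' f'" and r: "roof s f" "roof s' f'" "tgt s' = tgt s" "tgt f' = tgt f"
  shows "fr (FM E s) (FM E f) = fr (FM E s') (FM E f')"
proof -
  obtain p q where p: "qs p" "tgt p = src s" "ar q" "src q = src p" "tgt q = src s'"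
    and ep: "s \<bullet> p = s' \<bullet> q" using ore[of s s'] r by auto
  obtain w where w: "qs w" "tgt w = src p" and ew: "f \<bullet> (p \<bullet> w) = f' \<bullet> (q \<bullet> w)"
    using fr_equalize[OF e(1) _ _ _ _ _ _ _ _ _ ep] r p by auto
  have "s \<bullet> (p \<bullet> w) = (s \<bullet> p) \<bullet> w" using r p w by simp
  hence e2: "s \<bullet> (p \<bullet> w) = s' \<bullet> (q \<bullet> w)" unfolding ep using r p w by simp
  show ?thesis
  proof (rule fr_eqI[where u = "FM E (p \<bullet> w)" and v = "FM E (q \<bullet> w)"])
    have "FM E (s \<bullet> (p \<bullet> w)) = FM E (s' \<bullet> (q \<bullet> w))" by (simp only: e2)
    thus "FM E s \<bullet> FM E (p \<bullet> w) = FM E s' \<bullet> FM E (q \<bullet> w)" using r p w by simp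
    have "FM E (f \<bullet> (p \<bullet> w)) = FM E (f' \<bullet> (q \<bullet> w))" by (simp only: ew)
    thus "FM E f \<bullet> FM E (p \<bullet> w) = FM E f' \<bullet> FM E (q \<bullet> w)" using r p w by simp
  qed (use r p w E_qs in simp_all)
qed

lemma VE_fr: assumes r: "roof s f" shows "FM VE (fr s f) = fr (FM E s) (FM E f)"
proof -
  have *: "roof_class T U (FO E X) (FO E Y) (FM E s') (FM E f') = fr (FM E s) (FM E f)"
    if "X \<in> Obj T" "Y \<in> Obj T" "(s', f') \<in> fr s f" "(s', f') \<in> roofs T U X Y" for X Y s' f'
  proof -
    have F: "roof s' f'" "tgt s' = tgt s" "tgt f' = tgt f" "fr s' f' = fr s f" using fr_mem[OF that(3) r] by auto
    have "X = tgt s" "Y = tgt f" using that(4) F roofs_iff[OF that(1,2)] by auto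
    thus ?thesis using E_fr_cong[OF F(4) F(1) r] F by (simp add: fr_def)
  qed
  have o: "tgt s \<in> Obj T" "tgt f \<in> Obj T" "(s, f) \<in> fr s f" "(s, f) \<in> roofs T U (tgt s) (tgt f)"
    using r fr_self roofs_iff[of "tgt s" "tgt f"] by auto
  show ?thesis
  proof (intro equalityI subsetI)
    fix x assume "x \<in> FM VE (fr s f)"
    hence "\<exists>X\<in>Obj T. \<exists>Y\<in>Obj T. \<exists>s' f'. (s', f') \<in> fr s f \<and> (s', f') \<in> roofs T U X Y \<and>
             x \<in> roof_class T U (FO E X) (FO E Y) (FM E s') (FM E f')" by (simp add: verdier_induced_def)
    thus "x \<in> fr (FM E s) (FM E f)" by (elim bexE exE conjE) (simp only: *)
  next
    fix x assume "x \<in> fr (FM E s) (FM E f)"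
    hence "x \<in> roof_class T U (FO E (tgt s)) (FO E (tgt f)) (FM E s) (FM E f)" using *[OF o] by simp
    hence "\<exists>X\<in>Obj T. \<exists>Y\<in>Obj T. \<exists>s' f'. (s', f') \<in> fr s f \<and> (s', f') \<in> roofs T U X Y \<and>
             x \<in> roof_class T U (FO E X) (FO E Y) (FM E s') (FM E f')" using o by blast
    thus "x \<in> FM VE (fr s f)" by (simp add: verdier_induced_def)
  qed
qed

lemma E_roof: "roof s f \<Longrightarrow> roof (FM E s) (FM E f)"
  using E_qs by simp

lemma VE_qf: "ar f \<Longrightarrow> FM VE (qf f) = qf (FM E f)"
  using VE_fr[of "idt (src f)" f] by (simp add: qf_eq)

lemma VE_functor: "lin_functor k \<Q> \<Q> VE"
proof (rule lin_functorI)
  show "lin_cat k \<Q>" "lin_cat k \<Q>" by unfold_locales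
  show "FO VE X \<in> Obj \<Q>" if "X \<in> Obj \<Q>" for X using that by simp
  show "FM VE (ident \<Q> X) = ident \<Q> (FO VE X)" if "X \<in> Obj \<Q>" for X
    using that VE_fr[of "idt X" "idt X"] by (simp add: VQ_ident)
  show "Q.arrow (FM VE a) (FO VE X) (FO VE Y)" if a: "Q.arrow a X Y" for a X Y
  proof -
    obtain s f where "roof s f" "tgt s = X" "tgt f = Y" "a = fr s f" using a by (rule Q_arrowE)
    thus ?thesis using fr_arrow[OF E_roof, of s f] VE_fr by simp
  qed
  show "FM VE (a \<oplus>\<^bsub>Hom \<Q> X Y\<^esub> b) = FM VE a \<oplus>\<^bsub>Hom \<Q> (FO VE X) (FO VE Y)\<^esub> FM VE b"
    if ab: "Q.arrow a X Y" "Q.arrow b X Y" for a b X Y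
  proof -
    obtain s f where a: "roof s f" "tgt s = X" "tgt f = Y" "a = fr s f" using ab(1) by (rule Q_arrowE)
    obtain t g where b: "roof t g" "tgt t = X" "tgt g = Y" "b = fr t g" using ab(2) by (rule Q_arrowE)
    obtain r f' g' where c: "roof r f'" "roof r g'" "tgt r = X" "tgt f' = Y" "tgt g' = Y" "a = fr r f'" "b = fr r g'"
      using common_denominator2[OF a(1) b(1)] a b by metis
    have r: "roof r (f' \<boxplus> g')" using c by simp
    have "FM VE (fr r f' \<oplus>\<^bsub>Hom \<Q> X Y\<^esub> fr r g') = fr (FM E r) (FM E f' \<boxplus> FM E g')"
      using Q_add[OF c(1-5)] VE_fr[OF r] c(1-5) by simp
    also have "\<dots> = fr (FM E r) (FM E f') \<oplus>\<^bsub>Hom \<Q> (FO VE X) (FO VE Y)\<^esub> fr (FM E r) (FM E g')"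
      by (rule Q_add[OF E_roof E_roof, symmetric]) (use c in simp_all)
    finally show ?thesis using VE_fr[OF c(1)] VE_fr[OF c(2)] c(6,7) by simp
  qed
  show "FM VE (c \<odot>\<^bsub>Hom \<Q> X Y\<^esub> a) = c \<odot>\<^bsub>Hom \<Q> (FO VE X) (FO VE Y)\<^esub> FM VE a"
    if ca: "c \<in> carrier k" "Q.arrow a X Y" for c a X Y
  proof -
    obtain s f where a: "roof s f" "tgt s = X" "tgt f = Y" "a = fr s f" using ca(2) by (rule Q_arrowE)
    have r: "roof s (c \<triangleright> f)" using a ca by simp
    have "FM VE (c \<odot>\<^bsub>Hom \<Q> X Y\<^esub> fr s f) = fr (FM E s) (c \<triangleright> FM E f)"
      using Q_smult[OF ca(1) a(1-3)] VE_fr[OF r] a(1-3) ca by simp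
    also have "\<dots> = c \<odot>\<^bsub>Hom \<Q> (FO VE X) (FO VE Y)\<^esub> fr (FM E s) (FM E f)"
      by (rule Q_smult[OF ca(1) E_roof, symmetric]) (use a in simp_all)
    finally show ?thesis using VE_fr[OF a(1)] a(4) by simp
  qed
  show "FM VE (b \<cdot>\<^bsub>\<Q>\<^esub> a) = FM VE b \<cdot>\<^bsub>\<Q>\<^esub> FM VE a" if ab: "Q.arrow a X Y" "Q.arrow b Y Z" for a b X Y Z
  proof -
    obtain s f where a: "roof s f" "tgt s = X" "tgt f = Y" "a = fr s f" using ab(1) by (rule Q_arrowE)
    obtain t g where b: "roof t g" "tgt t = Y" "tgt g = Z" "b = fr t g" using ab(2) by (rule Q_arrowE)
    have tt: "tgt t = tgt f" using a b by simp
    obtain t' f' where c: "roof t' f'" "tgt t' = src s" "tgt f' = src t" and e: "f \<bullet> t' = t \<bullet> f'"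
      by (rule fr_cmp_ex[OF a(1) b(1) tt])
    have r: "roof (s \<bullet> t') (g \<bullet> f')" using a b c by simp
    have "FM E (f \<bullet> t') = FM E (t \<bullet> f')" using e by simp
    hence eE: "FM E f \<bullet> FM E t' = FM E t \<bullet> FM E f'" using a b c by simp
    have "fr (FM E t) (FM E g) \<cdot>\<^bsub>\<Q>\<^esub> fr (FM E s) (FM E f) = fr (FM E s \<bullet> FM E t') (FM E g \<bullet> FM E f')"
      by (rule Q_cmp[OF E_roof[OF a(1)] E_roof[OF b(1)] _ E_roof[OF c(1)] _ _ eE]) (use a b c in simp_all)
    also have "\<dots> = FM VE (fr (s \<bullet> t') (g \<bullet> f'))" using VE_fr[OF r] a b c by simp
    finally show ?thesis using Q_cmp[OF a(1) b(1) tt c e] VE_fr[OF a(1)] VE_fr[OF b(1)] a(4) b(4) by simp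
  qed
qed

text \<open>The middle object of a roof is an image under \<open>E\<close> only up to isomorphism.
  Precomposition with this isomorphism does not change the fraction, after which fullness lifts both
  legs; that \<open>E\<close> reflects \<open>qs\<close> keeps the lifted denominator
  admissible.\<close>

lemma VE_equivalence:
  assumes E: "lin_equivalence k T T E" and refl: "\<And>s. \<lbrakk>ar s; qs (FM E s)\<rbrakk> \<Longrightarrow> qs s"
  shows "lin_equivalence k \<Q> \<Q> VE"
proof -
  note E = E.equivalenceD[OF E]
  interpret V: lin_fun k \<Q> \<Q> VE using VE_functor by (rule lin_funI)
  have lift: "\<exists>V e. V \<in> Obj T \<and> is_iso T (FO E V) W e \<and> qs e" if "W \<in> Obj T" for W
    using E(3) that qs_iso unfolding E.dense_def by blast
  have lift_arrow: "\<exists>f. arrow f X Y \<and> FM E f = h" if "X \<in> Obj T" "Y \<in> Obj T" "arrow h (FO E X) (FO E Y)" for h X Y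
    using E.fullE[OF E(2) that] by blast
  show ?thesis
  proof (rule V.equivalenceI)
    show V.faithful
    proof (rule V.faithfulI)
      fix a X Y assume a: "Q.arrow a X Y" and z: "FM VE a = Q.zr (FO VE X) (FO VE Y)"
      obtain s f where r: "roof s f" "tgt s = X" "tgt f = Y" "a = fr s f" and XY: "X \<in> Obj T" "Y \<in> Obj T"
        using a by (rule Q_arrowE)
      have "fr (FM E s) (FM E f) = Q.zr (tgt (FM E s)) (tgt (FM E f))" using z r VE_fr by simp
      then obtain w where w: "qs w" "tgt w = src (FM E s)" "FM E f \<bullet> w = zr (src w) (tgt (FM E f))"
        using fr_eq_zero[OF E_roof[OF r(1)]] by blast
      obtain V e where V: "V \<in> Obj T" "is_iso T (FO E V) (src w) e" "qs e" using lift[of "src w"] w by auto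
      have e: "arrow e (FO E V) (src w)" using V(2) by (rule is_iso_arrow)
      have so: "src s \<in> Obj T" using r by simp
      have we: "arrow (w \<bullet> e) (FO E V) (FO E (src s))" using w e r by (simp add: arrow_iff)
      obtain u where u: "arrow u V (src s)" "FM E u = w \<bullet> e" using lift_arrow[OF V(1) so we] by blast
      have "qs (FM E u)" unfolding u(2) using w V e by (simp add: arrow_iff)
      hence qu: "qs u" using refl[of u] u(1) by (simp add: arrow_iff)
      have "FM E (f \<bullet> u) = FM E f \<bullet> (w \<bullet> e)" unfolding u(2)[symmetric] using u(1) r by (simp add: arrow_iff)
      also have "\<dots> = FM E (zr V Y)" using w(1,2) e r XY V(1) by (simp add: cmp_rew[OF w(3)] arrow_iff)
      finally have "FM E (f \<bullet> u) = FM E (zr V Y)" .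
      hence "f \<bullet> u = zr V Y" 
        by (rule E.faithfulD[OF E(1), rotated -1]) (use u(1) r XY V(1) in \<open>simp_all add: arrow_iff\<close>)
      thus "a = Q.zr X Y" using fr_zeroI[OF r(1) qu] r u(1) by (simp add: arrow_iff)
    qed
    show V.full unfolding V.full_def
    proof (intro ballI allI impI)
      fix X Y h assume XY: "X \<in> Obj \<Q>" "Y \<in> Obj \<Q>" and h: "Q.arrow h (FO VE X) (FO VE Y)"
      obtain s g where r: "roof s g" "tgt s = FO E X" "tgt g = FO E Y" "h = fr s g" using h by (rule Q_arrowE) simp
      obtain V e where V: "V \<in> Obj T" "is_iso T (FO E V) (src s) e" "qs e" using lift[of "src s"] r by auto
      have e: "arrow e (FO E V) (src s)" using V(2) by (rule is_iso_arrow)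
      have "arrow (s \<bullet> e) (FO E V) (FO E X)" "arrow (g \<bullet> e) (FO E V) (FO E Y)" using r e XY by (simp_all add: arrow_iff)
      then obtain s1 g1 where s1: "arrow s1 V X" "FM E s1 = s \<bullet> e" and g1: "arrow g1 V Y" "FM E g1 = g \<bullet> e"
        using lift_arrow V(1) XY by (metis VQ_Obj)
      have "qs (FM E s1)" unfolding s1(2) using V r e by (simp add: arrow_iff)
      hence q: "qs s1" using refl[of s1] s1(1) by (simp add: arrow_iff)
      have r1: "roof s1 g1" using q s1(1) g1(1) by (simp add: arrow_iff)
      have "FM VE (fr s1 g1) = h" using VE_fr[OF r1] s1(2) g1(2) r(4) fr_refine(1)[OF r(1) V(3)] e by (simp add: arrow_iff)
      moreover have "Q.arrow (fr s1 g1) X Y" using fr_arrow[OF r1] s1(1) g1(1) by (simp add: arrow_iff)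
      ultimately show "\<exists>f. Q.arrow f X Y \<and> FM VE f = h" by blast
    qed
    show V.dense unfolding V.dense_def
    proof
      fix Z assume "Z \<in> Obj \<Q>"
      then obtain X e where "X \<in> Obj T" "is_iso T (FO E X) Z e" using E(3) unfolding E.dense_def by auto
      thus "\<exists>X\<in>Obj \<Q>. \<exists>e. is_iso \<Q> (FO VE X) Z e" using Qf.F_iso[of "FO E X" Z e] by auto
    qed
  qed
qed

end


section \<open>Extension-closed subcategories\<close>

lemma (in lin_cat) lin_cat_subcategory:
  assumes "Obj D \<subseteq> Obj C" "Hom D = Hom C" "ident D = ident C" "cmp D = cmp C"
  shows "lin_cat k D"
proof (rule lin_cat.intro, unfold assms(2-4))
  note s = subsetD[OF assms(1)]
  show "vectorspace k (Hom C X Y)" if "X \<in> Obj D" "Y \<in> Obj D" for X Y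
    using hom_vectorspace that s by simp
  show "X = X' \<and> Y = Y'" if "X \<in> Obj D" "Y \<in> Obj D" "X' \<in> Obj D" "Y' \<in> Obj D" "f \<in> Mor C X Y" "f \<in> Mor C X' Y'"
    for X Y X' Y' f using hom_disjoint[of X Y X' Y' f] that s by simp
  show "ident C X \<in> Mor C X X" if "X \<in> Obj D" for X using ident_closed that s by simp
  show "g \<bullet> f \<in> Mor C X Z" if "X \<in> Obj D" "Y \<in> Obj D" "Z \<in> Obj D" "f \<in> Mor C X Y" "g \<in> Mor C Y Z"
    for X Y Z f g using cmp_closed[of X Y Z f g] that s by simp
  show "ident C Y \<bullet> f = f" "f \<bullet> ident C X = f" if "X \<in> Obj D" "Y \<in> Obj D" "f \<in> Mor C X Y" for X Y f
    using cmp_ident_left[of X Y f] cmp_ident_right[of X Y f] that s by simp_all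
  show "(h \<bullet> g) \<bullet> f = h \<bullet> (g \<bullet> f)"
    if "W \<in> Obj D" "X \<in> Obj D" "Y \<in> Obj D" "Z \<in> Obj D" "f \<in> Mor C W X" "g \<in> Mor C X Y" "h \<in> Mor C Y Z"
    for W X Y Z f g h using cmp_assoc[of W X Y Z f g h] that s by simp
  show "linear_map k (Hom C Y Z) (Hom C X Z) (\<lambda>g. g \<bullet> f)"
    if "X \<in> Obj D" "Y \<in> Obj D" "Z \<in> Obj D" "f \<in> Mor C X Y" for X Y Z f
    using cmp_linear_left[of X Y Z f] that s by simp
  show "linear_map k (Hom C X Y) (Hom C X Z) (\<lambda>f. g \<bullet> f)"
    if "X \<in> Obj D" "Y \<in> Obj D" "Z \<in> Obj D" "g \<in> Mor C Y Z" for X Y Z g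
    using cmp_linear_right[of X Y Z g] that s by simp
qed (rule ground_field)

section \<open>Direct sums of distinguished triangles\<close>

context triangulated
begin

text \<open>The map \<open>c\<close> together with identities compares the candidate with a
  distinguished triangle on the same first map. By the five lemma it is invertible, so the candidate
  is distinguished as well.\<close>

lemma tri_from_exact:
  assumes e: "exact_cand X Y Z f g h" and t: "Tri T X Y D f u v"
    and c: "arrow c Z D" "c \<bullet> g = u" "v \<bullet> c = h"
  shows "Tri T X Y Z f g h"
proof -
  note A = exact_candD(1-3)[OF e] tri_arrow[OF t] c(1) and O = tri_obj[OF t]
  have i: "is_iso T Z D c"
    by (rule five[OF e tri_exact[OF t] is_iso_ident[OF O(1)] is_iso_ident[OF O(2)] c(1)])
      (use A c in \<open>simp_all add: arrow_iff\<close>)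
  then obtain d where d: "arrow d D Z" "d \<bullet> c = idt Z" "c \<bullet> d = idt D" "is_iso T D Z d" by (rule is_isoE)
  have "d \<bullet> u = (d \<bullet> c) \<bullet> g" unfolding c(2)[symmetric] using A d(1) by (simp add: arrow_iff)
  hence 1: "d \<bullet> u = g" unfolding d(2) using A by (simp add: arrow_iff)
  have "h \<bullet> d = v \<bullet> (c \<bullet> d)" unfolding c(3)[symmetric] using A d(1) by (simp add: arrow_iff)
  hence 2: "h \<bullet> d = v" unfolding d(3) using A by (simp add: arrow_iff)
  show ?thesis
    by (rule tri_change_iso[OF t is_iso_ident[OF O(1)] is_iso_ident[OF O(2)] d(4)])
      (use A 1 2 in \<open>simp_all add: arrow_iff\<close>)
qed

lemma biproductD:
  assumes "is_biproduct T X Y B i j p q"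
  shows "arrow i X B" "arrow j Y B" "arrow p B X" "arrow q B Y"
     "p \<bullet> i = idt X" "q \<bullet> j = idt Y" "p \<bullet> j = zr Y X" "q \<bullet> i = zr X Y" "i \<bullet> p \<boxplus> j \<bullet> q = idt B"
  using assms unfolding is_biproduct_iff by blast+

lemma biproduct_decomp:
  assumes "is_biproduct T X Y B i j p q" "arrow b W B" shows "i \<bullet> (p \<bullet> b) \<boxplus> j \<bullet> (q \<bullet> b) = b"
proof -
  note D = biproductD[OF assms(1)]
  have "i \<bullet> (p \<bullet> b) \<boxplus> j \<bullet> (q \<bullet> b) = (i \<bullet> p \<boxplus> j \<bullet> q) \<bullet> b" using D(1-4) assms(2) by (simp add: arrow_iff cmp_pl)
  thus ?thesis unfolding D(9) using assms(2) by (simp add: arrow_iff)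
qed

text \<open>Exactness of the split candidate follows from the biproduct equations. The comparison
  with a chosen cone of \<open>i\<close> is the cone map \<open>u\<close> restricted to the second
  summand.\<close>

lemma biproduct_tri:
  assumes b: "is_biproduct T A C B i j p q" shows "Tri T A B C i q (zr C (\<Sigma> A))"
proof -
  note D = biproductD[OF b]
  obtain Z u v where t: "Tri T A B Z i u v" using D(1) by (rule tri_cone')
  note A = D(1-4) tri_arrow[OF t]
  have "exact_cand A B C i q (zr C (\<Sigma> A))"
    unfolding exact_cand_def
  proof (intro conjI allI impI)
    show "\<exists>a. arrow a W A \<and> i \<bullet> a = b'" if "arrow b' W B \<and> q \<bullet> b' = zr W C" for W b'
      using biproduct_decomp[OF b, of b' W] that A by (intro exI[of _ "p \<bullet> b'"]) (auto simp: arrow_iff)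
    show "\<exists>a. arrow a W B \<and> q \<bullet> a = b'" if "arrow b' W C \<and> zr C (\<Sigma> A) \<bullet> b' = zr W (\<Sigma> A)" for W b'
      using that A by (intro exI[of _ "j \<bullet> b'"]) (simp add: arrow_iff cmp_rew[OF D(6)])
    show "\<exists>a. arrow a W C \<and> zr C (\<Sigma> A) \<bullet> a = b'" if b': "arrow b' W (\<Sigma> A) \<and> \<sigma> i \<bullet> b' = zr W (\<Sigma> B)" for W b'
    proof -
      have e: "\<sigma> p \<bullet> \<sigma> i = idt (\<Sigma> A)" using A D(5) by (simp add: arrow_iff flip: Sh.F_cmp)
      have b1: "arrow b' W (\<Sigma> A)" and b2: "\<sigma> i \<bullet> b' = zr W (\<Sigma> B)" using b' by blast+
      have "b' = \<sigma> p \<bullet> (\<sigma> i \<bullet> b')" using b1 A by (simp add: arrow_iff cmp_rew[OF e])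
      also have "\<dots> = zr W (\<Sigma> A)" unfolding b2 using b1 A by (simp add: arrow_iff)
      finally have "b' = zr W (\<Sigma> A)" .
      thus ?thesis using b1 A by (intro exI[of _ "zr W C"]) (simp add: arrow_iff)
    qed
  qed (use A D(8) in \<open>simp_all add: arrow_iff\<close>)
  thus ?thesis
  proof (rule tri_from_exact[OF _ t])
    show "arrow (u \<bullet> j) C Z" using A by (simp add: arrow_iff)
    have "u = u \<bullet> (i \<bullet> p \<boxplus> j \<bullet> q)" unfolding D(9) using A by (simp add: arrow_iff)
    also have "\<dots> = (u \<bullet> i) \<bullet> p \<boxplus> (u \<bullet> j) \<bullet> q" using A by (simp add: arrow_iff cmp_pl)
    also have "\<dots> = (u \<bullet> j) \<bullet> q" unfolding tri_comp_zero12[OF t] using A by (simp add: arrow_iff)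
    finally show "(u \<bullet> j) \<bullet> q = u" by simp
    have "v \<bullet> (u \<bullet> j) = (v \<bullet> u) \<bullet> j" using A by (simp add: arrow_iff)
    thus "v \<bullet> (u \<bullet> j) = zr C (\<Sigma> A)" unfolding tri_comp_zero23[OF t] using A by (simp add: arrow_iff)
  qed
qed

text \<open>Exactness at a single spot, to be applied at the three consecutive spots of a sum of
  triangles; at the last one the biproducts are shifted.\<close>

lemma sum_exact:
  assumes X: "is_biproduct T X X' X'' iX iX' pX pX'" and Y: "is_biproduct T Y Y' Y'' iY iY' pY pY'"
    and Z: "is_biproduct T Z Z' Z'' iZ iZ' pZ pZ'"
    and f: "arrow f X Y" "arrow f' X' Y'" and g: "arrow g Y Z" "arrow g' Y' Z'"
    and z: "g \<bullet> f = zr X Z" "g' \<bullet> f' = zr X' Z'"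
    and e: "\<And>W b. \<lbrakk>arrow b W Y; g \<bullet> b = zr W Z\<rbrakk> \<Longrightarrow> \<exists>a. arrow a W X \<and> f \<bullet> a = b"
    and e': "\<And>W b. \<lbrakk>arrow b W Y'; g' \<bullet> b = zr W Z'\<rbrakk> \<Longrightarrow> \<exists>a. arrow a W X' \<and> f' \<bullet> a = b"
  defines "F \<equiv> iY \<bullet> (f \<bullet> pX) \<boxplus> iY' \<bullet> (f' \<bullet> pX')" and "G \<equiv> iZ \<bullet> (g \<bullet> pY) \<boxplus> iZ' \<bullet> (g' \<bullet> pY')"
  shows "arrow F X'' Y''" "arrow G Y'' Z''" "G \<bullet> F = zr X'' Z''"
    "\<And>W b. \<lbrakk>arrow b W Y''; G \<bullet> b = zr W Z''\<rbrakk> \<Longrightarrow> \<exists>a. arrow a W X'' \<and> F \<bullet> a = b"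
proof -
  note X = biproductD[OF X] and Yd = biproductD[OF Y] and Z = biproductD[OF Z]
  note A = X(1-4) Yd(1-4) Z(1-4) f g
  note r = X(5-8) Yd(5-8) Z(5-8) cmp_rew[OF X(5)] cmp_rew[OF X(6)] cmp_rew[OF X(7)] cmp_rew[OF X(8)]
    cmp_rew[OF Yd(5)] cmp_rew[OF Yd(6)] cmp_rew[OF Yd(7)] cmp_rew[OF Yd(8)]
    cmp_rew[OF Z(5)] cmp_rew[OF Z(6)] cmp_rew[OF Z(7)] cmp_rew[OF Z(8)] cmp_rew[OF z(1)] cmp_rew[OF z(2)]
  show F: "arrow F X'' Y''" and G: "arrow G Y'' Z''" using A by (simp_all add: F_def G_def arrow_iff)
  show "G \<bullet> F = zr X'' Z''" using A by (simp add: F_def G_def arrow_iff cmp_pl r)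
  fix W b assume b: "arrow b W Y''" "G \<bullet> b = zr W Z''"
  have "g \<bullet> (pY \<bullet> b) = pZ \<bullet> (G \<bullet> b)" using A b(1) by (simp add: G_def arrow_iff cmp_pl r)
  also have "\<dots> = zr W Z" unfolding b(2) using A b(1) by (simp add: arrow_iff)
  finally obtain a1 where a1: "arrow a1 W X" "f \<bullet> a1 = pY \<bullet> b" using e[of "pY \<bullet> b" W] A b(1) by (auto simp: arrow_iff)
  have "g' \<bullet> (pY' \<bullet> b) = pZ' \<bullet> (G \<bullet> b)" using A b(1) by (simp add: G_def arrow_iff cmp_pl r)
  also have "\<dots> = zr W Z'" unfolding b(2) using A b(1) by (simp add: arrow_iff)
  finally obtain a2 where a2: "arrow a2 W X'" "f' \<bullet> a2 = pY' \<bullet> b" using e'[of "pY' \<bullet> b" W] A b(1) by (auto simp: arrow_iff)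
  have "F \<bullet> (iX \<bullet> a1 \<boxplus> iX' \<bullet> a2) = iY \<bullet> (f \<bullet> a1) \<boxplus> iY' \<bullet> (f' \<bullet> a2)"
    using A a1(1) a2(1) by (simp add: F_def arrow_iff cmp_pl r)
  also have "\<dots> = b" unfolding a1(2) a2(2) by (rule biproduct_decomp[OF Y b(1)])
  finally show "\<exists>a. arrow a W X'' \<and> F \<bullet> a = b"
    using A a1(1) a2(1) by (intro exI[of _ "iX \<bullet> a1 \<boxplus> iX' \<bullet> a2"]) (simp add: arrow_iff)
qed

text \<open>A cone \<open>D\<close> of the summed first map receives fill-ins \<open>c1\<close> and
  \<open>c2\<close> from the two given cones. Together they compare the summed candidate, whose
  exactness is checked summand by summand, with a distinguished triangle.\<close>

lemma tri_sum:
  assumes t: "Tri T A B C x y \<delta>" and t': "Tri T A' B' C' x' y' \<delta>'"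
    and A: "is_biproduct T A A' A'' iA iA' pA pA'" and B: "is_biproduct T B B' B'' iB iB' pB pB'"
    and C: "is_biproduct T C C' C'' iC iC' pC pC'"
  shows "Tri T A'' B'' C'' (iB \<bullet> (x \<bullet> pA) \<boxplus> iB' \<bullet> (x' \<bullet> pA')) (iC \<bullet> (y \<bullet> pB) \<boxplus> iC' \<bullet> (y' \<bullet> pB'))
    (\<sigma> iA \<bullet> (\<delta> \<bullet> pC) \<boxplus> \<sigma> iA' \<bullet> (\<delta>' \<bullet> pC'))" (is "Tri T _ _ _ ?x ?y ?\<delta>")
proof -
  note a = tri_arrow[OF t] tri_arrow[OF t'] and e = exact_candD[OF tri_exact[OF t]] and e' = exact_candD[OF tri_exact[OF t']]
  note SA = Sh.F_biproduct[OF A] and SB = Sh.F_biproduct[OF B]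
  note Ad = biproductD[OF A] and Bd = biproductD[OF B] and Cd = biproductD[OF C]
  note s1 = sum_exact[OF A B C a(1,4,2,5) e(4) e'(4) e(7) e'(7)]
  note s2 = sum_exact[OF B C SA a(2,5,3,6) e(5) e'(5) e(8) e'(8)]
  note s3 = sum_exact[OF C SA SB a(3,6) Sh.F_arrow[OF a(1)] Sh.F_arrow[OF a(4)] e(6) e'(6) e(9) e'(9)]
  note ar = Ad(1-4) Bd(1-4) Cd(1-4) a
  have sx: "\<sigma> ?x = \<sigma> iB \<bullet> (\<sigma> x \<bullet> \<sigma> pA) \<boxplus> \<sigma> iB' \<bullet> (\<sigma> x' \<bullet> \<sigma> pA')" using ar by (simp add: arrow_iff)
  have ex: "exact_cand A'' B'' C'' ?x ?y ?\<delta>" unfolding exact_cand_def sx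
    using s1 s2 s3 by blast
  obtain D u v where D: "Tri T A'' B'' D ?x u v" using s1(1) by (rule tri_cone')
  note ud = tri_arrow[OF D]
  have e1: "iB \<bullet> x = ?x \<bullet> iA" "iB' \<bullet> x' = ?x \<bullet> iA'"
    using ar by (simp_all add: arrow_iff cmp_pl Ad(5-8))
  obtain c1 where c1: "arrow c1 C D" "c1 \<bullet> y = u \<bullet> iB" "\<sigma> iA \<bullet> \<delta> = v \<bullet> c1" by (rule tri_morphism'[OF t D Ad(1) Bd(1) e1(1)])
  obtain c2 where c2: "arrow c2 C' D" "c2 \<bullet> y' = u \<bullet> iB'" "\<sigma> iA' \<bullet> \<delta>' = v \<bullet> c2" by (rule tri_morphism'[OF t' D Ad(2) Bd(2) e1(2)])
  show ?thesis
  proof (rule tri_from_exact[OF ex D])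
    show "arrow (c1 \<bullet> pC \<boxplus> c2 \<bullet> pC') C'' D" using c1(1) c2(1) ar by (simp add: arrow_iff)
    have "(c1 \<bullet> pC \<boxplus> c2 \<bullet> pC') \<bullet> ?y = u \<bullet> (iB \<bullet> pB) \<boxplus> u \<bullet> (iB' \<bullet> pB')"
      using c1(1) c2(1) ar ud by (simp add: arrow_iff cmp_pl cmp_rew[OF Cd(5)] cmp_rew[OF Cd(6)] cmp_rew[OF Cd(7)] cmp_rew[OF Cd(8)]
       cmp_rew[OF c1(2)] cmp_rew[OF c2(2)])
    also have "\<dots> = u \<bullet> (iB \<bullet> pB \<boxplus> iB' \<bullet> pB')" using ar ud by (simp add: arrow_iff cmp_pl)
    also have "\<dots> = u" unfolding Bd(9) using ud by (simp add: arrow_iff)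
    finally show "(c1 \<bullet> pC \<boxplus> c2 \<bullet> pC') \<bullet> ?y = u" .
    show "v \<bullet> (c1 \<bullet> pC \<boxplus> c2 \<bullet> pC') = ?\<delta>"
      using c1(1) c2(1) ar ud
      by (simp add: arrow_iff cmp_pl cmp_rew[OF c1(3)[symmetric]] cmp_rew[OF c2(3)[symmetric]])
  qed
qed

end

section \<open>The extriangulated structure on an extension-closed subcategory\<close>

lemma sub_extricat_simps:
  "Obj (sub_extricat T U) = U" "Hom (sub_extricat T U) = Hom T" "ident (sub_extricat T U) = ident T"
  "cmp (sub_extricat T U) = cmp T" "Ext (sub_extricat T U) C A = ring.truncate (Hom T C (FO (Sh T) A))"
  "Push (sub_extricat T U) C a \<delta> = FM (Sh T) a \<cdot>\<^bsub>T\<^esub> \<delta>" "Pull (sub_extricat T U) A c \<delta> = \<delta> \<cdot>\<^bsub>T\<^esub> c"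
  "Real (sub_extricat T U) A B C x y \<delta> \<longleftrightarrow> A \<in> U \<and> B \<in> U \<and> C \<in> U \<and> Tri T A B C x y \<delta>"
  by (simp_all add: sub_extricat_def full_sub_def lincat.extend_def)

lemma sub_extricat_Ext:
  "ExtEl (sub_extricat T U) C A = Mor T C (FO (Sh T) A)"
  "\<zero>\<^bsub>Ext (sub_extricat T U) C A\<^esub> = \<zero>\<^bsub>Hom T C (FO (Sh T) A)\<^esub>"
  "\<delta> \<oplus>\<^bsub>Ext (sub_extricat T U) C A\<^esub> \<delta>' = \<delta> \<oplus>\<^bsub>Hom T C (FO (Sh T) A)\<^esub> \<delta>'"
  by (simp_all add: sub_extricat_simps ring.truncate_def)

locale extension_closed_subcategory = triangulated k T
  for k :: "('k, 'r) ring_scheme" and T :: "('o, 'm, 'k, 'z) tricat_scheme" +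
  fixes U :: "'o set"
  assumes ext_closed: "extension_closed T U" and zero_mem: "\<exists>Z\<in>U. is_zero_obj T Z"
begin

abbreviation SE where "SE \<equiv> sub_extricat T U"

lemma U_sub: "U \<subseteq> Obj T" and U_obj [simp]: "X \<in> U \<Longrightarrow> X \<in> Obj T"
  using ext_closed unfolding extension_closed_def by blast+

lemma U_ext: "\<lbrakk>Tri T A B C f g h; A \<in> U; C \<in> U\<rbrakk> \<Longrightarrow> B \<in> U"
  using ext_closed unfolding extension_closed_def by blast

lemmas SE_simps = sub_extricat_simps[where T = T and U = U]

lemmas Ext_simps = sub_extricat_Ext[where T = T and U = U]

lemma SE_ext_group:
  assumes CA: "C \<in> U" "A \<in> U" shows "abelian_group (Ext SE C A)"
proof -
  interpret V: abelian_group "Hom T C (\<Sigma> A)" using CA by (simp add: Hom_ag)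
  show ?thesis
  proof (rule abelian_groupI, unfold Ext_simps)
    show "\<exists>y\<in>Mor T C (\<Sigma> A). y \<oplus>\<^bsub>Hom T C (\<Sigma> A)\<^esub> x = zr C (\<Sigma> A)" if "x \<in> Mor T C (\<Sigma> A)" for x
      using that V.l_neg V.a_inv_closed by blast
  qed (simp_all add: V.a_ac)
qed

lemma SE_lin_cat: "lin_cat k SE"
  by (rule lin_cat_subcategory) (use U_sub in \<open>simp_all add: SE_simps\<close>)

lemma SE_biproduct_iff: "is_biproduct SE X Y B i j p q \<longleftrightarrow> is_biproduct T X Y B i j p q \<and> X \<in> U \<and> Y \<in> U \<and> B \<in> U"
  unfolding is_biproduct_def SE_simps using U_obj by blast

lemma SE_additive: "additive_cat k SE"
proof (rule additive_cat.intro[OF SE_lin_cat], unfold_locales, unfold SE_simps)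
  show "\<exists>Z. is_zero_obj SE Z"
    using zero_mem unfolding is_zero_obj_def hom_zero_def SE_simps by (meson U_obj)
  show "\<exists>B i j p q. is_biproduct SE X Y B i j p q" if XY: "X \<in> U" "Y \<in> U" for X Y
  proof -
    obtain B i j p q where b: "is_biproduct T X Y B i j p q" using biproduct_exists XY U_obj by blast
    \<comment> \<open>A biproduct is the middle term of a split triangle, so closure under
      extensions also gives biproducts.\<close>
    hence "B \<in> U" using U_ext[OF biproduct_tri[OF b]] XY by blast
    thus ?thesis using b XY unfolding SE_biproduct_iff by blast
  qed
qed

lemma SE_iso_iff: "is_iso SE X Y f \<longleftrightarrow> is_iso T X Y f \<and> X \<in> U \<and> Y \<in> U"
  unfolding is_iso_def SE_simps using U_obj by blast

lemma Mor_U: "\<lbrakk>X \<in> U; Y \<in> U\<rbrakk> \<Longrightarrow> f \<in> Mor T X Y \<longleftrightarrow> arrow f X Y"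
  "\<lbrakk>X \<in> U; Y \<in> U\<rbrakk> \<Longrightarrow> f \<in> Mor T X (\<Sigma> Y) \<longleftrightarrow> arrow f X (\<Sigma> Y)"
  by (simp_all add: Mor_arrow)

text \<open>The octahedral axiom starts from composable first maps, so it is applied to the rotated
  triangles beginning with \<open>g\<close>, \<open>f\<close> and \<open>f \<bullet> g\<close>. It
  yields the shift of the required triangle; unshifting removes the signs that rotation has
  introduced.\<close>

lemma ET4op_tri:
  assumes t: "Tri T D B A f' f \<delta>" and t': "Tri T F C B g' g \<delta>'"
  obtains G h' d e \<delta>'' where "Tri T G C A h' (f \<bullet> g) \<delta>''" "arrow d G D" "arrow e F G" 
    "g \<bullet> h' = f' \<bullet> d" "h' \<bullet> e = g'" "Tri T F G D e d (\<delta>' \<bullet> f')" "\<sigma> d \<bullet> \<delta>'' = \<delta>" "\<delta>'' \<bullet> f = \<sigma> e \<bullet> \<delta>'"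
proof -
  note A = tri_arrow[OF t] tri_arrow[OF t'] and O = tri_obj[OF t] tri_obj[OF t']
  have "arrow (f \<bullet> g) C A" using A by (simp add: arrow_iff)
  then obtain G h' \<delta>'' where G: "Tri T G C A h' (f \<bullet> g) \<delta>''" by (rule tri_cocone)
  note AG = tri_arrow[OF G] and OG = tri_obj[OF G]
  obtain a b where ab: "Tri T (\<Sigma> F) (\<Sigma> G) (\<Sigma> D) a b (\<sigma> \<delta>' \<bullet> (\<boxminus> \<sigma> f'))"
     and eq: "a \<bullet> \<delta>' = \<delta>'' \<bullet> f" "(\<boxminus> \<sigma> h') \<bullet> a = \<boxminus> \<sigma> g'" "b \<bullet> \<delta>'' = \<delta>" "(\<boxminus> \<sigma> f') \<bullet> b = \<sigma> g \<bullet> (\<boxminus> \<sigma> h')"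
    using tri_octahedral[OF tri_rot[OF t'] tri_rot[OF t] tri_rot[OF G]] by blast
  note Aab = tri_arrow[OF ab]
  have sab: "\<sigma> (\<sigma>\<^sub>- a) = a" "\<sigma> (\<sigma>\<^sub>- b) = b" using Aab by (simp_all add: arrow_iff)
  have ar: "arrow (\<sigma>\<^sub>- b) G D" "arrow (\<sigma>\<^sub>- a) F G" using Aab O OG by (simp_all add: arrow_iff)
  have ab': "Tri T (\<Sigma> F) (\<Sigma> G) (\<Sigma> D) (\<sigma> (\<sigma>\<^sub>- a)) (\<sigma> (\<sigma>\<^sub>- b)) (\<boxminus> \<sigma> (\<delta>' \<bullet> f'))"
    using ab A unfolding sab by (simp add: arrow_iff cmp_ng)
  have t3: "Tri T F G D (\<sigma>\<^sub>- a) (\<sigma>\<^sub>- b) (\<delta>' \<bullet> f')"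
    by (rule tri_shift_iff[THEN iffD2, OF _ _ _ ab']) (use ar A in \<open>simp_all add: arrow_iff\<close>)
  have "\<boxminus> (\<sigma> (h' \<bullet> \<sigma>\<^sub>- a)) = \<boxminus> (\<sigma> g')" using eq(2) AG Aab ar sab by (simp add: arrow_iff cmp_ng)
  hence "\<sigma> (h' \<bullet> \<sigma>\<^sub>- a) = \<sigma> g'" using ng_ng[of "\<sigma> (h' \<bullet> \<sigma>\<^sub>- a)"] ng_ng[of "\<sigma> g'"] AG ar A by (simp add: arrow_iff)
  hence "\<sigma>\<^sub>- (\<sigma> (h' \<bullet> \<sigma>\<^sub>- a)) = \<sigma>\<^sub>- (\<sigma> g')" by simp
  hence 1: "h' \<bullet> \<sigma>\<^sub>- a = g'" using AG ar A by (simp add: arrow_iff)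
  have "\<boxminus> (\<sigma> (f' \<bullet> \<sigma>\<^sub>- b)) = \<boxminus> (\<sigma> (g \<bullet> h'))" using eq(4) AG Aab ar A sab by (simp add: arrow_iff cmp_ng)
  hence "\<sigma> (f' \<bullet> \<sigma>\<^sub>- b) = \<sigma> (g \<bullet> h')" using ng_ng[of "\<sigma> (f' \<bullet> \<sigma>\<^sub>- b)"] ng_ng[of "\<sigma> (g \<bullet> h')"] AG ar A by (simp add: arrow_iff)
  hence "\<sigma>\<^sub>- (\<sigma> (f' \<bullet> \<sigma>\<^sub>- b)) = \<sigma>\<^sub>- (\<sigma> (g \<bullet> h'))" by simp
  hence 2: "g \<bullet> h' = f' \<bullet> \<sigma>\<^sub>- b" using AG ar A by (simp add: arrow_iff)
  show ?thesis by (rule that[OF G ar 2 1 t3]) (use eq sab in simp_all)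
qed

text \<open>The axioms are those of a triangulated category restricted to \<open>U\<close>.
  Extension closure is what keeps the objects produced by them inside \<open>U\<close>: the middle
  term that realises an extension, and the new object in \<open>ET4\<close> and
  \<open>ET4op\<close>, which is itself an extension.\<close>

lemma SE_extriangulated: "extriangulated k SE"
proof (rule extriangulated.intro[OF SE_additive], rule extriangulated_axioms.intro, unfold Ext_simps SE_simps(1-4,6-) SE_biproduct_iff)
  fix C A assume "C \<in> U" "A \<in> U"
  thus "abelian_group (Ext SE C A)" by (rule SE_ext_group)
next
  fix A B C x y \<delta> A' B' C' x' y' \<delta>' a c
  assume t: "A \<in> U \<and> B \<in> U \<and> C \<in> U \<and> Tri T A B C x y \<delta>" and t': "A' \<in> U \<and> B' \<in> U \<and> C' \<in> U \<and> Tri T A' B' C' x' y' \<delta>'"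
    and ac: "a \<in> Mor T A A'" "c \<in> Mor T C C'" and sq: "\<sigma> a \<bullet> \<delta> = \<delta>' \<bullet> c"
  have "arrow a A A'" "arrow c C C'" using ac t t' by (simp_all add: Mor_U)
  from tri_morphism_mid[OF _ _ this sq] t t' show "\<exists>b\<in>Mor T B B'. b \<bullet> x = x' \<bullet> a \<and> y' \<bullet> b = c \<bullet> y"
    by (metis arrow_Mor)
next
  fix A B C x y \<delta> A' B' C' x' y' \<delta>' a b
  assume t: "A \<in> U \<and> B \<in> U \<and> C \<in> U \<and> Tri T A B C x y \<delta>" and t': "A' \<in> U \<and> B' \<in> U \<and> C' \<in> U \<and> Tri T A' B' C' x' y' \<delta>'"
    and ac: "a \<in> Mor T A A'" "b \<in> Mor T B B'" and sq: "b \<bullet> x = x' \<bullet> a"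
  have "arrow a A A'" "arrow b B B'" using ac t t' by (simp_all add: Mor_U)
  from tri_morphism'[OF _ _ this sq] t t' show "\<exists>c\<in>Mor T C C'. c \<bullet> y = y' \<bullet> b \<and> \<sigma> a \<bullet> \<delta> = \<delta>' \<bullet> c"
    by (metis arrow_Mor)
next
  fix A B C x y \<delta> A' B' C' x' y' \<delta>' b c
  assume t: "A \<in> U \<and> B \<in> U \<and> C \<in> U \<and> Tri T A B C x y \<delta>" and t': "A' \<in> U \<and> B' \<in> U \<and> C' \<in> U \<and> Tri T A' B' C' x' y' \<delta>'"
    and ac: "b \<in> Mor T B B'" "c \<in> Mor T C C'" and sq: "c \<bullet> y = y' \<bullet> b"
  have "arrow b B B'" "arrow c C C'" using ac t t' by (simp_all add: Mor_U)
  from tri_morphism_left[OF _ _ this sq] t t' show "\<exists>a\<in>Mor T A A'. b \<bullet> x = x' \<bullet> a \<and> \<sigma> a \<bullet> \<delta> = \<delta>' \<bullet> c"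
    by (metis arrow_Mor)
next
  fix A B C x y \<delta> B' x' y'
  assume t: "A \<in> U \<and> B \<in> U \<and> C \<in> U \<and> Tri T A B C x y \<delta>" and B': "B' \<in> U" and m: "x' \<in> Mor T A B'" "y' \<in> Mor T B' C"
  have xy: "arrow x' A B'" "arrow y' B' C" using m t B' by (simp_all add: Mor_U)
  have o: "A \<in> Obj T" "C \<in> Obj T" using t by simp_all
  note A = tri_arrow[of A B C x y \<delta>]
  show "A \<in> U \<and> B' \<in> U \<and> C \<in> U \<and> Tri T A B' C x' y' \<delta> \<longleftrightarrow> seq_equiv SE B x y B' x' y'"
  proof
    assume "A \<in> U \<and> B' \<in> U \<and> C \<in> U \<and> Tri T A B' C x' y' \<delta>"
    hence t': "Tri T A B' C x' y' \<delta>" by blast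
    have e: "\<sigma> (idt A) \<bullet> \<delta> = \<delta> \<bullet> idt C" using tri_arrow(3)[OF t'] o by (simp add: arrow_iff)
    obtain b where b: "arrow b B B'" "b \<bullet> x = x' \<bullet> idt A" "idt C \<bullet> y = y' \<bullet> b"
      using tri_morphism_mid[OF _ t' arrow_ident[OF o(1)] arrow_ident[OF o(2)] e] t by metis
    have "is_iso T B B' b"
      by (rule tri_iso_mid[OF _ t' is_iso_ident[OF o(1)] is_iso_ident[OF o(2)] b e]) (use t in blast)
    moreover have "b \<bullet> x = x'" "y' \<bullet> b = y" using b t A xy by (auto simp: arrow_iff)
    ultimately show "seq_equiv SE B x y B' x' y'" using t B' unfolding seq_equiv_def SE_simps SE_iso_iff by blast
  next
    assume "seq_equiv SE B x y B' x' y'"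
    then obtain b where b: "is_iso T B B' b" "b \<bullet> x = x'" "y' \<bullet> b = y" unfolding seq_equiv_def SE_simps SE_iso_iff by blast
    have tt: "Tri T A B C x y \<delta>" using t by blast
    have "Tri T A B' C x' y' \<delta>"
      by (rule tri_change_iso[OF tt is_iso_ident[OF o(1)] b(1) is_iso_ident[OF o(2)] xy tri_arrow(3)[OF tt]])
        (use A[OF tt] b xy in \<open>simp_all add: arrow_iff\<close>)
    thus "A \<in> U \<and> B' \<in> U \<and> C \<in> U \<and> Tri T A B' C x' y' \<delta>" using t B' by blast
  qed
next
  fix A B C x y \<delta> A' B' C' x' y' \<delta>' A'' iA iA' pA pA' B'' iB iB' pB pB' C'' iC iC' pC pC'
  assume t: "A \<in> U \<and> B \<in> U \<and> C \<in> U \<and> Tri T A B C x y \<delta>" and t': "A' \<in> U \<and> B' \<in> U \<and> C' \<in> U \<and> Tri T A' B' C' x' y' \<delta>'"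
    and A: "is_biproduct T A A' A'' iA iA' pA pA' \<and> A \<in> U \<and> A' \<in> U \<and> A'' \<in> U"
    and B: "is_biproduct T B B' B'' iB iB' pB pB' \<and> B \<in> U \<and> B' \<in> U \<and> B'' \<in> U"
    and C: "is_biproduct T C C' C'' iC iC' pC pC' \<and> C \<in> U \<and> C' \<in> U \<and> C'' \<in> U"
  have tt: "Tri T A B C x y \<delta>" "Tri T A' B' C' x' y' \<delta>'" and bb: "is_biproduct T A A' A'' iA iA' pA pA'"
    "is_biproduct T B B' B'' iB iB' pB pB'" "is_biproduct T C C' C'' iC iC' pC pC'"
    using t t' A B C by blast+
  note ar = tri_arrow[OF tt(1)] tri_arrow[OF tt(2)] biproductD(1-4)[OF bb(1)] biproductD(1-4)[OF bb(2)] biproductD(1-4)[OF bb(3)]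
  have "arrow (iB \<bullet> (x \<bullet> pA)) A'' B''" "arrow (iC \<bullet> (y \<bullet> pB)) B'' C''" "arrow (\<sigma> iA \<bullet> (\<delta> \<bullet> pC)) C'' (\<Sigma> A'')"
    using ar by (simp_all add: arrow_iff)
  note e = this[THEN pl_eq]
  show "A'' \<in> U \<and> B'' \<in> U \<and> C'' \<in> U \<and> Tri T A'' B'' C''
      ((iB \<bullet> x \<bullet> pA) \<oplus>\<^bsub>Hom T A'' B''\<^esub> (iB' \<bullet> x' \<bullet> pA'))
      ((iC \<bullet> y \<bullet> pB) \<oplus>\<^bsub>Hom T B'' C''\<^esub> (iC' \<bullet> y' \<bullet> pB'))
      ((\<sigma> iA \<bullet> \<delta> \<bullet> pC) \<oplus>\<^bsub>Hom T C'' (\<Sigma> A'')\<^esub> (\<sigma> iA' \<bullet> \<delta>' \<bullet> pC'))"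
    unfolding e using tri_sum[OF tt bb] A B C by blast
next
  fix A B D f f' \<delta> C F g g' \<delta>'
  assume t: "A \<in> U \<and> B \<in> U \<and> D \<in> U \<and> Tri T A B D f f' \<delta>" and t': "B \<in> U \<and> C \<in> U \<and> F \<in> U \<and> Tri T B C F g g' \<delta>'"
  have tt: "Tri T A B D f f' \<delta>" "Tri T B C F g g' \<delta>'" using t t' by blast+
  have "arrow (g \<bullet> f) A C" using tri_arrow[OF tt(1)] tri_arrow[OF tt(2)] by (simp add: arrow_iff)
  then obtain G h' \<delta>'' where G: "Tri T A C G (g \<bullet> f) h' \<delta>''" by (rule tri_cone')
  obtain d e where de: "Tri T D G F d e (\<sigma> f' \<bullet> \<delta>')" and eq: "d \<bullet> f' = h' \<bullet> g" "\<delta>'' \<bullet> d = \<delta>" "e \<bullet> h' = g'" "\<delta>' \<bullet> e = \<sigma> f \<bullet> \<delta>''"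
    using tri_octahedral[OF tt G] by blast
  have GU: "G \<in> U" using U_ext[OF de] t t' by blast
  have m: "d \<in> Mor T D G" "e \<in> Mor T G F" using tri_arrow[OF de] arrow_Mor by blast+
  show "\<exists>G\<in>U. \<exists>h' d e \<delta>''.
              (A \<in> U \<and> C \<in> U \<and> G \<in> U \<and> Tri T A C G (g \<bullet> f) h' \<delta>'') \<and>
              d \<in> Mor T D G \<and> e \<in> Mor T G F \<and>
              h' \<bullet> g = d \<bullet> f' \<and> e \<bullet> h' = g' \<and>
              (D \<in> U \<and> G \<in> U \<and> F \<in> U \<and> Tri T D G F d e (\<sigma> f' \<bullet> \<delta>')) \<and>
              \<delta>'' \<bullet> d = \<delta> \<and> \<sigma> f \<bullet> \<delta>'' = \<delta>' \<bullet> e"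
    using GU G de m eq t t' by metis
next
  fix D B A f' f \<delta> F C g' g \<delta>'
  assume t: "D \<in> U \<and> B \<in> U \<and> A \<in> U \<and> Tri T D B A f' f \<delta>" and t': "F \<in> U \<and> C \<in> U \<and> B \<in> U \<and> Tri T F C B g' g \<delta>'"
  have tt: "Tri T D B A f' f \<delta>" "Tri T F C B g' g \<delta>'" using t t' by blast+
  obtain G h' d e \<delta>'' where G: "Tri T G C A h' (f \<bullet> g) \<delta>''" "arrow d G D" "arrow e F G" 
    "g \<bullet> h' = f' \<bullet> d" "h' \<bullet> e = g'" "Tri T F G D e d (\<delta>' \<bullet> f')" "\<sigma> d \<bullet> \<delta>'' = \<delta>" "\<delta>'' \<bullet> f = \<sigma> e \<bullet> \<delta>'"
    using tt by (rule ET4op_tri)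
  have GU: "G \<in> U" using U_ext[OF G(6)] t t' by blast
  have m: "d \<in> Mor T G D" "e \<in> Mor T F G" using G(2,3) arrow_Mor by blast+
  show "\<exists>G\<in>U. \<exists>h' d e \<delta>''.
              (G \<in> U \<and> C \<in> U \<and> A \<in> U \<and> Tri T G C A h' (f \<bullet> g) \<delta>'') \<and>
              d \<in> Mor T G D \<and> e \<in> Mor T F G \<and>
              g \<bullet> h' = f' \<bullet> d \<and> h' \<bullet> e = g' \<and>
              (F \<in> U \<and> G \<in> U \<and> D \<in> U \<and> Tri T F G D e d (\<delta>' \<bullet> f')) \<and>
              \<sigma> d \<bullet> \<delta>'' = \<delta> \<and> \<delta>'' \<bullet> f = \<sigma> e \<bullet> \<delta>'"
    using GU G m t t' by metis
next
  fix A C B i j p q assume "is_biproduct T A C B i j p q \<and> A \<in> U \<and> C \<in> U \<and> B \<in> U"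
  thus "A \<in> U \<and> B \<in> U \<and> C \<in> U \<and> Tri T A B C i q (zr C (\<Sigma> A))" using biproduct_tri by blast
next
  fix A B C x y \<delta> assume *: "A \<in> U \<and> B \<in> U \<and> C \<in> U \<and> Tri T A B C x y \<delta>"
  hence "Tri T A B C x y \<delta>" by blast
  from tri_arrow[OF this, THEN arrow_Mor] *
  show "A \<in> U \<and> B \<in> U \<and> C \<in> U \<and> x \<in> Mor T A B \<and> y \<in> Mor T B C \<and> \<delta> \<in> Mor T C (\<Sigma> A)" by blast
next
  fix A C \<delta> assume *: "A \<in> U" "C \<in> U" "\<delta> \<in> Mor T C (\<Sigma> A)"
  hence "arrow \<delta> C (\<Sigma> A)" "A \<in> Obj T" by (simp_all add: Mor_U)
  then obtain B x y where "Tri T A B C x y \<delta>" by (rule tri_cone_third)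
  thus "\<exists>B x y. A \<in> U \<and> B \<in> U \<and> C \<in> U \<and> Tri T A B C x y \<delta>" using U_ext * by blast
next
  fix A A' C a a' \<delta> assume "A \<in> U" "A' \<in> U" "C \<in> U" "a \<in> Mor T A A'" "a' \<in> Mor T A A'" "\<delta> \<in> Mor T C (\<Sigma> A)"
  hence *: "arrow a A A'" "arrow a' A A'" "arrow \<delta> C (\<Sigma> A)" by (simp_all add: Mor_U)
  have "arrow (\<sigma> a \<bullet> \<delta>) C (\<Sigma> A')" using * by (simp add: arrow_iff)
  thus "\<sigma> (a \<oplus>\<^bsub>Hom T A A'\<^esub> a') \<bullet> \<delta> = \<sigma> a \<bullet> \<delta> \<oplus>\<^bsub>Hom T C (\<Sigma> A')\<^esub> \<sigma> a' \<bullet> \<delta>"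
    using * by (simp add: pl_eq[OF *(1)] pl_eq[of "\<sigma> a \<bullet> \<delta>"] arrow_iff cmp_pl)
next
  fix A C C' c c' \<delta> assume "A \<in> U" "C \<in> U" "C' \<in> U" "c \<in> Mor T C' C" "c' \<in> Mor T C' C" "\<delta> \<in> Mor T C (\<Sigma> A)"
  hence *: "arrow c C' C" "arrow c' C' C" "arrow \<delta> C (\<Sigma> A)" by (simp_all add: Mor_U)
  have "arrow (\<delta> \<bullet> c) C' (\<Sigma> A)" using * by (simp add: arrow_iff)
  thus "\<delta> \<bullet> (c \<oplus>\<^bsub>Hom T C' C\<^esub> c') = \<delta> \<bullet> c \<oplus>\<^bsub>Hom T C' (\<Sigma> A)\<^esub> \<delta> \<bullet> c'"
    using * by (simp add: pl_eq[OF *(1)] pl_eq[of "\<delta> \<bullet> c"] arrow_iff cmp_pl)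
next
  fix A A' C a \<delta> \<delta>' assume "A \<in> U" "A' \<in> U" "C \<in> U" "a \<in> Mor T A A'" "\<delta> \<in> Mor T C (\<Sigma> A)" "\<delta>' \<in> Mor T C (\<Sigma> A)"
  hence *: "arrow a A A'" "arrow \<delta> C (\<Sigma> A)" "arrow \<delta>' C (\<Sigma> A)" by (simp_all add: Mor_U)
  have "arrow (\<sigma> a \<bullet> \<delta>) C (\<Sigma> A')" using * by (simp add: arrow_iff)
  thus "\<sigma> a \<bullet> (\<delta> \<oplus>\<^bsub>Hom T C (\<Sigma> A)\<^esub> \<delta>') = \<sigma> a \<bullet> \<delta> \<oplus>\<^bsub>Hom T C (\<Sigma> A')\<^esub> \<sigma> a \<bullet> \<delta>'"
    using * by (simp add: pl_eq[OF *(2)] pl_eq[of "\<sigma> a \<bullet> \<delta>"] arrow_iff cmp_pl)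
next
  fix A C C' c \<delta> \<delta>' assume "A \<in> U" "C \<in> U" "C' \<in> U" "c \<in> Mor T C' C" "\<delta> \<in> Mor T C (\<Sigma> A)" "\<delta>' \<in> Mor T C (\<Sigma> A)"
  hence *: "arrow c C' C" "arrow \<delta> C (\<Sigma> A)" "arrow \<delta>' C (\<Sigma> A)" by (simp_all add: Mor_U)
  have "arrow (\<delta> \<bullet> c) C' (\<Sigma> A)" using * by (simp add: arrow_iff)
  thus "(\<delta> \<oplus>\<^bsub>Hom T C (\<Sigma> A)\<^esub> \<delta>') \<bullet> c = \<delta> \<bullet> c \<oplus>\<^bsub>Hom T C' (\<Sigma> A)\<^esub> \<delta>' \<bullet> c"
    using * by (simp add: pl_eq[OF *(2)] pl_eq[of "\<delta> \<bullet> c"] arrow_iff cmp_pl)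
qed (simp_all add: Mor_U arrow_iff)

end


section \<open>Additive quotients\<close>

lemma additive_cat_cong:
  assumes "additive_cat k C" "Obj D = Obj C" "Hom D = Hom C" "ident D = ident C" "cmp D = cmp C"
  shows "additive_cat k D"
proof -
  interpret additive_cat k C by fact
  have "lin_cat k D" by (rule lin_cat_subcategory) (use assms in simp_all)
  moreover have "is_zero_obj D = is_zero_obj C" "is_biproduct D = is_biproduct C"
    unfolding is_zero_obj_def hom_zero_def is_biproduct_def assms(2-) by simp_all
  ultimately show ?thesis
    using zero_obj_exists biproduct_exists
    by (intro additive_cat.intro additive_cat_axioms.intro) (simp_all add: assms(2))
qed

text \<open>The ideal of a full functor is the ideal of an additive quotient as soon as it consists of the
morphisms that factor through \<open>P\<close>; no closure property of \<open>P\<close> is then needed.\<close>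

locale factor_kernel = lin_fun k C D F
  for k :: "('k, 'r) ring_scheme" and C :: "('o, 'm, 'k, 'y) lincat_scheme"
    and D :: "('p, 'n, 'k, 'z) lincat_scheme" and F :: "('o, 'm, 'p, 'n) fct" +
  fixes P :: "'o set"
  assumes kernel: "\<lbrakk>X \<in> Obj C; Y \<in> Obj C\<rbrakk> \<Longrightarrow>
      f \<in> factor_ideal C P X Y \<longleftrightarrow> C.arrow f X Y \<and> FM F f = D.zr (FO F X) (FO F Y)"
begin

abbreviation AQ where "AQ \<equiv> additive_quotient C P"

text \<open>Fibres of \<open>F\<close> on a hom space. They are the cosets of the ideal, and
  computing with them turns statements on the quotient into statements on images under
  \<open>F\<close>.\<close>

definition cl where "cl f = {h. C.arrow h (C.src f) (C.tgt f) \<and> FM F h = FM F f}"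

lemma cl_self: "C.ar f \<Longrightarrow> f \<in> cl f"
  using C.ar_arrow by (simp add: cl_def)

lemma cl_eq_iff: "\<lbrakk>C.arrow f X Y; C.arrow g X Y\<rbrakk> \<Longrightarrow> cl f = cl g \<longleftrightarrow> FM F f = FM F g"
  using cl_self[of f] by (auto simp: cl_def C.arrow_iff)

lemma coset_eq:
  assumes f: "C.arrow f X Y"
  shows "factor_ideal C P X Y +>\<^bsub>Hom C X Y\<^esub> f = cl f"
proof -
  have A: "C.ar f" "C.src f = X" "C.tgt f = Y" "X \<in> Obj C" "Y \<in> Obj C" using f by (simp_all add: C.arrow_iff)
  have k: "i \<in> factor_ideal C P X Y \<longleftrightarrow> C.arrow i X Y \<and> FM F i = D.zr (FO F X) (FO F Y)" for i
    using kernel A by blast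
  show ?thesis
  proof (intro equalityI subsetI)
    fix h assume "h \<in> factor_ideal C P X Y +>\<^bsub>Hom C X Y\<^esub> f"
    then obtain i where i: "C.arrow i X Y" "FM F i = D.zr (FO F X) (FO F Y)" "h = i \<oplus>\<^bsub>Hom C X Y\<^esub> f"
      unfolding a_r_coset_def' using k by blast
    have "h = C.pl i f" using i C.pl_eq[OF i(1)] by simp
    thus "h \<in> cl f" using i(1,2) A by (simp add: cl_def C.arrow_iff)
  next
    fix h assume "h \<in> cl f"
    hence h: "C.arrow h X Y" "FM F h = FM F f" using A by (simp_all add: cl_def)
    let ?i = "C.pl h (C.ng f)"
    have i: "C.arrow ?i X Y" using h A by (simp add: C.arrow_iff)
    have "?i \<in> factor_ideal C P X Y" unfolding k using i h(1) A by (simp add: C.arrow_iff h(2))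
    moreover have "h = ?i \<oplus>\<^bsub>Hom C X Y\<^esub> f" using C.pl_eq[OF i] h(1) A by (simp add: C.arrow_iff C.pl_assoc)
    ultimately show "h \<in> factor_ideal C P X Y +>\<^bsub>Hom C X Y\<^esub> f" unfolding a_r_coset_def' by blast
  qed
qed

lemma AQ_simps: "Obj AQ = Obj C" "Hom AQ = quotient_hom C P"
  by (simp_all add: additive_quotient_def)

lemma ideal_eq: "\<lbrakk>X \<in> Obj C; Y \<in> Obj C\<rbrakk> \<Longrightarrow> factor_ideal C P X Y = cl (C.zr X Y)"
  using kernel by (auto simp: cl_def)

lemma AQ_ident: "X \<in> Obj C \<Longrightarrow> ident AQ X = cl (ident C X)"
  using coset_eq[OF C.arrow_ident] by (simp add: additive_quotient_def)

lemma AQ_zero: "\<lbrakk>X \<in> Obj C; Y \<in> Obj C\<rbrakk> \<Longrightarrow> \<zero>\<^bsub>quotient_hom C P X Y\<^esub> = cl (C.zr X Y)"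
  using ideal_eq by (simp add: quotient_hom_def Let_def)

lemma AQ_carrier:
  assumes "X \<in> Obj C" "Y \<in> Obj C"
  shows "a \<in> carrier (quotient_hom C P X Y) \<longleftrightarrow> (\<exists>f. C.arrow f X Y \<and> a = cl f)"
proof -
  have "a \<in> carrier (quotient_hom C P X Y) \<longleftrightarrow> (\<exists>f\<in>Mor C X Y. a = factor_ideal C P X Y +>\<^bsub>Hom C X Y\<^esub> f)"
    by (auto simp: quotient_hom_def Let_def A_RCOSETS_def')
  also have "\<dots> \<longleftrightarrow> (\<exists>f. C.arrow f X Y \<and> a = cl f)" using coset_eq C.Mor_arrow[OF assms] by metis
  finally show ?thesis .
qed

lemma AQ_add:
  assumes "C.arrow f X Y" "C.arrow g X Y"
  shows "cl f \<oplus>\<^bsub>quotient_hom C P X Y\<^esub> cl g = cl (C.pl f g)"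
proof -
  have A: "C.ar f" "C.src f = X" "C.tgt f = Y" "C.ar g" "C.src g = X" "C.tgt g = Y" "X \<in> Obj C" "Y \<in> Obj C"
    using assms by (simp_all add: C.arrow_iff)
  have "cl f \<oplus>\<^bsub>quotient_hom C P X Y\<^esub> cl g = {u. \<exists>x\<in>cl f. \<exists>y\<in>cl g. u = x \<oplus>\<^bsub>Hom C X Y\<^esub> y}"
    by (auto simp: quotient_hom_def Let_def set_add_def')
  also have "\<dots> = cl (C.pl f g)"
  proof (intro equalityI subsetI)
    fix u assume "u \<in> {u. \<exists>x\<in>cl f. \<exists>y\<in>cl g. u = x \<oplus>\<^bsub>Hom C X Y\<^esub> y}"
    then obtain x y where x: "C.arrow x X Y" "FM F x = FM F f" "C.arrow y X Y" "FM F y = FM F g" "u = x \<oplus>\<^bsub>Hom C X Y\<^esub> y"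
      using A by (auto simp: cl_def)
    have "u = C.pl x y" using x C.pl_eq[OF x(1)] by simp
    thus "u \<in> cl (C.pl f g)" using x(1-4) A by (simp add: cl_def C.arrow_iff)
  next
    fix u assume "u \<in> cl (C.pl f g)"
    hence u: "C.arrow u X Y" "FM F u = D.pl (FM F f) (FM F g)" using A by (simp_all add: cl_def)
    let ?y = "C.pl (C.ng f) u"
    have "FM F ?y = FM F g" using u(1) A by (simp add: C.arrow_iff u(2))
    hence "?y \<in> cl g" using u(1) A by (simp add: cl_def C.arrow_iff)
    moreover have "u = f \<oplus>\<^bsub>Hom C X Y\<^esub> ?y" using C.pl_eq[OF assms(1)] u(1) A by (simp add: C.arrow_iff)
    ultimately show "u \<in> {u. \<exists>x\<in>cl f. \<exists>y\<in>cl g. u = x \<oplus>\<^bsub>Hom C X Y\<^esub> y}" using cl_self[OF A(1)] by blast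
  qed
  finally show ?thesis .
qed

lemma AQ_smult:
  assumes c: "c \<in> carrier k" and f: "C.arrow f X Y"
  shows "c \<odot>\<^bsub>quotient_hom C P X Y\<^esub> cl f = cl (C.sm c f)"
proof -
  have A: "C.ar f" "C.src f = X" "C.tgt f = Y" "X \<in> Obj C" "Y \<in> Obj C"
    using f by (simp_all add: C.arrow_iff)
  have "c \<odot>\<^bsub>quotient_hom C P X Y\<^esub> cl f = {u. \<exists>i\<in>factor_ideal C P X Y. \<exists>x\<in>cl f. u = i \<oplus>\<^bsub>Hom C X Y\<^esub> (c \<odot>\<^bsub>Hom C X Y\<^esub> x)}"
    by (auto simp: quotient_hom_def Let_def set_add_def')
  also have "\<dots> = cl (C.sm c f)"
  proof (intro equalityI subsetI)
    fix u assume "u \<in> {u. \<exists>i\<in>factor_ideal C P X Y. \<exists>x\<in>cl f. u = i \<oplus>\<^bsub>Hom C X Y\<^esub> (c \<odot>\<^bsub>Hom C X Y\<^esub> x)}"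
    then obtain i x where x: "C.arrow i X Y" "FM F i = D.zr (FO F X) (FO F Y)" "C.arrow x X Y" "FM F x = FM F f"
      "u = i \<oplus>\<^bsub>Hom C X Y\<^esub> (c \<odot>\<^bsub>Hom C X Y\<^esub> x)"
      using A kernel[OF A(4,5)] by (auto simp: cl_def)
    have "u = C.pl i (C.sm c x)" using x C.pl_eq[OF x(1)] C.sm_eq[OF x(3)] by simp
    thus "u \<in> cl (C.sm c f)" using x(1-4) A c by (simp add: cl_def C.arrow_iff)
  next
    fix u assume "u \<in> cl (C.sm c f)"
    hence u: "C.arrow u X Y" "FM F u = D.sm c (FM F f)" using A c by (simp_all add: cl_def)
    let ?i = "C.pl u (C.ng (C.sm c f))"
    have i: "C.arrow ?i X Y" using u(1) A c by (simp add: C.arrow_iff)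
    have "FM F ?i = D.zr (FO F X) (FO F Y)" using u(1) A c by (simp add: C.arrow_iff u(2))
    hence "?i \<in> factor_ideal C P X Y" using kernel[OF A(4,5)] i by blast
    moreover have "u = ?i \<oplus>\<^bsub>Hom C X Y\<^esub> (c \<odot>\<^bsub>Hom C X Y\<^esub> f)"
      using C.pl_eq[OF i] C.sm_eq[OF f] u(1) A c by (simp add: C.arrow_iff C.pl_assoc)
    ultimately show "u \<in> {u. \<exists>i\<in>factor_ideal C P X Y. \<exists>x\<in>cl f. u = i \<oplus>\<^bsub>Hom C X Y\<^esub> (c \<odot>\<^bsub>Hom C X Y\<^esub> x)}"
      using cl_self[OF A(1)] by blast
  qed
  finally show ?thesis .
qed

lemma AQ_cmp:
  assumes "C.arrow f X Y" "C.arrow g Y Z"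
  shows "cl g \<cdot>\<^bsub>AQ\<^esub> cl f = cl (g \<cdot>\<^bsub>C\<^esub> f)"
proof -
  have A: "C.ar f" "C.src f = X" "C.tgt f = Y" "C.ar g" "C.src g = Y" "C.tgt g = Z" "X \<in> Obj C" "Y \<in> Obj C" "Z \<in> Obj C"
    using assms by (simp_all add: C.arrow_iff)
  have *: "factor_ideal C P X' Z' +>\<^bsub>Hom C X' Z'\<^esub> (g' \<cdot>\<^bsub>C\<^esub> f') = cl (g \<cdot>\<^bsub>C\<^esub> f)"
    if "X' \<in> Obj C" "Y' \<in> Obj C" "Z' \<in> Obj C" "f' \<in> cl f \<inter> Mor C X' Y'" "g' \<in> cl g \<inter> Mor C Y' Z'" for X' Y' Z' f' g'
  proof -
    have f': "C.arrow f' X Y" "FM F f' = FM F f" and g': "C.arrow g' Y Z" "FM F g' = FM F g"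
      using that A by (auto simp: cl_def)
    have "C.arrow f' X' Y'" "C.arrow g' Y' Z'" using that by (auto simp: C.Mor_arrow)
    hence "X' = X" "Z' = Z" using f' g' by (auto simp: C.arrow_iff)
    hence "factor_ideal C P X' Z' +>\<^bsub>Hom C X' Z'\<^esub> (g' \<cdot>\<^bsub>C\<^esub> f') = cl (g' \<cdot>\<^bsub>C\<^esub> f')"
      using coset_eq C.arrow_cmp[OF f'(1) g'(1)] by simp
    also have "\<dots> = cl (g \<cdot>\<^bsub>C\<^esub> f)"
      using cl_eq_iff[OF C.arrow_cmp[OF f'(1) g'(1)] C.arrow_cmp[OF assms]] f' g' A by (simp add: C.arrow_iff)
    finally show ?thesis .
  qed
  have "f \<in> cl f \<inter> Mor C X Y" "g \<in> cl g \<inter> Mor C Y Z" using assms[THEN C.arrow_Mor] A cl_self by simp_all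
  note o = A(7-9) this
  show ?thesis
  proof (intro equalityI subsetI)
    fix h assume "h \<in> cl g \<cdot>\<^bsub>AQ\<^esub> cl f"
    thus "h \<in> cl (g \<cdot>\<^bsub>C\<^esub> f)" unfolding additive_quotient_def lincat.simps mem_Collect_eq
      by (elim bexE) (simp only: *)
  next
    fix h assume "h \<in> cl (g \<cdot>\<^bsub>C\<^esub> f)"
    hence "h \<in> factor_ideal C P X Z +>\<^bsub>Hom C X Z\<^esub> (g \<cdot>\<^bsub>C\<^esub> f)" using *[OF o] by simp
    thus "h \<in> cl g \<cdot>\<^bsub>AQ\<^esub> cl f" unfolding additive_quotient_def lincat.simps mem_Collect_eq
      using o by blast
  qed
qed

lemma AQ_E:
  assumes "a \<in> carrier (quotient_hom C P X Y)" "X \<in> Obj C" "Y \<in> Obj C"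
  obtains f where "C.arrow f X Y" "a = cl f"
  using assms AQ_carrier by blast

lemma AQ_I: "C.arrow f X Y \<Longrightarrow> cl f \<in> carrier (quotient_hom C P X Y)"
  using AQ_carrier[of X Y] by (auto simp: C.arrow_def)

lemma AQ_vectorspace:
  assumes XY: "X \<in> Obj C" "Y \<in> Obj C" shows "vectorspace k (quotient_hom C P X Y)"
proof (rule vectorspaceI_image[OF C.ground_field])
  show "\<zero>\<^bsub>quotient_hom C P X Y\<^esub> \<in> carrier (quotient_hom C P X Y)"
    using AQ_zero[OF XY] AQ_I[OF C.arrow_zr[OF XY]] by simp
  have im: "a \<in> cl ` Mor C X Y" if a: "a \<in> carrier (quotient_hom C P X Y)" for a
  proof -
    obtain f where "C.arrow f X Y" "a = cl f" using a XY by (rule AQ_E)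
    thus ?thesis using C.arrow_Mor by blast
  qed
  fix a b c assume abc: "a \<in> carrier (quotient_hom C P X Y)" "b \<in> carrier (quotient_hom C P X Y)"
    "c \<in> carrier (quotient_hom C P X Y)"
  show "\<exists>(V :: ('k, 'm) module) h. vectorspace k V \<and> h \<in> carrier V \<rightarrow> carrier (quotient_hom C P X Y) \<and>
        (\<forall>x\<in>carrier V. \<forall>y\<in>carrier V. h (x \<oplus>\<^bsub>V\<^esub> y) = h x \<oplus>\<^bsub>quotient_hom C P X Y\<^esub> h y) \<and>
        (\<forall>r\<in>carrier k. \<forall>x\<in>carrier V. h (r \<odot>\<^bsub>V\<^esub> x) = r \<odot>\<^bsub>quotient_hom C P X Y\<^esub> h x) \<and>
        h \<zero>\<^bsub>V\<^esub> = \<zero>\<^bsub>quotient_hom C P X Y\<^esub> \<and> a \<in> h ` carrier V \<and> b \<in> h ` carrier V \<and> c \<in> h ` carrier V"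
  proof (intro exI[of _ "Hom C X Y"] exI[of _ cl] conjI ballI)
    show "vectorspace k (Hom C X Y)" using C.hom_vectorspace XY by simp
    show "cl \<in> Mor C X Y \<rightarrow> carrier (quotient_hom C P X Y)" using AQ_I C.Mor_arrow[OF XY] by blast
    show "cl (x \<oplus>\<^bsub>Hom C X Y\<^esub> y) = cl x \<oplus>\<^bsub>quotient_hom C P X Y\<^esub> cl y" if "x \<in> Mor C X Y" "y \<in> Mor C X Y" for x y
      using that AQ_add[of x X Y y] C.pl_eq[of x X Y y] unfolding C.Mor_arrow[OF XY] by simp
    show "cl (r \<odot>\<^bsub>Hom C X Y\<^esub> x) = r \<odot>\<^bsub>quotient_hom C P X Y\<^esub> cl x" if "r \<in> carrier k" "x \<in> Mor C X Y" for r x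
      using that AQ_smult[of r x X Y] C.sm_eq[of x X Y r] unfolding C.Mor_arrow[OF XY] by simp
  qed (use AQ_zero[OF XY] im abc in simp_all)
qed

lemma AQ_lin_cat: "lin_cat k AQ"
proof (rule lin_cat.intro, unfold AQ_simps)
  show "field k" by (rule C.ground_field)
next
  fix X Y assume "X \<in> Obj C" "Y \<in> Obj C"
  thus "vectorspace k (quotient_hom C P X Y)" by (rule AQ_vectorspace)
next
  fix X Y X' Y' a assume o: "X \<in> Obj C" "Y \<in> Obj C" "X' \<in> Obj C" "Y' \<in> Obj C"
    and a: "a \<in> carrier (quotient_hom C P X Y)" "a \<in> carrier (quotient_hom C P X' Y')"
  obtain f where f: "C.arrow f X Y" "a = cl f" using a(1) o(1,2) by (rule AQ_E)
  obtain g where g: "C.arrow g X' Y'" "a = cl g" using a(2) o(3,4) by (rule AQ_E)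
  have "f \<in> cl g" using f g cl_self[of f] by (simp add: C.arrow_iff)
  thus "X = X' \<and> Y = Y'" using f g by (simp add: cl_def C.arrow_iff)
next
  fix X assume "X \<in> Obj C"
  thus "ident AQ X \<in> carrier (quotient_hom C P X X)" using AQ_ident AQ_I[OF C.arrow_ident] by simp
next
  fix X Y Z a b assume o: "X \<in> Obj C" "Y \<in> Obj C" "Z \<in> Obj C"
    and a: "a \<in> carrier (quotient_hom C P X Y)" and b: "b \<in> carrier (quotient_hom C P Y Z)"
  obtain f where f: "C.arrow f X Y" "a = cl f" using a o(1,2) by (rule AQ_E)
  obtain g where g: "C.arrow g Y Z" "b = cl g" using b o(2,3) by (rule AQ_E)
  show "b \<cdot>\<^bsub>AQ\<^esub> a \<in> carrier (quotient_hom C P X Z)"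
    unfolding f(2) g(2) AQ_cmp[OF f(1) g(1)] by (rule AQ_I[OF C.arrow_cmp[OF f(1) g(1)]])
next
  fix X Y a assume o: "X \<in> Obj C" "Y \<in> Obj C" and a: "a \<in> carrier (quotient_hom C P X Y)"
  obtain f where f: "C.arrow f X Y" "a = cl f" using a o(1,2) by (rule AQ_E)
  show "ident AQ Y \<cdot>\<^bsub>AQ\<^esub> a = a" "a \<cdot>\<^bsub>AQ\<^esub> ident AQ X = a"
    using AQ_cmp[OF f(1) C.arrow_ident[OF o(2)]] AQ_cmp[OF C.arrow_ident[OF o(1)] f(1)] f o
    by (simp_all add: AQ_ident C.arrow_iff)
next
  fix W X Y Z a b c assume o: "W \<in> Obj C" "X \<in> Obj C" "Y \<in> Obj C" "Z \<in> Obj C"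
    and a: "a \<in> carrier (quotient_hom C P W X)" and b: "b \<in> carrier (quotient_hom C P X Y)"
    and c: "c \<in> carrier (quotient_hom C P Y Z)"
  obtain f where f: "C.arrow f W X" "a = cl f" using a o(1,2) by (rule AQ_E)
  obtain g where g: "C.arrow g X Y" "b = cl g" using b o(2,3) by (rule AQ_E)
  obtain h where h: "C.arrow h Y Z" "c = cl h" using c o(3,4) by (rule AQ_E)
  show "(c \<cdot>\<^bsub>AQ\<^esub> b) \<cdot>\<^bsub>AQ\<^esub> a = c \<cdot>\<^bsub>AQ\<^esub> (b \<cdot>\<^bsub>AQ\<^esub> a)"
    using f(1) g(1) h(1) AQ_cmp[OF f(1) g(1)] AQ_cmp[OF g(1) h(1)] 
      AQ_cmp[OF C.arrow_cmp[OF f(1) g(1)] h(1)] AQ_cmp[OF f(1) C.arrow_cmp[OF g(1) h(1)]]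
    unfolding f(2) g(2) h(2) by (simp add: C.arrow_iff)
next
  fix X Y Z a assume o: "X \<in> Obj C" "Y \<in> Obj C" "Z \<in> Obj C" and a: "a \<in> carrier (quotient_hom C P X Y)"
  obtain f where f: "C.arrow f X Y" "a = cl f" using a o(1,2) by (rule AQ_E)
  have fa: "C.ar f" "C.src f = X" "C.tgt f = Y" using f by (simp_all add: C.arrow_iff)
  show "linear_map k (quotient_hom C P Y Z) (quotient_hom C P X Z) (\<lambda>b. b \<cdot>\<^bsub>AQ\<^esub> a)"
  proof (rule linear_mapI)
    show "vectorspace k (quotient_hom C P Y Z)" "vectorspace k (quotient_hom C P X Z)"
      using AQ_vectorspace o by blast+
    fix b assume b: "b \<in> carrier (quotient_hom C P Y Z)"
    obtain g where g: "C.arrow g Y Z" "b = cl g" using b o(2,3) by (rule AQ_E)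
    show "b \<cdot>\<^bsub>AQ\<^esub> a \<in> carrier (quotient_hom C P X Z)"
      unfolding f(2) g(2) AQ_cmp[OF f(1) g(1)] by (rule AQ_I[OF C.arrow_cmp[OF f(1) g(1)]])
    show "(c \<odot>\<^bsub>quotient_hom C P Y Z\<^esub> b) \<cdot>\<^bsub>AQ\<^esub> a = c \<odot>\<^bsub>quotient_hom C P X Z\<^esub> (b \<cdot>\<^bsub>AQ\<^esub> a)" if c: "c \<in> carrier k" for c
      unfolding f(2) g(2) AQ_smult[OF c g(1)] AQ_cmp[OF f(1) g(1)] AQ_cmp[OF f(1) C.arrow_sm[OF c g(1)]]
        AQ_smult[OF c C.arrow_cmp[OF f(1) g(1)]] using f(1) g(1) c by (simp add: C.arrow_iff C.cmp_sm)
    fix d assume d: "d \<in> carrier (quotient_hom C P Y Z)"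
    obtain h where h: "C.arrow h Y Z" "d = cl h" using d o(2,3) by (rule AQ_E)
    show "(b \<oplus>\<^bsub>quotient_hom C P Y Z\<^esub> d) \<cdot>\<^bsub>AQ\<^esub> a = b \<cdot>\<^bsub>AQ\<^esub> a \<oplus>\<^bsub>quotient_hom C P X Z\<^esub> d \<cdot>\<^bsub>AQ\<^esub> a"
      unfolding f(2) g(2) h(2) AQ_add[OF g(1) h(1)] AQ_cmp[OF f(1) g(1)] AQ_cmp[OF f(1) h(1)]
        AQ_cmp[OF f(1) C.arrow_pl[OF g(1) h(1)]]
        AQ_add[OF C.arrow_cmp[OF f(1) g(1)] C.arrow_cmp[OF f(1) h(1)]]
      using f(1) g(1) h(1) by (simp add: C.arrow_iff C.cmp_pl)
  qed
next
  fix X Y Z b assume o: "X \<in> Obj C" "Y \<in> Obj C" "Z \<in> Obj C" and b: "b \<in> carrier (quotient_hom C P Y Z)"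
  obtain g where g: "C.arrow g Y Z" "b = cl g" using b o(2,3) by (rule AQ_E)
  show "linear_map k (quotient_hom C P X Y) (quotient_hom C P X Z) ((\<cdot>\<^bsub>AQ\<^esub>) b)"
  proof (rule linear_mapI)
    show "vectorspace k (quotient_hom C P X Y)" "vectorspace k (quotient_hom C P X Z)"
      using AQ_vectorspace o by blast+
    fix a assume a: "a \<in> carrier (quotient_hom C P X Y)"
    obtain f where f: "C.arrow f X Y" "a = cl f" using a o(1,2) by (rule AQ_E)
    show "b \<cdot>\<^bsub>AQ\<^esub> a \<in> carrier (quotient_hom C P X Z)"
      unfolding f(2) g(2) AQ_cmp[OF f(1) g(1)] by (rule AQ_I[OF C.arrow_cmp[OF f(1) g(1)]])
    show "b \<cdot>\<^bsub>AQ\<^esub> (c \<odot>\<^bsub>quotient_hom C P X Y\<^esub> a) = c \<odot>\<^bsub>quotient_hom C P X Z\<^esub> (b \<cdot>\<^bsub>AQ\<^esub> a)" if c: "c \<in> carrier k" for c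
      unfolding f(2) g(2) AQ_smult[OF c f(1)] AQ_cmp[OF f(1) g(1)] AQ_cmp[OF C.arrow_sm[OF c f(1)] g(1)]
        AQ_smult[OF c C.arrow_cmp[OF f(1) g(1)]] using f(1) g(1) c by (simp add: C.arrow_iff C.cmp_sm)
    fix d assume d: "d \<in> carrier (quotient_hom C P X Y)"
    obtain h where h: "C.arrow h X Y" "d = cl h" using d o(1,2) by (rule AQ_E)
    show "b \<cdot>\<^bsub>AQ\<^esub> (a \<oplus>\<^bsub>quotient_hom C P X Y\<^esub> d) = b \<cdot>\<^bsub>AQ\<^esub> a \<oplus>\<^bsub>quotient_hom C P X Z\<^esub> b \<cdot>\<^bsub>AQ\<^esub> d"
      unfolding f(2) g(2) h(2) AQ_add[OF f(1) h(1)] AQ_cmp[OF f(1) g(1)] AQ_cmp[OF h(1) g(1)]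
        AQ_cmp[OF C.arrow_pl[OF f(1) h(1)] g(1)]
        AQ_add[OF C.arrow_cmp[OF f(1) g(1)] C.arrow_cmp[OF h(1) g(1)]]
      using f(1) g(1) h(1) by (simp add: C.arrow_iff C.cmp_pl)
  qed
qed

lemma quotient_functor_eq:
  assumes f: "C.arrow f X Y" shows "FM (additive_quotient_functor C P) f = cl f"
proof -
  have 1: "X' = X \<and> Y' = Y" if "X' \<in> Obj C" "Y' \<in> Obj C" "f \<in> Mor C X' Y'" for X' Y'
    using that f C.arrow_unique[of f X' Y' X Y] by (simp add: C.Mor_arrow)
  have "(\<exists>X\<in>Obj C. \<exists>Y\<in>Obj C. f \<in> Mor C X Y \<and> h \<in> factor_ideal C P X Y +>\<^bsub>Hom C X Y\<^esub> f) \<longleftrightarrow>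
      h \<in> factor_ideal C P X Y +>\<^bsub>Hom C X Y\<^esub> f" for h
    using 1 f unfolding C.arrow_def by blast
  thus ?thesis unfolding additive_quotient_functor_def fct.simps coset_eq[OF f] by simp
qed

definition qfun where "qfun = \<lparr>FO = (\<lambda>X. X), FM = cl\<rparr>"

lemma qfun_functor: "lin_functor k C AQ qfun"
proof -
  interpret AQ: lin_cat k AQ by (rule AQ_lin_cat)
  show ?thesis
  proof (rule lin_functorI, unfold qfun_def fct.simps)
    show "lin_cat k C" "lin_cat k AQ" by unfold_locales
    show "AQ.arrow (cl f) X Y" if "C.arrow f X Y" for f X Y
      using AQ_I[OF that] that by (simp add: AQ.arrow_def AQ_simps C.arrow_def)
    show "cl (f \<oplus>\<^bsub>Hom C X Y\<^esub> g) = cl f \<oplus>\<^bsub>Hom AQ X Y\<^esub> cl g" if "C.arrow f X Y" "C.arrow g X Y" for f g X Y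
      using AQ_add[OF that] C.pl_eq[OF that(1)] by (simp add: AQ_simps)
    show "cl (c \<odot>\<^bsub>Hom C X Y\<^esub> f) = c \<odot>\<^bsub>Hom AQ X Y\<^esub> cl f" if "c \<in> carrier k" "C.arrow f X Y" for c f X Y
      using AQ_smult[OF that] C.sm_eq[OF that(2)] by (simp add: AQ_simps)
  qed (simp_all add: AQ_simps AQ_ident AQ_cmp)
qed

lemma AQ_additive: assumes "additive_cat k C" shows "additive_cat k AQ"
proof -
  interpret A: additive_cat k C by fact
  interpret AQ: lin_cat k AQ by (rule AQ_lin_cat)
  interpret q: lin_fun k C AQ qfun by (rule lin_funI[OF qfun_functor])
  have q: "FO qfun X = X" for X by (simp add: qfun_def)
  show ?thesis
  proof
    obtain Z where Z: "is_zero_obj C Z" "Z \<in> Obj C" using A.zero_obj_exists by (auto simp: is_zero_obj_def)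
    have "ident C Z = C.zr Z Z" using C.zero_obj_hom(1)[OF Z(1) C.arrow_ident[OF Z(2)]] .
    hence "ident AQ Z = \<zero>\<^bsub>Hom AQ Z Z\<^esub>" using q.F_ident[OF Z(2), unfolded q] q.F_zr[OF Z(2) Z(2), unfolded q] by simp
    hence "is_zero_obj AQ Z" using Z by (intro AQ.is_zero_objI) (simp_all add: AQ_simps)
    thus "\<exists>Z. is_zero_obj AQ Z" by blast
    fix X Y assume "X \<in> Obj AQ" "Y \<in> Obj AQ"
    then obtain B i j p r where "is_biproduct C X Y B i j p r" using A.biproduct_exists AQ_simps(1) by metis
    from q.F_biproduct[OF this] show "\<exists>B i j p q. is_biproduct AQ X Y B i j p q" unfolding q by blast
  qed
qed

text \<open>Faithfulness is built in, since the classes are the fibres of \<open>F\<close>. The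
  induced functor evaluates \<open>F\<close> on an arbitrary representative, which is why its value
  on the class of \<open>f\<close> is \<open>FM F f\<close>.\<close>

lemma AQ_equivalence:
  assumes full dense
  obtains \<pi> where "lin_equivalence k AQ D \<pi>" "\<And>X. FO \<pi> X = FO F X"
    "\<And>f X Y. C.arrow f X Y \<Longrightarrow> FM \<pi> (FM (additive_quotient_functor C P) f) = FM F f"
proof -
  interpret AQ: lin_cat k AQ by (rule AQ_lin_cat)
  define \<pi> where "\<pi> = \<lparr>FO = FO F, FM = (\<lambda>a. FM F (SOME f. f \<in> a))\<rparr>"
  have FO: "FO \<pi> X = FO F X" for X by (simp add: \<pi>_def)
  have FM: "FM \<pi> (cl f) = FM F f" if "C.ar f" for f
  proof -
    have "(SOME g. g \<in> cl f) \<in> cl f" using someI[of "\<lambda>g. g \<in> cl f"] cl_self[OF that] by blast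
    thus ?thesis by (simp add: \<pi>_def cl_def)
  qed
  have E: "\<exists>f. C.arrow f X Y \<and> a = cl f" if "AQ.arrow a X Y" for a X Y
    using that AQ_carrier[of X Y a] by (simp add: AQ.arrow_def AQ_simps)
  have ar: "C.ar f" if "C.arrow f X Y" for f X Y using that by (simp add: C.arrow_iff)
  have lin: "lin_functor k AQ D \<pi>"
  proof (rule lin_functorI, unfold FO)
    show "lin_cat k AQ" "lin_cat k D" by unfold_locales
    show "D.arrow (FM \<pi> a) (FO F X) (FO F Y)" if "AQ.arrow a X Y" for a X Y
      using E[OF that] FM ar F_arrow by metis
    show "FM \<pi> (a \<oplus>\<^bsub>Hom AQ X Y\<^esub> b) = FM \<pi> a \<oplus>\<^bsub>Hom D (FO F X) (FO F Y)\<^esub> FM \<pi> b"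
      if ab: "AQ.arrow a X Y" "AQ.arrow b X Y" for a b X Y
    proof -
      obtain f g where f: "C.arrow f X Y" "a = cl f" and g: "C.arrow g X Y" "b = cl g" using E ab by metis
      show ?thesis using f g AQ_add[OF f(1) g(1)] D.pl_eq[OF F_arrow[OF f(1)]]
        by (simp add: AQ_simps FM C.arrow_iff)
    qed
    show "FM \<pi> (c \<odot>\<^bsub>Hom AQ X Y\<^esub> a) = c \<odot>\<^bsub>Hom D (FO F X) (FO F Y)\<^esub> FM \<pi> a"
      if ab: "c \<in> carrier k" "AQ.arrow a X Y" for c a X Y
    proof -
      obtain f where f: "C.arrow f X Y" "a = cl f" using E ab by metis
      show ?thesis using f ab AQ_smult[OF ab(1) f(1)] D.sm_eq[OF F_arrow[OF f(1)]]
        by (simp add: AQ_simps FM C.arrow_iff)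
    qed
    show "FM \<pi> (b \<cdot>\<^bsub>AQ\<^esub> a) = FM \<pi> b \<cdot>\<^bsub>D\<^esub> FM \<pi> a" if ab: "AQ.arrow a X Y" "AQ.arrow b Y Z" for a b X Y Z
    proof -
      obtain f g where f: "C.arrow f X Y" "a = cl f" and g: "C.arrow g Y Z" "b = cl g" using E ab by metis
      show ?thesis using f g AQ_cmp[OF f(1) g(1)] by (simp add: FM C.arrow_iff)
    qed
  qed (simp_all add: AQ_simps AQ_ident FM)
  interpret pi: lin_fun k AQ D \<pi> by (rule lin_funI[OF lin])
  have "lin_equivalence k AQ D \<pi>"
  proof (rule pi.equivalenceI)
    show pi.faithful unfolding pi.faithful_def
    proof (intro allI impI, elim conjE)
      fix X Y a b assume ab: "AQ.arrow a X Y" "AQ.arrow b X Y" "FM \<pi> a = FM \<pi> b"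
      obtain f g where f: "C.arrow f X Y" "a = cl f" and g: "C.arrow g X Y" "b = cl g" using E ab by metis
      have "FM F f = FM F g" using ab(3) f g FM ar by metis
      thus "a = b" using cl_eq_iff[OF f(1) g(1)] f g by simp
    qed
    show pi.full unfolding pi.full_def FO
    proof (intro ballI allI impI)
      fix X Y h assume "X \<in> Obj AQ" "Y \<in> Obj AQ" "D.arrow h (FO F X) (FO F Y)"
      then obtain f where f: "C.arrow f X Y" "FM F f = h" using assms(1) fullE by (metis AQ_simps(1))
      have "AQ.arrow (cl f) X Y" using AQ_I[OF f(1)] f(1) by (simp add: AQ.arrow_def AQ_simps C.arrow_def)
      thus "\<exists>f. AQ.arrow f X Y \<and> FM \<pi> f = h" using FM[OF ar[OF f(1)]] f(2) by blast
    qed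
    show pi.dense using assms(2) unfolding pi.dense_def dense_def FO AQ_simps .
  qed
  thus ?thesis using that FO FM ar quotient_functor_eq by metis
qed

end


section \<open>Orthogonal subcategories\<close>

context triangulated
begin

lemma left_perp_iff: "X \<in> left_perp T A \<longleftrightarrow> X \<in> Obj T \<and> (\<forall>S\<in>A. hom_zero T X S)"
  by (simp add: left_perp_def)

lemma hom_zero_mid_left:
  assumes t: "Tri T X Y Z f g h" and "hom_zero T X W" "hom_zero T Z W" "W \<in> Obj T"
  shows "hom_zero T Y W"
proof -
  note A = tri_arrow[OF t] and O = tri_obj[OF t]
  have "b = zr Y W" if b: "arrow b Y W" for b
  proof -
    have "b \<bullet> f = zr X W" using arrow_cmp[OF A(1) b] hom_zeroD assms(2) by blast
    then obtain c where "arrow c Z W" "c \<bullet> g = b" using tri_extend[OF t b] by blast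
    thus ?thesis using hom_zeroD[OF assms(3), of c] A assms(4) by (simp add: arrow_iff)
  qed
  thus ?thesis using O assms(4) by (simp add: hom_zero_iff)
qed

lemma hom_zero_mid_right:
  assumes t: "Tri T X Y Z f g h" and "hom_zero T W X" "hom_zero T W Z" "W \<in> Obj T"
  shows "hom_zero T W Y"
proof -
  note A = tri_arrow[OF t] and O = tri_obj[OF t]
  have "b = zr W Y" if b: "arrow b W Y" for b
  proof -
    have "g \<bullet> b = zr W Z" using arrow_cmp[OF b A(2)] hom_zeroD assms(3) by blast
    then obtain a where "arrow a W X" "f \<bullet> a = b" using tri_lift[OF t b] by blast
    thus ?thesis using hom_zeroD[OF assms(2), of a] A assms(4) by (simp add: arrow_iff)
  qed
  thus ?thesis using O assms(4) by (simp add: hom_zero_iff)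
qed

lemma hom_zero_shift:
  assumes "X \<in> Obj T" "Y \<in> Obj T" shows "hom_zero T (\<Sigma> X) (\<Sigma> Y) \<longleftrightarrow> hom_zero T X Y"
proof
  assume "hom_zero T (\<Sigma> X) (\<Sigma> Y)"
  hence "f = zr X Y" if "arrow f X Y" for f
    using hom_zeroD[OF _ Sh.F_arrow[OF that]] Shi.F_zr[of "\<Sigma> X" "\<Sigma> Y"] shift_mor(1)[of f] that assms
    by (simp add: arrow_iff)
  thus "hom_zero T X Y" using assms by (simp add: hom_zero_iff)
next
  assume "hom_zero T X Y"
  hence "f = zr (\<Sigma> X) (\<Sigma> Y)" if "arrow f (\<Sigma> X) (\<Sigma> Y)" for f
    using hom_zeroD[of X Y "\<sigma>\<^sub>- f"] Shi.F_arrow[OF that] Sh.F_zr[of X Y] shift_mor(2)[of f] that assms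
    by (simp add: arrow_iff)
  thus "hom_zero T (\<Sigma> X) (\<Sigma> Y)" using assms by (simp add: hom_zero_iff)
qed

lemma hom_zero_shift_left:
  assumes "X \<in> Obj T" "Y \<in> Obj T"
  shows "hom_zero T (\<Sigma> X) Y \<longleftrightarrow> hom_zero T X (\<Sigma>\<^sub>- Y)" "hom_zero T X (\<Sigma> Y) \<longleftrightarrow> hom_zero T (\<Sigma>\<^sub>- X) Y"
  using hom_zero_shift[of X "\<Sigma>\<^sub>- Y"] hom_zero_shift[of "\<Sigma>\<^sub>- X" Y] assms by simp_all

lemma shift_in_obj [simp]: "X \<in> Obj T \<Longrightarrow> shift T i X \<in> Obj T"
proof -
  assume X: "X \<in> Obj T"
  have "(FO (Sh T) ^^ n) X \<in> Obj T" "(FO (Shi T) ^^ n) X \<in> Obj T" for n by (induction n) (use X in simp_all)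
  thus ?thesis by (simp add: shift_def)
qed

lemma shift_succ: assumes X: "X \<in> Obj T" shows "\<Sigma> (shift T i X) = shift T (i + 1) X"
proof (cases "0 \<le> i")
  case True
  hence "nat (i + 1) = Suc (nat i)" by simp
  thus ?thesis using True by (simp add: shift_def)
next
  case False
  hence "nat (- i) = Suc (nat (- (i + 1)))" by simp
  moreover have "(FO (Shi T) ^^ n) X \<in> Obj T" for n by (induction n) (use X in simp_all)
  ultimately show ?thesis using False X by (cases "i = -1") (simp_all add: shift_def)
qed

lemma shift_pred: "X \<in> Obj T \<Longrightarrow> \<Sigma>\<^sub>- (shift T i X) = shift T (i - 1) X"
  using shift_succ[of X "i - 1"] shift_obj(1)[of "shift T (i - 1) X"] by simp

lemma shift_invariant_iff:
  assumes "\<And>Y. Y \<in> A' \<Longrightarrow> \<Sigma> Y \<in> A" "\<And>Y. Y \<in> A \<Longrightarrow> \<Sigma>\<^sub>- Y \<in> A'" "A \<subseteq> Obj T" "A' \<subseteq> Obj T" "X \<in> Obj T"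
  shows "\<Sigma> X \<in> left_perp T A \<longleftrightarrow> X \<in> left_perp T A'"
proof -
  have "hom_zero T (\<Sigma> X) Y" if "\<forall>S\<in>A'. hom_zero T X S" "Y \<in> A" for Y
    using hom_zero_shift_left(1)[of X Y] assms(2)[OF that(2)] that assms by blast
  moreover have "hom_zero T X Y" if "\<forall>S\<in>A. hom_zero T (\<Sigma> X) S" "Y \<in> A'" for Y
    using hom_zero_shift[of X Y] assms(1)[OF that(2)] that assms by blast
  ultimately show ?thesis using assms(5) by (auto simp: left_perp_iff)
qed

lemma left_perp_ext: "\<lbrakk>Tri T X Y Z f g h; X \<in> left_perp T A; Z \<in> left_perp T A; A \<subseteq> Obj T\<rbrakk> \<Longrightarrow> Y \<in> left_perp T A"
  using hom_zero_mid_left tri_obj(2) unfolding left_perp_iff by blast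

lemma left_perp_antimono: "A \<subseteq> A' \<Longrightarrow> left_perp T A' \<subseteq> left_perp T A"
  unfolding left_perp_def by blast

lemma hom_zero_retract:
  assumes "arrow i X B" "arrow p B X" "p \<bullet> i = idt X" "W \<in> Obj T"
  shows "hom_zero T B W \<Longrightarrow> hom_zero T X W" "hom_zero T W B \<Longrightarrow> hom_zero T W X"
proof -
  note A = assms(1,2)
  show "hom_zero T X W" if h: "hom_zero T B W"
  proof -
    have "f = zr X W" if f: "arrow f X W" for f
    proof -
      have "f = (f \<bullet> p) \<bullet> i" using A f assms(3) by (simp add: arrow_iff)
      also have "\<dots> = zr X W" using hom_zeroD[OF h arrow_cmp[OF A(2) f]] A assms(4) by (simp add: arrow_iff)
      finally show ?thesis .
    qed
    thus ?thesis using A assms(4) by (simp add: hom_zero_iff arrow_iff)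
  qed
  show "hom_zero T W X" if h: "hom_zero T W B"
  proof -
    have "f = zr W X" if f: "arrow f W X" for f
    proof -
      have "f = p \<bullet> (i \<bullet> f)" using A f by (simp add: arrow_iff cmp_rew[OF assms(3)])
      also have "\<dots> = zr W X" using hom_zeroD[OF h arrow_cmp[OF f A(1)]] A assms(4) by (simp add: arrow_iff)
      finally show ?thesis .
    qed
    thus ?thesis using A assms(4) by (simp add: hom_zero_iff arrow_iff)
  qed
qed

lemma tri_iso_first:
  assumes t: "Tri T X Y Z f g h" and t': "Tri T X' Y' Z' f' g' h'"
    and b: "is_iso T Y Y' b" and c: "is_iso T Z Z' c" and a: "arrow a X X'"
    and sq: "b \<bullet> f = f' \<bullet> a" "c \<bullet> g = g' \<bullet> b" "\<sigma> a \<bullet> h = h' \<bullet> c"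
  shows "is_iso T X X' a"
proof -
  note A = tri_arrow[OF t] tri_arrow[OF t'] a is_iso_arrow[OF b]
  have "\<sigma> (b \<bullet> f) = \<sigma> (f' \<bullet> a)" using sq(1) by simp
  hence "\<sigma> b \<bullet> (\<boxminus> \<sigma> f) = (\<boxminus> \<sigma> f') \<bullet> \<sigma> a" using A by (simp add: arrow_iff cmp_ng)
  hence "is_iso T (\<Sigma> X) (\<Sigma> X') (\<sigma> a)"
    using five_tri[OF tri_rot[OF t] tri_rot[OF t'] b c Sh.F_arrow[OF a] sq(2,3)] by simp
  from Shi.F_iso[OF this] show ?thesis using A by (simp add: arrow_iff)
qed

text \<open>For classes defined by vanishing of Hom, middle terms and retracts are easier than cones
  and biproduct summands. The cone of a map is the middle term of the rotated triangle, whose outer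
  terms are \<open>Y\<close> and the shift of \<open>X\<close>.\<close>

lemma thickI:
  assumes sub: "V \<subseteq> Obj T" and z: "\<And>Z. is_zero_obj T Z \<Longrightarrow> Z \<in> V"
    and sh: "\<And>X. X \<in> V \<Longrightarrow> \<Sigma> X \<in> V" "\<And>X. X \<in> V \<Longrightarrow> \<Sigma>\<^sub>- X \<in> V"
    and mid: "\<And>X Y Z f g h. \<lbrakk>Tri T X Y Z f g h; X \<in> V; Z \<in> V\<rbrakk> \<Longrightarrow> Y \<in> V"
    and ret: "\<And>X B i p. \<lbrakk>arrow i X B; arrow p B X; p \<bullet> i = idt X; B \<in> V\<rbrakk> \<Longrightarrow> X \<in> V"
  shows "thick T V"
  unfolding thick_def
proof (intro conjI ballI allI impI)
  show "\<exists>Z\<in>V. is_zero_obj T Z" using zero_obj_exists z by blast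
  show "Y \<in> V" if X: "X \<in> V" and f: "is_iso T X Y f" for X Y f
  proof -
    obtain g where "arrow f X Y" "arrow g Y X" "f \<bullet> g = idt Y" using f by (rule is_isoE)
    thus ?thesis using ret X by blast
  qed
  show "Z \<in> V" if "Tri T X Y Z f g h \<and> X \<in> V \<and> Y \<in> V" for X Y Z f g h
    using mid[OF tri_rot[of X Y Z f g h]] that sh by blast
  show "X \<in> V" if "is_biproduct T X Y B i j p q \<and> B \<in> V" for X Y B i j p q
    using ret[of i X B p] that biproductD[of X Y B i j p q] by blast
qed (use sub sh in blast)+

text \<open>Vanishing at one fixed index is not stable under shifts, but vanishing for all large
  indices is. Boundedness can therefore be checked on generators and holds for every object that
  they generate.\<close>

lemma thick_right_tail:
  assumes sub: "\<And>i. W i \<subseteq> Obj T" and sh: "\<And>i Y. Y \<in> W i \<Longrightarrow> \<Sigma> Y \<in> W (i + 1)" "\<And>i Y. Y \<in> W i \<Longrightarrow> \<Sigma>\<^sub>- Y \<in> W (i - 1)"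
  shows "thick T {Z \<in> Obj T. \<exists>n::int. \<forall>m\<ge>n. \<forall>Y\<in>W m. hom_zero T Y Z}" (is "thick T ?V")
proof (rule thickI)
  have W: "Y \<in> Obj T" if "Y \<in> W i" for Y i using sub that by blast
  show "Z \<in> ?V" if "is_zero_obj T Z" for Z using that W by (auto simp: is_zero_obj_def)
  show "\<Sigma> Z \<in> ?V" if Z: "Z \<in> ?V" for Z
  proof -
    obtain n where n: "\<forall>m\<ge>n. \<forall>Y\<in>W m. hom_zero T Y Z" using Z by blast
    have "hom_zero T Y (\<Sigma> Z)" if "m \<ge> n + 1" "Y \<in> W m" for m Y
      using hom_zero_shift_left(2)[of Y Z] n[rule_format, of "m - 1" "\<Sigma>\<^sub>- Y"] sh(2)[OF that(2)] that W[OF that(2)] Z by simp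
    moreover have "\<Sigma> Z \<in> Obj T" using Z by simp
    ultimately show ?thesis by blast
  qed
  show "\<Sigma>\<^sub>- Z \<in> ?V" if Z: "Z \<in> ?V" for Z
  proof -
    obtain n where n: "\<forall>m\<ge>n. \<forall>Y\<in>W m. hom_zero T Y Z" using Z by blast
    have "hom_zero T Y (\<Sigma>\<^sub>- Z)" if "m \<ge> n - 1" "Y \<in> W m" for m Y
      using hom_zero_shift_left(1)[of Y Z] n[rule_format, of "m + 1" "\<Sigma> Y"] sh(1)[OF that(2)] that W[OF that(2)] Z by simp
    moreover have "\<Sigma>\<^sub>- Z \<in> Obj T" using Z by simp
    ultimately show ?thesis by blast
  qed
  show "Y \<in> ?V" if t: "Tri T X Y Z f g h" and XZ: "X \<in> ?V" "Z \<in> ?V" for X Y Z f g h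
  proof -
    obtain n n' where n: "\<forall>m\<ge>n. \<forall>Y\<in>W m. hom_zero T Y X" "\<forall>m\<ge>n'. \<forall>Y\<in>W m. hom_zero T Y Z" using XZ by blast
    have "hom_zero T B Y" if "m \<ge> max n n'" "B \<in> W m" for m B
      by (rule hom_zero_mid_right[OF t]) (use n that W[OF that(2)] in auto)
    thus ?thesis using tri_obj[OF t] by blast
  qed
  show "X \<in> ?V" if r: "arrow i X B" "arrow p B X" "p \<bullet> i = idt X" and B: "B \<in> ?V" for X B i p
  proof -
    obtain n where n: "\<forall>m\<ge>n. \<forall>Y\<in>W m. hom_zero T Y B" using B by blast
    have "hom_zero T Y X" if "m \<ge> n" "Y \<in> W m" for m Y
      using hom_zero_retract(2)[OF r W[OF that(2)]] n that by blast
    thus ?thesis using r(1) by (auto simp: arrow_def)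
  qed
qed auto

lemma thick_left_tail:
  assumes sub: "\<And>i. W i \<subseteq> Obj T" and sh: "\<And>i Y. Y \<in> W i \<Longrightarrow> \<Sigma> Y \<in> W (i - 1)" "\<And>i Y. Y \<in> W i \<Longrightarrow> \<Sigma>\<^sub>- Y \<in> W (i + 1)"
  shows "thick T {Z \<in> Obj T. \<exists>n::int. \<forall>m\<ge>n. \<forall>Y\<in>W m. hom_zero T Z Y}" (is "thick T ?V")
proof (rule thickI)
  have W: "Y \<in> Obj T" if "Y \<in> W i" for Y i using sub that by blast
  show "Z \<in> ?V" if "is_zero_obj T Z" for Z using that W by (auto simp: is_zero_obj_def)
  show "\<Sigma> Z \<in> ?V" if Z: "Z \<in> ?V" for Z
  proof -
    obtain n where n: "\<forall>m\<ge>n. \<forall>Y\<in>W m. hom_zero T Z Y" using Z by blast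
    have "hom_zero T (\<Sigma> Z) Y" if "m \<ge> n - 1" "Y \<in> W m" for m Y
      using hom_zero_shift_left(1)[of Z Y] n[rule_format, of "m + 1" "\<Sigma>\<^sub>- Y"] sh(2)[OF that(2)] that W[OF that(2)] Z by simp
    moreover have "\<Sigma> Z \<in> Obj T" using Z by simp
    ultimately show ?thesis by blast
  qed
  show "\<Sigma>\<^sub>- Z \<in> ?V" if Z: "Z \<in> ?V" for Z
  proof -
    obtain n where n: "\<forall>m\<ge>n. \<forall>Y\<in>W m. hom_zero T Z Y" using Z by blast
    have "hom_zero T (\<Sigma>\<^sub>- Z) Y" if "m \<ge> n + 1" "Y \<in> W m" for m Y
      using hom_zero_shift_left(2)[of Z Y] n[rule_format, of "m - 1" "\<Sigma> Y"] sh(1)[OF that(2)] that W[OF that(2)] Z by simp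
    moreover have "\<Sigma>\<^sub>- Z \<in> Obj T" using Z by simp
    ultimately show ?thesis by blast
  qed
  show "Y \<in> ?V" if t: "Tri T X Y Z f g h" and XZ: "X \<in> ?V" "Z \<in> ?V" for X Y Z f g h
  proof -
    obtain n n' where n: "\<forall>m\<ge>n. \<forall>Y\<in>W m. hom_zero T X Y" "\<forall>m\<ge>n'. \<forall>Y\<in>W m. hom_zero T Z Y" using XZ by blast
    have "hom_zero T Y B" if "m \<ge> max n n'" "B \<in> W m" for m B
      by (rule hom_zero_mid_left[OF t]) (use n that W[OF that(2)] in auto)
    thus ?thesis using tri_obj[OF t] by blast
  qed
  show "X \<in> ?V" if r: "arrow i X B" "arrow p B X" "p \<bullet> i = idt X" and B: "B \<in> ?V" for X B i p
  proof -
    obtain n where n: "\<forall>m\<ge>n. \<forall>Y\<in>W m. hom_zero T B Y" using B by blast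
    have "hom_zero T X Y" if "m \<ge> n" "Y \<in> W m" for m Y
      using hom_zero_retract(1)[OF r W[OF that(2)]] n that by blast
    thus ?thesis using r(1) by (auto simp: arrow_def)
  qed
qed auto

end


section \<open>The co-t-structures of an SMC quadruple\<close>

sublocale smc_quadruple \<subseteq> thick_subcategory k T Tp
  by (intro thick_subcategory.intro thick_subcategory_axioms.intro triangulated_axioms RS0_thick)

lemma (in smc_quadruple) SS_functor: "lin_functor k T T SS"
  using RS1_triangle_equivalence by (simp add: triangle_equivalence_def lin_equivalence_def)

sublocale smc_quadruple \<subseteq> SS: lin_fun k T T SS
  by (rule lin_funI[OF SS_functor])

context smc_quadruple
begin

abbreviation So ("\<S>") where "\<S> X \<equiv> FO SS X"
abbreviation Smor ("\<s>") where "\<s> f \<equiv> FM SS f"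

lemma SS_ff: "SS.faithful" "SS.full" "SS.dense"
  using SS.equivalenceD RS1_triangle_equivalence by (simp_all add: triangle_equivalence_def)

lemma SS_tri:
  assumes "Tri T X Y Z f g h"
  obtains h' where "Tri T (\<S> X) (\<S> Y) (\<S> Z) (\<s> f) (\<s> g) h'"
  using RS1_triangle_equivalence assms unfolding triangle_equivalence_def by blast

lemma SS_shift: assumes "X \<in> Obj T" obtains e where "is_iso T (\<S> (\<Sigma> X)) (\<Sigma> (\<S> X)) e"
  using RS1_triangle_equivalence assms unfolding triangle_equivalence_def nat_iso_def functor_cmp_def by auto

lemma SS_Tp:
  shows "X \<in> Tp \<Longrightarrow> \<S> X \<in> Tp" and "Z \<in> Tp \<Longrightarrow> \<exists>X\<in>Tp. \<exists>e. is_iso T (\<S> X) Z e"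
proof -
  have "lin_functor k (full_sub T Tp) (full_sub T Tp) SS"
    using RS1_restricts by (simp add: lin_equivalence_def)
  then interpret R: lin_fun k "full_sub T Tp" "full_sub T Tp" SS by (rule lin_funI)
  show "X \<in> Tp \<Longrightarrow> \<S> X \<in> Tp" using R.F_obj[of X] by (simp add: full_sub_def)
  assume Z: "Z \<in> Tp"
  have "R.dense" by (rule R.equivalenceD(3)[OF RS1_restricts])
  then obtain X e where X: "X \<in> Tp" "is_iso (full_sub T Tp) (\<S> X) Z e"
    using Z unfolding R.dense_def by (auto simp: full_sub_def)
  hence "is_iso T (\<S> X) Z e" using U_obj by (auto simp: is_iso_def full_sub_def)
  thus "\<exists>X\<in>Tp. \<exists>e. is_iso T (\<S> X) Z e" using X by blast
qed

text \<open>On perfect objects \<open>SS\<close> is essentially surjective; an isomorphism between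
  images lifts by full faithfulness, so \<open>X\<close> is isomorphic to a perfect object.\<close>

lemma SS_reflects_Tp: assumes "X \<in> Obj T" "\<S> X \<in> Tp" shows "X \<in> Tp"
proof -
  obtain Y e where Y: "Y \<in> Tp" "is_iso T (\<S> Y) (\<S> X) e" using SS_Tp(2)[OF assms(2)] by blast
  obtain f where f: "arrow f Y X" "\<s> f = e"
    using SS.fullE[OF SS_ff(2) U_obj[OF Y(1)] assms(1) is_iso_arrow[OF Y(2)]] by blast
  have "is_iso T Y X f" using SS.reflects_iso[OF SS_ff(1,2) f(1)] Y(2) f(2) by simp
  thus ?thesis using U_iso Y(1) by blast
qed

lemma hom_zero_SS:
  assumes "X \<in> Obj T" "Y \<in> Obj T" shows "hom_zero T (\<S> X) (\<S> Y) \<longleftrightarrow> hom_zero T X Y"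
proof
  assume h: "hom_zero T (\<S> X) (\<S> Y)"
  have "f = zr X Y" if f: "arrow f X Y" for f
    by (rule SS.faithfulD[OF SS_ff(1) f arrow_zr[OF assms]])
      (use hom_zeroD[OF h SS.F_arrow[OF f]] assms in simp)
  thus "hom_zero T X Y" using assms by (simp add: hom_zero_iff)
next
  assume h: "hom_zero T X Y"
  have "f = zr (\<S> X) (\<S> Y)" if f: "arrow f (\<S> X) (\<S> Y)" for f
  proof -
    obtain g where g: "arrow g X Y" "\<s> g = f" using SS.fullE[OF SS_ff(2) assms f] by blast
    show ?thesis using hom_zeroD[OF h g(1)] g(2) assms by auto
  qed
  thus "hom_zero T (\<S> X) (\<S> Y)" using assms by (simp add: hom_zero_iff)
qed

definition \<alpha> where "\<alpha> = (SOME \<alpha>. serre_duality k T Tp SS \<alpha>)"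

lemma alpha: "serre_duality k T Tp SS \<alpha>"
  unfolding \<alpha>_def using someI_ex[OF RS1_duality] .

lemma alpha_bij: "\<lbrakk>X \<in> Tp; Y \<in> Obj T\<rbrakk> \<Longrightarrow> bij_betw (\<alpha> X Y) (carrier (dual k (Hom T X Y))) (Mor T Y (\<S> X))"
  and alpha_linear: "\<lbrakk>X \<in> Tp; Y \<in> Obj T\<rbrakk> \<Longrightarrow> linear_map k (dual k (Hom T X Y)) (Hom T Y (\<S> X)) (\<alpha> X Y)"
  using alpha unfolding serre_duality_def by blast+

lemma hom_fin_dim: "\<lbrakk>X \<in> Obj T; Y \<in> Obj T\<rbrakk> \<Longrightarrow> vectorspace.fin_dim k (Hom T X Y)"
  using RS0_hom_finite by (simp add: hom_finite_def)

text \<open>A finite-dimensional space vanishes exactly when its dual does. This transfers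
  orthogonality from one side to the other without mentioning functionals again.\<close>

lemma hom_zero_dual:
  assumes X: "X \<in> Tp" and Y: "Y \<in> Obj T"
  shows "hom_zero T X Y \<longleftrightarrow> hom_zero T Y (\<S> X)"
proof -
  have Xo: "X \<in> Obj T" using X by (rule U_obj)
  note V = hom_vectorspace[OF Xo Y]
  interpret k: field k by (rule ground_field)
  interpret D: vectorspace k "dual k (Hom T X Y)" by (rule dual_vectorspace[OF V])
  note b = alpha_bij[OF X Y] and l = linear_mapD[OF alpha_linear[OF X Y]]
  show ?thesis
  proof
    assume h: "hom_zero T X Y"
    have "\<phi> = \<zero>\<^bsub>dual k (Hom T X Y)\<^esub>" if \<phi>: "\<phi> \<in> carrier (dual k (Hom T X Y))" for \<phi>
    proof (rule extensionalityI[of _ "Mor T X Y"])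
      show "\<phi> \<in> extensional (Mor T X Y)" "\<zero>\<^bsub>dual k (Hom T X Y)\<^esub> \<in> extensional (Mor T X Y)"
        using \<phi> by (simp_all add: dual_simps(1)[OF V] dual_simps(4)[OF V] PiE_def)
      fix v assume "v \<in> Mor T X Y"
      thus "\<phi> v = \<zero>\<^bsub>dual k (Hom T X Y)\<^esub> v" 
        using h dual_zero[OF V \<phi>] by (simp add: dual_simps(4)[OF V] hom_zero_def)
    qed
    hence "carrier (dual k (Hom T X Y)) = {\<zero>\<^bsub>dual k (Hom T X Y)\<^esub>}" using D.M.zero_closed by blast
    hence "Mor T Y (\<S> X) = {zr Y (\<S> X)}" using b l(4) by (simp add: bij_betw_def)
    thus "hom_zero T Y (\<S> X)" by (simp add: hom_zero_def)
  next
    assume h: "hom_zero T Y (\<S> X)"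
    have 1: "\<phi> = \<zero>\<^bsub>dual k (Hom T X Y)\<^esub>" if \<phi>: "\<phi> \<in> carrier (dual k (Hom T X Y))" for \<phi>
    proof -
      have "\<alpha> X Y \<phi> = zr Y (\<S> X)" using l(1)[OF \<phi>] h by (simp add: hom_zero_def)
      thus ?thesis using b \<phi> l(4) D.M.zero_closed unfolding bij_betw_def inj_on_def by metis
    qed
    have "f = zr X Y" if f: "arrow f X Y" for f
    proof (rule dual_separates[OF V hom_fin_dim[OF Xo Y] arrow_Mor[OF f]])
      fix \<phi> assume "\<phi> \<in> carrier (dual k (Hom T X Y))"
      from 1[OF this] show "\<phi> f = \<zero>\<^bsub>k\<^esub>" using arrow_Mor[OF f] by (simp add: dual_simps(4)[OF V])
    qed
    thus "hom_zero T X Y" using Xo Y by (simp add: hom_zero_iff)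
  qed
qed

lemma S_obj: "S \<subseteq> Obj T"
  using RS2_smc by (simp add: smc_def)

lemma thick_generated: assumes "thick T V" "S \<subseteq> V" "X \<in> Obj T" shows "X \<in> V"
  using RS2_smc assms unfolding smc_def by blast

section \<open>Truncations with respect to the first co-t-structure at every index\<close>

abbreviation SG where "SG \<equiv> shifts_ge T S"
abbreviation SL where "SL \<equiv> shifts_less T S"
abbreviation TG where "TG \<equiv> T_gt T S"
abbreviation TL where "TL \<equiv> T_le T S"
definition L where "L i = left_perp T (TL i \<inter> Tp)"

lemma shifts_sub: "SG n \<subseteq> Obj T" "SL n \<subseteq> Obj T"
  using S_obj unfolding shifts_ge_def shifts_less_def by auto

lemma shifts_shift:
  "Y \<in> SG n \<Longrightarrow> \<Sigma> Y \<in> SG (n + 1)" "Y \<in> SG n \<Longrightarrow> \<Sigma>\<^sub>- Y \<in> SG (n - 1)"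
  "Y \<in> SL n \<Longrightarrow> \<Sigma> Y \<in> SL (n + 1)" "Y \<in> SL n \<Longrightarrow> \<Sigma>\<^sub>- Y \<in> SL (n - 1)"
proof -
  have o: "s \<in> Obj T" if "s \<in> S" for s using S_obj that by blast
  show "Y \<in> SG n \<Longrightarrow> \<Sigma> Y \<in> SG (n + 1)" "Y \<in> SL n \<Longrightarrow> \<Sigma> Y \<in> SL (n + 1)"
    unfolding shifts_ge_def shifts_less_def using shift_succ o by force+
  show "Y \<in> SG n \<Longrightarrow> \<Sigma>\<^sub>- Y \<in> SG (n - 1)" "Y \<in> SL n \<Longrightarrow> \<Sigma>\<^sub>- Y \<in> SL (n - 1)"
    unfolding shifts_ge_def shifts_less_def using shift_pred o by force+
qed

lemma shifts_mono: "m \<le> n \<Longrightarrow> SG n \<subseteq> SG m" "m \<le> n \<Longrightarrow> SL m \<subseteq> SL n"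
  unfolding shifts_ge_def shifts_less_def by force+

text \<open>The shift lowers the index, because T_{>i} is the left orthogonal of the shifts by at
  least -i.\<close>

lemma TG_shift: assumes "X \<in> Obj T" shows "\<Sigma> X \<in> TG i \<longleftrightarrow> X \<in> TG (i + 1)"
  unfolding T_gt_def
  by (rule shift_invariant_iff) (use shifts_sub shifts_shift(1)[of _ "- (i + 1)"] shifts_shift(2)[of _ "- i"] assms in simp_all)

lemma TL_shift: assumes "X \<in> Obj T" shows "\<Sigma> X \<in> TL i \<longleftrightarrow> X \<in> TL (i + 1)"
  unfolding T_le_def
  by (rule shift_invariant_iff) (use shifts_sub shifts_shift(3)[of _ "- (i + 1)"] shifts_shift(4)[of _ "- i"] assms in simp_all)

lemma TG_obj: "X \<in> TG i \<Longrightarrow> X \<in> Obj T" and TL_obj: "X \<in> TL i \<Longrightarrow> X \<in> Obj T" and L_obj: "X \<in> L i \<Longrightarrow> X \<in> Obj T"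
  by (simp_all add: T_gt_def T_le_def L_def left_perp_def)

lemma TG_shift': "X \<in> TG i \<Longrightarrow> \<Sigma> X \<in> TG (i - 1)" "X \<in> TG i \<Longrightarrow> \<Sigma>\<^sub>- X \<in> TG (i + 1)"
  and TL_shift': "X \<in> TL i \<Longrightarrow> \<Sigma> X \<in> TL (i - 1)" "X \<in> TL i \<Longrightarrow> \<Sigma>\<^sub>- X \<in> TL (i + 1)"
  using TG_shift[of X "i - 1"] TG_shift[of "\<Sigma>\<^sub>- X" i] TG_obj TL_shift[of X "i - 1"] TL_shift[of "\<Sigma>\<^sub>- X" i] TL_obj by simp_all

lemma L_shift: assumes "X \<in> Obj T" shows "\<Sigma> X \<in> L i \<longleftrightarrow> X \<in> L (i + 1)"
  unfolding L_def
proof (rule shift_invariant_iff[OF _ _ _ _ assms])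
  show "\<Sigma> Y \<in> TL i \<inter> Tp" if "Y \<in> TL (i + 1) \<inter> Tp" for Y using that TL_shift'(1)[of Y "i + 1"] U_shift by simp
  show "\<Sigma>\<^sub>- Y \<in> TL (i + 1) \<inter> Tp" if "Y \<in> TL i \<inter> Tp" for Y using that TL_shift'(2)[of Y i] U_shift by simp
qed (use TL_obj in blast)+

lemma L_shift': "X \<in> L i \<Longrightarrow> \<Sigma> X \<in> L (i - 1)" "X \<in> L i \<Longrightarrow> \<Sigma>\<^sub>- X \<in> L (i + 1)"
  using L_shift[of X "i - 1"] L_shift[of "\<Sigma>\<^sub>- X" i] L_obj by simp_all

lemma TL_mono: "i \<le> j \<Longrightarrow> TL i \<subseteq> TL j"
  unfolding T_le_def by (intro left_perp_antimono shifts_mono) simp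

lemma L_antimono: "i \<le> j \<Longrightarrow> L j \<subseteq> L i"
  unfolding L_def using TL_mono[of i j] by (intro left_perp_antimono) blast

lemma TG_ext: "\<lbrakk>Tri T X Y Z f g h; X \<in> TG i; Z \<in> TG i\<rbrakk> \<Longrightarrow> Y \<in> TG i"
  unfolding T_gt_def using left_perp_ext shifts_sub by blast
lemma TL_ext: "\<lbrakk>Tri T X Y Z f g h; X \<in> TL i; Z \<in> TL i\<rbrakk> \<Longrightarrow> Y \<in> TL i"
  unfolding T_le_def using left_perp_ext shifts_sub by blast
lemma L_ext: "\<lbrakk>Tri T X Y Z f g h; X \<in> L i; Z \<in> L i\<rbrakk> \<Longrightarrow> Y \<in> L i"
  unfolding L_def using left_perp_ext[of X Y Z f g h "TL i \<inter> Tp"] TL_obj by blast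

text \<open>The co-t-structures are given at index 0 only; orthogonality, truncation and perfectness
  are carried to all integers by shifting in both directions.\<close>

lemma int_shift_induct:
  assumes "P (0::int)" "\<And>i. P i \<Longrightarrow> P (i + 1)" "\<And>i. P i \<Longrightarrow> P (i - 1)"
  shows "P i"
  using assms by (induction i rule: int_induct[of _ 0]) auto

lemma torsion_left: "torsion_pair T (TG 0) (TL 0)"
  using RS2_left by (simp add: co_t_structure_def T_gt_def T_le_def)

lemma TG_TL_zero:
  assumes "X \<in> TG i" "Y \<in> TL i" shows "hom_zero T X Y"
proof -
  have "\<forall>X\<in>TG i. \<forall>Y\<in>TL i. hom_zero T X Y"
  proof (induction i rule: int_shift_induct)
    case 1 thus ?case using torsion_left by (simp add: torsion_pair_def)
  next
    case (2 i)
    thus ?case using TG_shift'(1)[of _ "i + 1"] TL_shift'(1)[of _ "i + 1"] TG_obj TL_obj hom_zero_shift by (metis add_diff_cancel_right')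
  next
    case (3 i)
    thus ?case using TG_shift'(2)[of _ "i - 1"] TL_shift'(2)[of _ "i - 1"] TG_obj TL_obj hom_zero_shift[of "\<Sigma>\<^sub>- _" "\<Sigma>\<^sub>- _"]
      by (metis Shi.F_obj diff_add_cancel shift_obj(2))
  qed
  thus ?thesis using assms by blast
qed

lemma TG_TL_decomp:
  assumes "X \<in> Obj T" obtains A B f g h where "A \<in> TG i" "B \<in> TL i" "Tri T A X B f g h"
proof -
  have "\<forall>X\<in>Obj T. \<exists>A B f g h. A \<in> TG i \<and> B \<in> TL i \<and> Tri T A X B f g h"
  proof (induction i rule: int_shift_induct)
    case 1 
    have "star T (TG 0) (TL 0) = Obj T" using torsion_left by (simp add: torsion_pair_def)
    thus ?case unfolding star_def by blast
  next
    case (2 i)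
    show ?case
    proof
      fix X assume X: "X \<in> Obj T"
      then obtain A B f g h where *: "A \<in> TG i" "B \<in> TL i" "Tri T A (\<Sigma> X) B f g h" using 2 Sh.F_obj by blast
      have "Tri T (\<Sigma>\<^sub>- A) X (\<Sigma>\<^sub>- B) (\<sigma>\<^sub>- f) (\<sigma>\<^sub>- g) (\<boxminus> \<sigma>\<^sub>- h)" using tri_unshift[OF *(3)] X by simp
      thus "\<exists>A B f g h. A \<in> TG (i + 1) \<and> B \<in> TL (i + 1) \<and> Tri T A X B f g h"
        using TG_shift'(2)[OF *(1)] TL_shift'(2)[OF *(2)] by blast
    qed
  next
    case (3 i)
    show ?case
    proof
      fix X assume X: "X \<in> Obj T"
      then obtain A B f g h where *: "A \<in> TG i" "B \<in> TL i" "Tri T A (\<Sigma>\<^sub>- X) B f g h" using 3 Shi.F_obj by blast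
      have "Tri T (\<Sigma> A) X (\<Sigma> B) (\<sigma> f) (\<sigma> g) (\<boxminus> \<sigma> h)" using tri_shift[OF *(3)] X by simp
      thus "\<exists>A B f g h. A \<in> TG (i - 1) \<and> B \<in> TL (i - 1) \<and> Tri T A X B f g h"
        using TG_shift'(1)[OF *(1)] TL_shift'(1)[OF *(2)] by blast
    qed
  qed
  thus ?thesis using assms that by blast
qed

lemma TG_Tp: assumes "X \<in> TG i" shows "X \<in> Tp"
proof -
  have "TG i \<subseteq> Tp"
  proof (induction i rule: int_shift_induct)
    case 1 show ?case using RS2_left_perfect by (simp add: T_gt_def)
  next
    case (2 i)
    show ?case
    proof
      fix X assume X: "X \<in> TG (i + 1)"
      hence "\<Sigma> X \<in> Tp" using TG_shift'(1)[OF X] 2 by auto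
      thus "X \<in> Tp" using U_shift(2)[of "\<Sigma> X"] TG_obj[OF X] by simp
    qed
  next
    case (3 i)
    show ?case
    proof
      fix X assume X: "X \<in> TG (i - 1)"
      hence "\<Sigma>\<^sub>- X \<in> Tp" using TG_shift'(2)[OF X] 3 by auto
      thus "X \<in> Tp" using U_shift(1)[of "\<Sigma>\<^sub>- X"] TG_obj[OF X] by simp
    qed
  qed
  thus ?thesis using assms by blast
qed

section \<open>The second co-t-structure transported along the Serre functor\<close>

abbreviation RG where "RG \<equiv> right_perp T (SG 0)"
abbreviation RL where "RL \<equiv> right_perp T (SL 0)"

lemma torsion_right: "torsion_pair T RG RL"
  using RS2_right by (simp add: co_t_structure_def)

text \<open>Serre duality identifies \<open>\<S>(T_le 0 \<inter> Tp)\<close> with \<open>RL\<close>; hence the second co-t-structure,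
transported along the inverse of \<open>\<S>\<close>, has \<open>T_le 0 \<inter> Tp\<close> as its right half.\<close>

lemma TL0_iff: assumes "X \<in> Tp" shows "X \<in> TL 0 \<longleftrightarrow> \<S> X \<in> RL"
proof -
  have "hom_zero T X s \<longleftrightarrow> hom_zero T s (\<S> X)" if "s \<in> SL 0" for s
    using hom_zero_dual[OF assms] shifts_sub that by blast
  thus ?thesis using U_obj[OF assms] by (simp add: T_le_def left_perp_def right_perp_def)
qed

lemma right_perp_iso: "\<lbrakk>X \<in> right_perp T A; is_iso T X Y f; A \<subseteq> Obj T\<rbrakk> \<Longrightarrow> Y \<in> right_perp T A"
  using hom_zero_iso[OF _ is_iso_ident] is_iso_arrow[of X Y f] unfolding right_perp_def arrow_def by blast

text \<open>\<open>RL\<close> consists of perfect objects, on which \<open>SS\<close> is essentially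
  surjective; duality then places the preimage in \<open>TL 0\<close>.\<close>

lemma RL_lift: assumes "B' \<in> RL" obtains B e where "B \<in> TL 0 \<inter> Tp" "is_iso T B' (\<S> B) e"
proof -
  have "B' \<in> Tp" using RS2_right_perfect assms by blast
  then obtain B e where B: "B \<in> Tp" "is_iso T (\<S> B) B' e" using SS_Tp(2) by blast
  obtain d where d: "is_iso T B' (\<S> B) d" using B(2) by (rule is_isoE)
  have "\<S> B \<in> RL" by (rule right_perp_iso[OF assms d shifts_sub(2)])
  thus ?thesis using that TL0_iff B(1) d by blast
qed

text \<open>Orthogonality of \<open>A\<close> to \<open>TL 0 \<inter> Tp\<close> becomes
  orthogonality of its image to all of \<open>RL\<close>, and the left orthogonal of
  \<open>RL\<close> is \<open>RG\<close> by the torsion pair.\<close>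

lemma L0_SS: assumes "A \<in> L 0" shows "\<S> A \<in> RG"
proof -
  have A: "A \<in> Obj T" using assms by (rule L_obj)
  have "hom_zero T (\<S> A) B'" if B': "B' \<in> RL" for B'
  proof -
    obtain B e where B: "B \<in> TL 0 \<inter> Tp" "is_iso T B' (\<S> B) e" using B' by (rule RL_lift)
    obtain d where d: "is_iso T (\<S> B) B' d" using B(2) by (rule is_isoE)
    have "hom_zero T A B" using assms B(1) by (simp add: L_def left_perp_def)
    hence "hom_zero T (\<S> A) (\<S> B)" using hom_zero_SS[OF A U_obj] B(1) by blast
    thus ?thesis using hom_zero_iso[OF _ is_iso_ident d] A by simp
  qed
  hence "\<S> A \<in> left_perp T RL" using A by (simp add: left_perp_def)
  thus ?thesis using torsion_right by (simp add: torsion_pair_def)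
qed

text \<open>The image of \<open>X\<close> under \<open>SS\<close> is truncated, and then the right
  term and the map onto it are lifted, by density on perfect objects and by fullness. The cocone of
  the lifted map is sent to an object isomorphic to the left term \<open>A'\<close>, from which it
  inherits the orthogonality defining \<open>L 0\<close>.\<close>

lemma L_decomp0:
  assumes X: "X \<in> Obj T" obtains A B f g h where "A \<in> L 0" "B \<in> TL 0 \<inter> Tp" "Tri T A X B f g h"
proof -
  have "\<S> X \<in> star T RG RL" using torsion_right X by (simp add: torsion_pair_def)
  then obtain A' B' f' g' h' where A': "A' \<in> RG" "B' \<in> RL" "Tri T A' (\<S> X) B' f' g' h'"
    unfolding star_def by blast
  obtain B e where B: "B \<in> TL 0 \<inter> Tp" "is_iso T B' (\<S> B) e" using A'(2) by (rule RL_lift)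
  have Bo: "B \<in> Obj T" using B(1) U_obj by blast
  note t' = tri_arrow[OF A'(3)] is_iso_arrow[OF B(2)]
  have "arrow (e \<bullet> g') (\<S> X) (\<S> B)" using t' by (simp add: arrow_iff)
  then obtain b where b: "arrow b X B" "\<s> b = e \<bullet> g'" using SS.fullE[OF SS_ff(2) X Bo] by blast
  obtain A f h where A: "Tri T A X B f b h" using b(1) by (rule tri_cocone)
  have Ao: "A \<in> Obj T" using tri_obj[OF A] by blast
  obtain h'' where SA: "Tri T (\<S> A) (\<S> X) (\<S> B) (\<s> f) (\<s> b) h''" using A by (rule SS_tri)
  have sq: "e \<bullet> g' = \<s> b \<bullet> idt (\<S> X)" using b X SS.F_arrow[OF b(1)] by (simp add: arrow_iff)
  obtain a where a: "arrow a A' (\<S> A)" "idt (\<S> X) \<bullet> f' = \<s> f \<bullet> a" "\<sigma> a \<bullet> h' = h'' \<bullet> e"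
    by (rule tri_morphism_left[OF A'(3) SA arrow_ident t'(4) sq]) (use X in simp_all)
  have ia: "is_iso T A' (\<S> A) a"
    by (rule tri_iso_first[OF A'(3) SA is_iso_ident B(2) a(1,2) sq a(3)]) (use X in simp)
  have "hom_zero T A C" if C: "C \<in> TL 0 \<inter> Tp" for C
  proof -
    have Co: "C \<in> Obj T" using C U_obj by blast
    have "\<S> C \<in> RL" using TL0_iff C by blast
    hence "hom_zero T A' (\<S> C)" using A'(1) torsion_right by (simp add: torsion_pair_def)
    hence "hom_zero T (\<S> A) (\<S> C)" using hom_zero_iso[OF _ ia is_iso_ident] Co by simp
    thus ?thesis using hom_zero_SS Ao Co by blast
  qed
  hence "A \<in> L 0" using Ao by (simp add: L_def left_perp_def)
  thus ?thesis using that B(1) A by blast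
qed

lemma L_decomp:
  assumes "X \<in> Obj T" obtains A B f g h where "A \<in> L i" "B \<in> TL i \<inter> Tp" "Tri T A X B f g h"
proof -
  have "\<forall>X\<in>Obj T. \<exists>A B f g h. A \<in> L i \<and> B \<in> TL i \<inter> Tp \<and> Tri T A X B f g h"
  proof (induction i rule: int_shift_induct)
    case 1 
    show ?case using L_decomp0 by metis
  next
    case (2 i)
    show ?case
    proof
      fix X assume X: "X \<in> Obj T"
      then obtain A B f g h where *: "A \<in> L i" "B \<in> TL i" "B \<in> Tp" "Tri T A (\<Sigma> X) B f g h" using 2 Sh.F_obj by blast
      have "Tri T (\<Sigma>\<^sub>- A) X (\<Sigma>\<^sub>- B) (\<sigma>\<^sub>- f) (\<sigma>\<^sub>- g) (\<boxminus> \<sigma>\<^sub>- h)" using tri_unshift[OF *(4)] X by simp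
      thus "\<exists>A B f g h. A \<in> L (i + 1) \<and> B \<in> TL (i + 1) \<inter> Tp \<and> Tri T A X B f g h"
        using L_shift'(2)[OF *(1)] TL_shift'(2)[OF *(2)] U_shift(2)[OF *(3)] by blast
    qed
  next
    case (3 i)
    show ?case
    proof
      fix X assume X: "X \<in> Obj T"
      then obtain A B f g h where *: "A \<in> L i" "B \<in> TL i" "B \<in> Tp" "Tri T A (\<Sigma>\<^sub>- X) B f g h" using 3 Shi.F_obj by blast
      have "Tri T (\<Sigma> A) X (\<Sigma> B) (\<sigma> f) (\<sigma> g) (\<boxminus> \<sigma> h)" using tri_shift[OF *(4)] X by simp
      thus "\<exists>A B f g h. A \<in> L (i - 1) \<and> B \<in> TL (i - 1) \<inter> Tp \<and> Tri T A X B f g h"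
        using L_shift'(1)[OF *(1)] TL_shift'(1)[OF *(2)] U_shift(1)[OF *(3)] by blast
    qed
  qed
  thus ?thesis using assms that by metis
qed

end


section \<open>The Frobenius structure and the additive quotient\<close>

context smc_quadruple
begin

notation VQ ("\<Q>")

definition FF where "FF = right_perp T (TG 0) \<inter> left_perp T (TL (-1) \<inter> Tp)"
definition PP where "PP = T_ge T S 0 \<inter> TL 0"

text \<open>The right orthogonal of T_{>0} is T_{<=0} by the torsion pair, so \<open>FF\<close> is
  described by the two kinds of truncation.\<close>

lemma FF_eq: "FF = TL 0 \<inter> L (-1)"
  using torsion_left by (simp add: FF_def L_def torsion_pair_def)

lemma PP_eq: "PP = TG (-1) \<inter> TL 0"
  by (simp add: PP_def T_ge_def)

lemma PP_Tp: "X \<in> PP \<Longrightarrow> X \<in> Tp"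
  using TG_Tp by (auto simp: PP_eq)

lemma PP_FF: "PP \<subseteq> FF"
proof
  fix X assume X: "X \<in> PP"
  hence "X \<in> L (-1)" using TG_TL_zero TG_obj by (auto simp: PP_eq L_def left_perp_def)
  thus "X \<in> FF" using X by (simp add: FF_eq PP_eq)
qed

lemma FF_obj: "X \<in> FF \<Longrightarrow> X \<in> Obj T"
  using TL_obj by (auto simp: FF_eq)

lemma FF_ext: "\<lbrakk>Tri T X Y Z f g h; X \<in> FF; Z \<in> FF\<rbrakk> \<Longrightarrow> Y \<in> FF"
  using TL_ext L_ext by (auto simp: FF_eq)

lemma zero_obj_PP: assumes "is_zero_obj T Z" shows "Z \<in> PP"
  using assms shifts_sub unfolding PP_eq T_gt_def T_le_def left_perp_def is_zero_obj_def by blast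

lemma FF_extension_closed: "extension_closed T FF"
  unfolding extension_closed_def using FF_obj FF_ext by blast

lemma FF_subcategory: "extension_closed_subcategory k T FF"
proof (intro extension_closed_subcategory.intro extension_closed_subcategory_axioms.intro triangulated_axioms FF_extension_closed)
  show "\<exists>Z\<in>FF. is_zero_obj T Z" using zero_obj_exists zero_obj_PP PP_FF by blast
qed

lemma perp_zero_L: "\<lbrakk>X \<in> L i; Y \<in> TL i; Y \<in> Tp\<rbrakk> \<Longrightarrow> hom_zero T X Y"
  by (simp add: L_def left_perp_def)

section \<open>Projective and injective objects\<close>

lemma PP_projective: assumes "X \<in> PP" "Y \<in> FF" shows "hom_zero T X (\<Sigma> Y)"
  using assms TG_TL_zero[of X "-1" "\<Sigma> Y"] TL_shift'(1)[of Y 0] by (simp add: PP_eq FF_eq)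

text \<open>The shift of \<open>X\<close> is a perfect object of \<open>TL (-1)\<close>, and these
  are exactly the objects to which \<open>L (-1)\<close> is orthogonal. This explains the perfect
  objects in the definition of \<open>FF\<close>.\<close>

lemma PP_injective: assumes "X \<in> PP" "Y \<in> FF" shows "hom_zero T Y (\<Sigma> X)"
  using assms perp_zero_L[of Y "-1" "\<Sigma> X"] TL_shift'(1)[of X 0] PP_Tp U_shift(1)[of X] by (simp add: PP_eq FF_eq)

text \<open>The cover is the truncation of \<open>X\<close> in T_{>=0}, which is
  \<open>TG (-1)\<close>. Its kernel is the unshifted right term; the kernel stays in
  \<open>L (-1)\<close> because a map from it to a perfect object of \<open>TL (-1)\<close> is
  squeezed between maps from \<open>A\<close> and maps from the unshifted \<open>X\<close>.\<close>

lemma FF_projective_cover: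
  assumes X: "X \<in> FF" obtains X' P f g h where "X' \<in> FF" "P \<in> PP" "Tri T X' P X f g h"
proof -
  obtain A B f g h where A: "A \<in> TG (-1)" "B \<in> TL (-1)" "Tri T A X B f g h"
    using FF_obj[OF X] by (rule TG_TL_decomp)
  note t = tri_unrot[OF A(3)]
  have B': "\<Sigma>\<^sub>- B \<in> TL 0" using TL_shift'(2)[OF A(2)] by simp
  have "A \<in> TL 0" using TL_ext[OF t B'] X by (simp add: FF_eq)
  hence AP: "A \<in> PP" using A by (simp add: PP_eq)
  have "hom_zero T (\<Sigma>\<^sub>- B) Y" if Y: "Y \<in> TL (-1) \<inter> Tp" for Y
  proof -
    have Yo: "Y \<in> Obj T" using Y U_obj by blast
    have 1: "hom_zero T A Y" using TG_TL_zero[OF A(1)] Y by blast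
    \<comment> \<open>\<open>TL (-1)\<close> is stable under the shift, so orthogonality of
      \<open>X\<close> also covers the shift of \<open>Y\<close>, that is, maps from the unshifted
      \<open>X\<close> to \<open>Y\<close>.\<close>
    have "\<Sigma> Y \<in> TL (-1)" using TL_shift'(1)[of Y "-1"] TL_mono[of "-2" "-1"] Y by auto
    hence "hom_zero T X (\<Sigma> Y)" using perp_zero_L[of X "-1" "\<Sigma> Y"] X Y U_shift(1) by (simp add: FF_eq)
    hence "hom_zero T (\<Sigma>\<^sub>- X) Y" using hom_zero_shift_left(2)[OF FF_obj[OF X] Yo] by simp
    thus ?thesis using hom_zero_mid_left[OF tri_unrot[OF t] _ 1 Yo] by blast
  qed
  hence "\<Sigma>\<^sub>- B \<in> L (-1)" using TL_obj[OF B'] by (simp add: L_def left_perp_def)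
  hence "\<Sigma>\<^sub>- B \<in> FF" using B' by (simp add: FF_eq)
  thus ?thesis using that AP t by blast
qed

text \<open>Truncation with respect to \<open>L 0\<close> gives a perfect hull \<open>B\<close> in
  \<open>TL 0\<close> with cokernel in \<open>FF\<close>. What remains is that \<open>B\<close> lies
  in \<open>TG (-1)\<close>, although the truncation provides only the weaker membership in
  \<open>L (-1)\<close>.\<close>

lemma FF_injective_hull:
  assumes X: "X \<in> FF" obtains X' P f g h where "X' \<in> FF" "P \<in> PP" "Tri T X P X' f g h"
proof -
  have Xo: "X \<in> Obj T" using X by (rule FF_obj)
  obtain A B f g h where A: "A \<in> L 0" "B \<in> TL 0 \<inter> Tp" "Tri T A X B f g h" using Xo by (rule L_decomp)
  note t = tri_rot[OF A(3)]
  have SA: "\<Sigma> A \<in> L (-1)" using L_shift'(1)[OF A(1)] by simp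
  have BL: "B \<in> L (-1)" using L_ext[OF t _ SA] X by (simp add: FF_eq)
  have "\<Sigma> X \<in> TL 0" using TL_shift'(1)[of X 0] TL_mono[of "-1" 0] X by (auto simp: FF_eq)
  hence "\<Sigma> A \<in> TL 0" using TL_ext[OF tri_rot[OF t]] A(2) by blast
  hence SF: "\<Sigma> A \<in> FF" using SA by (simp add: FF_eq)
  have Bo: "B \<in> Obj T" using A(2) U_obj by blast
  obtain B1 B2 u v w where B: "B1 \<in> TG (-1)" "B2 \<in> TL (-1)" "Tri T B1 B B2 u v w"
    using Bo by (rule TG_TL_decomp)
  note tB = tri_arrow[OF B(3)]
  \<comment> \<open>For perfect objects \<open>L (-1)\<close> and \<open>TG (-1)\<close> agree: the
    right term of the \<open>TG (-1)\<close> truncation is perfect, so the map \<open>v\<close> to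
    it vanishes and \<open>B\<close> is a retract of the left term.\<close>
  have "B2 \<in> Tp" using U_cone[OF B(3) TG_Tp[OF B(1)]] A(2) by blast
  hence "v = zr B B2" using hom_zeroD[OF perp_zero_L[OF BL B(2)] tB(2)] by blast
  then obtain d where d: "arrow d B B1" "u \<bullet> d = idt B"
    using tri_lift[OF B(3) arrow_ident[OF Bo]] Bo tri_obj[OF B(3)] by auto
  \<comment> \<open>\<open>SG 1\<close> is the class whose left orthogonal is
    \<open>TG (-1)\<close>, and vanishing of Hom passes to the retract.\<close>
  have "hom_zero T B Y" if Y: "Y \<in> SG 1" for Y
  proof -
    have "hom_zero T B1 Y" using B(1) Y by (simp add: T_gt_def left_perp_def)
    thus ?thesis using hom_zero_retract(1)[OF d(1) tB(1) d(2)] Y shifts_sub(1) by blast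
  qed
  hence "B \<in> PP" using Bo A(2) by (simp add: PP_eq T_gt_def left_perp_def)
  thus ?thesis using that SF t by blast
qed

lemma PP_retract:
  assumes "arrow i X B" "arrow p B X" "p \<bullet> i = idt X" "B \<in> PP" shows "X \<in> PP"
proof -
  have "hom_zero T X W" if "hom_zero T B W" "W \<in> Obj T" for W
    using hom_zero_retract(1)[OF assms(1-3) that(2) that(1)] .
  moreover have "X \<in> Obj T" using assms(1) by (simp add: arrow_def)
  ultimately show ?thesis using assms(4) shifts_sub unfolding PP_eq T_gt_def T_le_def left_perp_def by blast
qed

text \<open>The connecting map of the cover of a projective object vanishes, so the object is a
  retract of an object of \<open>PP\<close>. The injective case uses the hull.\<close>

lemma FF_Proj: "Proj (sub_extricat T FF) = PP"
proof
  show "PP \<subseteq> Proj (sub_extricat T FF)"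
    using PP_projective PP_FF by (auto simp: Proj_def sub_extricat_simps(1) sub_extricat_Ext hom_zero_def)
  show "Proj (sub_extricat T FF) \<subseteq> PP"
  proof
    fix X assume "X \<in> Proj (sub_extricat T FF)"
    hence X: "X \<in> FF" and p: "\<And>Y. Y \<in> FF \<Longrightarrow> hom_zero T X (\<Sigma> Y)"
      by (auto simp: Proj_def sub_extricat_simps(1) sub_extricat_Ext hom_zero_def)
    have Xo: "X \<in> Obj T" using X by (rule FF_obj)
    obtain X' P f g h where t: "X' \<in> FF" "P \<in> PP" "Tri T X' P X f g h" using X by (rule FF_projective_cover)
    have "h = zr X (\<Sigma> X')" using hom_zeroD[OF p[OF t(1)] tri_arrow(3)[OF t(3)]] .
    then obtain s where "arrow s X P" "g \<bullet> s = idt X"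
      using tri_lift[OF tri_rot[OF t(3)] arrow_ident[OF Xo]] Xo FF_obj[OF t(1)] by auto
    thus "X \<in> PP" using PP_retract[OF _ tri_arrow(2)[OF t(3)] _ t(2)] by blast
  qed
qed

lemma FF_Inj: "Inj (sub_extricat T FF) = PP"
proof
  show "PP \<subseteq> Inj (sub_extricat T FF)"
    using PP_injective PP_FF by (auto simp: Inj_def sub_extricat_simps(1) sub_extricat_Ext hom_zero_def)
  show "Inj (sub_extricat T FF) \<subseteq> PP"
  proof
    fix X assume "X \<in> Inj (sub_extricat T FF)"
    hence X: "X \<in> FF" and p: "\<And>Y. Y \<in> FF \<Longrightarrow> hom_zero T Y (\<Sigma> X)"
      by (auto simp: Inj_def sub_extricat_simps(1) sub_extricat_Ext hom_zero_def)
    have Xo: "X \<in> Obj T" using X by (rule FF_obj)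
    obtain X' P f g h where t: "X' \<in> FF" "P \<in> PP" "Tri T X P X' f g h" using X by (rule FF_injective_hull)
    have h: "h = zr X' (\<Sigma> X)" using hom_zeroD[OF p[OF t(1)] tri_arrow(3)[OF t(3)]] .
    note u = tri_unrot[OF t(3)]
    have "idt X \<bullet> (\<boxminus> \<sigma>\<^sub>- h) = zr (\<Sigma>\<^sub>- X') X" using h Xo FF_obj[OF t(1)] by simp
    then obtain r where "arrow r P X" "r \<bullet> f = idt X" using tri_extend[OF u arrow_ident[OF Xo]] by blast
    thus "X \<in> PP" using PP_retract[OF tri_arrow(1)[OF t(3)] _ _ t(2)] by blast
  qed
qed

lemma FF_frobenius: "frobenius_extriangulated k (sub_extricat T FF)"
proof -
  interpret E: extension_closed_subcategory k T FF by (rule FF_subcategory)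
  have c: "conflation (sub_extricat T FF) X Y Z" if "Tri T X Y Z f g h" "X \<in> FF" "Y \<in> FF" "Z \<in> FF" for X Y Z f g h
    unfolding conflation_def sub_extricat_Ext sub_extricat_simps(8) using that tri_arrow(3)[OF that(1)] arrow_Mor by blast
  show ?thesis
    unfolding frobenius_extriangulated_def FF_Proj FF_Inj sub_extricat_simps(1)
  proof (intro conjI ballI E.SE_extriangulated refl)
    fix X assume X: "X \<in> FF"
    show "\<exists>X'\<in>FF. \<exists>P\<in>PP. conflation (sub_extricat T FF) X' P X"
      using FF_projective_cover[OF X] c X PP_FF by (metis subsetD)
    show "\<exists>I\<in>PP. \<exists>X''\<in>FF. conflation (sub_extricat T FF) X I X''"
      using FF_injective_hull[OF X] c X PP_FF by (metis subsetD)
  qed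
qed

section \<open>Comparison of the additive quotient with the singularity category\<close>

lemma factor_TG:
  assumes "X \<in> L (-1)" "V \<in> Tp" "arrow a X V" "arrow b V Y"
  obtains V' a' b' where "V' \<in> TG (-1)" "arrow a' X V'" "arrow b' V' Y" "b \<bullet> a = b' \<bullet> a'"
proof -
  obtain A B f g h where A: "A \<in> TG (-1)" "B \<in> TL (-1)" "Tri T A V B f g h"
    using U_obj[OF assms(2)] by (rule TG_TL_decomp)
  note t = tri_arrow[OF A(3)]
  \<comment> \<open>The truncation of a perfect object has perfect terms, and \<open>L (-1)\<close>
    is orthogonal to the right one; hence \<open>a\<close> lifts to the left one.\<close>
  have "B \<in> Tp" using U_cone[OF A(3) TG_Tp[OF A(1)] assms(2)] .
  hence "g \<bullet> a = zr X B" using hom_zeroD[OF perp_zero_L[OF assms(1) A(2)] arrow_cmp[OF assms(3) t(2)]] by blast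
  then obtain a' where a': "arrow a' X A" "f \<bullet> a' = a" using tri_lift[OF A(3) assms(3)] by blast
  have "b \<bullet> a = (b \<bullet> f) \<bullet> a'" unfolding a'(2)[symmetric] using a'(1) assms(4) t by (simp add: arrow_iff)
  moreover have "arrow (b \<bullet> f) A Y" using assms(4) t by (simp add: arrow_iff)
  ultimately show ?thesis using that A(1) a'(1) by blast
qed

text \<open>The cone map of the denominator lifts to the \<open>TG (-1)\<close> truncation
  \<open>A\<close> of the cone, which yields a finer denominator \<open>s'\<close> with cone
  \<open>A\<close>; the numerator then extends along \<open>s'\<close>. The assumptions on
  \<open>X\<close> and \<open>Y\<close> are kept separate because the duality uses objects outside
  \<open>FF\<close>.\<close>

lemma qf_full:
  assumes X: "X \<in> L (-1)" and Y: "Y \<in> TL 0" and a: "Q.arrow a X Y"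
  obtains f where "arrow f X Y" "qf f = a"
proof -
  obtain s f where r: "roof s f" "tgt s = X" "tgt f = Y" "a = fr s f" using a by (rule Q_arrowE)
  obtain C g h where C: "C \<in> Tp" "Tri T (src s) X C s g h" using qsE[of s] r by metis
  obtain A B u v w where A: "A \<in> TG (-1)" "B \<in> TL (-1)" "Tri T A C B u v w"
    using U_obj[OF C(1)] by (rule TG_TL_decomp)
  note tC = tri_arrow[OF C(2)] and tA = tri_arrow[OF A(3)]
  have "B \<in> Tp" using U_cone[OF A(3) TG_Tp[OF A(1)] C(1)] .
  hence "v \<bullet> g = zr X B" using hom_zeroD[OF perp_zero_L[OF X A(2)] arrow_cmp[OF tC(2) tA(2)]] by blast
  then obtain g' where g': "arrow g' X A" "u \<bullet> g' = g" using tri_lift[OF A(3) tC(2)] by blast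
  obtain W s' h' where W: "Tri T W X A s' g' h'" using g'(1) by (rule tri_cocone)
  note tW = tri_arrow[OF W]
  have Xo: "X \<in> Obj T" using X by (rule L_obj)
  have sq: "u \<bullet> g' = g \<bullet> idt X" using g' tC by (simp add: arrow_iff)
  obtain e where e: "arrow e W (src s)" "idt X \<bullet> s' = s \<bullet> e"
    by (rule tri_morphism_left[OF W C(2) arrow_ident[OF Xo] tA(1) sq])
  have se: "s \<bullet> e = s'" using e tW by (simp add: arrow_iff)
  have qs': "qs s'" using qsI[OF W TG_Tp[OF A(1)]] .
  have fe: "arrow (f \<bullet> e) W Y" using r e(1) TL_obj[OF Y] by (simp add: arrow_iff)
  \<comment> \<open>Here the index -1 of the truncation pays off: unshifting raises it to 0, which
    is what orthogonality to \<open>Y\<close> in \<open>TL 0\<close> requires.\<close>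
  have "\<Sigma>\<^sub>- A \<in> TG 0" using TG_shift'(2)[OF A(1)] by simp
  hence "hom_zero T (\<Sigma>\<^sub>- A) Y" using TG_TL_zero Y by blast
  moreover note tri_unrot[OF W]
  moreover have "arrow ((f \<bullet> e) \<bullet> (\<boxminus> \<sigma>\<^sub>- h')) (\<Sigma>\<^sub>- A) Y"
    by (rule arrow_cmp[OF tri_arrow(1)[OF tri_unrot[OF W]] fe])
  ultimately obtain d where d: "arrow d X Y" "d \<bullet> s' = f \<bullet> e"
    using tri_extend[OF tri_unrot[OF W] fe] hom_zeroD by blast
  have r': "roof (s \<bullet> e) (f \<bullet> e)" unfolding se using qs' fe tW by (simp add: arrow_iff)
  have "fr s f = fr (s \<bullet> e) (f \<bullet> e)"
    by (rule fr_eqI[OF r(1) r', where u = e and v = "idt W"])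
      (use r e(1) qs' tW se in \<open>simp_all add: arrow_iff\<close>)
  also have "\<dots> = fr (idt X \<bullet> s') (d \<bullet> s')" using d tW unfolding se by (simp add: arrow_iff)
  also have "\<dots> = fr (idt X) d" by (rule fr_refine(1)) (use d(1) qs' tW Xo in \<open>simp_all add: arrow_iff\<close>)
  also have "\<dots> = qf d" using d(1) by (simp add: qf_eq arrow_iff)
  finally show ?thesis using that d(1) r(4) by simp
qed

text \<open>Two truncations bring the perfect object in the middle into \<open>PP\<close>: the
  condition on the source pushes it into \<open>TG (-1)\<close>, the condition on the target into
  \<open>TL 0\<close>.\<close>

lemma FF_kernel:
  assumes X: "X \<in> FF" and Y: "Y \<in> FF"
  shows "f \<in> factor_ideal (full_sub T FF) PP X Y \<longleftrightarrow> arrow f X Y \<and> qf f = Q.zr X Y"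
proof
  have o: "X \<in> Obj T" "Y \<in> Obj T" using X Y FF_obj by blast+
  assume "f \<in> factor_ideal (full_sub T FF) PP X Y"
  then obtain a b Z where Z: "Z \<in> PP" "a \<in> Mor T X Z" "b \<in> Mor T Z Y" "f = b \<bullet> a"
    unfolding factor_ideal_def full_sub_def by auto
  have Zp: "Z \<in> Tp" using PP_Tp Z(1) by blast
  have "arrow a X Z" "arrow b Z Y" using Z o U_obj[OF Zp] by (simp_all add: Mor_arrow)
  thus "arrow f X Y \<and> qf f = Q.zr X Y" using qf_factor_zero[OF Zp] arrow_cmp Z(4) by blast
next
  assume "arrow f X Y \<and> qf f = Q.zr X Y"
  then obtain V a b where V: "V \<in> Tp" "arrow a X V" "arrow b V Y" "f = b \<bullet> a" using qf_zero_factor by blast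
  have XL: "X \<in> L (-1)" using X by (simp add: FF_eq)
  obtain V' a' b' where V': "V' \<in> TG (-1)" "arrow a' X V'" "arrow b' V' Y" "f = b' \<bullet> a'"
    using factor_TG[OF XL V(1-3)] V(4) by metis
  \<comment> \<open>The second truncation does not undo the first: \<open>B\<close> is an extension
    of the shift of \<open>A\<close> by \<open>V'\<close>, both of which lie in
    \<open>TG (-1)\<close>.\<close>
  obtain A B u v w where A: "A \<in> TG 0" "B \<in> TL 0" "Tri T A V' B u v w"
    using TG_obj[OF V'(1)] by (rule TG_TL_decomp)
  note tA = tri_arrow[OF A(3)]
  have "b' \<bullet> u = zr A Y" using hom_zeroD[OF TG_TL_zero[OF A(1)] arrow_cmp[OF tA(1) V'(3)]] Y by (simp add: FF_eq)
  then obtain c where c: "arrow c B Y" "c \<bullet> v = b'" using tri_extend[OF A(3) V'(3)] by blast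
  have "\<Sigma> A \<in> TG (-1)" using TG_shift'(1)[OF A(1)] by simp
  hence "B \<in> TG (-1)" using TG_ext[OF tri_rot[OF A(3)] V'(1)] by blast
  hence B: "B \<in> PP" using A(2) by (simp add: PP_eq)
  have "f = c \<bullet> (v \<bullet> a')" unfolding V'(4) c(2)[symmetric] using c(1) tA V'(2) by (simp add: arrow_iff)
  moreover have "v \<bullet> a' \<in> Mor T X B" "c \<in> Mor T B Y" using arrow_Mor[OF arrow_cmp[OF V'(2) tA(2)]] arrow_Mor[OF c(1)] .
  ultimately show "f \<in> factor_ideal (full_sub T FF) PP X Y"
    using B unfolding factor_ideal_def full_sub_def by auto
qed

lemma Tp_cone_iso: 
  assumes "Tri T X Y Z f g h" shows "Z \<in> Tp \<Longrightarrow> is_iso \<Q> X Y (qf f)" "X \<in> Tp \<Longrightarrow> is_iso \<Q> Y Z (qf g)"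
proof -
  note t = tri_arrow[OF assms]
  show "is_iso \<Q> X Y (qf f)" if "Z \<in> Tp" using qf_iso[OF qsI[OF assms that]] t by (simp add: arrow_iff)
  show "is_iso \<Q> Y Z (qf g)" if "X \<in> Tp"
    using qf_iso[OF qsI[OF tri_rot[OF assms] U_shift(1)[OF that]]] t by (simp add: arrow_iff)
qed

text \<open>The last clause says that this replacement does not leave \<open>TL (i + 1)\<close>: the
  new object is an extension of \<open>X\<close> by the unshifted right term.\<close>

lemma rep_L: assumes "X \<in> Obj T" obtains X' e where "X' \<in> L i" "is_iso \<Q> X' X e" "X \<in> TL (i + 1) \<Longrightarrow> X' \<in> TL (i + 1)"
proof -
  obtain A B f g h where A: "A \<in> L i" "B \<in> TL i \<inter> Tp" "Tri T A X B f g h" using assms by (rule L_decomp)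
  have "A \<in> TL (i + 1)" if "X \<in> TL (i + 1)"
    using TL_ext[OF tri_unrot[OF A(3)] _ that] TL_shift'(2)[of B i] A(2) by blast
  thus ?thesis using that A Tp_cone_iso(1)[OF A(3)] by blast
qed

lemma rep_TL: assumes "X \<in> Obj T" obtains X' e where "X' \<in> TL i" "is_iso \<Q> X X' e"
proof -
  obtain A B f g h where A: "A \<in> TG i" "B \<in> TL i" "Tri T A X B f g h" using assms by (rule TG_TL_decomp)
  thus ?thesis using that Tp_cone_iso(2)[OF A(3) TG_Tp[OF A(1)]] by blast
qed

text \<open>The order of the replacements matters: \<open>TL 0\<close> comes before
  \<open>L (-1)\<close>, since the latter replacement is known to preserve the former
  condition.\<close>

lemma rep_FF: assumes "X \<in> Obj T" obtains X' e where "X' \<in> FF" "is_iso \<Q> X' X e"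
proof -
  obtain X1 e1 where 1: "X1 \<in> TL 0" "is_iso \<Q> X X1 e1" using assms by (rule rep_TL)
  obtain d where d: "is_iso \<Q> X1 X d" using 1(2) by (rule Q.is_isoE)
  obtain X2 e2 where 2: "X2 \<in> L (-1)" "is_iso \<Q> X2 X1 e2" "X1 \<in> TL 0 \<Longrightarrow> X2 \<in> TL 0"
    using rep_L[OF TL_obj[OF 1(1)], of "-1"] by auto
  have "X2 \<in> FF" using 1 2 by (simp add: FF_eq)
  thus ?thesis using that Q.is_iso_cmp[OF 2(2) d] by blast
qed

lemma FF_quotient:
  shows "additive_cat k (additive_quotient (full_sub T FF) PP)"
    and "\<exists>\<pi>. lin_equivalence k (additive_quotient (full_sub T FF) PP) \<Q> \<pi> \<and>
            (\<forall>X\<in>FF. FO \<pi> X = FO vf X) \<and>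
            (\<forall>X\<in>FF. \<forall>Y\<in>FF. \<forall>f\<in>Mor T X Y.
               FM \<pi> (FM (additive_quotient_functor (full_sub T FF) PP) f) = qf f)"
proof -
  interpret E: extension_closed_subcategory k T FF by (rule FF_subcategory)
  have fs: "Obj (full_sub T FF) = FF" "Hom (full_sub T FF) = Hom T" "ident (full_sub T FF) = ident T"
    "cmp (full_sub T FF) = cmp T" by (simp_all add: full_sub_def)
  have add: "additive_cat k (full_sub T FF)"
    by (rule additive_cat_cong[OF E.SE_additive]) (simp_all add: fs sub_extricat_simps)
  interpret A: additive_cat k "full_sub T FF" by (rule add)
  have arr: "A.arrow f X Y \<longleftrightarrow> arrow f X Y \<and> X \<in> FF \<and> Y \<in> FF" for f X Y
    unfolding A.arrow_def arrow_def fs using FF_obj by blast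
  have lf: "lin_functor k (full_sub T FF) \<Q> vf"
    using vf_functor A.lin_cat_axioms FF_obj unfolding lin_functor_def fs by blast
  interpret K: factor_kernel k "full_sub T FF" \<Q> vf PP
  proof (intro factor_kernel.intro lin_funI[OF lf] factor_kernel_axioms.intro)
    fix X Y f assume "X \<in> Obj (full_sub T FF)" "Y \<in> Obj (full_sub T FF)"
    thus "f \<in> factor_ideal (full_sub T FF) PP X Y \<longleftrightarrow> A.arrow f X Y \<and> qf f = Q.zr (FO vf X) (FO vf Y)"
      using FF_kernel[of X Y f] unfolding arr fs vf_FO by blast
  qed
  have full: K.full unfolding K.full_def fs vf_FO arr
  proof (intro ballI allI impI)
    fix X Y h assume XY: "X \<in> FF" "Y \<in> FF" and h: "Q.arrow h X Y"
    obtain f where "arrow f X Y" "qf f = h" by (rule qf_full[OF _ _ h]) (use XY in \<open>simp_all add: FF_eq\<close>)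
    thus "\<exists>f. (arrow f X Y \<and> X \<in> FF \<and> Y \<in> FF) \<and> qf f = h" using XY by blast
  qed
  have dense: K.dense unfolding K.dense_def fs vf_FO VQ_Obj using rep_FF by metis
  show "additive_cat k (additive_quotient (full_sub T FF) PP)" by (rule K.AQ_additive[OF add])
  obtain \<pi> where \<pi>: "lin_equivalence k (additive_quotient (full_sub T FF) PP) \<Q> \<pi>" "\<And>X. FO \<pi> X = FO vf X"
    "\<And>f X Y. A.arrow f X Y \<Longrightarrow> FM \<pi> (FM (additive_quotient_functor (full_sub T FF) PP) f) = qf f"
    using K.AQ_equivalence[OF full dense] by blast
  have "FM \<pi> (FM (additive_quotient_functor (full_sub T FF) PP) f) = qf f" if "X \<in> FF" "Y \<in> FF" "f \<in> Mor T X Y" for X Y f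
    using \<pi>(3)[of f X Y] that FF_obj unfolding arr by (simp add: Mor_arrow)
  thus "\<exists>\<pi>. lin_equivalence k (additive_quotient (full_sub T FF) PP) \<Q> \<pi> \<and>
            (\<forall>X\<in>FF. FO \<pi> X = FO vf X) \<and>
            (\<forall>X\<in>FF. \<forall>Y\<in>FF. \<forall>f\<in>Mor T X Y.
               FM \<pi> (FM (additive_quotient_functor (full_sub T FF) PP) f) = qf f)" using \<pi>(1,2) by blast
qed

text \<open>After replacing \<open>X\<close> by an object of \<open>L (-1)\<close> and
  \<open>Y\<close> by one of \<open>TL (-1)\<close>, which lies in \<open>TL 0\<close>, fullness
  presents the hom space of the quotient as a linear image of a finite-dimensional hom space of
  \<open>T\<close>.\<close>

lemma VQ_hom_finite: "hom_finite k \<Q>"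
  unfolding hom_finite_def VQ_Obj
proof (intro ballI)
  fix X Y assume XY: "X \<in> Obj T" "Y \<in> Obj T"
  obtain X' x where X': "X' \<in> L (-1)" "is_iso \<Q> X' X x" using XY(1) by (rule rep_L)
  obtain Y' y where Y': "Y' \<in> TL (-1)" "is_iso \<Q> Y Y' y" using XY(2) by (rule rep_TL)
  have o: "X' \<in> Obj T" "Y' \<in> Obj T" using X' Y' L_obj TL_obj by blast+
  obtain x' where x: "Q.arrow x X' X" "Q.arrow x' X X'" "x \<cdot>\<^bsub>\<Q>\<^esub> x' = ident \<Q> X" "x' \<cdot>\<^bsub>\<Q>\<^esub> x = ident \<Q> X'"
    using X'(2) by (rule Q.is_isoE)
  obtain y' where y: "Q.arrow y Y Y'" "Q.arrow y' Y' Y" "y' \<cdot>\<^bsub>\<Q>\<^esub> y = ident \<Q> Y" "y \<cdot>\<^bsub>\<Q>\<^esub> y' = ident \<Q> Y'"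
    using Y'(2) by (rule Q.is_isoE)
  let ?h = "\<lambda>f. y' \<cdot>\<^bsub>\<Q>\<^esub> (qf f \<cdot>\<^bsub>\<Q>\<^esub> x')"
  note Qm = Q.Mor_arrow[unfolded VQ_Obj]
  have ar: "Q.arrow (?h f) X Y" if "arrow f X' Y'" for f using qf_arrow[OF that] x y by (simp add: Q.arrow_iff)
  have lin: "linear_map k (Hom T X' Y') (Hom \<Q> X Y) ?h"
  proof (rule linear_mapI)
    show "vectorspace k (Hom T X' Y')" "vectorspace k (Hom \<Q> X Y)" using o XY hom_vectorspace Q.hom_vectorspace by simp_all
    show "?h f \<in> Mor \<Q> X Y" if "f \<in> Mor T X' Y'" for f using ar that o Q.arrow_Mor by (simp add: Mor_arrow)
    show "?h (f \<oplus>\<^bsub>Hom T X' Y'\<^esub> g) = ?h f \<oplus>\<^bsub>Hom \<Q> X Y\<^esub> ?h g" if "f \<in> Mor T X' Y'" "g \<in> Mor T X' Y'" for f g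
    proof -
      have fg: "arrow f X' Y'" "arrow g X' Y'" using that o by (simp_all add: Mor_arrow)
      show ?thesis unfolding pl_eq[OF fg(1)] Q.pl_eq[OF ar[OF fg(1)]]
        using fg qf_arrow[OF fg(1)] qf_arrow[OF fg(2)] x(2) y(2) by (simp add: arrow_iff Q.arrow_iff Q.cmp_pl)
    qed
    show "?h (c \<odot>\<^bsub>Hom T X' Y'\<^esub> f) = c \<odot>\<^bsub>Hom \<Q> X Y\<^esub> ?h f" if "c \<in> carrier k" "f \<in> Mor T X' Y'" for f c
    proof -
      have fg: "arrow f X' Y'" using that o by (simp_all add: Mor_arrow)
      show ?thesis unfolding sm_eq[OF fg(1)] Q.sm_eq[OF ar[OF fg(1)]]
        using that(1) fg qf_arrow[OF fg(1)] x(2) y(2) by (simp add: arrow_iff Q.arrow_iff Q.cmp_sm)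
    qed
  qed
  have "Mor \<Q> X Y \<subseteq> ?h ` Mor T X' Y'"
  proof
    fix a assume "a \<in> Mor \<Q> X Y"
    hence a: "Q.arrow a X Y" using XY by (simp add: Qm)
    have "Q.arrow (y \<cdot>\<^bsub>\<Q>\<^esub> (a \<cdot>\<^bsub>\<Q>\<^esub> x)) X' Y'" using a x y by (simp add: Q.arrow_iff)
    then obtain f where f: "arrow f X' Y'" "qf f = y \<cdot>\<^bsub>\<Q>\<^esub> (a \<cdot>\<^bsub>\<Q>\<^esub> x)"
      using qf_full[OF X'(1)] TL_mono[of "-1" 0] Y'(1) by (metis subsetD neg_le_0_iff_le zero_le_one)
    have "?h f = a" unfolding f(2) using a x y by (simp add: Q.arrow_iff Q.cmp_rew[OF y(3)])
    thus "a \<in> ?h ` Mor T X' Y'" using f(1) arrow_Mor by blast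
  qed
  moreover have "?h ` Mor T X' Y' \<subseteq> Mor \<Q> X Y" using linear_mapD(1)[OF lin] by blast
  ultimately show "vectorspace.fin_dim k (Hom \<Q> X Y)" using fin_dim_transfer[OF lin hom_fin_dim[OF o]] by blast
qed

end


section \<open>Serre duality on the singularity category\<close>

context lin_cat
begin

lemma dualD:
  assumes "X \<in> Obj C" "Y \<in> Obj C" "\<phi> \<in> carrier (dual k (Hom C X Y))"
  shows "arrow f X Y \<Longrightarrow> \<phi> f \<in> carrier k"
    "\<lbrakk>arrow f X Y; arrow g X Y\<rbrakk> \<Longrightarrow> \<phi> (f \<boxplus> g) = \<phi> f \<oplus>\<^bsub>k\<^esub> \<phi> g"
    "\<lbrakk>c \<in> carrier k; arrow f X Y\<rbrakk> \<Longrightarrow> \<phi> (c \<triangleright> f) = c \<otimes>\<^bsub>k\<^esub> \<phi> f"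
proof -
  note d = assms(3)[unfolded dual_simps(1)[OF hom_vectorspace[OF assms(1,2)]]]
  show "arrow f X Y \<Longrightarrow> \<phi> f \<in> carrier k" using d arrow_Mor PiE_mem by blast
  show "\<lbrakk>arrow f X Y; arrow g X Y\<rbrakk> \<Longrightarrow> \<phi> (f \<boxplus> g) = \<phi> f \<oplus>\<^bsub>k\<^esub> \<phi> g"
    using d arrow_Mor pl_eq[of f X Y g] by metis
  show "\<lbrakk>c \<in> carrier k; arrow f X Y\<rbrakk> \<Longrightarrow> \<phi> (c \<triangleright> f) = c \<otimes>\<^bsub>k\<^esub> \<phi> f"
    using d arrow_Mor sm_eq[of f X Y c] by metis
qed

lemma dual_precomp:
  assumes o: "X \<in> Obj C" "Y' \<in> Obj C" and \<phi>: "\<phi> \<in> carrier (dual k (Hom C X Y))" and g: "arrow g Y' Y"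
  shows "(\<lambda>h\<in>Mor C X Y'. \<phi> (g \<bullet> h)) \<in> carrier (dual k (Hom C X Y'))"
proof -
  have Y: "Y \<in> Obj C" using g by (simp add: arrow_def)
  note d = dualD[OF o(1) Y \<phi>]
  have a: "arrow (g \<bullet> h) X Y" if "h \<in> Mor C X Y'" for h using that g o by (simp add: Mor_arrow arrow_cmp)
  show ?thesis unfolding dual_simps(1)[OF hom_vectorspace[OF o]]
  proof (intro conjI ballI)
    show "(\<lambda>h\<in>Mor C X Y'. \<phi> (g \<bullet> h)) \<in> Mor C X Y' \<rightarrow>\<^sub>E carrier k" using d(1) a by simp
    fix v assume v: "v \<in> Mor C X Y'"
    hence va: "arrow v X Y'" using o by (simp add: Mor_arrow)
    show "(\<lambda>h\<in>Mor C X Y'. \<phi> (g \<bullet> h)) (v \<oplus>\<^bsub>Hom C X Y'\<^esub> w) =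
      (\<lambda>h\<in>Mor C X Y'. \<phi> (g \<bullet> h)) v \<oplus>\<^bsub>k\<^esub> (\<lambda>h\<in>Mor C X Y'. \<phi> (g \<bullet> h)) w" if w: "w \<in> Mor C X Y'" for w
    proof -
      have wa: "arrow w X Y'" using o w by (simp add: Mor_arrow)
      have "g \<bullet> (v \<boxplus> w) = g \<bullet> v \<boxplus> g \<bullet> w" using va wa g by (simp add: arrow_iff cmp_pl)
      thus ?thesis using v w arrow_Mor[OF arrow_pl[OF va wa]] d(2)[OF a[OF v] a[OF w]] by (simp add: pl_eq[OF va])
    qed
    show "(\<lambda>h\<in>Mor C X Y'. \<phi> (g \<bullet> h)) (c \<odot>\<^bsub>Hom C X Y'\<^esub> v) = c \<otimes>\<^bsub>k\<^esub> (\<lambda>h\<in>Mor C X Y'. \<phi> (g \<bullet> h)) v"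
      if c: "c \<in> carrier k" for c
    proof -
      have "g \<bullet> (c \<triangleright> v) = c \<triangleright> (g \<bullet> v)" using va g c by (simp add: arrow_iff cmp_sm)
      thus ?thesis using v arrow_Mor[OF arrow_sm[OF c va]] d(3)[OF c a[OF v]] by (simp add: sm_eq[OF va])
    qed
  qed
qed

lemma dual_postcomp:
  assumes o: "X \<in> Obj C" "Y \<in> Obj C" and \<phi>: "\<phi> \<in> carrier (dual k (Hom C X Y))" and f: "arrow f X X'"
  shows "(\<lambda>h\<in>Mor C X' Y. \<phi> (h \<bullet> f)) \<in> carrier (dual k (Hom C X' Y))"
proof -
  have X': "X' \<in> Obj C" using f by (simp add: arrow_def)
  note d = dualD[OF o \<phi>]
  have a: "arrow (h \<bullet> f) X Y" if "h \<in> Mor C X' Y" for h using that f o X' arrow_cmp by (simp add: Mor_arrow)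
  show ?thesis unfolding dual_simps(1)[OF hom_vectorspace[OF X' o(2)]]
  proof (intro conjI ballI)
    show "(\<lambda>h\<in>Mor C X' Y. \<phi> (h \<bullet> f)) \<in> Mor C X' Y \<rightarrow>\<^sub>E carrier k" using d(1) a by simp
    fix v assume v: "v \<in> Mor C X' Y"
    hence va: "arrow v X' Y" using o X' by (simp add: Mor_arrow)
    show "(\<lambda>h\<in>Mor C X' Y. \<phi> (h \<bullet> f)) (v \<oplus>\<^bsub>Hom C X' Y\<^esub> w) =
      (\<lambda>h\<in>Mor C X' Y. \<phi> (h \<bullet> f)) v \<oplus>\<^bsub>k\<^esub> (\<lambda>h\<in>Mor C X' Y. \<phi> (h \<bullet> f)) w" if w: "w \<in> Mor C X' Y" for w
    proof -
      have wa: "arrow w X' Y" using o X' w by (simp add: Mor_arrow)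
      have "(v \<boxplus> w) \<bullet> f = v \<bullet> f \<boxplus> w \<bullet> f" using va wa f by (simp add: arrow_iff cmp_pl)
      thus ?thesis using v w arrow_Mor[OF arrow_pl[OF va wa]] d(2)[OF a[OF v] a[OF w]] by (simp add: pl_eq[OF va])
    qed
    show "(\<lambda>h\<in>Mor C X' Y. \<phi> (h \<bullet> f)) (c \<odot>\<^bsub>Hom C X' Y\<^esub> v) = c \<otimes>\<^bsub>k\<^esub> (\<lambda>h\<in>Mor C X' Y. \<phi> (h \<bullet> f)) v"
      if c: "c \<in> carrier k" for c
    proof -
      have "(c \<triangleright> v) \<bullet> f = c \<triangleright> (v \<bullet> f)" using va f c by (simp add: arrow_iff cmp_sm)
      thus ?thesis using v arrow_Mor[OF arrow_sm[OF c va]] d(3)[OF c a[OF v]] by (simp add: sm_eq[OF va])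
    qed
  qed
qed

end

section \<open>Orthogonality bounds and the pairing for perfect objects\<close>

context smc_quadruple
begin

lemma zero_shift: "shift T 0 X = X"
  by (simp add: shift_def)

text \<open>The bound is immediate for a member of \<open>S\<close>, since \<open>TL (- m)\<close>
  is the left orthogonal of \<open>SL m\<close>; the tail condition is thick, and \<open>S\<close>
  generates \<open>T\<close>.\<close>

lemma TL_tail: assumes "Z \<in> Obj T" shows "\<exists>n. \<forall>m\<ge>n. \<forall>Y\<in>TL (- m). hom_zero T Y Z"
proof -
  have "thick T {Z \<in> Obj T. \<exists>n. \<forall>m\<ge>n. \<forall>Y\<in>TL (- m). hom_zero T Y Z}"
  proof (rule thick_right_tail)
    show "TL (- i) \<subseteq> Obj T" for i using TL_obj by blast
    show "\<Sigma> Y \<in> TL (- (i + 1))" "\<Sigma>\<^sub>- Y \<in> TL (- (i - 1))" if "Y \<in> TL (- i)" for i Y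
      using TL_shift'[OF that] by simp_all
  qed
  moreover have "S \<subseteq> {Z \<in> Obj T. \<exists>n. \<forall>m\<ge>n. \<forall>Y\<in>TL (- m). hom_zero T Y Z}"
  proof
    fix s assume s: "s \<in> S"
    \<comment> \<open>The inequality in \<open>SL m\<close> is strict, so the unshifted
      \<open>s\<close> belongs to it from m = 1 on.\<close>
    have "hom_zero T Y s" if "m \<ge> 1" "Y \<in> TL (- m)" for m Y
    proof -
      have "shift T 0 s \<in> SL m" using s that(1) unfolding shifts_less_def by force
      thus ?thesis using that(2) by (simp add: T_le_def left_perp_def zero_shift)
    qed
    thus "s \<in> {Z \<in> Obj T. \<exists>n. \<forall>m\<ge>n. \<forall>Y\<in>TL (- m). hom_zero T Y Z}" using s S_obj by blast
  qed
  ultimately show ?thesis using thick_generated assms by blast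
qed

text \<open>\<open>L m\<close> is defined by maps out of it, so maps into it cannot be tested on
  \<open>S\<close> directly. Its image under \<open>SS\<close>, however, lies in a right orthogonal
  of shifts of \<open>S\<close>. The bound is therefore shown for maps into the images and
  transferred back, as \<open>SS\<close> is fully faithful.\<close>

lemma L_tail: assumes X: "X \<in> Obj T" shows "\<exists>n. \<forall>m\<ge>n. \<forall>A\<in>L m. hom_zero T X A"
proof -
  \<comment> \<open>The isomorphism closure of the image of \<open>L j\<close>: \<open>SS\<close>
    commutes with the shift only up to isomorphism, so the image itself need not be stable.\<close>
  define W where "W j = {B. \<exists>A\<in>L j. \<exists>e. is_iso T (\<S> A) B e}" for j
  have "thick T {Z \<in> Obj T. \<exists>n. \<forall>m\<ge>n. \<forall>Y\<in>W m. hom_zero T Z Y}"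
  proof (rule thick_left_tail)
    show "W i \<subseteq> Obj T" for i by (auto simp: W_def is_iso_def)
    show "\<Sigma> Y \<in> W (i - 1)" if Y: "Y \<in> W i" for i Y
    proof -
      obtain A e where A: "A \<in> L i" "is_iso T (\<S> A) Y e" using Y by (auto simp: W_def)
      obtain d where d: "is_iso T (\<S> (\<Sigma> A)) (\<Sigma> (\<S> A)) d" using SS_shift[OF L_obj[OF A(1)]] .
      show ?thesis using is_iso_cmp[OF d Sh.F_iso[OF A(2)]] L_shift'(1)[OF A(1)] by (auto simp: W_def)
    qed
    show "\<Sigma>\<^sub>- Y \<in> W (i + 1)" if Y: "Y \<in> W i" for i Y
    proof -
      obtain A e where A: "A \<in> L i" "is_iso T (\<S> A) Y e" using Y by (auto simp: W_def)
      have Ao: "A \<in> Obj T" using A(1) by (rule L_obj)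
      obtain d where d: "is_iso T (\<S> (\<Sigma> (\<Sigma>\<^sub>- A))) (\<Sigma> (\<S> (\<Sigma>\<^sub>- A))) d" using SS_shift[of "\<Sigma>\<^sub>- A"] Ao by auto
      obtain d' where d': "is_iso T (\<Sigma> (\<S> (\<Sigma>\<^sub>- A))) (\<S> (\<Sigma> (\<Sigma>\<^sub>- A))) d'" using d by (rule is_isoE)
      have "is_iso T (\<S> (\<Sigma>\<^sub>- A)) (\<Sigma>\<^sub>- (\<S> A)) (\<sigma>\<^sub>- d')" using Shi.F_iso[OF d'] Ao by simp
      thus ?thesis using is_iso_cmp[OF _ Shi.F_iso[OF A(2)]] L_shift'(2)[OF A(1)] unfolding W_def by blast
    qed
  qed
  moreover have "S \<subseteq> {Z \<in> Obj T. \<exists>n. \<forall>m\<ge>n. \<forall>Y\<in>W m. hom_zero T Z Y}"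
  proof
    fix s assume s: "s \<in> S"
    have so: "s \<in> Obj T" using s S_obj by blast
    have "hom_zero T s Y" if m: "m \<ge> 0" and Y: "Y \<in> W m" for m Y
    proof -
      obtain A e where A: "A \<in> L m" "is_iso T (\<S> A) Y e" using Y by (auto simp: W_def)
      have "A \<in> L 0" using A(1) L_antimono[OF m] by blast
      hence "\<S> A \<in> RG" by (rule L0_SS)
      moreover have "shift T 0 s \<in> SG 0" using s unfolding shifts_ge_def by force
      ultimately have "hom_zero T s (\<S> A)" by (simp add: right_perp_def zero_shift)
      thus ?thesis using hom_zero_iso[OF _ is_iso_ident[OF so] A(2)] by blast
    qed
    thus "s \<in> {Z \<in> Obj T. \<exists>n. \<forall>m\<ge>n. \<forall>Y\<in>W m. hom_zero T Z Y}" using so by blast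
  qed
  ultimately have "\<S> X \<in> {Z \<in> Obj T. \<exists>n. \<forall>m\<ge>n. \<forall>Y\<in>W m. hom_zero T Z Y}"
    by (rule thick_generated[OF _ _ SS.F_obj[OF X]])
  then obtain n where n: "\<forall>m\<ge>n. \<forall>Y\<in>W m. hom_zero T (\<S> X) Y" by blast
  have "hom_zero T X A" if "m \<ge> n" "A \<in> L m" for m A
  proof -
    have Ao: "A \<in> Obj T" using that(2) by (rule L_obj)
    have "\<S> A \<in> W m" using that(2) is_iso_ident[of "\<S> A"] Ao unfolding W_def by auto
    thus ?thesis using n that(1) hom_zero_SS[OF X Ao] by blast
  qed
  thus ?thesis by blast
qed

text \<open>\<open>pr g h\<close> is the value at \<open>h \<in> Hom(C, Y)\<close> of the functional that corresponds to
\<open>g \<in> Hom(Y, \<S> C)\<close>; it is meaningful for perfect \<open>C\<close>.\<close>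

definition pr where
  "pr g h = the_inv_into (carrier (dual k (Hom T (src h) (src g)))) (\<alpha> (src h) (src g)) g h"

lemma alpha_pr:
  assumes C: "C \<in> Tp" and \<phi>: "\<phi> \<in> carrier (dual k (Hom T C Y))" and h: "arrow h C Y"
  shows "pr (\<alpha> C Y \<phi>) h = \<phi> h"
proof -
  have o: "C \<in> Obj T" "Y \<in> Obj T" using h by (simp_all add: arrow_def)
  note b = alpha_bij[OF C o(2)]
  have "\<alpha> C Y \<phi> \<in> Mor T Y (\<S> C)" using b \<phi> unfolding bij_betw_def by blast
  hence s: "src (\<alpha> C Y \<phi>) = Y" "src h = C" using o h by (simp_all add: Mor_arrow arrow_iff)
  have "inj_on (\<alpha> C Y) (carrier (dual k (Hom T C Y)))" using b unfolding bij_betw_def by blast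
  thus ?thesis using \<phi> by (simp only: pr_def s the_inv_into_f_f)
qed

lemma alpha_surj:
  assumes "C \<in> Tp" "arrow g Y (\<S> C)"
  obtains \<phi> where "\<phi> \<in> carrier (dual k (Hom T C Y))" "\<alpha> C Y \<phi> = g"
proof -
  have "Y \<in> Obj T" using assms by (simp add: arrow_def)
  hence "g \<in> \<alpha> C Y ` carrier (dual k (Hom T C Y))"
    using arrow_Mor[OF assms(2)] bij_betw_imp_surj_on[OF alpha_bij[OF assms(1)]] by simp
  thus ?thesis by (rule imageE) (rule that[OF _ sym])
qed

lemma pr_closed: assumes "C \<in> Tp" "arrow g Y (\<S> C)" "arrow h C Y" shows "pr g h \<in> carrier k"
proof -
  obtain \<phi> where \<phi>: "\<phi> \<in> carrier (dual k (Hom T C Y))" "\<alpha> C Y \<phi> = g" using assms(1,2) by (rule alpha_surj)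
  show ?thesis using alpha_pr[OF assms(1) \<phi>(1) assms(3)] dualD(1)[OF _ _ \<phi>(1) assms(3)] assms(3) \<phi>(2)
    by (simp add: arrow_def)
qed

lemma pr_add_right:
  assumes "C \<in> Tp" "arrow g Y (\<S> C)" "arrow h C Y" "arrow h' C Y"
  shows "pr g (h \<boxplus> h') = pr g h \<oplus>\<^bsub>k\<^esub> pr g h'"
proof -
  obtain \<phi> where \<phi>: "\<phi> \<in> carrier (dual k (Hom T C Y))" "\<alpha> C Y \<phi> = g" using assms(1,2) by (rule alpha_surj)
  have o: "C \<in> Obj T" "Y \<in> Obj T" using assms by (simp_all add: arrow_def)
  show ?thesis using alpha_pr[OF assms(1) \<phi>(1)] dualD(2)[OF o \<phi>(1) assms(3,4)] assms(3,4) arrow_pl[OF assms(3,4)] \<phi>(2)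
    by simp
qed

lemma pr_sm_right:
  assumes "C \<in> Tp" "arrow g Y (\<S> C)" "arrow h C Y" "c \<in> carrier k"
  shows "pr g (c \<triangleright> h) = c \<otimes>\<^bsub>k\<^esub> pr g h"
proof -
  obtain \<phi> where \<phi>: "\<phi> \<in> carrier (dual k (Hom T C Y))" "\<alpha> C Y \<phi> = g" using assms(1,2) by (rule alpha_surj)
  have o: "C \<in> Obj T" "Y \<in> Obj T" using assms by (simp_all add: arrow_def)
  show ?thesis using alpha_pr[OF assms(1) \<phi>(1)] dualD(3)[OF o \<phi>(1) assms(4,3)] assms(3) arrow_sm[OF assms(4,3)] \<phi>(2)
    by simp
qed

lemma pr_assoc:
  assumes C: "C \<in> Tp" and h: "arrow h C Y'" and g: "arrow g Y' Y" and g': "arrow g' Y (\<S> C)"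
  shows "pr (g' \<bullet> g) h = pr g' (g \<bullet> h)"
proof -
  obtain \<phi> where \<phi>: "\<phi> \<in> carrier (dual k (Hom T C Y))" "\<alpha> C Y \<phi> = g'" using C g' by (rule alpha_surj)
  have o: "C \<in> Obj T" "Y \<in> Obj T" "Y' \<in> Obj T" using h g by (simp_all add: arrow_def)
  have "\<alpha> C Y' (\<lambda>h\<in>Mor T C Y'. \<phi> (g \<bullet> h)) = \<alpha> C Y \<phi> \<bullet> g"
    using alpha C o \<phi>(1) arrow_Mor[OF g] unfolding serre_duality_def by blast
  hence "pr (g' \<bullet> g) h = (\<lambda>h\<in>Mor T C Y'. \<phi> (g \<bullet> h)) h"
    using alpha_pr[OF C dual_precomp[OF o(1,3) \<phi>(1) g] h] \<phi>(2) by simp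
  also have "\<dots> = pr g' (g \<bullet> h)" using alpha_pr[OF C \<phi>(1) arrow_cmp[OF h g]] \<phi>(2) arrow_Mor[OF h] by simp
  finally show ?thesis .
qed

text \<open>Naturality of the duality in its perfect argument, read as a cyclic rule: a morphism
  moves from one end of the pairing to the other and picks up \<open>SS\<close> on the way.\<close>

lemma pr_trace:
  assumes C: "C \<in> Tp" "C' \<in> Tp" and f: "arrow f C C'" and g: "arrow g Y (\<S> C)" and h: "arrow h C' Y"
  shows "pr (\<s> f \<bullet> g) h = pr g (h \<bullet> f)"
proof -
  obtain \<phi> where \<phi>: "\<phi> \<in> carrier (dual k (Hom T C Y))" "\<alpha> C Y \<phi> = g" using C(1) g by (rule alpha_surj)
  have o: "C \<in> Obj T" "Y \<in> Obj T" using f g by (simp_all add: arrow_def)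
  have "\<alpha> C' Y (\<lambda>h\<in>Mor T C' Y. \<phi> (h \<bullet> f)) = \<s> f \<bullet> \<alpha> C Y \<phi>"
    using alpha C o \<phi>(1) arrow_Mor[OF f] unfolding serre_duality_def by blast
  hence "pr (\<s> f \<bullet> g) h = (\<lambda>h\<in>Mor T C' Y. \<phi> (h \<bullet> f)) h"
    using alpha_pr[OF C(2) dual_postcomp[OF o \<phi>(1) f] h] \<phi>(2) by simp
  also have "\<dots> = pr g (h \<bullet> f)" using alpha_pr[OF C(1) \<phi>(1) arrow_cmp[OF f h]] \<phi>(2) arrow_Mor[OF h] by simp
  finally show ?thesis .
qed

text \<open>The pairing is perfect on the other side as well. The map \<open>\<alpha>\<close> turns
  a linear form on Hom(Y, \<S> C) into one on the dual of Hom(C, Y), and reflexivity represents it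
  by a vector.\<close>

lemma pr_perfect:
  assumes C: "C \<in> Tp" and Y: "Y \<in> Obj T"
    and \<Phi>: "\<And>g. arrow g Y (\<S> C) \<Longrightarrow> \<Phi> g \<in> carrier k"
      "\<And>g g'. \<lbrakk>arrow g Y (\<S> C); arrow g' Y (\<S> C)\<rbrakk> \<Longrightarrow> \<Phi> (g \<boxplus> g') = \<Phi> g \<oplus>\<^bsub>k\<^esub> \<Phi> g'"
      "\<And>c g. \<lbrakk>c \<in> carrier k; arrow g Y (\<S> C)\<rbrakk> \<Longrightarrow> \<Phi> (c \<triangleright> g) = c \<otimes>\<^bsub>k\<^esub> \<Phi> g"
  obtains h where "arrow h C Y" "\<And>g. arrow g Y (\<S> C) \<Longrightarrow> pr g h = \<Phi> g"
proof -
  have Co: "C \<in> Obj T" using C by (rule U_obj)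
  note l = linear_mapD[OF alpha_linear[OF C Y]]
  have a: "arrow (\<alpha> C Y \<phi>) Y (\<S> C)" if "\<phi> \<in> carrier (dual k (Hom T C Y))" for \<phi>
    using l(1)[OF that] Co Y by (simp add: Mor_arrow)
  have "\<exists>h\<in>Mor T C Y. \<forall>\<phi>\<in>carrier (dual k (Hom T C Y)). \<Phi> (\<alpha> C Y \<phi>) = \<phi> h"
  proof (rule double_dual_surj[OF hom_vectorspace[OF Co Y] hom_fin_dim[OF Co Y]])
    fix \<phi> assume p: "\<phi> \<in> carrier (dual k (Hom T C Y))"
    show "\<Phi> (\<alpha> C Y \<phi>) \<in> carrier k" using \<Phi>(1) a[OF p] .
    show "\<Phi> (\<alpha> C Y (c \<odot>\<^bsub>dual k (Hom T C Y)\<^esub> \<phi>)) = c \<otimes>\<^bsub>k\<^esub> \<Phi> (\<alpha> C Y \<phi>)" if "c \<in> carrier k" for c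
      using l(3)[OF that p] \<Phi>(3)[OF that a[OF p]] sm_eq[OF a[OF p]] by simp
    fix \<psi> assume q: "\<psi> \<in> carrier (dual k (Hom T C Y))"
    show "\<Phi> (\<alpha> C Y (\<phi> \<oplus>\<^bsub>dual k (Hom T C Y)\<^esub> \<psi>)) = \<Phi> (\<alpha> C Y \<phi>) \<oplus>\<^bsub>k\<^esub> \<Phi> (\<alpha> C Y \<psi>)"
      using l(2)[OF p q] \<Phi>(2)[OF a[OF p] a[OF q]] pl_eq[OF a[OF p]] by simp
  qed
  then obtain h where h: "arrow h C Y" "\<forall>\<phi>\<in>carrier (dual k (Hom T C Y)). \<Phi> (\<alpha> C Y \<phi>) = \<phi> h"
    using Mor_arrow[OF Co Y] by blast
  have "pr g h = \<Phi> g" if g: "arrow g Y (\<S> C)" for g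
  proof -
    obtain \<phi> where \<phi>: "\<phi> \<in> carrier (dual k (Hom T C Y))" "\<alpha> C Y \<phi> = g" using C g by (rule alpha_surj)
    show ?thesis using alpha_pr[OF C \<phi>(1) h(1)] bspec[OF h(2) \<phi>(1)] unfolding \<phi>(2) by simp
  qed
  thus ?thesis using that h(1) by blast
qed

end


section \<open>The functor on the quotient induced by the Serre functor and the inverse
  shift\<close>

context smc_quadruple
begin

text \<open>\<open>SS\<close> carries a cone of \<open>s\<close> to a cone of the image and both
  preserves and reflects perfect objects.\<close>

lemma qs_SS_iff: assumes "ar s" shows "qs (\<s> s) \<longleftrightarrow> qs s"
proof -
  obtain Z g h where Z: "Tri T (src s) (tgt s) Z s g h" using tri_cone'[OF ar_arrow[OF assms]] .
  obtain h' where SZ: "Tri T (\<S> (src s)) (\<S> (tgt s)) (\<S> Z) (\<s> s) (\<s> g) h'" using Z by (rule SS_tri)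
  have "Z \<in> Obj T" using tri_obj(3)[OF Z] .
  thus ?thesis using qs_cone_in[OF _ Z] qs_cone_in[OF _ SZ] qsI[OF Z] qsI[OF SZ] SS_Tp(1) SS_reflects_Tp by blast
qed

lemma qs_unshift_iff: assumes "ar s" shows "qs (\<sigma>\<^sub>- s) \<longleftrightarrow> qs s"
proof -
  obtain Z g h where Z: "Tri T (src s) (tgt s) Z s g h" using tri_cone'[OF ar_arrow[OF assms]] .
  note SZ = tri_unshift[OF Z]
  have "Z \<in> Obj T" using tri_obj(3)[OF Z] .
  hence "\<Sigma>\<^sub>- Z \<in> Tp \<longleftrightarrow> Z \<in> Tp" using U_shift(1)[of "\<Sigma>\<^sub>- Z"] U_shift(2)[of Z] by auto
  thus ?thesis using qs_cone_in[OF _ Z] qs_cone_in[OF _ SZ] qsI[OF Z] qsI[OF SZ] by blast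
qed

lemma unshift_equivalence: "lin_equivalence k T T (Shi T)"
proof (rule Shi.equivalenceI)
  show Shi.faithful unfolding Shi.faithful_def
  proof (intro allI impI, elim conjE)
    fix X Y f g assume "arrow f X Y" "arrow g X Y" and e: "\<sigma>\<^sub>- f = \<sigma>\<^sub>- g"
    hence "ar f" "ar g" by (simp_all add: arrow_iff)
    thus "f = g" using shift_mor(2)[of f] shift_mor(2)[of g] unfolding e by simp
  qed
  show Shi.full unfolding Shi.full_def
  proof (intro ballI allI impI)
    fix X Y h assume "X \<in> Obj T" "Y \<in> Obj T" "arrow h (\<Sigma>\<^sub>- X) (\<Sigma>\<^sub>- Y)"
    hence "arrow (\<sigma> h) X Y" "\<sigma>\<^sub>- (\<sigma> h) = h" by (simp_all add: arrow_iff)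
    thus "\<exists>f. arrow f X Y \<and> \<sigma>\<^sub>- f = h" by blast
  qed
  show Shi.dense unfolding Shi.dense_def
  proof
    fix Z assume "Z \<in> Obj T"
    hence "\<Sigma> Z \<in> Obj T" "is_iso T (\<Sigma>\<^sub>- (\<Sigma> Z)) Z (idt Z)" using is_iso_ident by simp_all
    thus "\<exists>X\<in>Obj T. \<exists>e. is_iso T (\<Sigma>\<^sub>- X) Z e" by blast
  qed
qed

end

sublocale smc_quadruple \<subseteq> SV: quotient_endofunctor k T Tp SS
  by unfold_locales (simp add: qs_SS_iff)
sublocale smc_quadruple \<subseteq> DV: quotient_endofunctor k T Tp "Shi T"
  by unfold_locales (simp add: qs_unshift_iff)

context smc_quadruple
begin

abbreviation NQ where "NQ \<equiv> functor_cmp (Shi \<Q>) (verdier_induced T Tp SS)"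

lemma NQ_equivalence: "lin_equivalence k \<Q> \<Q> NQ"
proof (rule lin_equivalence_cmp)
  show "lin_equivalence k \<Q> \<Q> (verdier_induced T Tp SS)"
    by (rule SV.VE_equivalence) (use RS1_triangle_equivalence qs_SS_iff in \<open>simp_all add: triangle_equivalence_def\<close>)
  show "lin_equivalence k \<Q> \<Q> (Shi \<Q>)"
    unfolding VQ_simps by (rule DV.VE_equivalence) (use unshift_equivalence qs_unshift_iff in simp_all)
qed

lemma NQ_functor: "lin_functor k \<Q> \<Q> NQ"
  using NQ_equivalence by (simp add: lin_equivalence_def)

end

sublocale smc_quadruple \<subseteq> N: lin_fun k "verdier_quotient T Tp" "verdier_quotient T Tp"
    "functor_cmp (Shi (verdier_quotient T Tp)) (verdier_induced T Tp SS)"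
  by (rule lin_funI[OF NQ_functor])

context smc_quadruple
begin

section \<open>The trace form\<close>

notation Q.comp_mor (infixr "\<star>" 75)

abbreviation No ("\<N>") where "\<N> X \<equiv> FO NQ X"
abbreviation Nmor ("\<n>") where "\<n> x \<equiv> FM NQ x"

lemma NQ_obj: "\<N> X = \<Sigma>\<^sub>- (\<S> X)"
  unfolding VQ_simps by (simp add: functor_cmp_def verdier_induced_def)

lemma NQ_qf: assumes "ar f" shows "\<n> (qf f) = qf (\<sigma>\<^sub>- (\<s> f))"
  unfolding VQ_simps using SV.VE_qf[OF assms] DV.VE_qf[of "\<s> f"] assms by (simp add: functor_cmp_def)

text \<open>A roof \<open>X \<longleftarrow> W \<longrightarrow> \<N> X\<close> with denominator \<open>s\<close> gives, through the cone \<open>C\<close> of \<open>s\<close>, maps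
\<open>C \<longrightarrow> \<Sigma> W \<longrightarrow> \<S> X \<longrightarrow> \<S> C\<close> whose pairing is the trace.\<close>

definition tr where
  "tr x = (SOME r. \<exists>s f C a d. roof s f \<and> tgt f = \<N> (tgt s) \<and> x = fr s f \<and> C \<in> Tp \<and>
     Tri T (src s) (tgt s) C s a d \<and> r = pr (\<s> a) (\<sigma> f \<bullet> d))"

text \<open>Refining the denominator induces a map \<open>c\<close> of cones. It enters the pairing
  on the right through \<open>d\<close> and is moved to the left by the cyclic rule, where it turns
  \<open>a'\<close> into \<open>a\<close>.\<close>

lemma tr_refine:
  assumes t: "Tri T W X C s a d" "C \<in> Tp" and f: "arrow f W (\<N> X)" and u: "arrow u W' W"
    and t': "Tri T W' X C' (s \<bullet> u) a' d'" "C' \<in> Tp"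
  shows "pr (\<s> a') (\<sigma> (f \<bullet> u) \<bullet> d') = pr (\<s> a) (\<sigma> f \<bullet> d)"
proof -
  note A = tri_arrow[OF t(1)] tri_arrow[OF t'(1)]
  have o: "X \<in> Obj T" using A by (simp add: arrow_iff)
  have sq: "idt X \<bullet> (s \<bullet> u) = s \<bullet> u" using A u by (simp add: arrow_iff)
  obtain c where c: "arrow c C' C" and e: "c \<bullet> a' = a \<bullet> idt X" "\<sigma> u \<bullet> d' = d \<bullet> c"
    by (rule tri_morphism'[OF t'(1) t(1) u arrow_ident[OF o] sq])
  have h: "arrow (\<sigma> f \<bullet> d) C (\<S> X)" using A f o by (simp add: arrow_iff NQ_obj)
  have "\<sigma> (f \<bullet> u) \<bullet> d' = \<sigma> f \<bullet> (\<sigma> u \<bullet> d')" using f u A by (simp add: arrow_iff)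
  also have "\<dots> = (\<sigma> f \<bullet> d) \<bullet> c" unfolding e using f c A by (simp add: arrow_iff)
  finally have "pr (\<s> a') (\<sigma> (f \<bullet> u) \<bullet> d') = pr (\<s> c \<bullet> \<s> a') (\<sigma> f \<bullet> d)"
    using pr_trace[OF t'(2) t(2) c SS.F_arrow[OF A(5)] h] by simp
  also have "\<s> c \<bullet> \<s> a' = \<s> (c \<bullet> a')" using c A by (simp add: arrow_iff)
  also have "\<dots> = \<s> a" unfolding e using A by (simp add: arrow_iff)
  finally show ?thesis .
qed

text \<open>Two representatives of the same fraction have a common refinement, and by the previous
  lemma neither refinement changes the pairing. Hence the description operator in \<open>tr\<close>
  has only one possible value, whatever the roof and the cone.\<close>

lemma tr_fr:
  assumes r: "roof s f" and f: "tgt f = \<N> (tgt s)" and t: "Tri T (src s) (tgt s) C s a d" "C \<in> Tp"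
  shows "tr (fr s f) = pr (\<s> a) (\<sigma> f \<bullet> d)"
  unfolding tr_def
proof (rule some_equality)
  show "\<exists>s' f' C' a' d'. roof s' f' \<and> tgt f' = \<N> (tgt s') \<and> fr s f = fr s' f' \<and> C' \<in> Tp \<and>
     Tri T (src s') (tgt s') C' s' a' d' \<and> pr (\<s> a) (\<sigma> f \<bullet> d) = pr (\<s> a') (\<sigma> f' \<bullet> d')"
    using assms by blast
  fix r assume "\<exists>s' f' C' a' d'. roof s' f' \<and> tgt f' = \<N> (tgt s') \<and> fr s f = fr s' f' \<and> C' \<in> Tp \<and>
     Tri T (src s') (tgt s') C' s' a' d' \<and> r = pr (\<s> a') (\<sigma> f' \<bullet> d')"
  then obtain s' f' C' a' d' where r': "roof s' f'" "tgt f' = \<N> (tgt s')" "fr s f = fr s' f'"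
    and t': "Tri T (src s') (tgt s') C' s' a' d'" "C' \<in> Tp" and r: "r = pr (\<s> a') (\<sigma> f' \<bullet> d')" by blast
  \<comment> \<open>Equal fractions have equal end points because hom sets of the quotient are
    disjoint; this has to be known before the roof relation can be used.\<close>
  have X: "tgt s' = tgt s"
  proof -
    have "Q.arrow (fr s f) (tgt s) (tgt f)" "Q.arrow (fr s f) (tgt s') (tgt f')"
      using fr_arrow[OF assms(1)] fr_arrow[OF r'(1)] unfolding r'(3) by simp_all
    thus ?thesis using Q.arrow_unique by blast
  qed
  have Y: "tgt f' = tgt f" using X f r'(2) by simp
  have "((s, f), (s', f')) \<in> roof_rel T Tp (tgt s) (tgt f)" using fr_eq_iff[OF assms(1) r'(1) X Y] r'(3) by simp
  then obtain u v where u: "ar u" "ar v" "src v = src u" "tgt u = src s" "tgt v = src s'"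
    "s \<bullet> u = s' \<bullet> v" "qs (s \<bullet> u)" "f \<bullet> u = f' \<bullet> v"
    by (rule roof_relD) (use assms(1) in simp_all)
  obtain C2 a2 d2 where t2: "C2 \<in> Tp" "Tri T (src (s \<bullet> u)) (tgt (s \<bullet> u)) C2 (s \<bullet> u) a2 d2" using u(7) by (rule qsE)
  have e: "src (s \<bullet> u) = src u" "tgt (s \<bullet> u) = tgt s" using u(1,4) assms(1) by simp_all
  note t2 = t2[unfolded e]
  have t3: "Tri T (src u) (tgt s') C2 (s' \<bullet> v) a2 d2" using t2(2) unfolding X u(6) .
  have "pr (\<s> a2) (\<sigma> (f \<bullet> u) \<bullet> d2) = pr (\<s> a) (\<sigma> f \<bullet> d)"
    by (rule tr_refine[OF t _ _ t2(2,1)]) (use assms(1) f u in \<open>simp_all add: arrow_iff NQ_obj\<close>)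
  moreover have "pr (\<s> a2) (\<sigma> (f' \<bullet> v) \<bullet> d2) = pr (\<s> a') (\<sigma> f' \<bullet> d')"
    by (rule tr_refine[OF t' _ _ t3 t2(1)]) (use r' u in \<open>simp_all add: arrow_iff NQ_obj\<close>)
  ultimately show "r = pr (\<s> a) (\<sigma> f \<bullet> d)" using r unfolding u(8) by simp
qed

lemma tr_linear:
  assumes x: "Q.arrow x X (\<N> X)" and y: "Q.arrow y X (\<N> X)"
  shows "tr x \<in> carrier k" "tr (Q.pl x y) = tr x \<oplus>\<^bsub>k\<^esub> tr y" "c \<in> carrier k \<Longrightarrow> tr (Q.sm c x) = c \<otimes>\<^bsub>k\<^esub> tr x"
proof -
  obtain s1 f1 where 1: "roof s1 f1" "tgt s1 = X" "tgt f1 = \<N> X" "x = fr s1 f1" "X \<in> Obj T" using x by (rule Q_arrowE)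
  obtain s2 f2 where 2: "roof s2 f2" "tgt s2 = X" "tgt f2 = \<N> X" "y = fr s2 f2" using y by (rule Q_arrowE)
  obtain s f g where r: "roof s f" "roof s g" "tgt s = X" "tgt f = \<N> X" "tgt g = \<N> X" and e: "x = fr s f" "y = fr s g"
    using common_denominator2[OF 1(1) 2(1)] 1 2 by metis
  obtain C a d where t: "C \<in> Tp" "Tri T (src s) (tgt s) C s a d" using qsE[of s] r by metis
  note A = tri_arrow[OF t(2)] and tr' = tr_fr[OF _ _ t(2,1)]
  have g: "arrow (\<s> a) (\<S> X) (\<S> C)" using A r by (simp add: arrow_iff)
  have h: "arrow (\<sigma> f \<bullet> d) C (\<S> X)" "arrow (\<sigma> g \<bullet> d) C (\<S> X)" using A r 1(5) by (simp_all add: arrow_iff NQ_obj)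
  have E: "tr x = pr (\<s> a) (\<sigma> f \<bullet> d)" "tr y = pr (\<s> a) (\<sigma> g \<bullet> d)"
    unfolding e by (rule tr'; use r in simp)+
  show "tr x \<in> carrier k" unfolding E by (rule pr_closed[OF t(1) g h(1)])
  have "tr (Q.pl x y) = pr (\<s> a) (\<sigma> (f \<boxplus> g) \<bullet> d)"
    unfolding e using fr_pl[OF r(1,2)] tr'[of "f \<boxplus> g"] r by simp
  also have "\<sigma> (f \<boxplus> g) \<bullet> d = \<sigma> f \<bullet> d \<boxplus> \<sigma> g \<bullet> d" using A r by (simp add: arrow_iff lin)
  finally show "tr (Q.pl x y) = tr x \<oplus>\<^bsub>k\<^esub> tr y" unfolding E pr_add_right[OF t(1) g h] .
  assume c: "c \<in> carrier k"
  have "tr (Q.sm c x) = pr (\<s> a) (\<sigma> (c \<triangleright> f) \<bullet> d)"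
    unfolding e using fr_sm[OF r(1) c] tr'[of "c \<triangleright> f"] r c by simp
  also have "\<sigma> (c \<triangleright> f) \<bullet> d = c \<triangleright> (\<sigma> f \<bullet> d)" using A r c by (simp add: arrow_iff lin)
  finally show "tr (Q.sm c x) = c \<otimes>\<^bsub>k\<^esub> tr x" unfolding E pr_sm_right[OF t(1) g h(1) c] .
qed

text \<open>Both composites with a morphism of \<open>T\<close> are evaluated to the same
  expression, by naturality in the two arguments of the pairing. Cyclicity for such morphisms is
  then read off.\<close>

lemma tr_qf:
  assumes f: "arrow f X Y" and r: "roof s h" "tgt s = Y" "tgt h = \<N> X" and t: "Tri T (src s) (tgt s) C s a d" "C \<in> Tp"
  shows "tr (fr s h \<star> qf f) = pr (\<s> a \<bullet> \<s> f) (\<sigma> h \<bullet> d)" "tr (\<n> (qf f) \<star> fr s h) = pr (\<s> a \<bullet> \<s> f) (\<sigma> h \<bullet> d)"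
proof -
  have F: "ar f" "src f = X" "tgt f = Y" and o: "X \<in> Obj T" "Y \<in> Obj T" using f by (simp_all add: arrow_iff)
  note A = tri_arrow[OF t(1)]
  have g: "arrow (\<s> a) (\<S> Y) (\<S> C)" using A r by (simp add: arrow_iff)
  have h: "arrow (\<sigma> h \<bullet> d) C (\<S> X)" using A r o by (simp add: arrow_iff NQ_obj)
  obtain s' f' where s': "qs s'" "tgt s' = X" "ar f'" "src f' = src s'" "tgt f' = src s" and e: "f \<bullet> s' = s \<bullet> f'"
    using ore[of f s] r F by metis
  obtain C' a' d' where t': "C' \<in> Tp" "Tri T (src s') (tgt s') C' s' a' d'" using s'(1) by (rule qsE)
  note A' = tri_arrow[OF t'(2)]
  have af: "arrow f' (src s') (src s)" "arrow f (tgt s') (tgt s)" using s' F r o by (simp_all add: arrow_iff)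
  \<comment> \<open>The Ore square extends to a morphism of triangles; its component on the cones is
    what the cyclic rule moves.\<close>
  obtain c where c: "arrow c C' C" and ec: "c \<bullet> a' = a \<bullet> f" "\<sigma> f' \<bullet> d' = d \<bullet> c"
    by (rule tri_morphism'[OF t'(2) t(1) af e])
  have "fr s h \<star> qf f = fr (idt X \<bullet> s') (h \<bullet> f')" unfolding qf_eq[OF F(1)] F(2)
    by (rule Q_cmp) (use r F s' e o in simp_all)
  hence "tr (fr s h \<star> qf f) = tr (fr s' (h \<bullet> f'))" using s' by simp
  also have "\<dots> = pr (\<s> a') (\<sigma> (h \<bullet> f') \<bullet> d')" by (rule tr_fr[OF _ _ t'(2,1)]) (use r s' in simp_all)
  also have "\<sigma> (h \<bullet> f') \<bullet> d' = \<sigma> h \<bullet> (\<sigma> f' \<bullet> d')" using A' r s' by (simp add: arrow_iff)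
  also have "\<dots> = (\<sigma> h \<bullet> d) \<bullet> c" unfolding ec using A c r by (simp add: arrow_iff)
  also have "pr (\<s> a') \<dots> = pr (\<s> c \<bullet> \<s> a') (\<sigma> h \<bullet> d)"
    by (rule pr_trace[OF t'(1) t(2) c SS.F_arrow[OF A'(2)], symmetric]) (use h s' in simp)
  also have "\<s> c \<bullet> \<s> a' = \<s> (c \<bullet> a')" using A' c by (simp add: arrow_iff)
  also have "\<dots> = \<s> a \<bullet> \<s> f" unfolding ec using A f r by (simp add: arrow_iff)
  finally show "tr (fr s h \<star> qf f) = pr (\<s> a \<bullet> \<s> f) (\<sigma> h \<bullet> d)" .
  have "\<n> (qf f) \<star> fr s h = fr s (\<sigma>\<^sub>- (\<s> f) \<bullet> h)" unfolding NQ_qf[OF F(1)]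
    by (rule qf_fr) (use F r in \<open>simp_all add: NQ_obj\<close>)
  hence "tr (\<n> (qf f) \<star> fr s h) = tr (fr s (\<sigma>\<^sub>- (\<s> f) \<bullet> h))" by simp
  also have "\<dots> = pr (\<s> a) (\<sigma> (\<sigma>\<^sub>- (\<s> f) \<bullet> h) \<bullet> d)"
    by (rule tr_fr[OF _ _ t]) (use F r in \<open>simp_all add: NQ_obj\<close>)
  also have "\<sigma> (\<sigma>\<^sub>- (\<s> f) \<bullet> h) \<bullet> d = \<s> f \<bullet> (\<sigma> h \<bullet> d)" using A F r o by (simp add: arrow_iff NQ_obj)
  also have "pr (\<s> a) \<dots> = pr (\<s> a \<bullet> \<s> f) (\<sigma> h \<bullet> d)"
    by (rule pr_assoc[OF t(2) h SS.F_arrow[OF f] g, symmetric])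
  finally show "tr (\<n> (qf f) \<star> fr s h) = pr (\<s> a \<bullet> \<s> f) (\<sigma> h \<bullet> d)" .
qed

lemma tr_cyclic_qf:
  assumes f: "arrow f X Y" and y: "Q.arrow y Y (\<N> X)" shows "tr (y \<star> qf f) = tr (\<n> (qf f) \<star> y)"
proof -
  obtain s h where r: "roof s h" "tgt s = Y" "tgt h = \<N> X" "y = fr s h" using y by (rule Q_arrowE)
  obtain C a d where t: "C \<in> Tp" "Tri T (src s) (tgt s) C s a d" using qsE[of s] r by metis
  show ?thesis unfolding r(4) tr_qf[OF f r(1-3) t(2,1)] ..
qed

text \<open>A general \<open>x\<close> is the image of a morphism divided by the image of
  \<open>s\<close>. The division is undone by inserting \<open>e\<close>, a right inverse of the
  image of \<open>s\<close> under the functor, and cyclicity is applied to the two legs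
  \<open>s\<close> and \<open>f\<close> in turn.\<close>

lemma tr_cyclic:
  assumes x: "Q.arrow x X Y" and y: "Q.arrow y Y (\<N> X)" shows "tr (y \<star> x) = tr (\<n> x \<star> y)"
proof -
  obtain s f where r: "roof s f" "tgt s = X" "tgt f = Y" "x = fr s f" "X \<in> Obj T" "Y \<in> Obj T" using x by (rule Q_arrowE)
  define W where "W = src s"
  have s: "arrow s W X" and f: "arrow f W Y" using r unfolding W_def by (simp_all add: arrow_iff)
  have xs: "x \<star> qf s = qf f" unfolding r(4) by (rule fr_qf[OF r(1)])
  note Qs = qf_arrow[OF s] qf_arrow[OF f]
  have "is_iso \<Q> (\<N> W) (\<N> X) (\<n> (qf s))" using N.F_iso[OF qf_iso[of s]] r s by (simp add: arrow_iff)
  then obtain e where e: "Q.arrow e (\<N> X) (\<N> W)" "\<n> (qf s) \<star> e = ident \<Q> (\<N> X)" by (rule Q.is_isoE)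
  note A = x y Qs e(1) N.F_arrow[OF x] N.F_arrow[OF Qs(1)] N.F_arrow[OF Qs(2)]
  have z: "Q.arrow (e \<star> y \<star> x) X (\<N> W)" "Q.arrow (e \<star> y) Y (\<N> W)" using A by (simp_all add: Q.arrow_iff)
  have "\<n> (qf s) \<star> (e \<star> y \<star> x) = (\<n> (qf s) \<star> e) \<star> (y \<star> x)" using A by (simp add: Q.arrow_iff)
  also have "\<dots> = y \<star> x" unfolding e(2) using A by (simp add: Q.arrow_iff)
  finally have "tr (y \<star> x) = tr ((e \<star> y \<star> x) \<star> qf s)" using tr_cyclic_qf[OF s z(1)] by simp
  also have "(e \<star> y \<star> x) \<star> qf s = (e \<star> y) \<star> (x \<star> qf s)" using A by (simp add: Q.arrow_iff)
  also have "\<dots> = (e \<star> y) \<star> qf f" unfolding xs ..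
  also have "tr \<dots> = tr (\<n> (qf f) \<star> (e \<star> y))" by (rule tr_cyclic_qf[OF f z(2)])
  also have "\<n> (qf f) = \<n> x \<star> \<n> (qf s)" unfolding xs[symmetric] by (rule N.F_cmp) (use A in \<open>simp_all add: Q.arrow_iff\<close>)
  also have "(\<n> x \<star> \<n> (qf s)) \<star> (e \<star> y) = \<n> x \<star> ((\<n> (qf s) \<star> e) \<star> y)" using A by (simp add: Q.arrow_iff)
  also have "\<dots> = \<n> x \<star> y" unfolding e(2) using A by (simp add: Q.arrow_iff)
  finally show ?thesis .
qed

end


section \<open>Nondegeneracy of the trace and the Serre functor\<close>

context smc_quadruple
begin

text \<open>For \<open>X\<close> in \<open>L (-1)\<close> and \<open>Y\<close> in a sufficiently small \<open>TL (-n)\<close>, truncating \<open>Y\<close> far enough gives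
a perfect \<open>B\<close> with \<open>Hom \<Q> X Y = Hom T X B\<close>, whose dual is \<open>Hom T B (\<S> X)\<close>; maps \<open>B \<longrightarrow> \<S> X\<close> vanish
on \<open>Y\<close>, hence come from \<open>\<Sigma> A\<close>, and this yields the roofs \<open>Y \<longleftarrow> A \<longrightarrow> \<N> X\<close>.\<close>

lemma tr_surj_aux:
  assumes X: "X \<in> L (-1)" and n: "n \<ge> 1" "\<And>Y. Y \<in> TL (- n) \<Longrightarrow> hom_zero T Y (\<S> X)"
    and Y: "Y \<in> TL (- n)" and \<phi>: "\<phi> \<in> carrier (dual k (Hom \<Q> X Y))"
  obtains g where "Q.arrow g Y (\<N> X)" "\<And>x. Q.arrow x X Y \<Longrightarrow> tr (g \<star> x) = \<phi> x"
proof -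
  have Xo: "X \<in> Obj T" and Yo: "Y \<in> Obj T" using X Y L_obj TL_obj by blast+
  have Y': "Y \<in> TL 0" "Y \<in> TL (-1)" using TL_mono[of "- n" 0] TL_mono[of "- n" "-1"] n(1) Y by auto
  have \<phi>_add: "\<phi> (Q.pl x y) = \<phi> x \<oplus>\<^bsub>k\<^esub> \<phi> y" and \<phi>_sm: "c \<in> carrier k \<Longrightarrow> \<phi> (Q.sm c x) = c \<otimes>\<^bsub>k\<^esub> \<phi> x"
    and \<phi>_closed: "\<phi> x \<in> carrier k" if "Q.arrow x X Y" "Q.arrow y X Y" for x y c
    using Q.dualD[OF _ _ \<phi>] that Xo Yo by simp_all
  \<comment> \<open>Truncation takes place at i + 1, so that the bound applies to \<open>A\<close>
    and also to its shift, which lies in \<open>L i\<close>. The two vanishings make composition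
    with \<open>a\<close> injective and surjective on maps from \<open>X\<close>.\<close>
  obtain i where i: "\<And>m A. \<lbrakk>m \<ge> i; A \<in> L m\<rbrakk> \<Longrightarrow> hom_zero T X A" using L_tail[OF Xo] by blast
  obtain A B s a d where A: "A \<in> L (i + 1)" "B \<in> TL (i + 1) \<inter> Tp" and t: "Tri T A Y B s a d"
    using Yo by (rule L_decomp)
  have B: "B \<in> Tp" using A(2) by blast
  have z: "hom_zero T X A" "hom_zero T X (\<Sigma> A)" using i[of "i + 1" A] i[of i "\<Sigma> A"] A(1) L_shift'(1)[OF A(1)] by simp_all
  note ta = tri_arrow[OF t] and to = tri_obj[OF t]
  have inj: "h = h'" if h: "arrow h X Y" "arrow h' X Y" "a \<bullet> h = a \<bullet> h'" for h h'
  proof -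
    have e: "arrow (h \<boxplus> \<boxminus> h') X Y" using h(1,2) by (simp add: arrow_iff)
    have "a \<bullet> (h \<boxplus> \<boxminus> h') = a \<bullet> h \<boxplus> \<boxminus> (a \<bullet> h')" using h(1,2) ta by (simp add: arrow_iff lin)
    also have "\<dots> = zr X B" unfolding h(3) using h(1,2) ta by (simp add: arrow_iff)
    finally obtain v where v: "arrow v X A" "s \<bullet> v = h \<boxplus> \<boxminus> h'" using tri_lift[OF t e] by blast
    have "h \<boxplus> \<boxminus> h' = zr X Y" unfolding v(2)[symmetric] hom_zeroD[OF z(1) v(1)] using ta Xo by (simp add: arrow_iff)
    thus ?thesis using sub_zero h(1,2) by blast
  qed
  have surj: "\<exists>h. arrow h X Y \<and> \<s> (a \<bullet> h) = g" if g: "arrow g (\<S> X) (\<S> B)" for g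
  proof -
    obtain g' where g': "arrow g' X B" "\<s> g' = g" using SS.fullE[OF SS_ff(2) Xo to(3) g] .
    have "d \<bullet> g' = zr X (\<Sigma> A)" by (rule hom_zeroD[OF z(2) arrow_cmp[OF g'(1) ta(3)]])
    then obtain h where "arrow h X Y" "a \<bullet> h = g'" using tri_lift[OF tri_rot[OF t] g'(1)] by blast
    thus ?thesis using g'(2) by blast
  qed
  \<comment> \<open>The inverse of the bijection from Hom(X, Y) to Hom(\<S> X, \<S> B) that composes
    with \<open>a\<close> and applies \<open>SS\<close>; along it \<open>\<phi>\<close> becomes a
    linear form to which the perfect pairing applies.\<close>
  define hf where "hf g = (THE h. arrow h X Y \<and> \<s> (a \<bullet> h) = g)" for g
  have hf_eq: "hf (\<s> (a \<bullet> h)) = h" if h: "arrow h X Y" for h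
    unfolding hf_def
  proof (rule the_equality)
    show "arrow h X Y \<and> \<s> (a \<bullet> h) = \<s> (a \<bullet> h)" using h by blast
    fix h' assume h': "arrow h' X Y \<and> \<s> (a \<bullet> h') = \<s> (a \<bullet> h)"
    hence "a \<bullet> h' = a \<bullet> h" using SS.faithfulD[OF SS_ff(1) arrow_cmp arrow_cmp, of h' X Y a B h Y a] h ta(2) by blast
    thus "h' = h" using inj h' h by blast
  qed
  have hf: "arrow (hf g) X Y" "\<s> (a \<bullet> hf g) = g" if "arrow g (\<S> X) (\<S> B)" for g
    using surj[OF that] hf_eq by force+
  have hf_pl: "hf (g \<boxplus> g') = hf g \<boxplus> hf g'" if g: "arrow g (\<S> X) (\<S> B)" and g': "arrow g' (\<S> X) (\<S> B)" for g g'
  proof -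
    have "\<s> (a \<bullet> (hf g \<boxplus> hf g')) = \<s> (a \<bullet> hf g) \<boxplus> \<s> (a \<bullet> hf g')"
      using hf(1)[OF g] hf(1)[OF g'] ta by (simp add: arrow_iff lin)
    thus ?thesis using hf_eq[OF arrow_pl[OF hf(1)[OF g] hf(1)[OF g']]] hf(2)[OF g] hf(2)[OF g'] by simp
  qed
  have hf_sm: "hf (c \<triangleright> g) = c \<triangleright> hf g" if c: "c \<in> carrier k" and g: "arrow g (\<S> X) (\<S> B)" for c g
  proof -
    have "\<s> (a \<bullet> (c \<triangleright> hf g)) = c \<triangleright> \<s> (a \<bullet> hf g)"
      using hf(1)[OF g] ta c by (simp add: arrow_iff lin)
    thus ?thesis using hf_eq[OF arrow_sm[OF c hf(1)[OF g]]] hf(2)[OF g] by simp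
  qed
  \<comment> \<open>The roles in the pairing are reversed here: \<open>B\<close> is the perfect
    argument, and the image of \<open>X\<close> under \<open>SS\<close> is the other one.\<close>
  have "\<exists>e. arrow e B (\<S> X) \<and> (\<forall>g. arrow g (\<S> X) (\<S> B) \<longrightarrow> pr g e = \<phi> (qf (hf g)))"
  proof (rule pr_perfect[OF B SS.F_obj[OF Xo], of "\<lambda>g. \<phi> (qf (hf g))"])
    fix g assume g: "arrow g (\<S> X) (\<S> B)"
    note q = qf_arrow[OF hf(1)[OF g]]
    show "\<phi> (qf (hf g)) \<in> carrier k" by (rule \<phi>_closed[OF q q])
    show "\<phi> (qf (hf (c \<triangleright> g))) = c \<otimes>\<^bsub>k\<^esub> \<phi> (qf (hf g))" if c: "c \<in> carrier k" for c
    proof -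
      have "qf (c \<triangleright> hf g) = Q.sm c (qf (hf g))" using hf(1)[OF g] c by (simp add: arrow_iff)
      thus ?thesis using \<phi>_sm[OF q q c] hf_sm[OF c g] by simp
    qed
    fix g' assume g': "arrow g' (\<S> X) (\<S> B)"
    note q' = qf_arrow[OF hf(1)[OF g']]
    have "qf (hf g \<boxplus> hf g') = Q.pl (qf (hf g)) (qf (hf g'))" using hf(1)[OF g] hf(1)[OF g'] by (simp add: arrow_iff)
    thus "\<phi> (qf (hf (g \<boxplus> g'))) = \<phi> (qf (hf g)) \<oplus>\<^bsub>k\<^esub> \<phi> (qf (hf g'))" using \<phi>_add[OF q q'] hf_pl[OF g g'] by simp
  qed blast
  then obtain e where e: "arrow e B (\<S> X)" "\<And>g. arrow g (\<S> X) (\<S> B) \<Longrightarrow> pr g e = \<phi> (qf (hf g))" by blast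
  \<comment> \<open>The bound on \<open>Y\<close> enters at this point. It lets \<open>e\<close>
    factor through \<open>d\<close>, which is the shape that the trace of a roof with denominator
    \<open>s\<close> has.\<close>
  have "e \<bullet> a = zr Y (\<S> X)" by (rule hom_zeroD[OF n(2)[OF Y] arrow_cmp[OF ta(2) e(1)]])
  then obtain f where f: "arrow f (\<Sigma> A) (\<S> X)" "f \<bullet> d = e" by (rule tri_extend[OF tri_rot[OF t] e(1)])
  have S: "src s = A" "tgt s = Y" "ar f" "src f = \<Sigma> A" "tgt f = \<S> X" using ta f by (simp_all add: arrow_iff)
  have r: "roof s (\<sigma>\<^sub>- f)" "tgt (\<sigma>\<^sub>- f) = \<N> X" using qsI[OF t B] S to(1) by (simp_all add: NQ_obj)
  have g: "Q.arrow (fr s (\<sigma>\<^sub>- f)) Y (\<N> X)" using fr_arrow[OF r(1)] S r(2) by simp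
  have "tr (fr s (\<sigma>\<^sub>- f) \<star> x) = \<phi> x" if x: "Q.arrow x X Y" for x
  proof -
    obtain h where h: "arrow h X Y" "qf h = x" using X Y'(1) x by (rule qf_full)
    have t': "Tri T (src s) (tgt s) B s a d" using t S by simp
    have ah: "arrow (\<s> (a \<bullet> h)) (\<S> X) (\<S> B)" by (rule SS.F_arrow[OF arrow_cmp[OF h(1) ta(2)]])
    have "tr (fr s (\<sigma>\<^sub>- f) \<star> x) = pr (\<s> a \<bullet> \<s> h) (\<sigma> (\<sigma>\<^sub>- f) \<bullet> d)"
      unfolding h(2)[symmetric] by (rule tr_qf(1)[OF h(1) r(1) S(2) r(2) t' B])
    also have "\<s> a \<bullet> \<s> h = \<s> (a \<bullet> h)" using h(1) ta by (simp add: arrow_iff)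
    also have "\<sigma> (\<sigma>\<^sub>- f) \<bullet> d = e" using S(3) f(2) by simp
    also have "pr (\<s> (a \<bullet> h)) e = \<phi> x" using e(2)[OF ah] hf_eq[OF h(1)] h(2) by simp
    finally show ?thesis .
  qed
  thus ?thesis using that g by blast
qed

text \<open>Only isomorphisms of the quotient separate the general case from the special one. The
  functional is transported along them, and cyclicity carries \<open>p\<close> from the left of the
  trace to the right, where it cancels.\<close>

lemma tr_surj:
  assumes X: "X \<in> Obj T" and Y: "Y \<in> Obj T" and \<phi>: "\<phi> \<in> carrier (dual k (Hom \<Q> X Y))"
  obtains g where "Q.arrow g Y (\<N> X)" "\<And>x. Q.arrow x X Y \<Longrightarrow> tr (g \<star> x) = \<phi> x"
proof -
  obtain X' p where X': "X' \<in> L (-1)" and ip: "is_iso \<Q> X' X p" using X by (rule rep_L)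
  have X'o: "X' \<in> Obj T" using X' by (rule L_obj)
  obtain n where n: "\<And>m Y. \<lbrakk>m \<ge> n; Y \<in> TL (- m)\<rbrakk> \<Longrightarrow> hom_zero T Y (\<S> X')" using TL_tail[OF SS.F_obj[OF X'o]] by blast
  define m where "m = max n 1"
  have m: "m \<ge> n" "m \<ge> 1" by (simp_all add: m_def)
  obtain Y' q where Y': "Y' \<in> TL (- m)" and iq: "is_iso \<Q> Y Y' q" using Y by (rule rep_TL)
  have Y'o: "Y' \<in> Obj T" using Y' by (rule TL_obj)
  obtain p' where p: "Q.arrow p X' X" "Q.arrow p' X X'" "p \<star> p' = ident \<Q> X" using ip by (rule Q.is_isoE)
  obtain q' where q: "Q.arrow q Y Y'" "Q.arrow q' Y' Y" "q' \<star> q = ident \<Q> Y" using iq by (rule Q.is_isoE)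
  \<comment> \<open>The functional that sends \<open>h\<close> to the value of \<open>\<phi>\<close>
    at \<open>q' \<star> h \<star> p'\<close>, built from the two composition lemmas so that its
    linearity need not be checked again.\<close>
  define \<psi> where "\<psi> = (\<lambda>h\<in>Mor \<Q> X' Y'. (\<lambda>h\<in>Mor \<Q> X' Y. \<phi> (h \<star> p')) (q' \<star> h))"
  have \<psi>: "\<psi> \<in> carrier (dual k (Hom \<Q> X' Y'))" unfolding \<psi>_def
    by (rule Q.dual_precomp[OF _ _ Q.dual_postcomp[OF _ _ \<phi> p(2)] q(2)]) (use X Y X'o Y'o in simp_all)
  obtain g where g: "Q.arrow g Y' (\<N> X')" "\<And>x. Q.arrow x X' Y' \<Longrightarrow> tr (g \<star> x) = \<psi> x"
    by (rule tr_surj_aux[OF X' m(2) n[OF m(1)] Y' \<psi>]) blast+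
  note A = p(1,2) q(1,2) g(1) N.F_arrow[OF p(1)]
  have 1: "Q.arrow (\<n> p \<star> g \<star> q) Y (\<N> X)" using A by (simp add: Q.arrow_iff)
  have "tr ((\<n> p \<star> g \<star> q) \<star> x) = \<phi> x" if x: "Q.arrow x X Y" for x
  proof -
    have a1: "Q.arrow (g \<star> q \<star> x) X (\<N> X')" "Q.arrow (q \<star> x \<star> p) X' Y'" "Q.arrow (x \<star> p) X' Y"
      using A x by (simp_all add: Q.arrow_iff)
    have "(\<n> p \<star> g \<star> q) \<star> x = \<n> p \<star> (g \<star> q \<star> x)" using A x by (simp add: Q.arrow_iff)
    hence "tr ((\<n> p \<star> g \<star> q) \<star> x) = tr ((g \<star> q \<star> x) \<star> p)" using tr_cyclic[OF p(1) a1(1)] by simp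
    also have "(g \<star> q \<star> x) \<star> p = g \<star> (q \<star> x \<star> p)" using A x by (simp add: Q.arrow_iff)
    also have "tr \<dots> = \<psi> (q \<star> x \<star> p)" by (rule g(2)[OF a1(2)])
    also have "\<dots> = (\<lambda>h\<in>Mor \<Q> X' Y. \<phi> (h \<star> p')) (q' \<star> (q \<star> x \<star> p))"
      unfolding \<psi>_def using Q.arrow_Mor[OF a1(2)] by simp
    also have "q' \<star> (q \<star> x \<star> p) = (q' \<star> q) \<star> (x \<star> p)" using A x by (simp add: Q.arrow_iff)
    also have "\<dots> = x \<star> p" unfolding q(3) using A x by (simp add: Q.arrow_iff)
    also have "(\<lambda>h\<in>Mor \<Q> X' Y. \<phi> (h \<star> p')) (x \<star> p) = \<phi> ((x \<star> p) \<star> p')" using Q.arrow_Mor[OF a1(3)] by simp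
    also have "(x \<star> p) \<star> p' = x \<star> (p \<star> p')" using A x by (simp add: Q.arrow_iff)
    also have "\<dots> = x" unfolding p(3) using x by (simp add: Q.arrow_iff)
    finally show ?thesis .
  qed
  thus ?thesis using that 1 by blast
qed

text \<open>By surjectivity a functional on the space containing \<open>g\<close> is the trace
  against some \<open>y\<close>, and \<open>y\<close> is the image of some \<open>x\<close> because
  the functor is full. Cyclicity turns its value at \<open>g\<close> into the trace of
  \<open>g \<star> x\<close>, which is zero; finite dimension then gives g = 0.\<close>

lemma tr_nondegenerate:
  assumes g: "Q.arrow g Y (\<N> X)" and X: "X \<in> Obj T" and z: "\<And>x. Q.arrow x X Y \<Longrightarrow> tr (g \<star> x) = \<zero>\<^bsub>k\<^esub>"
  shows "g = Q.zr Y (\<N> X)"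
proof -
  have Y: "Y \<in> Obj T" using g by (simp add: Q.arrow_def)
  have Q: "X \<in> Obj \<Q>" "Y \<in> Obj \<Q>" using X Y by simp_all
  note NX = N.F_obj[OF Q(1)]
  show ?thesis
  proof (rule dual_separates[OF Q.hom_vectorspace[OF Q(2) NX] _ Q.arrow_Mor[OF g]])
    show "vectorspace.fin_dim k (Hom \<Q> Y (\<N> X))" using VQ_hom_finite Q(2) NX unfolding hom_finite_def by blast
    fix \<phi> assume \<phi>: "\<phi> \<in> carrier (dual k (Hom \<Q> Y (\<N> X)))"
    have "\<N> X \<in> Obj T" using NX by simp
    obtain y where y: "Q.arrow y (\<N> X) (\<N> Y)" "\<And>u. Q.arrow u Y (\<N> X) \<Longrightarrow> tr (y \<star> u) = \<phi> u"
      by (rule tr_surj[OF Y \<open>\<N> X \<in> Obj T\<close> \<phi>]) blast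
    obtain x where x: "Q.arrow x X Y" "\<n> x = y" using N.fullE[OF N.equivalenceD(2)[OF NQ_equivalence] Q y(1)] .
    show "\<phi> g = \<zero>\<^bsub>k\<^esub>" using y(2)[OF g] tr_cyclic[OF x(1) g] z[OF x(1)] unfolding x(2) by simp
  qed
qed

lemma tr_unique:
  assumes X: "X \<in> Obj T" and g: "Q.arrow g Y (\<N> X)" "Q.arrow g' Y (\<N> X)"
    and e: "\<And>x. Q.arrow x X Y \<Longrightarrow> tr (g \<star> x) = tr (g' \<star> x)"
  shows "g = g'"
proof -
  interpret k: field k by (rule ground_field)
  let ?d = "Q.pl g (Q.ng g')"
  have d: "Q.arrow ?d Y (\<N> X)" using Q.arrow_pl[OF g(1) Q.arrow_ng[OF g(2)]] .
  have "?d = Q.zr Y (\<N> X)"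
  proof (rule tr_nondegenerate[OF d X])
    fix x assume x: "Q.arrow x X Y"
    have a: "Q.arrow (?d \<star> x) X (\<N> X)" "Q.arrow (g' \<star> x) X (\<N> X)" using Q.arrow_cmp x g d by blast+
    \<comment> \<open>Additivity of \<open>tr\<close> is available for sums, so the trace of the
      difference is found by adding the trace of \<open>g' \<star> x\<close> back and
      cancelling.\<close>
    have "Q.pl ?d g' = g" using g by (simp add: Q.arrow_iff Q.pl_assoc)
    hence "Q.pl (?d \<star> x) (g' \<star> x) = g \<star> x" using Q.cmp_pl(2)[of ?d g' x] x g d by (simp add: Q.arrow_iff)
    hence "tr (?d \<star> x) \<oplus>\<^bsub>k\<^esub> tr (g' \<star> x) = tr (g' \<star> x)"
      using tr_linear(2)[OF a] e[OF x] by simp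
    thus "tr (?d \<star> x) = \<zero>\<^bsub>k\<^esub>"
      using k.add.r_cancel_one[OF tr_linear(1)[OF a(2,2)] tr_linear(1)[OF a]] by simp
  qed
  thus ?thesis using Q.sub_zero g by blast
qed

text \<open>The inverse of the trace form: the morphism that represents \<open>\<phi>\<close>. Being
  characterised by uniqueness, it is linear and natural as soon as the proposed value represents the
  right functional.\<close>

definition \<beta> where
  "\<beta> X Y \<phi> = (THE g. Q.arrow g Y (\<N> X) \<and> (\<forall>x. Q.arrow x X Y \<longrightarrow> tr (g \<star> x) = \<phi> x))"

lemma beta_eq:
  assumes X: "X \<in> Obj T" and g: "Q.arrow g Y (\<N> X)" "\<And>x. Q.arrow x X Y \<Longrightarrow> tr (g \<star> x) = \<phi> x"
  shows "\<beta> X Y \<phi> = g"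
  unfolding \<beta>_def
proof (rule the_equality)
  show "Q.arrow g Y (\<N> X) \<and> (\<forall>x. Q.arrow x X Y \<longrightarrow> tr (g \<star> x) = \<phi> x)" using g by blast
  fix g' assume g': "Q.arrow g' Y (\<N> X) \<and> (\<forall>x. Q.arrow x X Y \<longrightarrow> tr (g' \<star> x) = \<phi> x)"
  show "g' = g" by (rule tr_unique[OF X _ g(1)]) (use g' g(2) in auto)
qed

lemma beta:
  assumes "X \<in> Obj T" "Y \<in> Obj T" "\<phi> \<in> carrier (dual k (Hom \<Q> X Y))"
  shows "Q.arrow (\<beta> X Y \<phi>) Y (\<N> X)" "Q.arrow x X Y \<Longrightarrow> tr (\<beta> X Y \<phi> \<star> x) = \<phi> x"
proof -
  obtain g where g: "Q.arrow g Y (\<N> X)" "\<And>x. Q.arrow x X Y \<Longrightarrow> tr (g \<star> x) = \<phi> x" by (rule tr_surj[OF assms]) blast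
  have "\<beta> X Y \<phi> = g" using assms(1) g by (rule beta_eq)
  thus "Q.arrow (\<beta> X Y \<phi>) Y (\<N> X)" "Q.arrow x X Y \<Longrightarrow> tr (\<beta> X Y \<phi> \<star> x) = \<phi> x" using g by simp_all
qed

text \<open>Naturality in the first argument is cyclicity of the trace, naturality in the second is
  associativity of composition, and surjectivity onto the hom space holds because every morphism
  represents its own trace functional.\<close>

lemma VQ_serre_duality: "serre_duality k \<Q> (Obj \<Q>) NQ \<beta>"
  unfolding serre_duality_def VQ_Obj
proof (intro conjI ballI)
  fix X Y assume XY: "X \<in> Obj T" "Y \<in> Obj T"
  have Q: "X \<in> Obj \<Q>" "Y \<in> Obj \<Q>" using XY by simp_all
  note V = Q.hom_vectorspace[OF Q] and b = beta[OF XY]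
  interpret D: vectorspace k "dual k (Hom \<Q> X Y)" by (rule dual_vectorspace[OF V])
  show "linear_map k (dual k (Hom \<Q> X Y)) (Hom \<Q> Y (\<N> X)) (\<beta> X Y)"
  proof (rule linear_mapI[OF dual_vectorspace[OF V] Q.hom_vectorspace[OF Q(2) N.F_obj[OF Q(1)]]])
    fix \<phi> assume p: "\<phi> \<in> carrier (dual k (Hom \<Q> X Y))"
    show "\<beta> X Y \<phi> \<in> Mor \<Q> Y (\<N> X)" by (rule Q.arrow_Mor[OF b(1)[OF p]])
    show "\<beta> X Y (c \<odot>\<^bsub>dual k (Hom \<Q> X Y)\<^esub> \<phi>) = c \<odot>\<^bsub>Hom \<Q> Y (\<N> X)\<^esub> \<beta> X Y \<phi>" if c: "c \<in> carrier k" for c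
      unfolding Q.sm_eq[OF b(1)[OF p]]
    proof (rule beta_eq[OF XY(1) Q.arrow_sm[OF c b(1)[OF p]]])
      fix x assume x: "Q.arrow x X Y"
      note a = Q.arrow_cmp[OF x b(1)[OF p]]
      have "Q.sm c (\<beta> X Y \<phi>) \<star> x = Q.sm c (\<beta> X Y \<phi> \<star> x)" using x b(1)[OF p] c by (simp add: Q.arrow_iff Q.lin)
      thus "tr (Q.sm c (\<beta> X Y \<phi>) \<star> x) = (c \<odot>\<^bsub>dual k (Hom \<Q> X Y)\<^esub> \<phi>) x"
        using tr_linear(3)[OF a a c] b(2)[OF p x] Q.arrow_Mor[OF x] by (simp add: dual_simps(3)[OF V])
    qed
    fix \<psi> assume q: "\<psi> \<in> carrier (dual k (Hom \<Q> X Y))"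
    show "\<beta> X Y (\<phi> \<oplus>\<^bsub>dual k (Hom \<Q> X Y)\<^esub> \<psi>) = \<beta> X Y \<phi> \<oplus>\<^bsub>Hom \<Q> Y (\<N> X)\<^esub> \<beta> X Y \<psi>"
      unfolding Q.pl_eq[OF b(1)[OF p]]
    proof (rule beta_eq[OF XY(1) Q.arrow_pl[OF b(1)[OF p] b(1)[OF q]]])
      fix x assume x: "Q.arrow x X Y"
      note a = Q.arrow_cmp[OF x b(1)[OF p]] Q.arrow_cmp[OF x b(1)[OF q]]
      have "Q.pl (\<beta> X Y \<phi>) (\<beta> X Y \<psi>) \<star> x = Q.pl (\<beta> X Y \<phi> \<star> x) (\<beta> X Y \<psi> \<star> x)"
        using x b(1)[OF p] b(1)[OF q] by (simp add: Q.arrow_iff Q.lin)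
      thus "tr (Q.pl (\<beta> X Y \<phi>) (\<beta> X Y \<psi>) \<star> x) = (\<phi> \<oplus>\<^bsub>dual k (Hom \<Q> X Y)\<^esub> \<psi>) x"
        using tr_linear(2)[OF a] b(2)[OF p x] b(2)[OF q x] Q.arrow_Mor[OF x] by (simp add: dual_simps(2)[OF V])
    qed
  qed
  show "bij_betw (\<beta> X Y) (carrier (dual k (Hom \<Q> X Y))) (Mor \<Q> Y (\<N> X))"
    unfolding bij_betw_def
  proof (intro conjI inj_onI equalityI subsetI)
    fix \<phi> \<psi> assume pq: "\<phi> \<in> carrier (dual k (Hom \<Q> X Y))" "\<psi> \<in> carrier (dual k (Hom \<Q> X Y))" and e: "\<beta> X Y \<phi> = \<beta> X Y \<psi>"
    show "\<phi> = \<psi>"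
    proof (rule extensionalityI[of _ "Mor \<Q> X Y"])
      show "\<phi> \<in> extensional (Mor \<Q> X Y)" "\<psi> \<in> extensional (Mor \<Q> X Y)"
        using pq unfolding dual_simps(1)[OF V] PiE_def by blast+
      fix x assume "x \<in> Mor \<Q> X Y"
      hence x: "Q.arrow x X Y" using Q.Mor_arrow[OF Q] by blast
      show "\<phi> x = \<psi> x" using b(2)[OF pq(1) x] b(2)[OF pq(2) x] unfolding e by simp
    qed
  next
    fix g assume "g \<in> \<beta> X Y ` carrier (dual k (Hom \<Q> X Y))"
    thus "g \<in> Mor \<Q> Y (\<N> X)" using Q.arrow_Mor[OF b(1)] by blast
  next
    fix g assume "g \<in> Mor \<Q> Y (\<N> X)"
    hence g: "Q.arrow g Y (\<N> X)" using Q.Mor_arrow[OF Q(2) N.F_obj[OF Q(1)]] by blast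
    let ?\<phi> = "\<lambda>x\<in>Mor \<Q> X Y. tr (g \<star> x)"
    have "?\<phi> \<in> carrier (dual k (Hom \<Q> X Y))" unfolding dual_simps(1)[OF V]
    proof (intro conjI ballI)
      have M: "Q.arrow x X Y" if "x \<in> Mor \<Q> X Y" for x using that Q.Mor_arrow[OF Q] by blast
      have a: "Q.arrow (g \<star> x) X (\<N> X)" if "x \<in> Mor \<Q> X Y" for x using Q.arrow_cmp[OF M[OF that] g] .
      show "?\<phi> \<in> Mor \<Q> X Y \<rightarrow>\<^sub>E carrier k" using tr_linear(1)[OF a a] by simp
      fix v assume v: "v \<in> Mor \<Q> X Y"
      show "?\<phi> (v \<oplus>\<^bsub>Hom \<Q> X Y\<^esub> w) = ?\<phi> v \<oplus>\<^bsub>k\<^esub> ?\<phi> w" if w: "w \<in> Mor \<Q> X Y" for w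
      proof -
        have "g \<star> Q.pl v w = Q.pl (g \<star> v) (g \<star> w)" using M[OF v] M[OF w] g by (simp add: Q.arrow_iff Q.lin)
        thus ?thesis using tr_linear(2)[OF a[OF v] a[OF w]] v w Q.arrow_Mor[OF Q.arrow_pl[OF M[OF v] M[OF w]]]
          by (simp add: Q.pl_eq[OF M[OF v]])
      qed
      show "?\<phi> (c \<odot>\<^bsub>Hom \<Q> X Y\<^esub> v) = c \<otimes>\<^bsub>k\<^esub> ?\<phi> v" if c: "c \<in> carrier k" for c
      proof -
        have "g \<star> Q.sm c v = Q.sm c (g \<star> v)" using M[OF v] g c by (simp add: Q.arrow_iff Q.lin)
        thus ?thesis using tr_linear(3)[OF a[OF v] a[OF v] c] v Q.arrow_Mor[OF Q.arrow_sm[OF c M[OF v]]]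
          by (simp add: Q.sm_eq[OF M[OF v]])
      qed
    qed
    moreover have "\<beta> X Y ?\<phi> = g" by (rule beta_eq[OF XY(1) g]) (simp add: Q.arrow_Mor)
    ultimately show "g \<in> \<beta> X Y ` carrier (dual k (Hom \<Q> X Y))" by force
  qed
next
  fix X X' Y f \<phi> assume o: "X \<in> Obj T" "X' \<in> Obj T" "Y \<in> Obj T" and "f \<in> Mor \<Q> X X'"
    and p: "\<phi> \<in> carrier (dual k (Hom \<Q> X Y))"
  hence f: "Q.arrow f X X'" by (simp add: Q.Mor_arrow)
  note b = beta[OF o(1,3) p]
  show "\<beta> X' Y (\<lambda>h\<in>Mor \<Q> X' Y. \<phi> (h \<star> f)) = \<n> f \<star> \<beta> X Y \<phi>"
  proof (rule beta_eq[OF o(2) Q.arrow_cmp[OF b(1) N.F_arrow[OF f]]])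
    fix h assume h: "Q.arrow h X' Y"
    have "(\<n> f \<star> \<beta> X Y \<phi>) \<star> h = \<n> f \<star> (\<beta> X Y \<phi> \<star> h)"
      using h b(1) N.F_arrow[OF f] by (simp add: Q.arrow_iff)
    hence "tr ((\<n> f \<star> \<beta> X Y \<phi>) \<star> h) = tr ((\<beta> X Y \<phi> \<star> h) \<star> f)" using tr_cyclic[OF f Q.arrow_cmp[OF h b(1)]] by simp
    also have "(\<beta> X Y \<phi> \<star> h) \<star> f = \<beta> X Y \<phi> \<star> (h \<star> f)" using h b(1) f by (simp add: Q.arrow_iff)
    also have "tr \<dots> = \<phi> (h \<star> f)" by (rule b(2)[OF Q.arrow_cmp[OF f h]])
    finally show "tr ((\<n> f \<star> \<beta> X Y \<phi>) \<star> h) = (\<lambda>h\<in>Mor \<Q> X' Y. \<phi> (h \<star> f)) h" using Q.arrow_Mor[OF h] by simp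
  qed
next
  fix X Y Y' g \<phi> assume o: "X \<in> Obj T" "Y \<in> Obj T" "Y' \<in> Obj T" and "g \<in> Mor \<Q> Y' Y"
    and p: "\<phi> \<in> carrier (dual k (Hom \<Q> X Y))"
  hence g: "Q.arrow g Y' Y" by (simp add: Q.Mor_arrow)
  note b = beta[OF o(1,2) p]
  show "\<beta> X Y' (\<lambda>h\<in>Mor \<Q> X Y'. \<phi> (g \<star> h)) = \<beta> X Y \<phi> \<star> g"
  proof (rule beta_eq[OF o(1) Q.arrow_cmp[OF g b(1)]])
    fix h assume h: "Q.arrow h X Y'"
    have "(\<beta> X Y \<phi> \<star> g) \<star> h = \<beta> X Y \<phi> \<star> (g \<star> h)" using h b(1) g by (simp add: Q.arrow_iff)
    thus "tr ((\<beta> X Y \<phi> \<star> g) \<star> h) = (\<lambda>h\<in>Mor \<Q> X Y'. \<phi> (g \<star> h)) h"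
      using b(2)[OF Q.arrow_cmp[OF h g]] Q.arrow_Mor[OF h] by simp
  qed
qed

lemma VQ_serre_functor: "serre_functor k \<Q> NQ"
  unfolding serre_functor_def using VQ_hom_finite NQ_equivalence VQ_serre_duality by blast

end

theorem theorem1p2:
  fixes k :: "('k, 'r) ring_scheme"
    and T :: "('o, 'm, 'k) tricat"
    and Tp :: "'o set"
    and SS :: "('o, 'm, 'o, 'm) fct"
    and S :: "'o set"
    and Tsg :: "('o, ('m \<times> 'm) set, 'k) tricat"
    and F P :: "'o set"
  assumes "smc_quadruple k T Tp SS S"
    and "Tsg = verdier_quotient T Tp"
    and "F = right_perp T (T_gt T S 0) \<inter> left_perp T (T_le T S (-1) \<inter> Tp)"
    and "P = T_ge T S 0 \<inter> T_le T S 0"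
  shows "(extension_closed T F \<and>
          frobenius_extriangulated k (sub_extricat T F) \<and>
          Proj (sub_extricat T F) = P) \<and>
         (additive_cat k (additive_quotient (full_sub T F) P) \<and>
          additive_cat k Tsg \<and>
          (\<exists>\<pi>. lin_equivalence k (additive_quotient (full_sub T F) P) Tsg \<pi> \<and>
            (\<forall>X\<in>F. FO \<pi> X = FO (verdier_functor T Tp) X) \<and>
            (\<forall>X\<in>F. \<forall>Y\<in>F. \<forall>f\<in>Mor T X Y.
               FM \<pi> (FM (additive_quotient_functor (full_sub T F) P) f)
                 = FM (verdier_functor T Tp) f)) \<and>
          serre_functor k Tsg (functor_cmp (Shi Tsg) (verdier_induced T Tp SS)))"
proof -
  interpret smc_quadruple k T Tp SS S by (rule assms(1))
  have F: "F = FF" and P: "P = PP" unfolding assms(3,4) FF_def PP_def by (rule refl)+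
  show ?thesis unfolding assms(2) F P
    by (intro conjI FF_extension_closed FF_frobenius FF_Proj FF_quotient VQ_additive VQ_serre_functor)
qed

end
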